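(* For forms of degree $d$ in $n$ variables over $\mathbb{C}$, one has $\mathrm{ApoLim}\subset\mathrm{ApoEqu}$. Moreover: (1) There exists $n$ such that for all $d\ge 2n$ the inclusion is strict: $\mathrm{ApoLim}\subsetneq\mathrm{ApoEqu}$. (2) If $d=3$ or if $n=3$, then $\mathrm{ApoLim}=\mathrm{ApoEqu}$.
   Context: Let $V$ be a complex vector space with basis $x_1,\dots,x_n$, let $S=\mathbb{C}[x_1,\dots,x_n]=\bigoplus_d S^dV$ and let $T=\mathbb{C}[\alpha_1,\dots,\alpha_n]$ be the dual ring, acting on $S$ by letting $\alpha_i$ act as $\partial/\partial x_i$; write $\Theta\circ F$ for this action. The apolar ideal of a nonzero form $F$ is $F^\perp=\{\Theta\in T:\Theta\circ F=0\}$ and $A_F=T/F^\perp$. A form $F\in S^dV$ is a direct sum if there are subspaces $V_1,V_2\subset V$ with $V=V_1\oplus V_2$ and nonzero $F_1\in S^dV_1$, $F_2\in S^dV_2$ such that $F=F_1+F_2$. With $\mathfrak m=\langle\alpha_1,\dots,\alpha_n\rangle$, $\mathrm{ApoEqu}\subset S^dV$ is the set of forms $F$ of degree $d$ such that $F^\perp$ has a minimal generator of degree $d$, i.e. $(F^\perp/\mathfrak m F^\perp)_d\ne0$ (an "equipotent apolar generator"). $\mathrm{ApoLim}\subset S^dV$ is the set of apolar limits of direct sums: forms $F$ for which there is an algebraic family $\{F_t\}$ of nonzero forms in $S^dV$, parametrized by a smooth irreducible curve with a marked point $0$, such that $F_0=F$, $F_t$ is a direct sum for $t\neq 0$, and the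 ideals $\{F_t^\perp\}$ form a flat family (including at $t=0$); equivalently, the Hilbert function of $A_{F_t}$ is constant in $t$. *)

theory Defs
  imports
    "HOL-Analysis.Abstract_Topology"
    "HOL-Library.Poly_Mapping"
    "HOL-Library.Extended_Nat"
    Complex_Main
begin

section \<open>Polynomials as complex vector spaces\<close>

text \<open>
  A monomial is a finitely supported exponent vector.  The same type represents
  the polynomials of \<open>S\<close> (in the variables \<open>x\<^sub>0, ..., x\<^sub>n\<^sub>-\<^sub>1\<close>) and
  those of the dual ring \<open>T\<close> (in \<open>\<alpha>\<^sub>0, ..., \<alpha>\<^sub>n\<^sub>-\<^sub>1\<close>).
\<close>

type_synonym monomial = "nat \<Rightarrow>\<^sub>0 nat"
type_synonym cpoly = "monomial \<Rightarrow>\<^sub>0 complex"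

definition cscale :: "complex \<Rightarrow> ('a \<Rightarrow>\<^sub>0 complex) \<Rightarrow> ('a \<Rightarrow>\<^sub>0 complex)" where
  "cscale c p = Poly_Mapping.map ((*) c) p"

lemma lookup_cscale: "Poly_Mapping.lookup (cscale c p) a = c * Poly_Mapping.lookup p a"
  by (simp add: cscale_def Poly_Mapping.map.rep_eq when_def)

interpretation cvs: vector_space cscale
  by unfold_locales
    (auto intro!: poly_mapping_eqI simp: lookup_cscale lookup_add algebra_simps)

definition var :: "nat \<Rightarrow> cpoly" where
  "var i = Poly_Mapping.single (Poly_Mapping.single i 1) 1"

definition mdegree :: "monomial \<Rightarrow> nat" where
  "mdegree m = (\<Sum>i\<in>Poly_Mapping.keys m. Poly_Mapping.lookup m i)"

definition polys :: "nat \<Rightarrow> cpoly set" where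
  "polys n = {P. \<forall>m\<in>Poly_Mapping.keys P. Poly_Mapping.keys m \<subseteq> {..<n}}"

text \<open>The forms of degree \<open>d\<close>, zero included: the space \<open>S\<^sup>d V\<close> (or \<open>T\<^sub>d\<close>).
  In particular \<open>forms n 1\<close> is \<open>V\<close> itself.\<close>

definition forms :: "nat \<Rightarrow> nat \<Rightarrow> cpoly set" where
  "forms n d = {P \<in> polys n. \<forall>m\<in>Poly_Mapping.keys P. mdegree m = d}"

definition ideal_gen :: "nat \<Rightarrow> cpoly set \<Rightarrow> cpoly set" where
  "ideal_gen n A = cvs.span {P * a |P a. P \<in> polys n \<and> a \<in> A}"

definition ideal_mult :: "cpoly set \<Rightarrow> cpoly set \<Rightarrow> cpoly set" where
  "ideal_mult I J = cvs.span {a * b |a b. a \<in> I \<and> b \<in> J}"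


section \<open>Apolarity\<close>

text \<open>In \<open>pdiff\<close> the subtraction of exponents is truncated; this is harmless, as
  the terms in which \<open>x\<^sub>i\<close> does not occur have coefficient \<open>0\<close>.\<close>

definition pdiff :: "nat \<Rightarrow> cpoly \<Rightarrow> cpoly" where
  "pdiff i F = (\<Sum>m\<in>Poly_Mapping.keys F.
     Poly_Mapping.single (m - Poly_Mapping.single i 1)
       (of_nat (Poly_Mapping.lookup m i) * Poly_Mapping.lookup F m))"

definition apolar_act :: "cpoly \<Rightarrow> cpoly \<Rightarrow> cpoly" where
  "apolar_act \<Theta> F = (\<Sum>a\<in>Poly_Mapping.keys \<Theta>. cscale (Poly_Mapping.lookup \<Theta> a)
     (foldr (\<lambda>i. pdiff i ^^ Poly_Mapping.lookup a i)
        (sorted_list_of_set (Poly_Mapping.keys a)) F))"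

definition apolar_ideal :: "nat \<Rightarrow> cpoly \<Rightarrow> cpoly set" where
  "apolar_ideal n F = {\<Theta> \<in> polys n. apolar_act \<Theta> F = 0}"

text \<open>The Hilbert function of \<open>A\<^sub>F = T / F\<^sup>\<bottom>\<close>, for a form \<open>F\<close>.\<close>

definition hilbert :: "nat \<Rightarrow> cpoly \<Rightarrow> nat \<Rightarrow> nat" where
  "hilbert n F k = cvs.dim (forms n k) - cvs.dim (apolar_ideal n F \<inter> forms n k)"

definition irrelevant_ideal :: "nat \<Rightarrow> cpoly set" where
  "irrelevant_ideal n = ideal_gen n (var ` {..<n})"

text \<open>\<open>F\<^sup>\<bottom>\<close> and \<open>\<mm> F\<^sup>\<bottom>\<close> are homogeneous ideals, so \<open>(F\<^sup>\<bottom> / \<mm> F\<^sup>\<bottom>)\<^sub>d\<close> is the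
  quotient of their degree \<open>d\<close> parts.\<close>

definition ApoEqu :: "nat \<Rightarrow> nat \<Rightarrow> cpoly set" where
  "ApoEqu n d = {F \<in> forms n d. F \<noteq> 0 \<and>
     ideal_mult (irrelevant_ideal n) (apolar_ideal n F) \<inter> forms n d
       \<noteq> apolar_ideal n F \<inter> forms n d}"


section \<open>Direct sums\<close>

text \<open>For a subspace \<open>W \<subseteq> V\<close>, the subspace \<open>S\<^sup>d W\<close> of \<open>S\<^sup>d V\<close>.\<close>

definition sym_power :: "nat \<Rightarrow> cpoly set \<Rightarrow> cpoly set" where
  "sym_power d W = cvs.span {(\<Prod>j<d. l j) |l. \<forall>j<d. l j \<in> W}"

definition direct_sum_form :: "nat \<Rightarrow> nat \<Rightarrow> cpoly \<Rightarrow> bool" where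
  "direct_sum_form n d F \<longleftrightarrow> (\<exists>V1 V2 F1 F2.
     cvs.subspace V1 \<and> cvs.subspace V2 \<and>
     {v1 + v2 |v1 v2. v1 \<in> V1 \<and> v2 \<in> V2} = forms n 1 \<and> V1 \<inter> V2 = {0} \<and>
     F1 \<in> sym_power d V1 \<and> F1 \<noteq> 0 \<and> F2 \<in> sym_power d V2 \<and> F2 \<noteq> 0 \<and>
     F = F1 + F2)"


section \<open>Smooth irreducible curves\<close>

text \<open>
  Every curve over the complex numbers is quasi-projective, so curves are taken
  to be locally closed subsets of a projective space.  A point of the projective
  space with homogeneous coordinates indexed by \<open>{..<N}\<close> is represented by any of
  its nonzero coordinate vectors, so that a subset of projective space appears as
  its punctured affine cone.  Open sets being generated by the loci
  \<open>G \<noteq> 0\<close> with \<open>G\<close> homogeneous, all open and closed sets are stable under rescaling and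
  they correspond to those of the projective space; hence irreducibility and Krull
  dimension are those of the projective variety, not of the cone.
\<close>

type_synonym coord_vec = "nat \<Rightarrow>\<^sub>0 complex"

definition coord_space :: "nat \<Rightarrow> coord_vec set" where
  "coord_space N = {p. Poly_Mapping.keys p \<subseteq> {..<N}}"

definition same_point :: "coord_vec \<Rightarrow> coord_vec \<Rightarrow> bool" where
  "same_point p q \<longleftrightarrow> (\<exists>c. c \<noteq> 0 \<and> q = cscale c p)"

definition peval :: "cpoly \<Rightarrow> coord_vec \<Rightarrow> complex" where
  "peval G p = (\<Sum>m\<in>Poly_Mapping.keys G. Poly_Mapping.lookup G m *
     (\<Prod>i\<in>Poly_Mapping.keys m. Poly_Mapping.lookup p i ^ Poly_Mapping.lookup m i))"

definition zariski :: "nat \<Rightarrow> coord_vec topology" where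
  "zariski N = topology_generated_by
     {{p \<in> coord_space N - {0}. peval G p \<noteq> 0} |G k. G \<in> forms N k}"

definition locally_closed_in :: "'a topology \<Rightarrow> 'a set \<Rightarrow> bool" where
  "locally_closed_in X C \<longleftrightarrow> (\<exists>U Z. openin X U \<and> closedin X Z \<and> C = U \<inter> Z)"

definition irreducible_space :: "'a topology \<Rightarrow> bool" where
  "irreducible_space X \<longleftrightarrow> topspace X \<noteq> {} \<and>
     (\<forall>A B. closedin X A \<and> closedin X B \<and> A \<union> B = topspace X
        \<longrightarrow> A = topspace X \<or> B = topspace X)"

definition krull_dim :: "'a topology \<Rightarrow> enat" where
  "krull_dim X = Sup {enat k |k. \<exists>Z :: nat \<Rightarrow> 'a set.
     (\<forall>i\<le>k. closedin X (Z i) \<and> irreducible_space (subtopology X (Z i))) \<and>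
     (\<forall>i<k. Z i \<subset> Z (Suc i))}"

text \<open>The Zariski tangent space at \<open>p\<close> of the affine cone over \<open>C\<close>.  It contains
  the line spanned by \<open>p\<close>, and its dimension exceeds that of the tangent space of \<open>C\<close>
  at \<open>p\<close> by one; this accounts for the summand \<open>1\<close> in the smoothness condition below.\<close>

definition cone_tangent :: "nat \<Rightarrow> coord_vec set \<Rightarrow> coord_vec \<Rightarrow> coord_vec set" where
  "cone_tangent N C p = {v \<in> coord_space N. \<forall>k. \<forall>G\<in>forms N k. (\<forall>q\<in>C. peval G q = 0) \<longrightarrow>
     (\<Sum>i<N. peval (pdiff i G) p * Poly_Mapping.lookup v i) = 0}"

definition smooth_irreducible_curve :: "nat \<Rightarrow> coord_vec set \<Rightarrow> bool" where
  "smooth_irreducible_curve N C \<longleftrightarrow>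
     locally_closed_in (zariski N) C \<and>
     irreducible_space (subtopology (zariski N) C) \<and>
     krull_dim (subtopology (zariski N) C) = 1 \<and>
     (\<forall>p\<in>C. cvs.dim (cone_tangent N C p) = 1 + 1)"

text \<open>Regular functions are locally quotients of homogeneous polynomials of equal degree;
  in particular they do not depend on the choice of homogeneous coordinates.\<close>

definition regular_on :: "nat \<Rightarrow> coord_vec set \<Rightarrow> (coord_vec \<Rightarrow> complex) \<Rightarrow> bool" where
  "regular_on N C f \<longleftrightarrow> (\<forall>p\<in>C. \<exists>U k. openin (zariski N) U \<and> p \<in> U \<and>
     (\<exists>G\<in>forms N k. \<exists>H\<in>forms N k. \<forall>q\<in>U \<inter> C. peval H q \<noteq> 0 \<and> f q = peval G q / peval H q))"


section \<open>Apolar limits of direct sums\<close>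

text \<open>An algebraic family of forms is a morphism from the curve to the affine space
  \<open>S\<^sup>d V\<close>, i.e. its coefficients are regular functions.  Flatness of the family of
  apolar ideals is expressed as constancy of the Hilbert function of \<open>A\<^sub>F\<^sub>t\<close>.\<close>

definition ApoLim :: "nat \<Rightarrow> nat \<Rightarrow> cpoly set" where
  "ApoLim n d = {F. \<exists>N C pt Fam.
     smooth_irreducible_curve N C \<and> pt \<in> C \<and>
     (\<forall>t\<in>C. Fam t \<in> forms n d \<and> Fam t \<noteq> 0) \<and>
     (\<forall>m. regular_on N C (\<lambda>t. Poly_Mapping.lookup (Fam t) m)) \<and>
     Fam pt = F \<and>
     (\<forall>t\<in>C. \<not> same_point pt t \<longrightarrow> direct_sum_form n d (Fam t)) \<and>
     (\<forall>t\<in>C. hilbert n (Fam t) = hilbert n F)}"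

end

theory Submission
  imports Defs "HOL-Computational_Algebra.Fundamental_Theorem_Algebra"
begin

text \<open>
  The two sets are compared through first-order operators, the linear forms of the dual ring.  By the
  perfect pairing between operators and forms of equal degree, a form \<open>F\<close> has an apolar generator of
  its own degree if and only if some form \<open>G\<close> of that degree, not a multiple of \<open>F\<close>, has all its first
  derivatives among the first derivatives of \<open>F\<close> (\<open>ApoEqu_iff\<close>).  For a direct sum \<open>F = F1 + F2\<close> the
  summand \<open>F1\<close> is such a \<open>G\<close>.

  Inclusion.  As long as the dimension of the space of first derivatives is constant, the absence of
  such a \<open>G\<close> says that a fixed number of vectors are linearly independent, and that is an open condition
  (\<open>no_shared_gradient_open\<close>).  Every neighbourhood of the marked point of a curve contains other
  points, where the form is a direct sum; so \<open>G\<close> exists at the marked point too.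

  Strictness.  In five variables take
  \<open>F = \<Sum>k<3. x\<^sub>k * y\<^sub>0^[d-6+k] * y\<^sub>1^[5-k]\<close>, where the exponents in brackets are divided powers; here
  \<open>G = y\<^sub>0^[d-5] * y\<^sub>1^[5]\<close>.  Suppose that \<open>F\<close> is the limit of a flat family of direct sums.  Its members
  have the same Hilbert function, with \<open>h(2) \<le> 7\<close> and \<open>h(3) \<ge> 9\<close>.  Moreover no nonzero linear operator
  \<open>l\<close> is such that the derivatives of \<open>l \<odot> F\<close> are all proportional, and by \<open>2\<times>2\<close> minors this persists
  near \<open>F\<close>.  For a direct sum it forces each summand to have at least two variables, hence a splitting
  \<open>2 + 3\<close>.  Then \<open>h(2) \<le> 7\<close> yields two independent quadratic operators in three variables that
  kill the form, \<open>h(3) \<ge> 9\<close> yields a linear syzygy between them, so they have a common linear factor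
  \<open>m\<close>, and the derivatives of \<open>m \<odot> F\<close> are proportional after all (\<open>no_split_2_3\<close>).

  Equality.  A form \<open>G\<close> as above gives an endomorphism \<open>A\<close> of the space of linear operators with
  \<open>A u \<odot> F = u \<odot> G\<close>, self-adjoint for the pairing \<open>(u, v) \<mapsto> u \<odot> v \<odot> F\<close>.  After subtraction of an
  eigenvalue, its Fitting decomposition either splits \<open>F\<close> as a direct sum or provides a self-adjoint
  \<open>N \<noteq> 0\<close> with \<open>N\<^sup>2 = 0\<close> (\<open>ApoEqu_dichotomy\<close>).  In the second case direct sums converging to \<open>F\<close> have to be
  exhibited.  For cubics they come from the flow of a linear vector field that inverts \<open>N\<close> partially,
  and flatness is a statement about \<open>h(1)\<close> alone, because \<open>h(2) = h(1)\<close> and \<open>h(0) = h(3) = 1\<close>.  For three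
  variables, \<open>F = x * y^[d-1] + B(y, z)\<close> in suitable coordinates.  The approximating forms are the sum of
  the power of a linear form close to \<open>y\<close>, with a coefficient that tends to infinity, and of a binary
  form that satisfies a linear recurrence of the same length for all parameters.  The recurrence bounds
  their Hilbert functions from above, and the minimality of its length bounds that of \<open>F\<close> from below
  (\<open>family_ApoLim\<close>).
\<close>


section \<open>The action of operators on forms\<close>

abbreviation lk where "lk \<equiv> Poly_Mapping.lookup"
abbreviation sg where "sg \<equiv> Poly_Mapping.single"
abbreviation ky where "ky \<equiv> Poly_Mapping.keys"

notation apolar_act (infixr "\<odot>" 75)

text \<open>
  In the scaled coordinates \<open>lk F m * mfact m\<close>, differentiation only shifts the exponents
  (\<open>lookup_act\<close>), so the module axioms become identities between sums.
\<close>

definition mfact :: "monomial \<Rightarrow> complex" where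
  "mfact m = (\<Prod>i\<in>ky m. fact (lk m i))"

lemma mfact_superset: "finite A \<Longrightarrow> ky m \<subseteq> A \<Longrightarrow> mfact m = (\<Prod>i\<in>A. fact (lk m i))"
  unfolding mfact_def by (rule prod.mono_neutral_left) (auto simp: in_keys_iff)

lemma mfact_nonzero [simp]: "mfact m \<noteq> 0"
  by (simp add: mfact_def)

lemma mfact_add_single: "mfact (m + sg i 1) = of_nat (lk m i + 1) * mfact m"
proof -
  let ?A = "insert i (ky m)"
  have "mfact (m + sg i 1) = (\<Prod>j\<in>?A. fact (lk (m + sg i 1) j))"
    by (rule mfact_superset) (auto simp: in_keys_iff lookup_add lookup_single when_def split: if_splits)
  also have "\<dots> = fact (lk m i + 1) * (\<Prod>j\<in>?A - {i}. fact (lk m j))"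
    by (subst prod.remove[of _ i]) (auto simp: lookup_add lookup_single when_def intro!: prod.cong)
  also have "\<dots> = of_nat (lk m i + 1) * (fact (lk m i) * (\<Prod>j\<in>?A - {i}. fact (lk m j)))"
    by simp
  also have "fact (lk m i) * (\<Prod>j\<in>?A - {i}. fact (lk m j)) = (\<Prod>j\<in>?A. fact (lk m j) :: complex)"
    by (subst (2) prod.remove[of _ i]) auto
  also have "\<dots> = mfact m" by (rule mfact_superset[symmetric]) auto
  finally show ?thesis .
qed

lemma cscale_eq_mult: "cscale c p = sg 0 c * (p :: 'a::monoid_add \<Rightarrow>\<^sub>0 complex)"
  by (simp add: cscale_def mult_map_scale_conv_mult)

lemma cscale_mult_left [simp]: "cscale c p * q = cscale c (p * (q :: 'a::monoid_add \<Rightarrow>\<^sub>0 complex))"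
  by (simp add: cscale_eq_mult mult.assoc)

lemma cscale_mult_right [simp]: "p * cscale c q = cscale c (p * (q :: 'a::comm_monoid_add \<Rightarrow>\<^sub>0 complex))"
  by (simp add: cscale_eq_mult algebra_simps)

lemma lk_sum_scale: "lk (\<Sum>x\<in>A. cscale (f x) (g x)) m = (\<Sum>x\<in>A. f x * lk (g x) m)"
  by (simp add: lookup_sum lookup_cscale)

lemma cpoly_expand: "(P :: 'a \<Rightarrow>\<^sub>0 complex) = (\<Sum>m\<in>ky P. cscale (lk P m) (sg m 1))"
  by (rule poly_mapping_eqI) (auto simp: lookup_sum lookup_cscale lookup_single when_def in_keys_iff
      if_distrib[of "\<lambda>x. _ * x"] cong: if_cong)

lemma lookup_pdiff: "lk (pdiff i F) b = of_nat (lk b i + 1) * lk F (b + sg i 1)"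
proof -
  have *: "(of_nat (lk m i) * lk F m when m - sg i 1 = b) =
      (if m = b + sg i 1 then of_nat (lk b i + 1) * lk F m else 0)" for m
  proof (cases "lk m i = 0")
    case True
    then have "m \<noteq> b + sg i 1" by (auto simp: lookup_add)
    then show ?thesis using True by simp
  next
    case False
    then have e: "m - sg i 1 + sg i 1 = m"
      by (intro poly_mapping_eqI) (auto simp: lookup_add lookup_minus lookup_single when_def)
    show ?thesis
    proof (cases "m = b + sg i 1")
      case True then show ?thesis using e by (auto simp: lookup_add when_def)
    next
      case False then show ?thesis using e by (auto simp: when_def)
    qed
  qed
  have "lk (pdiff i F) b = (\<Sum>m\<in>ky F. if m = b + sg i 1 then of_nat (lk b i + 1) * lk F m else 0)"
    by (simp add: pdiff_def lookup_sum lookup_single * del: One_nat_def)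
  also have "\<dots> = of_nat (lk b i + 1) * lk F (b + sg i 1)"
    by (simp add: in_keys_iff)
  finally show ?thesis .
qed

lemma lookup_pdiff_mfact: "lk (pdiff i F) b * mfact b = mfact (b + sg i 1) * lk F (b + sg i 1)"
  unfolding lookup_pdiff mfact_add_single by simp

lemma lookup_pdiff_pow: "lk ((pdiff i ^^ k) F) b * mfact b = mfact (b + sg i k) * lk F (b + sg i k)"
proof (induction k arbitrary: b)
  case 0 then show ?case by simp
next
  case (Suc k)
  have e: "b + sg i 1 + sg i k = b + sg i (Suc k)"
    by (simp add: add.assoc flip: single_add)
  have "lk ((pdiff i ^^ Suc k) F) b * mfact b = mfact (b + sg i 1) * lk ((pdiff i ^^ k) F) (b + sg i 1)"
    using lookup_pdiff_mfact[of i "(pdiff i ^^ k) F" b] by simp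
  also have "\<dots> = lk ((pdiff i ^^ k) F) (b + sg i 1) * mfact (b + sg i 1)" by simp
  also have "\<dots> = mfact (b + sg i 1 + sg i k) * lk F (b + sg i 1 + sg i k)"
    by (rule Suc.IH)
  finally show ?case by (simp only: e)
qed

lemma lookup_foldr_pdiff: "distinct xs \<Longrightarrow>
  lk (foldr (\<lambda>i. pdiff i ^^ lk a i) xs F) b * mfact b =
    mfact (b + (\<Sum>i\<in>set xs. sg i (lk a i))) * lk F (b + (\<Sum>i\<in>set xs. sg i (lk a i)))"
proof (induction xs arbitrary: b)
  case Nil then show ?case by simp
next
  case (Cons x xs)
  then show ?case
    by (simp add: lookup_pdiff_pow mult.commute add.assoc)
       (metis (no_types, lifting) Cons.IH lookup_pdiff_pow mult.commute add.assoc)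
qed

lemma monomial_expand: "(\<Sum>i\<in>ky a. sg i (lk a i)) = (a :: 'a \<Rightarrow>\<^sub>0 nat)"
  by (rule poly_mapping_eqI) (auto simp: lookup_sum lookup_single when_def in_keys_iff)

lemma lookup_act: "lk (\<Theta> \<odot> F) b * mfact b = (\<Sum>a\<in>ky \<Theta>. lk \<Theta> a * (mfact (a + b) * lk F (a + b)))"
proof -
  have "lk (foldr (\<lambda>i. pdiff i ^^ lk a i) (sorted_list_of_set (ky a)) F) b * mfact b =
      mfact (a + b) * lk F (a + b)" for a
    by (subst lookup_foldr_pdiff) (auto simp: monomial_expand add.commute)
  then show ?thesis
    unfolding apolar_act_def lk_sum_scale sum_distrib_right by (simp add: mult.assoc)
qed

lemma lookup_act_superset: "finite A \<Longrightarrow> ky \<Theta> \<subseteq> A \<Longrightarrow>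
   lk (\<Theta> \<odot> F) b * mfact b = (\<Sum>a\<in>A. lk \<Theta> a * (mfact (a + b) * lk F (a + b)))"
  unfolding lookup_act by (rule sum.mono_neutral_left) (auto simp: in_keys_iff)

lemma mfact_eqI:
  assumes "\<And>b. lk P b * mfact b = lk Q b * mfact b"
  shows "P = Q"
  using assms by (intro poly_mapping_eqI) simp

lemma act_add_right: "\<Theta> \<odot> (F + G) = \<Theta> \<odot> F + \<Theta> \<odot> G"
  by (rule mfact_eqI) (simp add: distrib_right distrib_left lookup_add lookup_act sum.distrib)

lemma act_scale_right: "\<Theta> \<odot> cscale c F = cscale c (\<Theta> \<odot> F)"
  by (rule mfact_eqI)
     (simp add: lookup_cscale lookup_act mult.assoc sum_distrib_left mult.left_commute)

lemma act_add_left: "(\<Theta> + \<Psi>) \<odot> F = \<Theta> \<odot> F + \<Psi> \<odot> F"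
proof (rule mfact_eqI)
  fix b
  let ?A = "ky \<Theta> \<union> ky \<Psi>"
  have "ky (\<Theta> + \<Psi>) \<subseteq> ?A" by (rule keys_add)
  then show "lk ((\<Theta> + \<Psi>) \<odot> F) b * mfact b = lk (\<Theta> \<odot> F + \<Psi> \<odot> F) b * mfact b"
    by (simp add: lookup_add distrib_right lookup_act_superset[of ?A] sum.distrib)
qed

lemma act_scale_left: "cscale c \<Theta> \<odot> F = cscale c (\<Theta> \<odot> F)"
proof (rule mfact_eqI)
  fix b
  have "ky (cscale c \<Theta>) \<subseteq> ky \<Theta>" by (auto simp: in_keys_iff lookup_cscale)
  then show "lk (cscale c \<Theta> \<odot> F) b * mfact b = lk (cscale c (\<Theta> \<odot> F)) b * mfact b"
    by (simp add: lookup_cscale mult.assoc lookup_act_superset[of "ky \<Theta>"] sum_distrib_left)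
qed

lemma linear_act_right: "Vector_Spaces.linear cscale cscale (\<lambda>F. \<Theta> \<odot> F)"
  by (simp add: Vector_Spaces.linear_iff act_add_right act_scale_right cvs.vector_space_axioms)

lemma linear_act_left: "Vector_Spaces.linear cscale cscale (\<lambda>\<Theta>. \<Theta> \<odot> F)"
  by (simp add: Vector_Spaces.linear_iff act_add_left act_scale_left cvs.vector_space_axioms)

interpretation cvp: vector_space_pair
  "cscale :: complex \<Rightarrow> ('a \<Rightarrow>\<^sub>0 complex) \<Rightarrow> ('a \<Rightarrow>\<^sub>0 complex)"
  "cscale :: complex \<Rightarrow> ('b \<Rightarrow>\<^sub>0 complex) \<Rightarrow> ('b \<Rightarrow>\<^sub>0 complex)" ..

lemma act_zero_right [simp]: "\<Theta> \<odot> 0 = 0"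
  using cvp.linear_0[OF linear_act_right] .
lemma act_zero_left [simp]: "0 \<odot> F = 0"
  using cvp.linear_0[OF linear_act_left] .
lemma act_sum_right: "\<Theta> \<odot> (\<Sum>x\<in>A. f x) = (\<Sum>x\<in>A. \<Theta> \<odot> f x)"
  using cvp.linear_sum[OF linear_act_right] .
lemma act_sum_left: "(\<Sum>x\<in>A. f x) \<odot> F = (\<Sum>x\<in>A. f x \<odot> F)"
  using cvp.linear_sum[OF linear_act_left] .
lemma act_diff_right: "\<Theta> \<odot> (F - G) = \<Theta> \<odot> F - \<Theta> \<odot> G"
  using cvp.linear_diff[OF linear_act_right] .
lemma act_diff_left: "(\<Theta> - \<Psi>) \<odot> F = \<Theta> \<odot> F - \<Psi> \<odot> F"
  using cvp.linear_diff[OF linear_act_left] .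
lemma act_neg_left: "(- \<Theta>) \<odot> F = - (\<Theta> \<odot> F)"
  using cvp.linear_neg[OF linear_act_left] .

lemma lookup_act_single: "lk (sg a 1 \<odot> F) b * mfact b = mfact (a + b) * lk F (a + b)"
  by (simp add: lookup_act)

lemma act_single_mult: "(sg a 1 * sg b 1) \<odot> F = sg a 1 \<odot> sg b 1 \<odot> F"
proof (rule mfact_eqI)
  fix c
  have "lk (sg a 1 \<odot> sg b 1 \<odot> F) c * mfact c = lk (sg b 1 \<odot> F) (a + c) * mfact (a + c)"
    using lookup_act_single[of a "sg b 1 \<odot> F" c] by (simp add: mult.commute)
  also have "\<dots> = lk (sg (a + b) 1 \<odot> F) c * mfact c"
    by (simp only: lookup_act_single add.assoc add.left_commute[of b])
  finally show "lk ((sg a 1 * sg b 1) \<odot> F) c * mfact c = lk (sg a 1 \<odot> sg b 1 \<odot> F) c * mfact c"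
    by (simp add: mult_single)
qed

text \<open>
  Since operators compose like polynomials, the forms are a module over the operators;
  with commutativity this is used as \<open>act_commute\<close> throughout.
\<close>

lemma act_mult: "(P * Q) \<odot> F = P \<odot> Q \<odot> F"
proof -
  have "(P * Q) \<odot> F = ((\<Sum>m\<in>ky P. cscale (lk P m) (sg m 1)) * (\<Sum>m\<in>ky Q. cscale (lk Q m) (sg m 1))) \<odot> F"
    by (simp flip: cpoly_expand)
  also have "\<dots> = (\<Sum>m\<in>ky P. cscale (lk P m) (sg m 1)) \<odot> (\<Sum>m\<in>ky Q. cscale (lk Q m) (sg m 1)) \<odot> F"
    by (simp add: sum_product act_sum_left act_sum_right act_scale_left act_scale_right act_single_mult
          cvs.scale_sum_right mult.commute) (rule sum.swap)
  finally show ?thesis by (simp flip: cpoly_expand)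
qed

lemma act_commute: "P \<odot> Q \<odot> F = Q \<odot> P \<odot> F"
  by (simp flip: act_mult add: mult.commute)

lemma act_one [simp]: "1 \<odot> F = F"
proof (rule mfact_eqI)
  fix b show "lk (1 \<odot> F) b * mfact b = lk F b * mfact b"
    using lookup_act_single[of 0 F b] by simp
qed

lemma act_var: "var i \<odot> F = pdiff i F"
proof (rule mfact_eqI)
  fix b show "lk (var i \<odot> F) b * mfact b = lk (pdiff i F) b * mfact b"
    unfolding var_def lookup_act_single lookup_pdiff_mfact by (simp add: add.commute)
qed

lemma pdiff_add: "pdiff i (F + G) = pdiff i F + pdiff i G"
  by (simp flip: act_var add: act_add_right)
lemma pdiff_scale: "pdiff i (cscale c F) = cscale c (pdiff i F)"
  by (simp flip: act_var add: act_scale_right)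
lemma pdiff_sum: "pdiff i (\<Sum>x\<in>A. f x) = (\<Sum>x\<in>A. pdiff i (f x))"
  by (simp flip: act_var add: act_sum_right)

lemma pdiff_single: "pdiff i (sg m c) = sg (m - sg i 1) (of_nat (lk m i) * c)"
  by (cases "c = 0") (simp_all add: pdiff_def)

lemma pdiff_mult_single: "pdiff i (sg m 1 * sg k 1) = pdiff i (sg m 1) * sg k 1 + sg m 1 * pdiff i (sg k 1)"
proof -
  have e: "lk a i \<noteq> 0 \<Longrightarrow> a - sg i 1 + b = a + b - sg i 1" for a b :: monomial
    by (intro poly_mapping_eqI) (auto simp: lookup_add lookup_minus lookup_single when_def)
  have "sg (m - sg i 1 + k) (of_nat (lk m i)) = sg (m + k - sg i 1) (of_nat (lk m i) :: complex)"
    using e[of m k] by (cases "lk m i = 0") auto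
  moreover have "sg (m + (k - sg i 1)) (of_nat (lk k i)) = sg (m + k - sg i 1) (of_nat (lk k i) :: complex)"
    using e[of k m] by (cases "lk k i = 0") (auto simp: add.commute)
  ultimately show ?thesis
    by (simp add: pdiff_single mult_single lookup_add flip: single_add del: One_nat_def)
qed

lemma pdiff_mult: "pdiff i (P * Q) = pdiff i P * Q + P * pdiff i Q"
proof -
  have "pdiff i (P * Q) = pdiff i ((\<Sum>m\<in>ky P. cscale (lk P m) (sg m 1)) * (\<Sum>m\<in>ky Q. cscale (lk Q m) (sg m 1)))"
    by (simp flip: cpoly_expand)
  also have "\<dots> = pdiff i (\<Sum>m\<in>ky P. cscale (lk P m) (sg m 1)) * (\<Sum>m\<in>ky Q. cscale (lk Q m) (sg m 1))
    + (\<Sum>m\<in>ky P. cscale (lk P m) (sg m 1)) * pdiff i (\<Sum>m\<in>ky Q. cscale (lk Q m) (sg m 1))"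
    by (simp add: sum_product pdiff_sum pdiff_scale pdiff_mult_single cvs.scale_right_distrib sum.distrib)
  finally show ?thesis by (simp flip: cpoly_expand)
qed


section \<open>Subspaces of finite dimension\<close>

definition fin_gen :: "('a \<Rightarrow>\<^sub>0 complex) set \<Rightarrow> bool" where
  "fin_gen X \<longleftrightarrow> (\<exists>B. finite B \<and> X \<subseteq> cvs.span B)"

lemma fin_gen_subset: "fin_gen Y \<Longrightarrow> X \<subseteq> Y \<Longrightarrow> fin_gen X"
  unfolding fin_gen_def by blast

lemma fin_gen_span: "fin_gen Y \<Longrightarrow> fin_gen (cvs.span Y)"
  unfolding fin_gen_def by (metis cvs.span_minimal cvs.subspace_span)

lemma fin_gen_finite: "finite B \<Longrightarrow> fin_gen B"
  unfolding fin_gen_def using cvs.span_superset by blast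

lemma independent_finite_dim:
  assumes "fin_gen X" "cvs.independent B" "B \<subseteq> cvs.span X"
  shows "finite B \<and> card B \<le> cvs.dim X"
proof -
  obtain C where C: "C \<subseteq> X" "cvs.independent C" "X \<subseteq> cvs.span C" "card C = cvs.dim X"
    using cvs.basis_exists by blast
  obtain D where D: "finite D" "X \<subseteq> cvs.span D" using assms(1) by (auto simp: fin_gen_def)
  have "finite C" using cvs.independent_span_bound[OF D(1) C(2)] C(1) D(2) by blast
  moreover have "B \<subseteq> cvs.span C"
    using assms(3) C(3) cvs.span_minimal[OF C(3) cvs.subspace_span] by blast
  ultimately show ?thesis using cvs.independent_span_bound[OF _ assms(2)] C(4) by metis
qed

lemma finite_basis_exists:
  assumes "fin_gen X"
  obtains B where "B \<subseteq> X" "cvs.independent B" "X \<subseteq> cvs.span B" "card B = cvs.dim X" "finite B"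
  using cvs.basis_exists independent_finite_dim[OF assms] cvs.span_superset by (metis subset_trans)

lemma dim_mono_gen:
  assumes "fin_gen Y" "X \<subseteq> cvs.span Y"
  shows "cvs.dim X \<le> cvs.dim Y"
proof -
  obtain B where B: "B \<subseteq> Y" "cvs.independent B" "Y \<subseteq> cvs.span B" "card B = cvs.dim Y" "finite B"
    using finite_basis_exists[OF assms(1)] .
  have "X \<subseteq> cvs.span B" using assms(2) cvs.span_minimal[OF B(3) cvs.subspace_span] by blast
  then show ?thesis using cvs.dim_le_card[OF _ B(5)] B(4) by metis
qed

lemma dim_subset_gen: "fin_gen Y \<Longrightarrow> X \<subseteq> Y \<Longrightarrow> cvs.dim X \<le> cvs.dim Y"
  using dim_mono_gen cvs.span_superset by (metis subset_trans)

lemma subspace_eq_of_dim: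
  assumes "cvs.subspace X" "fin_gen Y" "X \<subseteq> Y" "cvs.dim Y \<le> cvs.dim X"
  shows "X = Y"
proof (rule ccontr)
  assume "X \<noteq> Y"
  then obtain y where y: "y \<in> Y" "y \<notin> X" using assms(3) by blast
  obtain B where B: "B \<subseteq> X" "cvs.independent B" "X \<subseteq> cvs.span B" "card B = cvs.dim X" "finite B"
    using finite_basis_exists[OF fin_gen_subset[OF assms(2,3)]] .
  have "y \<notin> cvs.span B" using y(2) B(1) assms(1) cvs.span_minimal by blast
  then have "cvs.independent (insert y B)" using B(2) by (rule cvs.independent_insertI)
  moreover have "insert y B \<subseteq> cvs.span Y" using y(1) B(1) assms(3) cvs.span_superset[of Y] by blast
  ultimately have "card (insert y B) \<le> cvs.dim Y" using independent_finite_dim[OF assms(2)] by blast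
  moreover have "y \<notin> B" using B(1) y(2) by blast
  ultimately show False using B(4,5) assms(4) by simp
qed

lemma subspace_image: "Vector_Spaces.linear cscale cscale f \<Longrightarrow> cvs.subspace X \<Longrightarrow> cvs.subspace (f ` X)"
  by (rule cvp.linear_subspace_image)

lemma subspace_kernel:
  assumes "Vector_Spaces.linear cscale cscale f" "cvs.subspace X"
  shows "cvs.subspace {x \<in> X. f x = 0}"
  using cvs.subspace_inter[OF assms(2) cvp.linear_subspace_kernel[OF assms(1)]]
  by (simp add: Int_def)

lemma fin_gen_image:
  assumes "Vector_Spaces.linear cscale cscale f" "fin_gen X"
  shows "fin_gen (f ` X)"
proof -
  obtain B where B: "finite B" "X \<subseteq> cvs.span B" using assms(2) by (auto simp: fin_gen_def)
  then have "f ` X \<subseteq> cvs.span (f ` B)" using cvp.linear_span_image[OF assms(1), of B] by blast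
  then show ?thesis using B(1) unfolding fin_gen_def by blast
qed

text \<open>
  The ambient spaces of polynomials have infinite dimension, so the dimension theorem is
  stated for a subspace of finite dimension.
\<close>

lemma rank_nullity:
  assumes f: "Vector_Spaces.linear cscale cscale f" and X: "cvs.subspace X" "fin_gen X"
  shows "cvs.dim X = cvs.dim (f ` X) + cvs.dim {x \<in> X. f x = 0}"
proof -
  let ?K = "{x \<in> X. f x = 0}"
  obtain K where K: "K \<subseteq> ?K" "cvs.independent K" "?K \<subseteq> cvs.span K" "card K = cvs.dim ?K" "finite K"
    using finite_basis_exists[OF fin_gen_subset[OF X(2), of ?K]] by blast
  have "K \<subseteq> X" using K(1) by blast
  then obtain B where B: "K \<subseteq> B" "B \<subseteq> X" "cvs.independent B" "X \<subseteq> cvs.span B"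
    using cvs.maximal_independent_subset_extend[OF _ K(2)] by blast
  have fB: "finite B" using independent_finite_dim[OF X(2) B(3)] B(2) cvs.span_superset[of X] by blast
  have cB: "card B = cvs.dim X" using cvs.basis_card_eq_dim[OF B(2,4,3)] .
  have sB: "cvs.span B = X" using B(2,4) cvs.span_minimal[OF B(2) X(1)] by blast
  have KB: "cvs.span K \<subseteq> ?K" using K(1) subspace_kernel[OF f X(1)] by (rule cvs.span_minimal)
  let ?C = "B - K"
  have zero: "x = 0" if x: "x \<in> cvs.span ?C" "f x = 0" for x
  proof (rule ccontr)
    assume nz: "x \<noteq> 0"
    have "x \<in> X" using x(1) cvs.span_mono[of ?C B] sB by blast
    then have xK: "x \<in> cvs.span K" using x(2) K(3) by blast
    have fC: "finite ?C" using fB by simp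
    obtain u where u: "x = (\<Sum>v\<in>?C. cscale (u v) v)" using x(1) cvs.span_finite[OF fC] by auto
    obtain w where w: "x = (\<Sum>v\<in>K. cscale (w v) v)" using xK cvs.span_finite[OF K(5)] by auto
    define g where "g v = (if v \<in> K then w v else - u v)" for v
    have "(\<Sum>v\<in>B. cscale (g v) v) = (\<Sum>v\<in>?C. cscale (g v) v) + (\<Sum>v\<in>K. cscale (g v) v)"
      using sum.subset_diff[OF B(1) fB] .
    also have "(\<Sum>v\<in>?C. cscale (g v) v) = - x" unfolding u
      by (subst sum_negf[symmetric]) (auto simp: g_def intro!: sum.cong)
    also have "(\<Sum>v\<in>K. cscale (g v) v) = x" unfolding w by (auto simp: g_def intro!: sum.cong)
    finally have "(\<Sum>v\<in>B. cscale (g v) v) = 0" by simp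
    then have "\<forall>v\<in>B. g v = 0" using cvs.independentD[OF B(3) fB subset_refl] by blast
    then have "\<forall>v\<in>K. w v = 0" using B(1) unfolding g_def by (metis subsetD)
    then show False using w nz by simp
  qed
  have inj: "inj_on f (cvs.span ?C)"
  proof (rule inj_onI)
    fix x y assume a: "x \<in> cvs.span ?C" "y \<in> cvs.span ?C" "f x = f y"
    then have "f (x - y) = 0" by (simp add: cvp.linear_diff[OF f])
    then show "x = y" using zero[of "x - y"] cvs.span_diff[OF a(1,2)] by simp
  qed
  have indC: "cvs.independent ?C" using B(3) by (rule cvs.independent_mono) blast
  have ind: "cvs.independent (f ` ?C)"
    using cvp.linear_independent_injective_image[OF f indC inj] .
  have "f ` X = cvs.span (f ` ?C)"
  proof
    show "f ` X \<subseteq> cvs.span (f ` ?C)"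
    proof
      fix y assume "y \<in> f ` X"
      then obtain x where x: "x \<in> cvs.span B" "y = f x" using sB by blast
      have "f ` B \<subseteq> cvs.span (f ` ?C)"
      proof
        fix z assume "z \<in> f ` B"
        then obtain b where b: "b \<in> B" "z = f b" by blast
        show "z \<in> cvs.span (f ` ?C)"
        proof (cases "b \<in> K")
          case True then have "z = 0" using K(1) b(2) by blast
          then show ?thesis by (simp add: cvs.span_zero)
        next
          case False then show ?thesis using b by (intro cvs.span_base) auto
        qed
      qed
      then have "cvs.span (f ` B) \<subseteq> cvs.span (f ` ?C)" by (rule cvs.span_minimal) (rule cvs.subspace_span)
      then show "y \<in> cvs.span (f ` ?C)" using x cvp.linear_span_image[OF f, of B] by blast
    qed
    have "f ` ?C \<subseteq> f ` X" using B(2) by blast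
    then show "cvs.span (f ` ?C) \<subseteq> f ` X" using cvs.span_minimal subspace_image[OF f X(1)] by blast
  qed
  then have "cvs.dim (f ` X) = card (f ` ?C)" using cvs.dim_span_eq_card_independent[OF ind] by simp
  also have "\<dots> = card ?C" using inj_on_subset[OF inj cvs.span_superset] by (rule card_image)
  also have "\<dots> = cvs.dim X - cvs.dim ?K" using K(4,5) B(1) cB by (simp add: card_Diff_subset)
  finally show ?thesis using K(4) cB card_mono[OF fB B(1)] by simp
qed


section \<open>Homogeneous forms and their derivatives\<close>

lemma mdegree_superset: "finite A \<Longrightarrow> ky m \<subseteq> A \<Longrightarrow> mdegree m = (\<Sum>i\<in>A. lk m i)"
  unfolding mdegree_def by (rule sum.mono_neutral_left) (auto simp: in_keys_iff)

lemma mdegree_add [simp]: "mdegree (a + b) = mdegree a + mdegree b"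
proof -
  let ?A = "ky a \<union> ky b"
  have "ky (a + b) \<subseteq> ?A" by (rule keys_add)
  then show ?thesis by (simp add: mdegree_superset[of ?A] lookup_add sum.distrib)
qed

lemma mdegree_single [simp]: "mdegree (sg i k) = k"
  by (simp add: mdegree_def)

lemma mdegree_zero [simp]: "mdegree 0 = 0"
  by (simp add: mdegree_def)

lemma mdegree_eq_0: "mdegree m = 0 \<longleftrightarrow> m = 0"
  by (auto simp: mdegree_def in_keys_iff intro!: poly_mapping_eqI)

definition mons :: "nat \<Rightarrow> nat \<Rightarrow> monomial set" where
  "mons n d = {m. ky m \<subseteq> {..<n} \<and> mdegree m = d}"

lemma forms_iff: "P \<in> forms n d \<longleftrightarrow> ky P \<subseteq> mons n d"
  by (auto simp: forms_def polys_def mons_def)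

lemma forms_polys: "P \<in> forms n d \<Longrightarrow> P \<in> polys n"
  by (simp add: forms_def)

lemma mons_0 [simp]: "mons n 0 = {0}"
  by (auto simp: mons_def mdegree_eq_0)

lemma monomial_split: "lk m i \<noteq> 0 \<Longrightarrow> m = (m - sg i 1) + sg i (1::nat)"
  by (intro poly_mapping_eqI) (auto simp: lookup_add lookup_minus lookup_single when_def)

lemma keys_add_nat: "ky (a + b) = ky a \<union> ky (b :: 'a \<Rightarrow>\<^sub>0 nat)"
  by (auto simp: in_keys_iff lookup_add)

lemma mons_Suc: "mons n (Suc d) = (\<Union>i\<in>{..<n}. (\<lambda>m. m + sg i 1) ` mons n d)"
proof (intro equalityI subsetI)
  fix m assume m: "m \<in> mons n (Suc d)"
  then have "m \<noteq> 0" by (auto simp: mons_def)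
  then obtain i where i: "i \<in> ky m" by (metis keys_eq_empty ex_in_conv)
  let ?k = "m - sg i 1"
  have e: "m = ?k + sg i 1" using i by (intro monomial_split) (simp add: in_keys_iff)
  have "ky ?k \<subseteq> {..<n}" "i < n" using m i e keys_add_nat[of ?k "sg i 1"] by (auto simp: mons_def)
  moreover have "mdegree ?k = d"
  proof -
    have "mdegree (?k + sg i 1) = mdegree ?k + 1" by simp
    then show ?thesis using m e by (metis (mono_tags, lifting) Suc_eq_plus1 Suc_inject mem_Collect_eq mons_def)
  qed
  ultimately show "m \<in> (\<Union>i\<in>{..<n}. (\<lambda>m. m + sg i 1) ` mons n d)"
    using e by (auto simp: mons_def)
qed (auto simp: mons_def keys_add_nat split: if_splits)

lemma finite_mons [simp]: "finite (mons n d)"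
  by (induction d) (simp_all add: mons_Suc)

lemma subspace_forms: "cvs.subspace (forms n d)"
proof (rule cvs.subspaceI)
  show "0 \<in> forms n d" by (simp add: forms_iff)
  show "P + Q \<in> forms n d" if "P \<in> forms n d" "Q \<in> forms n d" for P Q
    using that keys_add[of P Q] by (auto simp: forms_iff)
  show "cscale c P \<in> forms n d" if "P \<in> forms n d" for c P
    using that by (auto simp: forms_iff in_keys_iff lookup_cscale subset_iff)
qed

lemma zero_forms [simp]: "0 \<in> forms n d" by (simp add: forms_iff)

lemmas forms_add = cvs.subspace_add[OF subspace_forms]
lemmas forms_diff = cvs.subspace_diff[OF subspace_forms]
lemmas forms_scale = cvs.subspace_scale[OF subspace_forms]
lemmas forms_sum = cvs.subspace_sum[OF subspace_forms]
lemmas forms_neg = cvs.subspace_neg[OF subspace_forms]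

lemma single_forms: "m \<in> mons n d \<Longrightarrow> sg m c \<in> forms n d"
  by (auto simp: forms_iff)

lemma var_forms [simp]: "i < n \<Longrightarrow> var i \<in> forms n 1" "i < n \<Longrightarrow> var i \<in> forms n (Suc 0)"
  unfolding var_def by (auto simp: mons_def intro!: single_forms)

lemma single_exp_inj [simp]: "sg i (Suc 0) = sg j (Suc 0) \<longleftrightarrow> i = j"
  by (metis lookup_single_eq lookup_single_not_eq nat.distinct(1))

lemma one_forms [simp]: "1 \<in> forms n 0"
  by (simp add: forms_iff)

lemma forms_mult: "P \<in> forms n d \<Longrightarrow> Q \<in> forms n e \<Longrightarrow> P * Q \<in> forms n (d + e)"
  using keys_mult[of P Q] unfolding forms_iff
  by (force simp: mons_def keys_add_nat subset_iff)

lemma span_mons: "forms n d = cvs.span ((\<lambda>m. sg m 1) ` mons n d)"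
proof
  show "forms n d \<subseteq> cvs.span ((\<lambda>m. sg m 1) ` mons n d)"
  proof
    fix P assume P: "P \<in> forms n d"
    have "P = (\<Sum>m\<in>ky P. cscale (lk P m) (sg m 1))" by (rule cpoly_expand)
    also have "\<dots> \<in> cvs.span ((\<lambda>m. sg m 1) ` mons n d)"
      using P by (intro cvs.span_sum cvs.span_scale cvs.span_base) (auto simp: forms_iff)
    finally show "P \<in> cvs.span ((\<lambda>m. sg m 1) ` mons n d)" .
  qed
  show "cvs.span ((\<lambda>m. sg m 1) ` mons n d) \<subseteq> forms n d"
    by (rule cvs.span_minimal[OF _ subspace_forms]) (auto intro: single_forms)
qed

lemma fin_gen_forms [simp]: "fin_gen (forms n d)"
  unfolding span_mons by (intro fin_gen_span fin_gen_finite) simp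

lemma forms_0: "forms n 0 = range (\<lambda>c. cscale c 1)"
  unfolding span_mons by (auto simp: cvs.span_singleton)

lemma var_single: "sg (m + sg i 1) 1 = var i * sg m 1"
  by (simp add: var_def mult_single add.commute)

lemma forms_Suc: "forms n (Suc d) = cvs.span {var i * P |i P. i < n \<and> P \<in> forms n d}" (is "_ = cvs.span ?A")
proof
  show "forms n (Suc d) \<subseteq> cvs.span ?A" unfolding span_mons[of n "Suc d"] mons_Suc
  proof (rule cvs.span_mono, rule subsetI)
    fix x :: cpoly assume "x \<in> (\<lambda>m. sg m 1) ` (\<Union>i\<in>{..<n}. (\<lambda>m. m + sg i 1) ` mons n d)"
    then obtain i m where "i < n" "m \<in> mons n d" "x = sg (m + sg i 1) 1" by auto
    then show "x \<in> ?A" using single_forms[of m n d 1] var_single[of m i] by blast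
  qed
  show "cvs.span ?A \<subseteq> forms n (Suc d)"
    by (rule cvs.span_minimal[OF _ subspace_forms]) (auto dest!: forms_mult[OF var_forms(1)])
qed

text \<open>
  Statements about operators of degree \<open>d + 1\<close> reduce to products of a variable and an
  operator of degree \<open>d\<close>; the linear map \<open>f\<close> is what the statement is about.
\<close>

lemma forms_Suc_induct:
  assumes "P \<in> forms n (Suc d)" "cvs.subspace X" "\<And>i P. i < n \<Longrightarrow> P \<in> forms n d \<Longrightarrow> f (var i * P) \<in> X"
    and "Vector_Spaces.linear cscale cscale f"
  shows "f P \<in> X"
proof -
  have "forms n (Suc d) \<subseteq> {P. f P \<in> X}" unfolding forms_Suc
  proof (rule cvs.span_minimal)
    show "cvs.subspace {P. f P \<in> X}" using cvp.linear_subspace_vimage[OF assms(4,2)] by (simp add: vimage_def)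
  qed (use assms(3) in auto)
  then show ?thesis using assms(1) by auto
qed

lemma pdiff_forms: "F \<in> forms n (Suc d) \<Longrightarrow> pdiff i F \<in> forms n d"
  unfolding forms_iff
proof
  fix b assume F: "ky F \<subseteq> mons n (Suc d)" and "b \<in> ky (pdiff i F)"
  then have "b + sg i 1 \<in> ky F" by (auto simp: in_keys_iff lookup_pdiff)
  then have "b + sg i 1 \<in> mons n (Suc d)" using F by blast
  then show "b \<in> mons n d" by (auto simp: mons_def keys_add_nat)
qed

lemma pdiff_forms_0: "F \<in> forms n 0 \<Longrightarrow> pdiff i F = 0"
proof -
  assume F: "F \<in> forms n 0"
  have "lk F (b + sg i 1) = 0" for b
  proof -
    have "b + sg i 1 \<noteq> 0" by (metis add_eq_0_iff_both_eq_0 mdegree_add mdegree_single mdegree_zero zero_neq_one)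
    then show ?thesis using F by (auto simp: forms_iff in_keys_iff subset_iff)
  qed
  then show ?thesis by (intro poly_mapping_eqI) (simp add: lookup_pdiff)
qed

lemma act_forms: "\<Theta> \<in> forms n k \<Longrightarrow> F \<in> forms n (k + d) \<Longrightarrow> \<Theta> \<odot> F \<in> forms n d"
proof (induction k arbitrary: \<Theta> d)
  case 0 then show ?case by (auto simp: forms_0[of n] act_scale_left intro: forms_scale)
next
  case (Suc k)
  show ?case
  proof (rule forms_Suc_induct[OF Suc.prems(1) subspace_forms _ linear_act_left])
    fix i P assume "i < n" "P \<in> forms n k"
    then show "(var i * P) \<odot> F \<in> forms n d"
      using Suc.IH[of P "Suc d"] Suc.prems(2) by (simp add: act_mult act_var pdiff_forms)
  qed
qed

lemma act_forms_zero: "\<Theta> \<in> forms n k \<Longrightarrow> F \<in> forms n d \<Longrightarrow> d < k \<Longrightarrow> \<Theta> \<odot> F = 0"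
proof (induction k arbitrary: \<Theta>)
  case 0 then show ?case by simp
next
  case (Suc k)
  have "\<Theta> \<odot> F \<in> {0}"
  proof (rule forms_Suc_induct[OF Suc.prems(1) cvs.subspace_single_0 _ linear_act_left])
    fix i P assume iP: "i < n" "P \<in> forms n k"
    show "(var i * P) \<odot> F \<in> {0}"
    proof (cases "d < k")
      case True then show ?thesis using Suc.IH[OF iP(2)] Suc.prems by (simp add: act_mult)
    next
      case False
      then have "P \<odot> F \<in> forms n 0" using act_forms[OF iP(2), of F 0] Suc.prems by (simp add: less_Suc_eq)
      then show ?thesis by (simp add: act_mult act_var pdiff_forms_0)
    qed
  qed
  then show ?case by simp
qed

lemma linear_form_expand: "u \<in> forms n 1 \<Longrightarrow> u = (\<Sum>i<n. cscale (lk u (sg i 1)) (var i))"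
proof -
  assume u: "u \<in> forms n 1"
  have m1: "mons n 1 = (\<lambda>i. sg i 1) ` {..<n}" using mons_Suc[of n 0] by auto
  have *: "lk u m = (\<Sum>i<n. lk u (sg i 1) * lk (var i) m)" for m
  proof (cases "m \<in> mons n 1")
    case True
    then obtain j where j: "j < n" "m = sg j 1" using m1 by auto
    then have "(\<Sum>i<n. lk u (sg i 1) * lk (var i) m) = (\<Sum>i<n. if i = j then lk u (sg j 1) else 0)"
      by (intro sum.cong) (auto simp: var_def lookup_single when_def)
    then show ?thesis using j by simp
  next
    case False
    then have "lk u m = 0" using u by (auto simp: forms_iff in_keys_iff subset_iff)
    moreover have "lk (var i) m = 0" if "i < n" for i
      using that False m1 by (auto simp: var_def lookup_single when_def)
    ultimately show ?thesis by simp
  qed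
  show ?thesis by (rule poly_mapping_eqI) (unfold lk_sum_scale, rule *)
qed

lemma act_linear_expand:
  assumes "u \<in> forms n 1"
  shows "u \<odot> F = (\<Sum>i<n. cscale (lk u (sg i 1)) (pdiff i F))"
  by (subst linear_form_expand[OF assms]) (simp add: act_sum_left act_scale_left act_var)

lemma act_leibniz: "u \<in> forms n 1 \<Longrightarrow> u \<odot> (P * Q) = (u \<odot> P) * Q + P * (u \<odot> Q)"
  by (simp add: act_linear_expand pdiff_mult sum.distrib cvs.scale_right_distrib sum_distrib_left sum_distrib_right)

lemma euler: "F \<in> forms n d \<Longrightarrow> (\<Sum>i<n. var i * pdiff i F) = cscale (of_nat d) F"
proof (induction d arbitrary: F)
  case 0 then show ?case by (simp add: pdiff_forms_0)
next
  case (Suc d)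
  let ?D = "\<lambda>F. (\<Sum>i<n. var i * pdiff i F) - cscale (of_nat (Suc d)) F"
  have lin: "Vector_Spaces.linear cscale cscale ?D"
    unfolding Vector_Spaces.linear_iff
  proof (intro conjI allI cvs.vector_space_axioms)
    show "?D (x + y) = ?D x + ?D y" for x y
      unfolding pdiff_add distrib_left sum.distrib cvs.scale_right_distrib by (rule add_diff_add)
    show "?D (cscale c x) = cscale c (?D x)" for c x
      unfolding pdiff_scale cscale_mult_right cvs.scale_sum_right[symmetric] cvs.scale_right_diff_distrib
        cvs.scale_left_commute[of c] ..
  qed
  have "?D F \<in> {0}"
  proof (rule forms_Suc_induct[OF Suc.prems cvs.subspace_single_0 _ lin])
    fix i P assume iP: "i < n" "P \<in> forms n d"
    have pv: "pdiff j (var i) = (if j = i then 1 else 0)" for j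
      by (auto simp: var_def pdiff_single lookup_single)
    have "(\<Sum>j<n. var j * pdiff j (var i * P)) = (\<Sum>j<n. if j = i then var i * P else 0) + (\<Sum>j<n. var i * (var j * pdiff j P))"
      unfolding sum.distrib[symmetric] by (rule sum.cong) (auto simp: pdiff_mult pv algebra_simps)
    also have "\<dots> = var i * P + var i * (\<Sum>j<n. var j * pdiff j P)" using iP by (simp add: sum_distrib_left)
    also have "\<dots> = cscale (of_nat (Suc d)) (var i * P)"
      using Suc.IH[OF iP(2)] by (simp add: cvs.scale_left_distrib)
    finally show "?D (var i * P) \<in> {0}" by simp
  qed
  then show ?case by simp
qed

text \<open>
  By Euler's formula a form of positive degree is recovered from its derivatives.
\<close>

lemma form_eq_0I: "F \<in> forms n d \<Longrightarrow> 1 \<le> d \<Longrightarrow> (\<And>i. i < n \<Longrightarrow> pdiff i F = 0) \<Longrightarrow> F = 0"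
  using euler[of F n d] by simp

lemma form_eq_0I': "F \<in> forms n d \<Longrightarrow> 1 \<le> d \<Longrightarrow> (\<And>u. u \<in> forms n 1 \<Longrightarrow> u \<odot> F = 0) \<Longrightarrow> F = 0"
  by (rule form_eq_0I) (auto, metis One_nat_def act_var var_forms(1))


section \<open>The pairing between forms of equal degree\<close>

lemma act_same_degree:
  assumes "\<Theta> \<in> forms n d" "F \<in> forms n d"
  shows "\<Theta> \<odot> F = cscale (\<Sum>m\<in>mons n d. lk \<Theta> m * (mfact m * lk F m)) 1"
proof -
  have "\<Theta> \<odot> F \<in> forms n 0" using act_forms[of \<Theta> n d F 0] assms by simp
  then obtain c where c: "\<Theta> \<odot> F = cscale c 1" by (auto simp: forms_0)
  have "lk (\<Theta> \<odot> F) 0 * mfact 0 = (\<Sum>m\<in>mons n d. lk \<Theta> m * (mfact (m + 0) * lk F (m + 0)))"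
    by (rule lookup_act_superset) (use assms in \<open>auto simp: forms_iff\<close>)
  then show ?thesis unfolding c by (simp add: lookup_cscale mfact_def)
qed

lemma act_same_degree_sym:
  assumes "\<Theta> \<in> forms n d" "F \<in> forms n d"
  shows "\<Theta> \<odot> F = F \<odot> \<Theta>"
proof -
  have "(\<Sum>m\<in>mons n d. lk \<Theta> m * (mfact m * lk F m)) = (\<Sum>m\<in>mons n d. lk F m * (mfact m * lk \<Theta> m))"
    by (intro sum.cong) simp_all
  then show ?thesis by (simp only: act_same_degree[OF assms] act_same_degree[OF assms(2,1)])
qed

text \<open>
  A linear functional that vanishes on \<open>X\<close> and not at \<open>G\<close> is the action of an operator of
  degree \<open>d\<close>, because the monomials pair to nonzero numbers with themselves and to zero with
  each other.
\<close>

lemma separation: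
  assumes X: "cvs.subspace X" and G: "G \<in> forms n d" "G \<notin> X"
  obtains \<Theta> where "\<Theta> \<in> forms n d" "\<And>P. P \<in> X \<Longrightarrow> P \<in> forms n d \<Longrightarrow> \<Theta> \<odot> P = 0" "\<Theta> \<odot> G = 1"
proof -
  obtain B where B: "B \<subseteq> X" "cvs.independent B" "X \<subseteq> cvs.span B"
    using cvs.basis_exists[of X] by metis
  have "G \<notin> cvs.span B" using G(2) cvs.span_minimal[OF B(1) X] by blast
  then have ind: "cvs.independent (insert G B)" using B(2) by (rule cvs.independent_insertI)
  obtain f :: "cpoly \<Rightarrow> cpoly" where f: "Vector_Spaces.linear cscale cscale f"
    "\<And>x. x \<in> insert G B \<Longrightarrow> f x = (if x = G then 1 else 0)"
    using cvp.linear_independent_extend[OF ind, of "\<lambda>x. if x = G then 1 else 0"] by metis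
  have fG: "f G = 1" using f(2) by simp
  have fX: "f P = 0" if "P \<in> X" for P
  proof (rule cvp.linear_eq_0_on_span[OF f(1)])
    show "P \<in> cvs.span B" using that B(3) by blast
    show "f x = 0" if "x \<in> B" for x using that f(2)[of x] G(2) B(1) by auto
  qed
  define \<Theta> where "\<Theta> = (\<Sum>m\<in>mons n d. sg m (lk (f (sg m 1)) 0 / mfact m))"
  have lk\<Theta>: "lk \<Theta> m = lk (f (sg m 1)) 0 / mfact m" if "m \<in> mons n d" for m
    using that by (simp add: \<Theta>_def lookup_sum lookup_single when_def)
  have \<Theta>: "\<Theta> \<in> forms n d" unfolding \<Theta>_def by (intro forms_sum single_forms)
  have act: "\<Theta> \<odot> P = cscale (lk (f P) 0) 1" if P: "P \<in> forms n d" for P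
  proof -
    have "P = (\<Sum>m\<in>ky P. cscale (lk P m) (sg m 1))" by (rule cpoly_expand)
    also have "\<dots> = (\<Sum>m\<in>mons n d. cscale (lk P m) (sg m 1))"
      using P by (intro sum.mono_neutral_left) (auto simp: forms_iff in_keys_iff)
    finally have "f P = f (\<Sum>m\<in>mons n d. cscale (lk P m) (sg m 1))" by simp
    also have "\<dots> = (\<Sum>m\<in>mons n d. cscale (lk P m) (f (sg m 1)))"
      by (simp add: cvp.linear_sum[OF f(1)] cvp.linear_scale[OF f(1)])
    finally have "lk (f P) 0 = (\<Sum>m\<in>mons n d. lk P m * lk (f (sg m 1)) 0)"
      by (simp add: lk_sum_scale)
    also have "\<dots> = (\<Sum>m\<in>mons n d. lk \<Theta> m * (mfact m * lk P m))"
      by (intro sum.cong) (simp_all add: lk\<Theta>)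
    finally show ?thesis using act_same_degree[OF \<Theta> P] by simp
  qed
  show ?thesis
    by (rule that[of \<Theta>]) (auto simp: \<Theta> act fX fG G(1))
qed


section \<open>Hilbert functions and apolar generators\<close>

lemma apolar_forms: "apolar_ideal n F \<inter> forms n k = {\<Theta> \<in> forms n k. \<Theta> \<odot> F = 0}"
  using forms_polys by (auto simp: apolar_ideal_def)

text \<open>
  The Hilbert function counts independent derivatives of order \<open>k\<close>; all estimates below are
  made in this form.
\<close>

lemma hilbert_eq_dim: "hilbert n F k = cvs.dim ((\<lambda>\<Theta>. \<Theta> \<odot> F) ` forms n k)"
  unfolding hilbert_def apolar_forms
  using rank_nullity[OF linear_act_left subspace_forms fin_gen_forms, of n k F] by simp

definition derivs1 :: "nat \<Rightarrow> cpoly \<Rightarrow> cpoly set" where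
  "derivs1 n F = (\<lambda>u. u \<odot> F) ` forms n 1"

lemma subspace_derivs1: "cvs.subspace (derivs1 n F)"
  unfolding derivs1_def by (rule subspace_image[OF linear_act_left subspace_forms])

definition shares_gradient :: "nat \<Rightarrow> cpoly \<Rightarrow> cpoly \<Rightarrow> bool" where
  "shares_gradient n F G \<longleftrightarrow> (\<forall>i<n. pdiff i G \<in> derivs1 n F)"

lemma irrelevant_ideal_eq: "irrelevant_ideal n = cvs.span {P * var i |P i. P \<in> polys n \<and> i < n}"
  unfolding irrelevant_ideal_def ideal_gen_def by (rule arg_cong[of _ _ cvs.span]) auto

lemma polys_one: "1 \<in> polys n"
  by (simp add: polys_def)

lemma var_irrelevant: "i < n \<Longrightarrow> var i \<in> irrelevant_ideal n"
  unfolding irrelevant_ideal_eq using polys_one by (intro cvs.span_base) force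

text \<open>
  If \<open>\<Theta>\<close> kills \<open>F\<close>, then \<open>\<alpha>\<^sub>i * \<Theta>\<close> kills \<open>G\<close>: the derivative \<open>\<alpha>\<^sub>i \<odot> G\<close> is \<open>u \<odot> F\<close> for some
  \<open>u\<close>, and \<open>\<Theta>\<close> commutes with \<open>u\<close>.
\<close>

lemma ideal_mult_kills:
  assumes "shares_gradient n F G" "\<Psi> \<in> ideal_mult (irrelevant_ideal n) (apolar_ideal n F)"
  shows "\<Psi> \<odot> G = 0"
proof -
  have "ideal_mult (irrelevant_ideal n) (apolar_ideal n F) \<subseteq> {\<Psi>. \<Psi> \<odot> G = 0}"
    unfolding ideal_mult_def
  proof (rule cvs.span_minimal)
    show "cvs.subspace {\<Psi>. \<Psi> \<odot> G = 0}"
      using cvp.linear_subspace_kernel[OF linear_act_left] .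
    show "{a * b |a b. a \<in> irrelevant_ideal n \<and> b \<in> apolar_ideal n F} \<subseteq> {\<Psi>. \<Psi> \<odot> G = 0}"
    proof clarify
      fix a b assume a: "a \<in> irrelevant_ideal n" and "b \<in> apolar_ideal n F"
      then have b: "b \<odot> F = 0" by (simp add: apolar_ideal_def)
      have "irrelevant_ideal n \<subseteq> {a. a \<odot> (b \<odot> G) = 0}" unfolding irrelevant_ideal_eq
      proof (rule cvs.span_minimal)
        show "cvs.subspace {a. a \<odot> (b \<odot> G) = 0}"
          using cvp.linear_subspace_kernel[OF linear_act_left] .
        show "{P * var i |P i. P \<in> polys n \<and> i < n} \<subseteq> {a. a \<odot> (b \<odot> G) = 0}"
        proof clarify
          fix P i assume "i < n"
          then obtain u where u: "pdiff i G = u \<odot> F"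
            using assms(1) by (auto simp: shares_gradient_def derivs1_def)
          have "var i \<odot> b \<odot> G = b \<odot> u \<odot> F" by (metis act_commute act_var u)
          also have "\<dots> = u \<odot> b \<odot> F" by (rule act_commute)
          finally show "(P * var i) \<odot> (b \<odot> G) = 0" by (simp add: act_mult b)
        qed
      qed
      then show "(a * b) \<odot> G = 0" using a by (auto simp: act_mult)
    qed
  qed
  then show ?thesis using assms(2) by blast
qed

lemma ideal_mult_subset_apolar:
  "ideal_mult (irrelevant_ideal n) (apolar_ideal n F) \<inter> forms n d \<subseteq> apolar_ideal n F \<inter> forms n d"
proof -
  have "shares_gradient n F F"
    by (auto simp: shares_gradient_def derivs1_def simp flip: act_var)
  then show ?thesis using ideal_mult_kills[of n F F] by (auto simp: apolar_forms)
qed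

text \<open>
  The forms \<open>G\<close> that share the gradient of \<open>F\<close> are exactly those orthogonal to the part of
  degree \<open>d\<close> of \<open>\<mm> F\<^sup>\<bottom>\<close>, whereas \<open>F\<close> spans the orthogonal complement of the part of degree \<open>d\<close>
  of \<open>F\<^sup>\<bottom>\<close>.  So the two parts differ if and only if there is a \<open>G\<close> outside the line of \<open>F\<close>.
\<close>

lemma ApoEqu_iff:
  assumes d: "1 \<le> d"
  shows "F \<in> ApoEqu n d \<longleftrightarrow> F \<in> forms n d \<and> F \<noteq> 0 \<and>
    (\<exists>G \<in> forms n d. G \<notin> cvs.span {F} \<and> shares_gradient n F G)"
proof (intro iffI; (elim conjE bexE)?)
  let ?K = "ideal_mult (irrelevant_ideal n) (apolar_ideal n F) \<inter> forms n d"
  assume "F \<in> ApoEqu n d"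
  then have F: "F \<in> forms n d" "F \<noteq> 0" "?K \<noteq> apolar_ideal n F \<inter> forms n d"
    by (auto simp: ApoEqu_def)
  then obtain \<Theta> where \<Theta>: "\<Theta> \<in> forms n d" "\<Theta> \<odot> F = 0" "\<Theta> \<notin> ?K"
    using ideal_mult_subset_apolar[of n F d] by (auto simp: apolar_forms)
  have sK: "cvs.subspace ?K" unfolding ideal_mult_def
    by (rule cvs.subspace_inter[OF cvs.subspace_span subspace_forms])
  obtain G where G: "G \<in> forms n d" "\<And>P. P \<in> ?K \<Longrightarrow> P \<in> forms n d \<Longrightarrow> G \<odot> P = 0" "G \<odot> \<Theta> = 1"
    using separation[OF sK \<Theta>(1,3)] by metis
  have G\<Theta>: "\<Theta> \<odot> G = 1" using G(1,3) \<Theta>(1) act_same_degree_sym by metis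
  have 1: "G \<notin> cvs.span {F}"
    using G\<Theta> \<Theta>(2) by (auto simp: cvs.span_singleton act_scale_right)
  have "pdiff i G \<in> derivs1 n F" if i: "i < n" for i
  proof (rule ccontr)
    assume a: "pdiff i G \<notin> derivs1 n F"
    have "pdiff i G \<in> forms n (d - 1)" using pdiff_forms[of G n "d - 1"] G(1) d by simp
    then obtain \<Psi> where \<Psi>: "\<Psi> \<in> forms n (d - 1)" "\<Psi> \<odot> pdiff i G = 1"
      "\<And>P. P \<in> derivs1 n F \<Longrightarrow> P \<in> forms n (d - 1) \<Longrightarrow> \<Psi> \<odot> P = 0"
      using separation[OF subspace_derivs1 _ a] by metis
    have "\<Psi> \<odot> F = 0"
    proof (rule form_eq_0I[of _ n 1])
      show "\<Psi> \<odot> F \<in> forms n 1" using act_forms[OF \<Psi>(1), of F 1] F(1) d by simp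
      fix j assume j: "j < n"
      have "pdiff j F \<in> forms n (d - 1)" using pdiff_forms[of F n "d - 1"] F(1) d by simp
      moreover have "pdiff j F \<in> derivs1 n F" using j by (auto simp: derivs1_def simp flip: act_var)
      ultimately show "pdiff j (\<Psi> \<odot> F) = 0" using \<Psi>(3) by (metis act_commute act_var)
    qed simp
    then have "\<Psi> \<in> apolar_ideal n F" using \<Psi>(1) by (auto simp: apolar_ideal_def forms_polys)
    then have "var i * \<Psi> \<in> ideal_mult (irrelevant_ideal n) (apolar_ideal n F)"
      unfolding ideal_mult_def using var_irrelevant[OF i] by (intro cvs.span_base) blast
    moreover have *: "var i * \<Psi> \<in> forms n d" using forms_mult[OF var_forms(1)[OF i] \<Psi>(1)] d by simp
    ultimately have "G \<odot> (var i * \<Psi>) = 0" using G(2) by blast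
    then have "(\<Psi> * var i) \<odot> G = 0" using act_same_degree_sym[OF * G(1)] by (simp add: mult.commute)
    then show False using \<Psi>(2) by (simp add: act_mult act_var)
  qed
  then show "F \<in> forms n d \<and> F \<noteq> 0 \<and> (\<exists>G \<in> forms n d. G \<notin> cvs.span {F} \<and> shares_gradient n F G)"
    using F(1,2) 1 G(1) by (auto simp: shares_gradient_def)
next
  fix G assume F: "F \<in> forms n d" "F \<noteq> 0" and G: "G \<in> forms n d" "G \<notin> cvs.span {F}" "shares_gradient n F G"
  obtain \<Theta> where \<Theta>: "\<Theta> \<in> forms n d" "\<And>P. P \<in> cvs.span {F} \<Longrightarrow> P \<in> forms n d \<Longrightarrow> \<Theta> \<odot> P = 0" "\<Theta> \<odot> G = 1"
    using separation[OF cvs.subspace_span G(1,2)] by metis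
  have "\<Theta> \<odot> F = 0" using \<Theta>(2) F(1) by (simp add: cvs.span_base)
  then have "\<Theta> \<in> apolar_ideal n F \<inter> forms n d" using \<Theta>(1) by (simp add: apolar_forms)
  moreover have "\<Theta> \<notin> ideal_mult (irrelevant_ideal n) (apolar_ideal n F)"
    using ideal_mult_kills[OF G(3)] \<Theta>(3) by force
  ultimately show "F \<in> ApoEqu n d" using F by (auto simp: ApoEqu_def)
qed


section \<open>Specialization and semicontinuity\<close>

text \<open>
  Independence of a family of functions, phrased by coordinates so that the coordinates
  may be regular functions of a parameter.
\<close>

definition indep_fun :: "'i set \<Rightarrow> ('i \<Rightarrow> 'c \<Rightarrow> complex) \<Rightarrow> bool" where
  "indep_fun I v \<longleftrightarrow> (\<forall>a. (\<forall>c. (\<Sum>i\<in>I. a i * v i c) = 0) \<longrightarrow> (\<forall>i\<in>I. a i = 0))"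

text \<open>
  What a deformation argument needs to know of a curve with a marked point: a ring of
  functions, and a filter of points that tend to \<open>pt\<close> and for which nonvanishing at \<open>pt\<close> is an
  open condition.  It is instantiated by arbitrary curves and by the affine line.
\<close>

locale specialization =
  fixes Reg :: "('p \<Rightarrow> complex) set" and pt :: 'p and Fil :: "'p filter"
  assumes reg_const: "(\<lambda>_. c) \<in> Reg"
    and reg_add: "f \<in> Reg \<Longrightarrow> g \<in> Reg \<Longrightarrow> (\<lambda>p. f p + g p) \<in> Reg"
    and reg_mult: "f \<in> Reg \<Longrightarrow> g \<in> Reg \<Longrightarrow> (\<lambda>p. f p * g p) \<in> Reg"
    and reg_nonzero: "f \<in> Reg \<Longrightarrow> f pt \<noteq> 0 \<Longrightarrow> eventually (\<lambda>p. f p \<noteq> 0) Fil"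
begin

lemma reg_sum: "(\<And>x. x \<in> A \<Longrightarrow> f x \<in> Reg) \<Longrightarrow> (\<lambda>p. \<Sum>x\<in>A. f x p) \<in> Reg"
  by (induction A rule: infinite_finite_induct) (auto intro: reg_const reg_add)

lemma reg_scale: "f \<in> Reg \<Longrightarrow> (\<lambda>p. c * f p) \<in> Reg"
  using reg_mult[OF reg_const] .

lemma reg_diff: "f \<in> Reg \<Longrightarrow> g \<in> Reg \<Longrightarrow> (\<lambda>p. f p - g p) \<in> Reg"
  using reg_add[of f "\<lambda>p. (-1) * g p"] reg_scale[of g "-1"] by simp

text \<open>
  One step of Gauss elimination without division: if \<open>c0\<close> is a coordinate in which the new vector
  does not vanish at \<open>pt\<close>, clear this coordinate in all the other vectors.  The
  results have regular coordinates again and remain independent at \<open>pt\<close>.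
\<close>

lemma indep_fun_open:
  assumes "finite I" "\<And>i c. i \<in> I \<Longrightarrow> (\<lambda>p. v p i c) \<in> Reg" "indep_fun I (v pt)"
  shows "eventually (\<lambda>p. indep_fun I (v p)) Fil"
  using assms
proof (induction I arbitrary: v rule: finite_induct)
  case empty
  show ?case by (simp add: indep_fun_def)
next
  case (insert j I)
  have "\<exists>c. v pt j c \<noteq> 0"
  proof (rule ccontr)
    assume "\<not> ?thesis"
    then have "\<forall>c. (\<Sum>i\<in>insert j I. (if i = j then 1 else 0) * v pt i c) = 0"
      using insert.hyps by (auto intro!: sum.neutral)
    then show False
      using insert.prems(2)[unfolded indep_fun_def, rule_format, of "\<lambda>i. if i = j then 1 else 0" j] by simp
  qed
  then obtain c0 where c0: "v pt j c0 \<noteq> 0" by blast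
  define w where "w p i c = v p j c0 * v p i c - v p i c0 * v p j c" for p i c
  have w_sum: "(\<Sum>i\<in>I. a i * w p i c) =
      v p j c0 * (\<Sum>i\<in>I. a i * v p i c) - (\<Sum>i\<in>I. a i * v p i c0) * v p j c" for a p c
    by (simp add: w_def sum_distrib_left sum_distrib_right sum_subtractf algebra_simps)
  have "indep_fun I (w pt)" unfolding indep_fun_def
  proof (intro allI impI)
    fix a assume a: "\<forall>c. (\<Sum>i\<in>I. a i * w pt i c) = 0"
    define b where "b i = (if i = j then - (\<Sum>i\<in>I. a i * v pt i c0) else v pt j c0 * a i)" for i
    have "(\<Sum>i\<in>insert j I. b i * v pt i c) = 0" for c
    proof -
      have "(\<Sum>i\<in>insert j I. b i * v pt i c) = b j * v pt j c + (\<Sum>i\<in>I. b i * v pt i c)"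
        using insert.hyps by simp
      also have "(\<Sum>i\<in>I. b i * v pt i c) = (\<Sum>i\<in>I. v pt j c0 * (a i * v pt i c))"
        using insert.hyps(2) by (intro sum.cong) (auto simp: b_def)
      finally show ?thesis using a[rule_format, of c] unfolding w_sum
        by (simp add: b_def sum_distrib_left)
    qed
    then have b0: "b i = 0" if "i \<in> insert j I" for i
      using that insert.prems(2)[unfolded indep_fun_def, rule_format, of b] by blast
    show "\<forall>i\<in>I. a i = 0"
    proof
      fix i assume "i \<in> I"
      then have "i \<noteq> j" "b i = 0" using insert.hyps(2) b0 by auto
      then show "a i = 0" using c0 by (simp add: b_def)
    qed
  qed
  moreover have "(\<lambda>p. w p i c) \<in> Reg" if "i \<in> I" for i c
    unfolding w_def using that insert.prems(1) by (intro reg_diff reg_mult) auto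
  ultimately have "eventually (\<lambda>p. indep_fun I (w p)) Fil" using insert.IH[of w] by blast
  moreover have "eventually (\<lambda>p. v p j c0 \<noteq> 0) Fil"
    using insert.prems(1) c0 by (intro reg_nonzero) auto
  ultimately show ?case
  proof eventually_elim
    case (elim p)
    show ?case unfolding indep_fun_def
    proof (intro allI impI)
      fix a assume a: "\<forall>c. (\<Sum>i\<in>insert j I. a i * v p i c) = 0"
      then have s: "(\<Sum>i\<in>I. a i * v p i c) = - (a j * v p j c)" for c
        using insert.hyps by (simp add: add_eq_0_iff2)
      have "(\<Sum>i\<in>I. a i * w p i c) = 0" for c unfolding w_sum s by simp
      then have I: "\<forall>i\<in>I. a i = 0" using elim(1) unfolding indep_fun_def by blast
      then have "a j * v p j c0 = 0" using s[of c0] by simp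
      then show "\<forall>i\<in>insert j I. a i = 0" using I elim(2) by simp
    qed
  qed
qed

definition reg_family :: "('p \<Rightarrow> cpoly) \<Rightarrow> bool" where
  "reg_family Fam \<longleftrightarrow> (\<forall>m. (\<lambda>p. lk (Fam p) m) \<in> Reg)"

lemma reg_family_act: "reg_family Fam \<Longrightarrow> reg_family (\<lambda>p. \<Theta> \<odot> Fam p)"
proof -
  assume F: "reg_family Fam"
  have e: "lk (\<Theta> \<odot> G) b = (\<Sum>a\<in>ky \<Theta>. (lk \<Theta> a * mfact (a + b) / mfact b) * lk G (a + b))" for G b
    using lookup_act[of \<Theta> G b] mfact_nonzero[of b]
    by (simp add: nonzero_eq_divide_eq[symmetric] sum_divide_distrib mult.assoc)
  show ?thesis unfolding reg_family_def e
    by (intro allI reg_sum reg_scale) (use F in \<open>simp add: reg_family_def\<close>)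
qed

end

lemma indep_fun_independent:
  assumes "finite I" "indep_fun I (\<lambda>i. lk (g i))"
  shows "inj_on g I" "cvs.independent (g ` I)"
proof -
  show inj: "inj_on g I"
  proof (rule inj_onI, rule ccontr)
    fix x y assume xy: "x \<in> I" "y \<in> I" "g x = g y" "x \<noteq> y"
    define a where "a i = (if i = x then 1 else if i = y then -1 else (0::complex))" for i
    have "(\<Sum>i\<in>I. a i * lk (g i) c) = (\<Sum>i\<in>{x,y}. a i * lk (g i) c)" for c
      using xy assms(1) by (intro sum.mono_neutral_right) (auto simp: a_def)
    then have "\<forall>c. (\<Sum>i\<in>I. a i * lk (g i) c) = 0" using xy by (simp add: a_def)
    then have "a x = 0" using assms(2)[unfolded indep_fun_def, rule_format, of a x] xy(1) by simp
    then show False by (simp add: a_def)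
  qed
  show "cvs.independent (g ` I)"
  proof (rule cvs.independent_if_scalars_zero)
    fix f x assume f: "(\<Sum>x\<in>g ` I. cscale (f x) x) = 0" and "x \<in> g ` I"
    then obtain i where i: "i \<in> I" "x = g i" by blast
    have "(\<Sum>i\<in>I. cscale (f (g i)) (g i)) = 0" using f inj by (simp add: sum.reindex)
    then have "\<forall>c. (\<Sum>i\<in>I. f (g i) * lk (g i) c) = 0" by (metis lk_sum_scale lookup_zero)
    then have "\<forall>i\<in>I. f (g i) = 0"
      using assms(2)[unfolded indep_fun_def, rule_format, of "\<lambda>i. f (g i)"] by blast
    then show "f x = 0" using i by simp
  qed (use assms(1) in simp)
qed

lemma independent_indep_fun:
  assumes "finite I" "inj_on g I" "cvs.independent (g ` I)"
  shows "indep_fun I (\<lambda>i. lk (g i))"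
  unfolding indep_fun_def
proof (intro allI impI)
  fix a assume a: "\<forall>c. (\<Sum>i\<in>I. a i * lk (g i) c) = 0"
  have "(\<Sum>i\<in>I. cscale (a i) (g i)) = 0"
    by (rule poly_mapping_eqI) (use a in \<open>simp add: lk_sum_scale\<close>)
  then have "(\<Sum>x\<in>g ` I. cscale (a (the_inv_into I g x)) x) = 0"
    by (simp add: sum.reindex[OF assms(2)] the_inv_into_f_f[OF assms(2)])
  then have "\<forall>x\<in>g ` I. a (the_inv_into I g x) = 0"
    using cvs.independentD[OF assms(3) _ subset_refl, of "\<lambda>x. a (the_inv_into I g x)"] assms(1) by auto
  then show "\<forall>i\<in>I. a i = 0" by (simp add: the_inv_into_f_f[OF assms(2)])
qed

lemma hilbert_geI:
  assumes "finite I" "\<And>i. i \<in> I \<Longrightarrow> \<Theta> i \<in> forms n k" "indep_fun I (\<lambda>i. lk (\<Theta> i \<odot> F))"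
  shows "card I \<le> hilbert n F k"
proof -
  let ?g = "\<lambda>i. \<Theta> i \<odot> F"
  have "card I = card (?g ` I)" using indep_fun_independent(1)[OF assms(1,3)] by (simp add: card_image)
  also have "\<dots> \<le> hilbert n F k" unfolding hilbert_eq_dim
  proof (rule conjunct2[OF independent_finite_dim])
    show "fin_gen ((\<lambda>\<Theta>. \<Theta> \<odot> F) ` forms n k)" by (rule fin_gen_image[OF linear_act_left fin_gen_forms])
    show "cvs.independent (?g ` I)" by (rule indep_fun_independent(2)[OF assms(1,3)])
    show "?g ` I \<subseteq> cvs.span ((\<lambda>\<Theta>. \<Theta> \<odot> F) ` forms n k)"
      using assms(2) by (auto intro!: cvs.span_base)
  qed
  finally show ?thesis .
qed

lemma hilbert_basis:
  obtains \<Theta> where "\<And>i. i < hilbert n F k \<Longrightarrow> \<Theta> i \<in> forms n k"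
    "indep_fun {..<hilbert n F k} (\<lambda>i. lk (\<Theta> i \<odot> F))"
    "(\<lambda>\<Theta>. \<Theta> \<odot> F) ` forms n k = cvs.span ((\<lambda>i. \<Theta> i \<odot> F) ` {..<hilbert n F k})"
proof -
  let ?W = "(\<lambda>\<Theta>. \<Theta> \<odot> F) ` forms n k"
  have "fin_gen ?W" by (rule fin_gen_image[OF linear_act_left fin_gen_forms])
  then obtain B where B: "B \<subseteq> ?W" "cvs.independent B" "?W \<subseteq> cvs.span B" "card B = cvs.dim ?W" "finite B"
    by (rule finite_basis_exists)
  obtain b where b: "bij_betw b {..<hilbert n F k} B"
    using ex_bij_betw_nat_finite[OF B(5)] B(4) unfolding hilbert_eq_dim atLeast0LessThan by auto
  have "\<forall>i<hilbert n F k. \<exists>\<Theta>. \<Theta> \<in> forms n k \<and> b i = \<Theta> \<odot> F"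
    using b B(1) unfolding bij_betw_def by fastforce
  then obtain \<Theta> where \<Theta>: "\<And>i. i < hilbert n F k \<Longrightarrow> \<Theta> i \<in> forms n k \<and> b i = \<Theta> i \<odot> F" by metis
  have im: "(\<lambda>i. \<Theta> i \<odot> F) ` {..<hilbert n F k} = B"
    using b \<Theta> unfolding bij_betw_def by force
  have inj: "inj_on (\<lambda>i. \<Theta> i \<odot> F) {..<hilbert n F k}"
    using b \<Theta> unfolding bij_betw_def by (auto simp: inj_on_def)
  show ?thesis
  proof (rule that[of \<Theta>])
    show "indep_fun {..<hilbert n F k} (\<lambda>i. lk (\<Theta> i \<odot> F))"
      by (rule independent_indep_fun) (use inj im B(2) in auto)
    have "cvs.span B \<subseteq> ?W"
      by (rule cvs.span_minimal[OF B(1) subspace_image[OF linear_act_left subspace_forms]])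
    then show "?W = cvs.span ((\<lambda>i. \<Theta> i \<odot> F) ` {..<hilbert n F k})" using im B(3) by auto
  qed (use \<Theta> in auto)
qed

context specialization begin

text \<open>
  Finitely many operators whose values at the special form are independent keep independent
  values nearby.
\<close>

lemma hilbert_semicontinuous:
  assumes "reg_family Fam"
  shows "eventually (\<lambda>p. hilbert n (Fam pt) k \<le> hilbert n (Fam p) k) Fil"
proof -
  obtain \<Theta> where \<Theta>: "\<And>i. i < hilbert n (Fam pt) k \<Longrightarrow> \<Theta> i \<in> forms n k"
    "indep_fun {..<hilbert n (Fam pt) k} (\<lambda>i. lk (\<Theta> i \<odot> Fam pt))"
    using hilbert_basis[of n "Fam pt" k] by metis
  have "eventually (\<lambda>p. indep_fun {..<hilbert n (Fam pt) k} (\<lambda>i. lk (\<Theta> i \<odot> Fam p))) Fil"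
    by (rule indep_fun_open) (use \<Theta> reg_family_act[OF assms] in \<open>auto simp: reg_family_def\<close>)
  then show ?thesis
  proof eventually_elim
    case (elim p)
    then show ?case using hilbert_geI[of "{..<hilbert n (Fam pt) k}" \<Theta> n k "Fam p"] \<Theta>(1) by simp
  qed
qed

end

lemma span_image_finite:
  assumes "finite I" "x \<in> cvs.span (g ` I)"
  obtains c where "x = (\<Sum>i\<in>I. cscale (c i) (g i))"
proof -
  let ?X = "{x. \<exists>c. x = (\<Sum>i\<in>I. cscale (c i) (g i))}"
  have "cvs.span (g ` I) \<subseteq> ?X"
  proof (rule cvs.span_minimal)
    show "cvs.subspace ?X"
    proof (rule cvs.subspaceI)
      show "0 \<in> ?X" by (auto intro!: exI[of _ "\<lambda>_. 0"])
      show "x + y \<in> ?X" if xy: "x \<in> ?X" "y \<in> ?X" for x y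
      proof -
        obtain c d where "x = (\<Sum>i\<in>I. cscale (c i) (g i))" "y = (\<Sum>i\<in>I. cscale (d i) (g i))"
          using xy by blast
        then have "x + y = (\<Sum>i\<in>I. cscale (c i + d i) (g i))"
          by (simp add: cvs.scale_left_distrib sum.distrib)
        then show ?thesis by (intro CollectI exI)
      qed
      show "cscale k x \<in> ?X" if x: "x \<in> ?X" for k x
      proof -
        obtain c where "x = (\<Sum>i\<in>I. cscale (c i) (g i))" using x by blast
        then have "cscale k x = (\<Sum>i\<in>I. cscale (k * c i) (g i))"
          by (simp add: cvs.scale_sum_right)
        then show ?thesis by (intro CollectI exI)
      qed
    qed
    show "g ` I \<subseteq> ?X"
    proof clarify
      fix i assume i: "i \<in> I"
      have "(\<Sum>j\<in>I. cscale (if j = i then 1 else 0) (g j)) = (\<Sum>j\<in>I. if j = i then g j else 0)"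
        by (intro sum.cong) auto
      then have "g i = (\<Sum>j\<in>I. cscale (if j = i then 1 else 0) (g j))"
        using i assms(1) by simp
      then show "\<exists>c. g i = (\<Sum>i\<in>I. cscale (c i) (g i))"
        by (rule exI[of _ "\<lambda>j. if j = i then 1 else 0"])
    qed
  qed
  then show ?thesis using assms(2) that by blast
qed

lemma pdiff_linear_form: "v \<in> forms n 1 \<Longrightarrow> pdiff i v = cscale (lk v (sg i 1)) 1"
proof (rule poly_mapping_eqI)
  fix b assume v: "v \<in> forms n 1"
  show "lk (pdiff i v) b = lk (cscale (lk v (sg i 1)) 1) b"
  proof (cases "b = 0")
    case True then show ?thesis by (simp add: lookup_pdiff lookup_cscale)
  next
    case False
    then have "b + sg i 1 \<notin> mons n 1" using mdegree_eq_0[of b] by (auto simp: mons_def)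
    then have "lk v (b + sg i 1) = 0" using v by (auto simp: forms_iff in_keys_iff)
    then show ?thesis using False by (simp add: lookup_pdiff lookup_cscale lookup_one when_def)
  qed
qed

lemma linear_form_act: "u \<in> forms n 1 \<Longrightarrow> v \<in> forms n 1 \<Longrightarrow>
    u \<odot> v = cscale (\<Sum>i<n. lk u (sg i 1) * lk v (sg i 1)) 1"
  by (simp only: act_linear_expand[of u n] pdiff_linear_form[of v n] cvs.scale_scale cvs.scale_sum_left)

lemma linear_act_one: "u \<in> forms n 1 \<Longrightarrow> u \<odot> 1 = 0"
  by (rule act_forms_zero[of u n 1 1 0]) auto


section \<open>Direct sums and projectors\<close>

lemma sym_power_subset:
  assumes "cvs.subspace X" "\<And>l. (\<forall>j<d. l j \<in> W) \<Longrightarrow> (\<Prod>j<d. l j) \<in> X"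
  shows "sym_power d W \<subseteq> X"
  unfolding sym_power_def by (rule cvs.span_minimal) (use assms in auto)

lemma sym_power_forms: assumes "W \<subseteq> forms n 1" shows "sym_power d W \<subseteq> forms n d"
proof (rule sym_power_subset[OF subspace_forms])
  fix l :: "nat \<Rightarrow> cpoly"
  show "\<forall>j<d. l j \<in> W \<Longrightarrow> (\<Prod>j<d. l j) \<in> forms n d"
  proof (induction d)
    case (Suc d)
    then have "(\<Prod>j<d. l j) * l d \<in> forms n (d + 1)" using assms by (intro forms_mult) auto
    then show ?case by simp
  qed simp
qed

lemma sym_power_killed:
  assumes u: "u \<in> forms n 1" "\<And>v. v \<in> W \<Longrightarrow> u \<odot> v = 0" and P: "P \<in> sym_power d W"
  shows "u \<odot> P = 0"
proof -
  have "sym_power d W \<subseteq> {P. u \<odot> P = 0}"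
  proof (rule sym_power_subset)
    show "cvs.subspace {P. u \<odot> P = 0}" by (rule cvp.linear_subspace_kernel[OF linear_act_right])
    fix l assume "\<forall>j<d. l j \<in> W"
    then have "u \<odot> (\<Prod>j<d. l j) = 0"
      by (induction d) (use u linear_act_one in \<open>simp_all add: act_leibniz\<close>)
    then show "(\<Prod>j<d. l j) \<in> {P. u \<odot> P = 0}" by simp
  qed
  then show ?thesis using P by blast
qed

lemma sym_power_mult:
  assumes "v \<in> W" "Q \<in> sym_power e W"
  shows "v * Q \<in> sym_power (Suc e) W"
proof -
  have lin: "Vector_Spaces.linear cscale cscale (\<lambda>Q. v * Q)"
    by (simp add: Vector_Spaces.linear_iff cvs.vector_space_axioms distrib_left)
  have "sym_power e W \<subseteq> {Q. v * Q \<in> sym_power (Suc e) W}"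
  proof (rule sym_power_subset)
    show "cvs.subspace {Q. v * Q \<in> sym_power (Suc e) W}"
      using cvp.linear_subspace_vimage[OF lin cvs.subspace_span] by (simp add: vimage_def sym_power_def)
    fix l assume l: "\<forall>j<e. l j \<in> W"
    have "v * (\<Prod>j<e. l j) = (\<Prod>j<Suc e. (l(e := v)) j)" by (simp add: mult.commute)
    moreover have "\<forall>j<Suc e. (l(e := v)) j \<in> W" using l assms(1) by auto
    ultimately have "v * (\<Prod>j<e. l j) \<in> sym_power (Suc e) W"
      unfolding sym_power_def by (intro cvs.span_base CollectI exI conjI)
    then show "(\<Prod>j<e. l j) \<in> {Q. v * Q \<in> sym_power (Suc e) W}" by simp
  qed
  then show ?thesis using assms(2) by blast
qed

text \<open>
  A direct sum seen from the dual side: \<open>U1\<close> and \<open>U2\<close> are the annihilators of the spaces of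
  variables of \<open>F2\<close> and of \<open>F1\<close>.
\<close>

definition splits_form :: "nat \<Rightarrow> nat \<Rightarrow> cpoly \<Rightarrow> cpoly set \<Rightarrow> cpoly set \<Rightarrow> cpoly \<Rightarrow> cpoly \<Rightarrow> bool" where
  "splits_form n d F U1 U2 F1 F2 \<longleftrightarrow>
     cvs.subspace U1 \<and> cvs.subspace U2 \<and> U1 \<subseteq> forms n 1 \<and> U2 \<subseteq> forms n 1 \<and>
     (\<forall>u\<in>forms n 1. \<exists>u1\<in>U1. \<exists>u2\<in>U2. u = u1 + u2) \<and> U1 \<inter> U2 = {0} \<and>
     F1 \<in> forms n d \<and> F2 \<in> forms n d \<and> F1 \<noteq> 0 \<and> F2 \<noteq> 0 \<and> F = F1 + F2 \<and>
     (\<forall>u\<in>U1. u \<odot> F2 = 0) \<and> (\<forall>u\<in>U2. u \<odot> F1 = 0)"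

lemma splits_form_sym: "splits_form n d F U1 U2 F1 F2 \<Longrightarrow> splits_form n d F U2 U1 F2 F1"
  unfolding splits_form_def by (metis add.commute inf_commute)

text \<open>
  Here \<open>p\<close> is the projection of the variables to \<open>V1\<close> along \<open>V2\<close>, and the operator on the
  left is \<open>u\<close> composed with this projection.
\<close>

lemma annihilator_complement:
  assumes V: "cvs.subspace V1" "cvs.subspace V2" "V1 \<inter> V2 = {0}"
    and p: "\<And>i. i < n \<Longrightarrow> p i \<in> V1" "\<And>i. i < n \<Longrightarrow> q i \<in> V2" "\<And>i. i < n \<Longrightarrow> var i = p i + q i"
    and pf: "\<And>i. i < n \<Longrightarrow> p i \<in> forms n 1" and u: "u \<in> forms n 1"
    and v: "v \<in> V2" "v \<in> forms n 1"
  shows "(\<Sum>i<n. cscale (lk (u \<odot> p i) 0) (var i)) \<odot> v = 0"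
proof -
  let ?s = "\<Sum>i<n. cscale (lk v (sg i 1)) (p i)"
  have "v = (\<Sum>i<n. cscale (lk v (sg i 1)) (var i))" by (rule linear_form_expand[OF v(2)])
  also have "\<dots> = (\<Sum>i<n. cscale (lk v (sg i 1)) (p i) + cscale (lk v (sg i 1)) (q i))"
    by (intro sum.cong refl) (simp only: p(3) lessThan_iff cvs.scale_right_distrib)
  also have "\<dots> = ?s + (\<Sum>i<n. cscale (lk v (sg i 1)) (q i))" by (rule sum.distrib)
  finally have "v = ?s + (\<Sum>i<n. cscale (lk v (sg i 1)) (q i))" .
  then have e: "?s = v - (\<Sum>i<n. cscale (lk v (sg i 1)) (q i))" by (rule eq_diff_eq[THEN iffD2, OF sym])
  have "?s \<in> V2" unfolding e
    by (intro cvs.subspace_diff[OF V(2)] cvs.subspace_sum[OF V(2)] cvs.subspace_scale[OF V(2)] v p(2)) simp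
  moreover have "?s \<in> V1"
    by (intro cvs.subspace_sum[OF V(1)] cvs.subspace_scale[OF V(1)] p(1)) simp
  ultimately have s0: "?s = 0" using V(3) by blast
  have up: "u \<odot> p i = cscale (lk (u \<odot> p i) 0) 1" if "i < n" for i
    using linear_form_act[OF u pf[OF that]] by (simp add: lookup_cscale)
  have "(\<Sum>i<n. cscale (lk (u \<odot> p i) 0) (var i)) \<odot> v =
      (\<Sum>i<n. cscale (lk (u \<odot> p i) 0) (cscale (lk v (sg i 1)) 1))"
    unfolding act_sum_left act_scale_left act_var pdiff_linear_form[OF v(2)] ..
  also have "\<dots> = (\<Sum>i<n. cscale (lk v (sg i 1)) (u \<odot> p i))"
  proof (intro sum.cong refl)
    fix i assume "i \<in> {..<n}"
    then have "cscale (lk v (sg i 1)) (cscale (lk (u \<odot> p i) 0) 1) = cscale (lk v (sg i 1)) (u \<odot> p i)"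
      using up[of i] by simp
    then show "cscale (lk (u \<odot> p i) 0) (cscale (lk v (sg i 1)) 1) = cscale (lk v (sg i 1)) (u \<odot> p i)"
      by (simp only: cvs.scale_left_commute)
  qed
  also have "\<dots> = u \<odot> ?s" by (simp add: act_sum_right act_scale_right)
  finally show ?thesis using s0 by simp
qed

lemma direct_sum_splits:
  assumes "direct_sum_form n d F"
  obtains U1 U2 F1 F2 where "splits_form n d F U1 U2 F1 F2"
proof -
  obtain V1 V2 F1 F2 where V: "cvs.subspace V1" "cvs.subspace V2"
    "{v1 + v2 |v1 v2. v1 \<in> V1 \<and> v2 \<in> V2} = forms n 1" "V1 \<inter> V2 = {0}"
    and F: "F1 \<in> sym_power d V1" "F1 \<noteq> 0" "F2 \<in> sym_power d V2" "F2 \<noteq> 0" "F = F1 + F2"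
    using assms unfolding direct_sum_form_def by blast
  have V1: "V1 \<subseteq> forms n 1" using V(3) cvs.subspace_0[OF V(2)] by force
  have V2: "V2 \<subseteq> forms n 1" using V(3) cvs.subspace_0[OF V(1)] by force
  have "\<forall>i<n. \<exists>p q. p \<in> V1 \<and> q \<in> V2 \<and> var i = p + q"
  proof (intro allI impI)
    fix i assume "i < n"
    then have "var i \<in> {v1 + v2 |v1 v2. v1 \<in> V1 \<and> v2 \<in> V2}" unfolding V(3) by simp
    then show "\<exists>p q. p \<in> V1 \<and> q \<in> V2 \<and> var i = p + q" by blast
  qed
  then obtain p q where pq: "\<And>i. i < n \<Longrightarrow> p i \<in> V1" "\<And>i. i < n \<Longrightarrow> q i \<in> V2" "\<And>i. i < n \<Longrightarrow> var i = p i + q i"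
    by metis
  define U1 where "U1 = {u \<in> forms n 1. \<forall>v\<in>V2. u \<odot> v = 0}"
  define U2 where "U2 = {u \<in> forms n 1. \<forall>v\<in>V1. u \<odot> v = 0}"
  have sub: "cvs.subspace {u \<in> forms n 1. \<forall>v\<in>X. u \<odot> v = 0}" for X
    by (rule cvs.subspaceI) (auto simp: forms_add forms_scale act_add_left act_scale_left)
  have "splits_form n d F U1 U2 F1 F2" unfolding splits_form_def
  proof (intro conjI ballI)
    show "cvs.subspace U1" "cvs.subspace U2" unfolding U1_def U2_def by (rule sub)+
    show "F1 \<in> forms n d" "F2 \<in> forms n d" using F(1,3) sym_power_forms V1 V2 by blast+
    show "u \<odot> F2 = 0" if "u \<in> U1" for u
      using sym_power_killed[of u n V2, OF _ _ F(3)] that by (simp add: U1_def)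
    show "u \<odot> F1 = 0" if "u \<in> U2" for u
      using sym_power_killed[of u n V1, OF _ _ F(1)] that by (simp add: U2_def)
    fix u assume u: "u \<in> forms n 1"
    let ?a = "\<Sum>i<n. cscale (lk (u \<odot> p i) 0) (var i)"
    let ?b = "\<Sum>i<n. cscale (lk (u \<odot> q i) 0) (var i)"
    have "?a \<odot> v = 0" if "v \<in> V2" for v
      by (rule annihilator_complement[OF V(1,2,4) pq _ u]) (use pq V1 V2 that in auto)
    then have a: "?a \<in> U1" unfolding U1_def by (auto intro!: forms_sum forms_scale)
    have "?b \<odot> v = 0" if "v \<in> V1" for v
      by (rule annihilator_complement[OF V(2,1) _ pq(2,1) _ _ u])
         (use pq V V1 V2 that in \<open>auto simp: add.commute\<close>)
    then have b: "?b \<in> U2" unfolding U2_def by (auto intro!: forms_sum forms_scale)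
    have "?a + ?b = (\<Sum>i<n. cscale (lk (u \<odot> var i) 0) (var i))"
      by (simp add: pq(3) act_add_right lookup_add cvs.scale_left_distrib flip: sum.distrib)
    also have "\<dots> = (\<Sum>i<n. cscale (lk u (sg i 1)) (var i))"
    proof (intro sum.cong refl)
      fix i assume "i \<in> {..<n}"
      then have "u \<odot> var i = var i \<odot> u" using u by (intro act_same_degree_sym[of _ n 1]) auto
      then show "cscale (lk (u \<odot> var i) 0) (var i) = cscale (lk u (sg i 1)) (var i)"
        by (simp only: act_var pdiff_linear_form[OF u]) (simp add: lookup_cscale)
    qed
    also have "\<dots> = u" by (rule linear_form_expand[OF u, symmetric])
    finally have "u = ?a + ?b" by (rule sym)
    then show "\<exists>u1\<in>U1. \<exists>u2\<in>U2. u = u1 + u2" by (intro bexI[OF _ a] bexI[OF _ b])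
  next
    show "U1 \<inter> U2 = {0}"
    proof -
      have "u = 0" if u: "u \<in> U1" "u \<in> U2" for u
      proof (rule form_eq_0I[of _ n 1])
        show uf: "u \<in> forms n 1" using u by (simp add: U1_def)
        fix i assume i: "i < n"
        have "pdiff i u = u \<odot> var i"
          using act_same_degree_sym[of u n 1 "var i"] uf i by (simp add: act_var)
        also have "\<dots> = 0" using u pq(1,2)[OF i] by (simp add: pq(3)[OF i] act_add_right U1_def U2_def)
        finally show "pdiff i u = 0" .
      qed simp
      moreover have "0 \<in> U1" "0 \<in> U2" by (simp_all add: U1_def U2_def)
      ultimately show ?thesis by blast
    qed
  qed (use F in \<open>auto simp: U1_def U2_def\<close>)
  then show ?thesis by (rule that)
qed

text \<open>
  If \<open>u1 + u2\<close> is the decomposition of the \<open>i\<close>-th derivation, then the \<open>i\<close>-th derivative of \<open>F1\<close> is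
  \<open>u1 \<odot> F\<close>.  A multiple of \<open>F\<close> would be killed by the operators of both parts.
\<close>

lemma splits_form_gradient:
  assumes s: "splits_form n d F U1 U2 F1 F2" and d: "1 \<le> d"
  shows "shares_gradient n F F1" "F1 \<notin> cvs.span {F}"
proof -
  note S = s[unfolded splits_form_def]
  show "shares_gradient n F F1" unfolding shares_gradient_def derivs1_def
  proof (intro allI impI)
    fix i assume "i < n"
    then obtain u1 u2 where u: "u1 \<in> U1" "u2 \<in> U2" "var i = u1 + u2"
      using S var_forms(1)[of i n] by blast
    have "pdiff i F1 = u1 \<odot> F" using S u by (simp flip: act_var add: act_add_left act_add_right)
    then show "pdiff i F1 \<in> (\<lambda>u. u \<odot> F) ` forms n 1" using S u by auto
  qed
  show "F1 \<notin> cvs.span {F}"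
  proof
    assume "F1 \<in> cvs.span {F}"
    then obtain c where c: "F1 = cscale c F" by (auto simp: cvs.span_singleton)
    have "cscale c F2 = 0"
    proof (rule form_eq_0I'[OF _ d])
      show "cscale c F2 \<in> forms n d" using S by (simp add: forms_scale)
      fix u assume "u \<in> forms n 1"
      then obtain u1 u2 where u: "u1 \<in> U1" "u2 \<in> U2" "u = u1 + u2" using S by blast
      have "u2 \<odot> F1 = cscale c (u2 \<odot> F)" by (subst c) (rule act_scale_right)
      then have "cscale c (u2 \<odot> F2) = 0" using S u by (simp add: act_add_right)
      then show "u \<odot> cscale c F2 = 0" using S u by (simp add: act_add_left act_scale_right)
    qed
    then have "c = 0" using S by simp
    then show False using c S by simp
  qed
qed

text \<open>
  The transpose of an endomorphism of the linear operators, acting on the variables.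
\<close>

definition transp :: "nat \<Rightarrow> (cpoly \<Rightarrow> cpoly) \<Rightarrow> cpoly \<Rightarrow> cpoly" where
  "transp n E v = (\<Sum>i<n. cscale (lk (E (var i) \<odot> v) 0) (var i))"

lemma var_act_linear_form: "u \<in> forms n 1 \<Longrightarrow> i < n \<Longrightarrow> u \<odot> var i = cscale (lk u (sg i 1)) 1"
  using act_same_degree_sym[of u n 1 "var i"] pdiff_linear_form[of u n i] by (simp add: act_var)

lemma linear_expand:
  assumes "Vector_Spaces.linear cscale cscale E" "w \<in> forms n 1"
  shows "E w = (\<Sum>i<n. cscale (lk w (sg i 1)) (E (var i)))"
  by (subst linear_form_expand[OF assms(2)]) (simp only: cvp.linear_sum[OF assms(1)] cvp.linear_scale[OF assms(1)])

lemma transp_forms: "transp n E v \<in> forms n 1"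
  unfolding transp_def by (intro forms_sum forms_scale) simp

lemma transp_act:
  assumes E: "Vector_Spaces.linear cscale cscale E" and w: "w \<in> forms n 1"
  shows "w \<odot> transp n E v = cscale (lk (E w \<odot> v) 0) 1"
proof -
  have "lk (E w \<odot> v) 0 = (\<Sum>i<n. lk w (sg i 1) * lk (E (var i) \<odot> v) 0)"
    by (subst linear_expand[OF E w]) (simp add: act_sum_left act_scale_left lk_sum_scale)
  moreover have "w \<odot> transp n E v = cscale (\<Sum>i<n. lk w (sg i 1) * lk (E (var i) \<odot> v) 0) 1"
    unfolding transp_def act_sum_right act_scale_right cvs.scale_sum_left
    by (intro sum.cong refl) (simp add: var_act_linear_form[OF w, simplified] mult.commute)
  ultimately show ?thesis by simp
qed

lemma transp_sum:
  assumes E: "\<And>i. i < n \<Longrightarrow> E (var i) \<in> forms n 1" and L: "Vector_Spaces.linear cscale cscale L"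
  shows "(\<Sum>i<n. var i * L (E (var i))) = (\<Sum>j<n. transp n E (var j) * L (var j))"
proof -
  have "(\<Sum>i<n. var i * L (E (var i))) =
      (\<Sum>i<n. \<Sum>j<n. cscale (lk (E (var i)) (sg j 1)) (var i * L (var j)))"
  proof (intro sum.cong refl)
    fix i assume "i \<in> {..<n}"
    then have "L (E (var i)) = (\<Sum>j<n. cscale (lk (E (var i)) (sg j 1)) (L (var j)))"
      by (intro linear_expand[OF L] E) simp
    then show "var i * L (E (var i)) = (\<Sum>j<n. cscale (lk (E (var i)) (sg j 1)) (var i * L (var j)))"
      by (simp add: sum_distrib_left)
  qed
  also have "\<dots> = (\<Sum>j<n. \<Sum>i<n. cscale (lk (E (var i)) (sg j 1)) (var i * L (var j)))" by (rule sum.swap)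
  also have "\<dots> = (\<Sum>j<n. transp n E (var j) * L (var j))"
    unfolding transp_def sum_distrib_right
    by (intro sum.cong refl) (simp add: var_act_linear_form[OF E, simplified] lookup_cscale)
  finally show ?thesis .
qed

text \<open>
  The space \<open>V\<close> is the annihilator of the kernel of the projector, and it is the image of the
  transpose.  A form killed by this annihilator is a polynomial in \<open>V\<close>: in Euler's formula the
  derivations may be replaced by their projections, and the projector then moves to the
  variables.
\<close>

lemma projector_sym_power:
  assumes E: "Vector_Spaces.linear cscale cscale E" "\<And>u. u \<in> forms n 1 \<Longrightarrow> E u \<in> forms n 1"
    "\<And>u. u \<in> forms n 1 \<Longrightarrow> E (E u) = E u"
  defines "V \<equiv> {v \<in> forms n 1. \<forall>u\<in>forms n 1. (u - E u) \<odot> v = 0}"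
  shows "transp n E v \<in> V"
    and "P \<in> forms n e \<Longrightarrow> (\<And>u. u \<in> forms n 1 \<Longrightarrow> (u - E u) \<odot> P = 0) \<Longrightarrow> P \<in> sym_power e V"
proof -
  have killV: "E (u - E u) = 0" if "u \<in> forms n 1" for u
    using E(3)[OF that] by (simp add: cvp.linear_diff[OF E(1)])
  show trV: "transp n E v \<in> V" for v
    using transp_act[OF E(1)] killV transp_forms[of n E v] forms_diff[OF _ E(2)] by (simp add: V_def)
  show "P \<in> sym_power e V" if "P \<in> forms n e" "\<And>u. u \<in> forms n 1 \<Longrightarrow> (u - E u) \<odot> P = 0"
    using that
  proof (induction e arbitrary: P)
    case 0
    then obtain c where "P = cscale c 1" by (auto simp: forms_0)
    then show ?case by (auto simp: sym_power_def intro!: cvs.span_scale intro: cvs.span_base)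
  next
    case (Suc e)
    have "cscale (of_nat (Suc e)) P = (\<Sum>i<n. var i * (var i \<odot> P))"
      using euler[OF Suc.prems(1)] by (simp add: act_var)
    also have "\<dots> = (\<Sum>i<n. var i * (E (var i) \<odot> P))"
      by (intro sum.cong refl) (use Suc.prems(2)[of "var _"] in \<open>simp add: act_diff_left\<close>)
    also have "\<dots> = (\<Sum>j<n. transp n E (var j) * (var j \<odot> P))"
      by (rule transp_sum[OF _ linear_act_left]) (use E(2) in simp)
    also have "\<dots> \<in> sym_power (Suc e) V"
    proof -
      have "transp n E (var j) * (var j \<odot> P) \<in> sym_power (Suc e) V" for j
      proof (rule sym_power_mult[OF trV Suc.IH])
        show "var j \<odot> P \<in> forms n e" using Suc.prems(1) unfolding act_var by (rule pdiff_forms)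
        show "(u - E u) \<odot> var j \<odot> P = 0" if "u \<in> forms n 1" for u
          using Suc.prems(2)[OF that] by (subst act_commute) simp
      qed
      then show ?thesis unfolding sym_power_def by (intro cvs.span_sum)
    qed
    finally have "cscale (inverse (of_nat (Suc e))) (cscale (of_nat (Suc e)) P) \<in> sym_power (Suc e) V"
      unfolding sym_power_def by (rule cvs.span_scale)
    then show ?case by (simp del: of_nat_Suc)
  qed
qed

text \<open>
  Apply Euler's formula twice.  With \<open>E'\<close> the complementary projector,
  \<open>d F = \<Sum> x\<^sub>i * (E \<alpha>\<^sub>i \<odot> F) + \<Sum> x\<^sub>i * (E' \<alpha>\<^sub>i \<odot> F)\<close>; by \<open>mixed\<close> the factors \<open>E \<alpha>\<^sub>i \<odot> F\<close> are
  forms in the variables of \<open>E\<close>, and moving \<open>E\<close> to the variables puts the whole sum there.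
\<close>

lemma direct_sum_projector:
  assumes d: "1 \<le> d" and F: "F \<in> forms n d"
    and E: "Vector_Spaces.linear cscale cscale E" "\<And>u. u \<in> forms n 1 \<Longrightarrow> E u \<in> forms n 1"
      "\<And>u. u \<in> forms n 1 \<Longrightarrow> E (E u) = E u"
    and mixed: "\<And>u v. u \<in> forms n 1 \<Longrightarrow> v \<in> forms n 1 \<Longrightarrow> (v - E v) \<odot> E u \<odot> F = 0"
    and nz: "\<exists>u\<in>forms n 1. E u \<odot> F \<noteq> 0" "\<exists>u\<in>forms n 1. (u - E u) \<odot> F \<noteq> 0"
  shows "direct_sum_form n d F"
proof -
  obtain e where e: "d = Suc e" using d by (cases d) auto
  define E' where "E' u = u - E u" for u
  have E': "Vector_Spaces.linear cscale cscale E'" "\<And>u. u \<in> forms n 1 \<Longrightarrow> E' u \<in> forms n 1"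
      "\<And>u. u \<in> forms n 1 \<Longrightarrow> E' (E' u) = E' u"
    using E by (auto simp: E'_def Vector_Spaces.linear_iff cvs.vector_space_axioms forms_diff
        cvs.scale_right_diff_distrib cvp.linear_diff[OF E(1)])
  define V1 where "V1 = {v \<in> forms n 1. \<forall>u\<in>forms n 1. (u - E u) \<odot> v = 0}"
  define V2 where "V2 = {v \<in> forms n 1. \<forall>u\<in>forms n 1. (u - E' u) \<odot> v = 0}"
  have sub: "cvs.subspace {v \<in> forms n 1. \<forall>u\<in>forms n 1. f u \<odot> v = 0}" for f
    by (rule cvs.subspaceI) (auto simp: forms_add forms_scale act_add_right act_scale_right)
  define c :: complex where "c = inverse (of_nat d)"
  define P1 where "P1 = (\<Sum>i<n. var i * (E (var i) \<odot> F))"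
  define P2 where "P2 = (\<Sum>i<n. var i * (E' (var i) \<odot> F))"
  define F1 where "F1 = cscale c P1"
  define F2 where "F2 = cscale c P2"
  \<comment> \<open>Both projectors satisfy the hypotheses, so the two summands are treated at once.\<close>
  have euler_twice: "(\<Sum>i<n. var i * (A (var i) \<odot> F)) \<in> sym_power d {v \<in> forms n 1. \<forall>u\<in>forms n 1. (u - A u) \<odot> v = 0}"
    if A: "Vector_Spaces.linear cscale cscale A" "\<And>u. u \<in> forms n 1 \<Longrightarrow> A u \<in> forms n 1"
      "\<And>u. u \<in> forms n 1 \<Longrightarrow> A (A u) = A u" "\<And>u v. u \<in> forms n 1 \<Longrightarrow> v \<in> forms n 1 \<Longrightarrow> (v - A v) \<odot> A u \<odot> F = 0" for A
  proof -
    let ?V = "{v \<in> forms n 1. \<forall>u\<in>forms n 1. (u - A u) \<odot> v = 0}"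
    have 1: "A (var j) \<odot> F \<in> sym_power e ?V" if j: "j < n" for j
    proof (rule projector_sym_power(2)[OF A(1-3)])
      show "A (var j) \<odot> F \<in> forms n e" using act_forms[OF A(2)[OF var_forms(1)[OF j]], of F e] F e by simp
    qed (use A(4) j in auto)
    have L: "Vector_Spaces.linear cscale cscale (\<lambda>u. A u \<odot> F)"
      using A(1) by (simp add: Vector_Spaces.linear_iff act_add_left act_scale_left)
    have "(\<Sum>i<n. var i * (A (var i) \<odot> F)) = (\<Sum>i<n. var i * (A (A (var i)) \<odot> F))"
      by (intro sum.cong refl) (simp add: A(3))
    also have "\<dots> = (\<Sum>j<n. transp n A (var j) * (A (var j) \<odot> F))"
      by (rule transp_sum[OF _ L]) (use A(2) in simp)
    also have "\<dots> \<in> sym_power d ?V"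
    proof -
      have "transp n A (var j) * (A (var j) \<odot> F) \<in> sym_power d ?V" if "j < n" for j
        unfolding e by (rule sym_power_mult[OF projector_sym_power(1)[OF A(1-3)] 1[OF that]])
      then show ?thesis unfolding sym_power_def by (auto intro!: cvs.span_sum)
    qed
    finally show ?thesis .
  qed
  have mixed': "(v - E' v) \<odot> E' u \<odot> F = 0" if "u \<in> forms n 1" "v \<in> forms n 1" for u v
    using mixed[OF that(2,1)] by (simp add: E'_def) (metis act_commute)
  have F1: "F1 \<in> sym_power d V1" unfolding F1_def P1_def V1_def
    using euler_twice[OF E mixed] unfolding sym_power_def by (intro cvs.span_scale)
  have F2: "F2 \<in> sym_power d V2" unfolding F2_def P2_def V2_def
    using euler_twice[OF E' mixed'] unfolding sym_power_def by (intro cvs.span_scale)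
  have "P1 + P2 = (\<Sum>i<n. var i * pdiff i F)" unfolding P1_def P2_def sum.distrib[symmetric]
    by (intro sum.cong refl) (simp add: E'_def act_diff_left act_var algebra_simps)
  then have "P1 + P2 = cscale (of_nat d) F" using euler[OF F] by simp
  then have sum: "F = F1 + F2" using d unfolding F1_def F2_def c_def
    by (simp add: cvs.scale_right_distrib[symmetric])
  have k1: "E' u \<odot> F1 = 0" if "u \<in> forms n 1" for u
    by (rule sym_power_killed[OF _ _ F1, of _ n]) (use that E'(2) in \<open>auto simp: V1_def E'_def\<close>)
  have k2: "E u \<odot> F2 = 0" if "u \<in> forms n 1" for u
  proof (rule sym_power_killed[OF _ _ F2, of _ n])
    show "E u \<in> forms n 1" by (rule E(2)[OF that])
    show "E u \<odot> v = 0" if v: "v \<in> V2" for v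
      using v \<open>u \<in> forms n 1\<close> by (auto simp: V2_def E'_def)
  qed
  show ?thesis unfolding direct_sum_form_def
  proof (intro exI conjI)
    show "cvs.subspace V1" "cvs.subspace V2" unfolding V1_def V2_def by (rule sub)+
    show "F1 \<in> sym_power d V1" "F2 \<in> sym_power d V2" by fact+
    show "F = F1 + F2" by (rule sum)
    show "F1 \<noteq> 0" using nz(1) k2 sum by auto
    show "F2 \<noteq> 0" using nz(2) k1 sum by (auto simp: E'_def)
    show "V1 \<inter> V2 = {0}"
    proof -
      have "v = 0" if "v \<in> V1" "v \<in> V2" for v
      proof (rule form_eq_0I'[of _ n 1])
        show "v \<in> forms n 1" using that by (simp add: V1_def)
        fix u assume "u \<in> forms n 1"
        then have "(u - E u) \<odot> v + (u - E' u) \<odot> v = 0" using that by (simp add: V1_def V2_def)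
        then show "u \<odot> v = 0" by (simp add: E'_def flip: act_add_left)
      qed simp
      then show ?thesis by (auto simp: V1_def V2_def)
    qed
    show "{v1 + v2 |v1 v2. v1 \<in> V1 \<and> v2 \<in> V2} = forms n 1"
    proof (intro equalityI subsetI)
      fix v assume v: "v \<in> forms n 1"
      have "transp n E v \<in> V1" "transp n E' v \<in> V2" unfolding V1_def V2_def
        using projector_sym_power(1)[OF E] projector_sym_power(1)[OF E'] by blast+
      moreover have "v = transp n E v + transp n E' v"
      proof -
        have "transp n E v + transp n E' v = (\<Sum>i<n. cscale (lk (var i \<odot> v) 0) (var i))"
          unfolding transp_def sum.distrib[symmetric] cvs.scale_left_distrib[symmetric] lookup_add[symmetric] act_add_left[symmetric]
          by (simp add: E'_def)
        also have "\<dots> = (\<Sum>i<n. cscale (lk v (sg i 1)) (var i))"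
          unfolding act_var pdiff_linear_form[OF v] by (simp add: lookup_cscale)
        finally show ?thesis using linear_form_expand[OF v] by metis
      qed
      ultimately show "v \<in> {v1 + v2 |v1 v2. v1 \<in> V1 \<and> v2 \<in> V2}" by blast
    qed (auto simp: V1_def V2_def intro: forms_add)
  qed
qed


section \<open>Persistence of shared gradients under specialization\<close>

context specialization begin

text \<open>
  Let \<open>S\<close> be a basis of a complement of the special form \<open>F\<close>, and let the \<open>\<Theta> i \<odot> F\<close> be a basis of its
  first derivatives.  There is no \<open>G\<close> for \<open>F\<close> if and only if the gradients of the members of \<open>S\<close> are
  independent modulo the vectors with entries \<open>\<Theta> i \<odot> F\<close>.  The constancy of \<open>h(1)\<close> ensures
  that the \<open>\<Theta> i\<close> still provide a basis of the first derivatives nearby, so that independence there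
  excludes a \<open>G\<close>.
\<close>

lemma no_shared_gradient_open:
  assumes Fam: "reg_family Fam" and d: "1 \<le> d" and F: "Fam pt \<in> forms n d" "Fam pt \<noteq> 0"
    and ev: "eventually (\<lambda>p. Fam p \<in> forms n d \<and> Fam p \<noteq> 0 \<and> hilbert n (Fam p) 1 = hilbert n (Fam pt) 1) Fil"
    and no: "\<not> (\<exists>G\<in>forms n d. G \<notin> cvs.span {Fam pt} \<and> shares_gradient n (Fam pt) G)"
  shows "eventually (\<lambda>p. \<not> (\<exists>G\<in>forms n d. G \<notin> cvs.span {Fam p} \<and> shares_gradient n (Fam p) G)) Fil"
proof -
  let ?F = "Fam pt" and ?h = "hilbert n (Fam pt) 1"
  obtain \<Theta> where \<Theta>: "\<And>i. i < ?h \<Longrightarrow> \<Theta> i \<in> forms n 1" "indep_fun {..<?h} (\<lambda>i. lk (\<Theta> i \<odot> ?F))"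
    using hilbert_basis[of n ?F 1] by metis
  have "cvs.independent {?F}" using F(2) by simp
  then obtain B where B: "{?F} \<subseteq> B" "B \<subseteq> forms n d" "cvs.independent B" "forms n d \<subseteq> cvs.span B"
    using cvs.maximal_independent_subset_extend[of "{?F}" "forms n d"] F(1) by auto
  have finB: "finite B" using independent_finite_dim[OF fin_gen_forms B(3)] B(2) cvs.span_superset by blast
  define S where "S = B - {?F}"
  have S: "finite S" "S \<subseteq> forms n d" "B = insert ?F S" using finB B(1,2) by (auto simp: S_def)
  define v where "v p x = (case x of Inl s \<Rightarrow> (\<lambda>(j, m). if j < n then lk (pdiff j s) m else 0)
      | Inr (i, j') \<Rightarrow> (\<lambda>(j, m). if j = j' then lk (\<Theta> i \<odot> Fam p) m else 0))"
    for p :: 'p and x :: "cpoly + nat \<times> nat" and c :: "nat \<times> monomial"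
  \<comment> \<open>The vectors indexed by Inl are gradients; those indexed by Inr have the single entry \<open>\<Theta> i \<odot> F\<close> in place j.\<close>
  define I where "I = S <+> ({..<?h} \<times> {..<n})"
  have finI: "finite I" using S(1) by (simp add: I_def)
  have sumv: "(\<Sum>x\<in>I. a x * v p x (j, m)) =
      lk (pdiff j (\<Sum>s\<in>S. cscale (a (Inl s)) s) + (\<Sum>i<?h. cscale (a (Inr (i, j))) (\<Theta> i \<odot> Fam p))) m"
    if j: "j < n" for a p j m
  proof -
    have "(\<Sum>x\<in>I. a x * v p x (j, m)) = (\<Sum>s\<in>S. a (Inl s) * lk (pdiff j s) m) +
        (\<Sum>y\<in>{..<?h} \<times> {..<n}. a (Inr y) * v p (Inr y) (j, m))"
      unfolding I_def using S(1) j by (simp add: sum.Plus v_def)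
    also have "(\<Sum>y\<in>{..<?h} \<times> {..<n}. a (Inr y) * v p (Inr y) (j, m)) =
        (\<Sum>i<?h. \<Sum>j'<n. if j' = j then a (Inr (i, j)) * lk (\<Theta> i \<odot> Fam p) m else 0)"
      unfolding sum.cartesian_product by (intro sum.cong) (auto simp: v_def)
    also have "\<dots> = (\<Sum>i<?h. a (Inr (i, j)) * lk (\<Theta> i \<odot> Fam p) m)" using j by simp
    finally show ?thesis by (simp add: lookup_add pdiff_sum pdiff_scale lk_sum_scale)
  qed
  have "indep_fun I (v pt)" unfolding indep_fun_def
  proof (intro allI impI)
    fix a assume a: "\<forall>c. (\<Sum>x\<in>I. a x * v pt x c) = 0"
    let ?G = "\<Sum>s\<in>S. cscale (a (Inl s)) s"
    have z: "pdiff j ?G + (\<Sum>i<?h. cscale (a (Inr (i, j))) (\<Theta> i \<odot> ?F)) = 0" if "j < n" for j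
      by (rule poly_mapping_eqI) (use a sumv[OF that, of a pt] in simp)
    have Gf: "?G \<in> forms n d" using S(2) by (intro forms_sum forms_scale) auto
    have "pdiff j ?G \<in> derivs1 n ?F" if j: "j < n" for j
    proof -
      have "pdiff j ?G = - (\<Sum>i<?h. cscale (a (Inr (i, j))) (\<Theta> i \<odot> ?F))"
        using z[OF j] by (simp add: add_eq_0_iff2)
      also have "\<dots> = (- (\<Sum>i<?h. cscale (a (Inr (i, j))) (\<Theta> i))) \<odot> ?F"
        by (simp add: act_neg_left act_sum_left act_scale_left)
      finally show ?thesis using \<Theta>(1) unfolding derivs1_def
        by (auto intro!: image_eqI forms_neg forms_sum forms_scale)
    qed
    then have "?G \<in> cvs.span {?F}" using no Gf by (auto simp: shares_gradient_def)
    then obtain c where c: "?G = cscale c ?F" by (auto simp: cvs.span_singleton)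
    define b where "b x = (if x = ?F then - c else a (Inl x))" for x
    have "(\<Sum>x\<in>B. cscale (b x) x) = cscale (- c) ?F + (\<Sum>x\<in>S. cscale (b x) x)"
      unfolding S(3) using S(1) by (subst sum.insert) (auto simp: S_def b_def)
    also have "(\<Sum>x\<in>S. cscale (b x) x) = ?G" by (intro sum.cong) (auto simp: S_def b_def)
    finally have "(\<Sum>x\<in>B. cscale (b x) x) = 0" using c by simp
    then have b0: "b x = 0" if "x \<in> B" for x
      using cvs.independentD[OF B(3) finB subset_refl] that by blast
    have aS: "a (Inl s) = 0" if "s \<in> S" for s
      using b0[of s] that by (simp add: b_def S_def)
    have aI: "a (Inr (i, j)) = 0" if "i < ?h" "j < n" for i j
    proof -
      have "\<forall>m. (\<Sum>i<?h. a (Inr (i, j)) * lk (\<Theta> i \<odot> ?F) m) = 0"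
        using z[OF that(2)] aS pdiff_scale[of j 0 0] by (simp flip: lk_sum_scale)
      then show ?thesis
        using \<Theta>(2)[unfolded indep_fun_def, rule_format, of "\<lambda>i. a (Inr (i, j))" i] that(1) by simp
    qed
    show "\<forall>x\<in>I. a x = 0" using aS aI by (auto simp: I_def)
  qed
  moreover have "(\<lambda>p. v p x c) \<in> Reg" for x c
  proof (cases x)
    case (Inl s) then show ?thesis using reg_const by (cases c) (simp add: v_def)
  next
    case (Inr y)
    then show ?thesis using reg_family_act[OF Fam] reg_const
      by (cases y; cases c; cases "fst c = snd y") (auto simp: v_def reg_family_def)
  qed
  ultimately have "eventually (\<lambda>p. indep_fun I (v p)) Fil" using indep_fun_open[OF finI] by blast
  moreover have "eventually (\<lambda>p. indep_fun {..<?h} (\<lambda>i. lk (\<Theta> i \<odot> Fam p))) Fil"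
    by (rule indep_fun_open) (use \<Theta> reg_family_act[OF Fam] in \<open>auto simp: reg_family_def\<close>)
  ultimately show ?thesis using ev
  proof eventually_elim
    case (elim p)
    let ?P = "Fam p"
    show ?case
    proof
      assume "\<exists>G\<in>forms n d. G \<notin> cvs.span {?P} \<and> shares_gradient n ?P G"
      then obtain G where G: "G \<in> forms n d" "G \<notin> cvs.span {?P}" "shares_gradient n ?P G" by blast
      have sp: "\<exists>c s. s \<in> cvs.span S \<and> X = cscale c ?F + s" if "X \<in> forms n d" for X
      proof -
        have "X \<in> cvs.span (insert ?F S)" using that B(4) S(3) by auto
        then obtain k where "X - cscale k ?F \<in> cvs.span S" using cvs.span_breakdown_eq by blast
        then show ?thesis by (intro exI[of _ k] exI[of _ "X - cscale k ?F"]) simp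
      qed
      obtain c s where cs: "s \<in> cvs.span S" "?P = cscale c ?F + s" using sp elim(3) by blast
      obtain c' s' where cs': "s' \<in> cvs.span S" "G = cscale c' ?F + s'" using sp G(1) by blast
      \<comment> \<open>If the nearby form P has no component along F, it lies in the span of S itself and serves as G.\<close>
      define K where "K = (if c = 0 then ?P else G - cscale (c' / c) ?P)"
      have KS: "K \<in> cvs.span S"
      proof (cases "c = 0")
        case True then show ?thesis using cs by (simp add: K_def)
      next
        case False
        have "K = s' - cscale (c' / c) s" using False
          by (simp add: K_def cs(2) cs'(2) cvs.scale_right_distrib)
        then show ?thesis using cs(1) cs'(1) by (simp add: cvs.span_diff cvs.span_scale)
      qed
      have K0: "K \<noteq> 0"
        using elim(3) G(2) by (auto simp: K_def cvs.span_singleton)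
      have Kg: "pdiff j K \<in> derivs1 n ?P" if "j < n" for j
      proof -
        have 1: "pdiff j ?P \<in> derivs1 n ?P" using that by (auto simp: derivs1_def simp flip: act_var)
        have "pdiff j (G - cscale (c' / c) ?P) = pdiff j G - cscale (c' / c) (pdiff j ?P)"
          by (simp flip: act_var add: act_diff_right act_scale_right)
        then show ?thesis using 1 G(3) that unfolding K_def shares_gradient_def
          by (auto intro: cvs.subspace_diff[OF subspace_derivs1] cvs.subspace_scale[OF subspace_derivs1])
      qed
      have span: "derivs1 n ?P = cvs.span ((\<lambda>i. \<Theta> i \<odot> ?P) ` {..<?h})"
      proof (rule sym, rule subspace_eq_of_dim[OF cvs.subspace_span])
        show "fin_gen (derivs1 n ?P)" unfolding derivs1_def by (rule fin_gen_image[OF linear_act_left fin_gen_forms])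
        show "cvs.span ((\<lambda>i. \<Theta> i \<odot> ?P) ` {..<?h}) \<subseteq> derivs1 n ?P"
          by (rule cvs.span_minimal[OF _ subspace_derivs1]) (use \<Theta>(1) in \<open>auto simp: derivs1_def\<close>)
        have "cvs.dim (cvs.span ((\<lambda>i. \<Theta> i \<odot> ?P) ` {..<?h})) = ?h"
          using indep_fun_independent[OF _ elim(2)] by (simp add: cvs.dim_eq_card_independent card_image)
        moreover have "cvs.dim (derivs1 n ?P) = ?h" using elim(3) by (simp add: derivs1_def hilbert_eq_dim)
        ultimately show "cvs.dim (derivs1 n ?P) \<le> cvs.dim (cvs.span ((\<lambda>i. \<Theta> i \<odot> ?P) ` {..<?h}))" by simp
      qed
      have "\<exists>b. pdiff j K = (\<Sum>i<?h. cscale (b i) (\<Theta> i \<odot> ?P))" if "j < n" for j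
        using Kg[OF that] span span_image_finite[of "{..<?h}"] by (metis finite_lessThan)
      then obtain b where b: "\<And>j. j < n \<Longrightarrow> pdiff j K = (\<Sum>i<?h. cscale (b j i) (\<Theta> i \<odot> ?P))" by metis
      have "K \<in> cvs.span (id ` S)" using KS by simp
      then obtain k where k: "K = (\<Sum>s\<in>S. cscale (k s) s)"
        using span_image_finite[OF S(1), of K id] by auto
      define a where "a x = (case x of Inl s \<Rightarrow> k s | Inr (i, j) \<Rightarrow> - b j i)" for x
      have "(\<Sum>x\<in>I. a x * v p x (j, m)) = 0" for j m
      proof (cases "j < n")
        case True
        have "pdiff j K + (\<Sum>i<?h. cscale (- b j i) (\<Theta> i \<odot> ?P)) = 0"
          unfolding b[OF True] by (simp add: sum_negf)
        then show ?thesis unfolding sumv[OF True] by (simp add: a_def flip: k)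
      next
        case False
        then show ?thesis by (intro sum.neutral) (auto simp: I_def v_def)
      qed
      then have "\<forall>x\<in>I. a x = 0" using elim(1) unfolding indep_fun_def by (metis surj_pair)
      then have "k s = 0" if "s \<in> S" for s using that by (force simp: I_def a_def)
      then show False using K0 k by simp
    qed
  qed
qed

end


section \<open>Smooth curves and their limits\<close>

definition mval :: "monomial \<Rightarrow> coord_vec \<Rightarrow> complex" where
  "mval m p = (\<Prod>i\<in>ky m. lk p i ^ lk m i)"

lemma mval_superset: "finite A \<Longrightarrow> ky m \<subseteq> A \<Longrightarrow> mval m p = (\<Prod>i\<in>A. lk p i ^ lk m i)"
  unfolding mval_def by (rule prod.mono_neutral_left) (auto simp: in_keys_iff)

lemma mval_add: "mval (a + b) p = mval a p * mval b p"
  using mval_superset[of "ky a \<union> ky b"] keys_add_nat[of a b]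
  by (simp add: lookup_add power_add prod.distrib)

lemma mval_zero [simp]: "mval 0 p = 1" by (simp add: mval_def)

lemma mval_single: "mval (sg i k) p = lk p i ^ k"
  by (simp add: mval_def)

lemma mval_scale: "mval m (cscale c p) = c ^ mdegree m * mval m p"
  by (simp add: mval_def lookup_cscale power_mult_distrib prod.distrib mdegree_def power_sum)

lemma peval_superset: "finite A \<Longrightarrow> ky G \<subseteq> A \<Longrightarrow> peval G p = (\<Sum>m\<in>A. lk G m * mval m p)"
  unfolding peval_def mval_def by (rule sum.mono_neutral_left) (auto simp: in_keys_iff)

lemma peval_add: "peval (G + H) p = peval G p + peval H p"
  using peval_superset[of "ky G \<union> ky H"] keys_add[of G H]
  by (simp add: lookup_add distrib_right sum.distrib)

lemma peval_scale: "peval (cscale c G) p = c * peval G p"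
proof -
  have "ky (cscale c G) \<subseteq> ky G" by (auto simp: in_keys_iff lookup_cscale)
  then show ?thesis using peval_superset[of "ky G" "cscale c G"] peval_superset[of "ky G" G]
    by (simp add: lookup_cscale sum_distrib_left mult.assoc)
qed

lemma peval_zero [simp]: "peval 0 p = 0" by (simp add: peval_def)

lemma peval_sum: "peval (\<Sum>x\<in>A. f x) p = (\<Sum>x\<in>A. peval (f x) p)"
  by (induction A rule: infinite_finite_induct) (simp_all add: peval_add)

lemma peval_single: "peval (sg m c) p = c * mval m p"
  by (cases "c = 0") (simp_all add: peval_def mval_def)

lemma peval_mult: "peval (G * H) p = peval G p * peval H p"
proof -
  have "peval (G * H) p = peval ((\<Sum>m\<in>ky G. cscale (lk G m) (sg m 1)) * (\<Sum>m\<in>ky H. cscale (lk H m) (sg m 1))) p"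
    by (simp flip: cpoly_expand)
  also have "\<dots> = peval (\<Sum>m\<in>ky G. cscale (lk G m) (sg m 1)) p * peval (\<Sum>m\<in>ky H. cscale (lk H m) (sg m 1)) p"
    by (simp add: sum_product peval_sum peval_scale peval_single mult_single mval_add) (simp add: ac_simps)
  finally show ?thesis by (simp flip: cpoly_expand)
qed

lemma peval_var [simp]: "peval (var i) p = lk p i"
  by (simp add: var_def peval_single mval_single)

lemma peval_one [simp]: "peval 1 p = 1"
  using peval_single[of 0 1 p] by simp

lemma peval_homogeneous: "G \<in> forms n k \<Longrightarrow> peval G (cscale c p) = c ^ k * peval G p"
  unfolding forms_iff peval_superset[OF finite_mons]
  by (auto simp: mval_scale mons_def sum_distrib_left intro!: sum.cong)

definition basic_open :: "nat \<Rightarrow> cpoly \<Rightarrow> coord_vec set" where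
  "basic_open N G = {p \<in> coord_space N - {0}. peval G p \<noteq> 0}"

lemma zariski_alt: "zariski N = topology_generated_by {basic_open N G |G k. G \<in> forms N k}"
  by (simp add: zariski_def basic_open_def)

lemma openin_basic: "G \<in> forms N k \<Longrightarrow> openin (zariski N) (basic_open N G)"
  unfolding zariski_alt by (rule topology_generated_by_Basis) blast

lemma topspace_zariski: "topspace (zariski N) = coord_space N - {0}"
proof
  show "topspace (zariski N) \<subseteq> coord_space N - {0}"
    by (auto simp: zariski_alt basic_open_def)
  have "basic_open N 1 = coord_space N - {0}" by (auto simp: basic_open_def)
  then show "coord_space N - {0} \<subseteq> topspace (zariski N)"
    using openin_basic[OF one_forms[of N]] openin_subset by metis
qed

lemma openin_zariski_space: "openin (zariski N) (coord_space N - {0})"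
  by (metis openin_topspace topspace_zariski)

lemma coord_space_scale: "p \<in> coord_space N \<Longrightarrow> cscale c p \<in> coord_space N"
  by (auto simp: coord_space_def in_keys_iff lookup_cscale subset_iff)

text \<open>
  Points are coordinate vectors, so invariance under rescaling has to be proved for open sets;
  it holds for the generating sets and is preserved by unions and intersections.
\<close>

lemma openin_zariski_scale:
  assumes "openin (zariski N) U" "p \<in> U" "c \<noteq> 0"
  shows "cscale c p \<in> U"
proof -
  have "generate_topology_on {basic_open N G |G k. G \<in> forms N k} U"
    using assms(1) by (simp add: zariski_alt openin_topology_generated_by_iff)
  then have "\<forall>p\<in>U. cscale c p \<in> U"
  proof induction
    case (Basis s)
    then show ?case using assms(3)
      by (auto simp: basic_open_def coord_space_scale peval_homogeneous)
  qed auto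
  then show ?thesis using assms(2) by blast
qed

lemma closedin_zariski_scale:
  assumes "closedin (subtopology (zariski N) C) A" "p \<in> A" "c \<noteq> 0" "cscale c p \<in> C"
  shows "cscale c p \<in> A"
proof -
  obtain T where T: "closedin (zariski N) T" "A = T \<inter> C"
    using assms(1) by (auto simp: closedin_subtopology)
  have o: "openin (zariski N) (topspace (zariski N) - T)" using T(1) by (simp add: closedin_def)
  have p: "p \<in> coord_space N - {0}" using T assms(2) closedin_subset topspace_zariski by blast
  have "cscale c p \<in> T"
  proof (rule ccontr)
    assume "cscale c p \<notin> T"
    then have "cscale c p \<in> topspace (zariski N) - T"
      using p assms(3) by (simp add: topspace_zariski coord_space_scale)
    from openin_zariski_scale[OF o this, of "inverse c"] have "p \<notin> T" using assms(3) by simp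
    then show False using T assms(2) by blast
  qed
  then show ?thesis using T assms(4) by blast
qed

lemma locally_closed_subset: "locally_closed_in (zariski N) C \<Longrightarrow> C \<subseteq> coord_space N - {0}"
  unfolding locally_closed_in_def using openin_subset topspace_zariski by fastforce

text \<open>
  Proportionality to \<open>pt\<close> is the vanishing of the minors \<open>pt\<^sub>i q\<^sub>j - pt\<^sub>j q\<^sub>i\<close>.
\<close>

lemma closedin_same_point:
  assumes C: "C \<subseteq> coord_space N - {0}" and pt: "pt \<in> C"
  shows "closedin (subtopology (zariski N) C) {q \<in> C. same_point pt q}"
proof -
  have N: "lk p i = 0" if "p \<in> coord_space N" "\<not> i < N" for p :: coord_vec and i
    using that by (auto simp: coord_space_def in_keys_iff)
  define G where "G i j = cscale (lk pt i) (var j) - cscale (lk pt j) (var i)" for i j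
  have Gf: "G i j \<in> forms N 1" if "i < N" "j < N" for i j
    unfolding G_def using that by (intro forms_diff forms_scale) auto
  have pG: "peval (G i j) p = lk pt i * lk p j - lk pt j * lk p i" for i j p
    using peval_add[of "G i j" "cscale (lk pt j) (var i)" p]
    by (simp add: G_def peval_scale algebra_simps)
  have ptN: "pt \<in> coord_space N" "pt \<noteq> 0" using pt C by auto
  then obtain i0 where "lk pt i0 \<noteq> 0" by (metis lookup_zero poly_mapping_eqI)
  then have i0: "lk pt i0 \<noteq> 0" "i0 < N" using N[OF ptN(1)] by auto
  have "same_point pt q \<longleftrightarrow> (\<forall>i<N. \<forall>j<N. peval (G i j) q = 0)" if q: "q \<in> C" for q
  proof
    assume "same_point pt q" then show "\<forall>i<N. \<forall>j<N. peval (G i j) q = 0"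
      by (auto simp: same_point_def pG lookup_cscale)
  next
    assume a: "\<forall>i<N. \<forall>j<N. peval (G i j) q = 0"
    define c where "c = lk q i0 / lk pt i0"
    have "lk q j = c * lk pt j" for j
    proof (cases "j < N")
      case True then show ?thesis using a i0 unfolding pG c_def by (auto simp: field_simps)
    next
      case False then show ?thesis using N ptN(1) q C by (simp add: subset_iff)
    qed
    then have e: "q = cscale c pt" by (intro poly_mapping_eqI) (simp add: lookup_cscale)
    moreover have "c \<noteq> 0" using e q C by auto
    ultimately show "same_point pt q" by (auto simp: same_point_def)
  qed
  then have e: "C - {q \<in> C. same_point pt q} = (\<Union>i\<in>{..<N}. \<Union>j\<in>{..<N}. basic_open N (G i j)) \<inter> C"
    using C by (auto simp: basic_open_def)
  have "openin (zariski N) (\<Union>i\<in>{..<N}. \<Union>j\<in>{..<N}. basic_open N (G i j))"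
    using openin_basic[OF Gf] by (intro openin_Union ballI) auto
  then have "openin (subtopology (zariski N) C) (C - {q \<in> C. same_point pt q})"
    unfolding e openin_subtopology by blast
  then show ?thesis using C by (auto simp: closedin_def topspace_zariski Int_absorb1)
qed

text \<open>
  An open point of an irreducible space would be the whole space, since its complement and the
  closed point cover it.  Then there is no chain of closed irreducible sets of length one, against
  dimension one.
\<close>

lemma curve_no_isolated_point:
  assumes C: "smooth_irreducible_curve N C" and pt: "pt \<in> C" and U: "openin (zariski N) U" "pt \<in> U"
  shows "\<exists>q\<in>U \<inter> C. \<not> same_point pt q"
proof (rule ccontr)
  assume "\<not> ?thesis"
  then have all: "\<And>q. q \<in> U \<inter> C \<Longrightarrow> same_point pt q" by blast
  let ?X = "subtopology (zariski N) C"
  have Cs: "C \<subseteq> coord_space N - {0}"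
    using C by (simp add: smooth_irreducible_curve_def locally_closed_subset)
  then have top: "topspace ?X = C" by (auto simp: topspace_zariski)
  have irr: "irreducible_space ?X" using C by (simp add: smooth_irreducible_curve_def)
  have "openin ?X (U \<inter> C)" using U(1) by (auto simp: openin_subtopology)
  then have "closedin ?X (C - U \<inter> C)" using top by (metis closedin_diff closedin_topspace)
  moreover have "closedin ?X {q \<in> C. same_point pt q}" by (rule closedin_same_point[OF Cs pt])
  moreover have "(C - U \<inter> C) \<union> {q \<in> C. same_point pt q} = C" using all by blast
  moreover have "C - U \<inter> C \<noteq> C" using pt U(2) by blast
  ultimately have one: "{q \<in> C. same_point pt q} = C" using irr unfolding irreducible_space_def top by blast
  have full: "A = C" if A: "closedin ?X A" "A \<noteq> {}" for A
  proof -
    obtain p where p: "p \<in> A" using A(2) by blast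
    have AC: "A \<subseteq> C" using A(1) closedin_subset top by blast
    have "q \<in> A" if q: "q \<in> C" for q
    proof -
      have "same_point pt p" "same_point pt q" using one p q AC by blast+
      then obtain a b where a: "a \<noteq> 0" "p = cscale a pt" and b: "b \<noteq> 0" "q = cscale b pt"
        unfolding same_point_def by blast
      have "q = cscale (b / a) p" using a b by simp
      then show ?thesis using closedin_zariski_scale[OF A(1) p, of "b / a"] a b q by simp
    qed
    then show ?thesis using AC by blast
  qed
  have "krull_dim ?X \<le> 0" unfolding krull_dim_def
  proof (rule Sup_least, clarify)
    fix k and Z :: "nat \<Rightarrow> coord_vec set"
    assume Z: "\<forall>i\<le>k. closedin ?X (Z i) \<and> irreducible_space (subtopology ?X (Z i))" "\<forall>i<k. Z i \<subset> Z (Suc i)"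
    have Zi: "Z i = C" if "i \<le> k" for i
    proof (rule full)
      show "Z i \<noteq> {}" using Z(1) that by (auto simp: irreducible_space_def)
    qed (use Z(1) that in blast)
    have "k = 0"
    proof (rule ccontr)
      assume "k \<noteq> 0"
      then have "Z 0 \<subset> Z 1" "Z 0 = C" "Z 1 = C" using Z(2) Zi[of 0] Zi[of 1] by auto
      then show False by blast
    qed
    then show "enat k \<le> 0" by (simp add: zero_enat_def)
  qed
  then show False using C by (simp add: smooth_irreducible_curve_def)
qed

lemma regular_const: "C \<subseteq> coord_space N - {0} \<Longrightarrow> regular_on N C (\<lambda>_. c)"
  unfolding regular_on_def
proof
  fix p assume "C \<subseteq> coord_space N - {0}" "p \<in> C"
  then show "\<exists>U k. openin (zariski N) U \<and> p \<in> U \<and> (\<exists>G\<in>forms N k. \<exists>H\<in>forms N k.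
      \<forall>q\<in>U \<inter> C. peval H q \<noteq> 0 \<and> c = peval G q / peval H q)"
    by (intro exI[of _ "coord_space N - {0}"] exI[of _ 0] conjI bexI[of _ "cscale c 1"] bexI[of _ 1]
        openin_zariski_space forms_scale one_forms)
       (auto simp: peval_scale)
qed

definition quotient_on :: "coord_vec set \<Rightarrow> (coord_vec \<Rightarrow> complex) \<Rightarrow> cpoly \<Rightarrow> cpoly \<Rightarrow> bool" where
  "quotient_on D f G H \<longleftrightarrow> (\<forall>q\<in>D. peval H q \<noteq> 0 \<and> f q = peval G q / peval H q)"

lemma regular_on_iff: "regular_on N C f \<longleftrightarrow> (\<forall>p\<in>C. \<exists>U k. openin (zariski N) U \<and> p \<in> U \<and>
     (\<exists>G\<in>forms N k. \<exists>H\<in>forms N k. quotient_on (U \<inter> C) f G H))"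
  by (simp only: regular_on_def quotient_on_def)

lemma regular_onE:
  assumes "regular_on N C f" "p \<in> C"
  obtains U k G H where "openin (zariski N) U" "p \<in> U" "G \<in> forms N k" "H \<in> forms N k"
    "quotient_on (U \<inter> C) f G H"
proof -
  obtain U k where 1: "openin (zariski N) U" "p \<in> U"
      "\<exists>G\<in>forms N k. \<exists>H\<in>forms N k. quotient_on (U \<inter> C) f G H"
    using assms(1)[unfolded regular_on_iff, THEN bspec, OF assms(2)] by (elim exE conjE)
  then obtain G H where "G \<in> forms N k" "H \<in> forms N k" "quotient_on (U \<inter> C) f G H" by (elim bexE)
  with 1(1,2) show ?thesis by (rule that)
qed

lemma regular_combine:
  assumes f: "regular_on N C f" and g: "regular_on N C g"
  shows "regular_on N C (\<lambda>p. f p + g p)" and "regular_on N C (\<lambda>p. f p * g p)"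
proof -
  have "(\<exists>U k. openin (zariski N) U \<and> p \<in> U \<and>
      (\<exists>G\<in>forms N k. \<exists>H\<in>forms N k. quotient_on (U \<inter> C) (\<lambda>q. f q + g q) G H)) \<and>
      (\<exists>U k. openin (zariski N) U \<and> p \<in> U \<and>
      (\<exists>G\<in>forms N k. \<exists>H\<in>forms N k. quotient_on (U \<inter> C) (\<lambda>q. f q * g q) G H))"
    if p: "p \<in> C" for p
  proof -
    obtain U k G H where 1: "openin (zariski N) U" "p \<in> U" "G \<in> forms N k" "H \<in> forms N k"
      "quotient_on (U \<inter> C) f G H" by (rule regular_onE[OF f p])
    obtain U' k' G' H' where 2: "openin (zariski N) U'" "p \<in> U'" "G' \<in> forms N k'" "H' \<in> forms N k'"
      "quotient_on (U' \<inter> C) g G' H'" by (rule regular_onE[OF g p])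
    have "G' * H \<in> forms N (k + k')" by (subst add.commute) (rule forms_mult[OF 2(3) 1(4)])
    from forms_add[OF forms_mult[OF 1(3) 2(4)] this] forms_mult[OF 1(3) 2(3)] forms_mult[OF 1(4) 2(4)]
    have fs: "G * H' + G' * H \<in> forms N (k + k')" "G * G' \<in> forms N (k + k')" "H * H' \<in> forms N (k + k')" .
    have "quotient_on ((U \<inter> U') \<inter> C) (\<lambda>q. f q + g q) (G * H' + G' * H) (H * H')"
      using 1(5) 2(5) by (auto simp: quotient_on_def peval_mult peval_add add_frac_eq)
    moreover have "quotient_on ((U \<inter> U') \<inter> C) (\<lambda>q. f q * g q) (G * G') (H * H')"
      using 1(5) 2(5) by (auto simp: quotient_on_def peval_mult)
    moreover have "openin (zariski N) (U \<inter> U')" "p \<in> U \<inter> U'" using 1 2 by auto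
    ultimately show ?thesis using fs by (intro conjI exI[of _ "U \<inter> U'"] exI[of _ "k + k'"] bexI)
  qed
  then show "regular_on N C (\<lambda>p. f p + g p)" "regular_on N C (\<lambda>p. f p * g p)"
    unfolding regular_on_iff by simp_all
qed

text \<open>
  Punctured Zariski neighbourhoods, with the representatives of the marked point taken out.
\<close>

definition curve_nhds :: "nat \<Rightarrow> coord_vec set \<Rightarrow> coord_vec \<Rightarrow> coord_vec filter" where
  "curve_nhds N C pt = (INF U\<in>{U. openin (zariski N) U \<and> pt \<in> U}. principal {q \<in> U \<inter> C. \<not> same_point pt q})"

lemma eventually_curve_nhds:
  assumes "C \<subseteq> coord_space N - {0}" "pt \<in> C"
  shows "eventually P (curve_nhds N C pt) \<longleftrightarrow>
    (\<exists>U. openin (zariski N) U \<and> pt \<in> U \<and> (\<forall>q\<in>U \<inter> C. \<not> same_point pt q \<longrightarrow> P q))"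
  unfolding curve_nhds_def
proof (subst eventually_INF_base)
  have "openin (zariski N) (coord_space N - {0})" "pt \<in> coord_space N - {0}"
    using assms openin_zariski_space by auto
  then show "{U. openin (zariski N) U \<and> pt \<in> U} \<noteq> {}" by blast
  fix a b assume "a \<in> {U. openin (zariski N) U \<and> pt \<in> U}" "b \<in> {U. openin (zariski N) U \<and> pt \<in> U}"
  then show "\<exists>x\<in>{U. openin (zariski N) U \<and> pt \<in> U}. principal {q \<in> x \<inter> C. \<not> same_point pt q} \<le>
      inf (principal {q \<in> a \<inter> C. \<not> same_point pt q}) (principal {q \<in> b \<inter> C. \<not> same_point pt q})"
    by (intro bexI[of _ "a \<inter> b"]) auto
qed (auto simp: eventually_principal)

lemma curve_specialization:
  assumes "C \<subseteq> coord_space N - {0}" "pt \<in> C"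
  shows "specialization {f. regular_on N C f} pt (curve_nhds N C pt)"
proof
  fix f assume f: "f \<in> {f. regular_on N C f}" "f pt \<noteq> 0"
  then have "regular_on N C f" by simp
  then obtain U k G H where 1: "openin (zariski N) U" "pt \<in> U" "G \<in> forms N k" "H \<in> forms N k"
      "quotient_on (U \<inter> C) f G H" by (rule regular_onE[OF _ assms(2)])
  have "peval G pt \<noteq> 0" using 1 f(2) assms(2) by (auto simp: quotient_on_def)
  then have "pt \<in> U \<inter> basic_open N G" using 1(2) assms by (auto simp: basic_open_def)
  moreover have "openin (zariski N) (U \<inter> basic_open N G)" using 1 openin_basic by blast
  ultimately show "eventually (\<lambda>p. f p \<noteq> 0) (curve_nhds N C pt)"
    unfolding eventually_curve_nhds[OF assms] using 1(5)
    by (intro exI[of _ "U \<inter> basic_open N G"]) (auto simp: basic_open_def quotient_on_def)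
qed (use regular_const[OF assms(1)] regular_combine in auto)

lemma curve_nhds_nontrivial:
  assumes "smooth_irreducible_curve N C" "pt \<in> C"
  shows "curve_nhds N C pt \<noteq> bot"
proof -
  have Cs: "C \<subseteq> coord_space N - {0}"
    using assms by (simp add: smooth_irreducible_curve_def locally_closed_subset)
  show ?thesis unfolding trivial_limit_def eventually_curve_nhds[OF Cs assms(2)]
    using curve_no_isolated_point[OF assms] by blast
qed

lemma ApoLim_specialization:
  assumes "F \<in> ApoLim n d"
  obtains Reg pt and Fil :: "coord_vec filter" and Fam where "specialization Reg pt Fil" "Fil \<noteq> bot"
    "specialization.reg_family Reg Fam" "Fam pt = F" "F \<in> forms n d" "F \<noteq> 0"
    "eventually (\<lambda>p. Fam p \<in> forms n d \<and> Fam p \<noteq> 0 \<and> direct_sum_form n d (Fam p) \<and>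
        hilbert n (Fam p) = hilbert n F) Fil"
proof -
  obtain N C pt Fam where c: "smooth_irreducible_curve N C" "pt \<in> C"
     "\<forall>t\<in>C. Fam t \<in> forms n d \<and> Fam t \<noteq> 0"
     "\<forall>m. regular_on N C (\<lambda>t. lk (Fam t) m)" "Fam pt = F"
     "\<forall>t\<in>C. \<not> same_point pt t \<longrightarrow> direct_sum_form n d (Fam t)"
     "\<forall>t\<in>C. hilbert n (Fam t) = hilbert n F"
    using assms unfolding ApoLim_def by blast
  have Cs: "C \<subseteq> coord_space N - {0}"
    using c by (simp add: smooth_irreducible_curve_def locally_closed_subset)
  have sp: "specialization {f. regular_on N C f} pt (curve_nhds N C pt)" by (rule curve_specialization[OF Cs c(2)])
  have "openin (zariski N) (coord_space N - {0})" "pt \<in> coord_space N - {0}"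
    using Cs c(2) openin_zariski_space by auto
  then show ?thesis
    using c by (intro that[OF sp curve_nhds_nontrivial[OF c(1,2)], of Fam])
      (auto simp: specialization.reg_family_def[OF sp] eventually_curve_nhds[OF Cs c(2)])
qed

text \<open>
  If \<open>F\<close> had no \<open>G\<close> in the sense of \<open>ApoEqu_iff\<close>, neither would the nearby members of
  the family; but these are direct sums, for which one summand is such a \<open>G\<close>.
\<close>

lemma ApoLim_subset_ApoEqu:
  assumes d: "1 \<le> d" shows "ApoLim n d \<subseteq> ApoEqu n d"
proof
  fix F assume "F \<in> ApoLim n d"
  then obtain Reg pt and Fil :: "coord_vec filter" and Fam where sp: "specialization Reg pt Fil" "Fil \<noteq> bot"
    "specialization.reg_family Reg Fam" "Fam pt = F" "F \<in> forms n d" "F \<noteq> 0"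
    "eventually (\<lambda>p. Fam p \<in> forms n d \<and> Fam p \<noteq> 0 \<and> direct_sum_form n d (Fam p) \<and>
        hilbert n (Fam p) = hilbert n F) Fil"
    by (rule ApoLim_specialization)
  show "F \<in> ApoEqu n d"
  proof (rule ccontr)
    assume "F \<notin> ApoEqu n d"
    then have no: "\<not> (\<exists>G\<in>forms n d. G \<notin> cvs.span {Fam pt} \<and> shares_gradient n (Fam pt) G)"
      using sp(4-6) by (simp add: ApoEqu_iff[OF d])
    have "eventually (\<lambda>p. \<not> (\<exists>G\<in>forms n d. G \<notin> cvs.span {Fam p} \<and> shares_gradient n (Fam p) G)) Fil"
      by (rule specialization.no_shared_gradient_open[OF sp(1,3) d _ _ _ no])
         (use sp(4-7) in \<open>auto elim: eventually_mono\<close>)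
    with sp(7) have "eventually (\<lambda>p. False) Fil"
    proof eventually_elim
      case (elim p)
      then obtain U1 U2 F1 F2 where s: "splits_form n d (Fam p) U1 U2 F1 F2"
        using direct_sum_splits by blast
      then have "F1 \<in> forms n d" by (simp add: splits_form_def)
      then show ?case using elim(2) splits_form_gradient[OF s d] by blast
    qed
    then show False using sp(2) by (simp add: trivial_limit_def)
  qed
qed


section \<open>Families over the affine line\<close>

definition affine_pt :: "complex \<Rightarrow> coord_vec" where
  "affine_pt t = sg 0 1 + sg 1 t"

lemma lookup_affine_pt: "lk (affine_pt t) i = (if i = 0 then 1 else if i = 1 then t else 0)"
  by (auto simp: affine_pt_def lookup_add lookup_single lookup_one when_def)

text \<open>
  The projective line without the point at infinity and without the points of \<open>B\<close>, where a
  family may fail to consist of direct sums.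
\<close>

definition affine_line :: "complex set \<Rightarrow> coord_vec set" where
  "affine_line B = {p \<in> coord_space 2. lk p 0 \<noteq> 0 \<and> lk p 1 / lk p 0 \<notin> B}"

lemma affine_pt_space: "affine_pt t \<in> coord_space 2"
  by (auto simp: coord_space_def in_keys_iff lookup_affine_pt split: if_splits)

lemma affine_pt_line: "affine_pt t \<in> affine_line B \<longleftrightarrow> t \<notin> B"
  by (simp add: affine_line_def affine_pt_space lookup_affine_pt)

lemma coord_space_2_eqI: "p \<in> coord_space 2 \<Longrightarrow> q \<in> coord_space 2 \<Longrightarrow> lk p 0 = lk q 0 \<Longrightarrow> lk p 1 = lk q 1 \<Longrightarrow> p = q"
proof (rule poly_mapping_eqI)
  fix i assume a: "p \<in> coord_space 2" "q \<in> coord_space 2" "lk p 0 = lk q 0" "lk p 1 = lk q 1"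
  consider "i = 0" | "i = 1" | "i \<notin> {..<2::nat}" by fastforce
  then show "lk p i = lk q i"
  proof cases
    case 3
    then have "i \<notin> ky p" "i \<notin> ky q" using a(1,2) by (auto simp: coord_space_def)
    then show ?thesis by (simp add: in_keys_iff)
  qed (use a in auto)
qed

lemma affine_line_normal:
  "p \<in> affine_line B \<Longrightarrow> p = cscale (lk p 0) (affine_pt (lk p 1 / lk p 0))"
  by (rule coord_space_2_eqI) (auto simp: affine_line_def affine_pt_space coord_space_scale lookup_cscale lookup_affine_pt)

lemma affine_line_subset: "affine_line B \<subseteq> coord_space 2 - {0}"
  by (auto simp: affine_line_def)

text \<open>
  Dehomogenization is injective on the binary forms of a given degree.
\<close>

lemma form_on_line:
  assumes "G \<in> forms 2 k"
  obtains g :: "complex poly" where "\<And>t. peval G (affine_pt t) = poly g t" "g = 0 \<longleftrightarrow> G = 0"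
proof -
  let ?e = "\<lambda>m. lk m (1::nat) :: nat"
  have m2: "lk m i = 0" if "m \<in> mons 2 k" "i \<noteq> 0" "i \<noteq> 1" for m i
  proof -
    have "i \<notin> {..<2}" using that(2,3) by auto
    then show ?thesis using that(1) by (auto simp: mons_def in_keys_iff subset_iff)
  qed
  have deg: "lk m 0 + ?e m = k" if "m \<in> mons 2 k" for m
  proof -
    have "mdegree m = (\<Sum>i\<in>{..<2}. lk m i)" by (rule mdegree_superset) (use that in \<open>auto simp: mons_def\<close>)
    then show ?thesis using that by (simp add: mons_def numeral_2_eq_2)
  qed
  have inj: "m = m'" if "m \<in> mons 2 k" "m' \<in> mons 2 k" "?e m = ?e m'" for m m'
  proof (rule poly_mapping_eqI)
    fix i
    show "lk m i = lk m' i" using m2[OF that(1), of i] m2[OF that(2), of i] deg[OF that(1)] deg[OF that(2)] that(3)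
      by (cases "i = 0"; cases "i = 1") auto
  qed
  define g where "g = (\<Sum>m\<in>mons 2 k. monom (lk G m) (?e m))"
  have mv: "mval m (affine_pt t) = t ^ ?e m" if "m \<in> mons 2 k" for m t
  proof -
    have "mval m (affine_pt t) = (\<Prod>i\<in>{..<2}. lk (affine_pt t) i ^ lk m i)"
      by (rule mval_superset) (use that in \<open>auto simp: mons_def\<close>)
    then show ?thesis by (simp add: numeral_2_eq_2 lookup_affine_pt)
  qed
  have 1: "peval G (affine_pt t) = poly g t" for t
    using assms unfolding forms_iff
    by (subst peval_superset[OF finite_mons])
       (auto simp: g_def poly_sum poly_monom mv[unfolded One_nat_def] intro!: sum.cong)
  have co: "coeff g (?e m) = lk G m" if "m \<in> mons 2 k" for m
  proof -
    have "coeff g (?e m) = (\<Sum>m'\<in>mons 2 k. if m' = m then lk G m' else 0)"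
      unfolding g_def coeff_sum
    proof (intro sum.cong refl)
      fix m' assume "m' \<in> mons 2 k"
      then show "coeff (monom (lk G m') (?e m')) (?e m) = (if m' = m then lk G m' else 0)"
        using inj[OF that, of m'] by (cases "m' = m") auto
    qed
    then show ?thesis using that by simp
  qed
  have 2: "G = 0" if "g = 0"
  proof (rule poly_mapping_eqI)
    fix m show "lk G m = lk 0 m"
      using co[of m] that assms by (cases "m \<in> mons 2 k") (auto simp: forms_iff in_keys_iff subset_iff)
  qed
  show ?thesis by (rule that[of g]) (use 1 2 in \<open>auto simp: g_def\<close>)
qed

lemma open_line_cofinite:
  assumes "openin (zariski 2) U" "U \<noteq> {}"
  shows "finite {t. affine_pt t \<notin> U}"
proof -
  have "generate_topology_on {basic_open 2 G |G k. G \<in> forms 2 k} U"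
    using assms(1) by (simp add: zariski_alt openin_topology_generated_by_iff)
  then have "U = {} \<or> finite {t. affine_pt t \<notin> U}"
  proof induction
    case (Int a b)
    have "{t. affine_pt t \<notin> a \<inter> b} = {t. affine_pt t \<notin> a} \<union> {t. affine_pt t \<notin> b}" by auto
    then show ?case using Int.IH by auto
  next
    case (UN K)
    show ?case
    proof (cases "\<Union>K = {}")
      case False
      then obtain k where k: "k \<in> K" "k \<noteq> {}" by blast
      have "{t. affine_pt t \<notin> \<Union>K} \<subseteq> {t. affine_pt t \<notin> k}" using k by auto
      then show ?thesis using UN.IH[OF k(1)] k(2) finite_subset by blast
    qed simp
  next
    case (Basis s)
    then obtain G k where G: "s = basic_open 2 G" "G \<in> forms 2 k" by blast
    show ?case
    proof (cases "s = {}")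
      case False
      then have "G \<noteq> 0" using G by (auto simp: basic_open_def)
      obtain g where g: "\<And>t. peval G (affine_pt t) = poly g t" "g = 0 \<longleftrightarrow> G = 0"
        using form_on_line[OF G(2)] by metis
      have "affine_pt t \<noteq> 0" for t by (metis lookup_affine_pt lookup_zero zero_neq_one)
      then have "{t. affine_pt t \<notin> s} = {t. poly g t = 0}"
        by (auto simp: G basic_open_def affine_pt_space g(1))
      then show ?thesis using poly_roots_finite[of g] g(2) \<open>G \<noteq> 0\<close> by simp
    qed simp
  qed simp
  then show ?thesis using assms(2) by simp
qed

text \<open>
  Proper closed subsets are finite, which gives irreducibility and, as a finite irreducible set
  is a point, dimension one.  No nonzero form vanishes on the whole set, so the tangent space of
  the cone is the full coordinate plane.
\<close>

lemma affine_line_smooth_curve: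
  assumes B: "finite B"
  shows "smooth_irreducible_curve 2 (affine_line B)"
proof -
  let ?C = "affine_line B"
  let ?X = "subtopology (zariski 2) ?C"
  have top: "topspace ?X = ?C" using affine_line_subset[of B] by (auto simp: topspace_zariski)
  \<comment> \<open>The complement of the removed points is the locus where this form does not vanish.\<close>
  define D where "D = var 0 * (\<Prod>b\<in>B. var 1 - cscale b (var 0))"
  have "(\<Prod>b\<in>B. var 1 - cscale b (var 0)) \<in> forms 2 (card B)"
    using B
  proof (induction B rule: finite_induct)
    case (insert b B)
    have "var 1 - cscale b (var 0) \<in> forms 2 1" by (intro forms_diff forms_scale) auto
    from forms_mult[OF this insert.IH] show ?case using insert.hyps by simp
  qed simp
  then have Df: "D \<in> forms 2 (1 + card B)" unfolding D_def by (intro forms_mult) auto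
  have pl: "peval (var 1 - cscale b (var 0)) p = lk p 1 - b * lk p 0" for b p
    using peval_add[of "var 1 - cscale b (var 0)" "cscale b (var 0)" p] by (simp add: peval_scale)
  have pD: "peval D p = lk p 0 * (\<Prod>b\<in>B. lk p 1 - b * lk p 0)" for p
  proof -
    have "peval (\<Prod>b\<in>B. var 1 - cscale b (var 0)) p = (\<Prod>b\<in>B. lk p 1 - b * lk p 0)"
      using B by (induction B rule: finite_induct) (simp_all add: peval_mult pl[unfolded One_nat_def])
    then show ?thesis by (simp add: D_def peval_mult)
  qed
  have "?C = basic_open 2 D" using B
    by (auto simp: affine_line_def basic_open_def pD divide_simps)
  then have opC: "openin (zariski 2) ?C" using openin_basic[OF Df] by simp
  have locC: "locally_closed_in (zariski 2) ?C" unfolding locally_closed_in_def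
    by (intro exI[of _ ?C] exI[of _ "topspace (zariski 2)"]) (use opC openin_subset in auto)
  have fin: "finite {t. affine_pt t \<in> A}" if A: "closedin ?X A" "A \<noteq> ?C" for A
  proof -
    obtain T where T: "closedin (zariski 2) T" "A = T \<inter> ?C" using A(1) by (auto simp: closedin_subtopology)
    let ?U = "topspace (zariski 2) - T"
    have "openin (zariski 2) ?U" using T(1) by (simp add: closedin_def)
    moreover have "?U \<noteq> {}" using A(2) T(2) affine_line_subset[of B] by (auto simp: topspace_zariski)
    ultimately have "finite {t. affine_pt t \<notin> ?U}" by (rule open_line_cofinite)
    then show ?thesis by (rule finite_subset[rotated]) (use T(2) in auto)
  qed
  have Cinf: "infinite {t. affine_pt t \<in> ?C}"
  proof -
    have "{t. affine_pt t \<in> ?C} = UNIV - B" by (auto simp: affine_pt_line)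
    then show ?thesis using B infinite_UNIV_char_0 by (metis Diff_infinite_finite)
  qed
  have irrC: "irreducible_space ?X" unfolding irreducible_space_def top
  proof (intro conjI allI impI)
    show "?C \<noteq> {}" using Cinf by auto
    fix A A' assume a: "closedin ?X A \<and> closedin ?X A' \<and> A \<union> A' = ?C"
    show "A = ?C \<or> A' = ?C"
    proof (rule ccontr)
      assume "\<not> ?thesis"
      then have "finite ({t. affine_pt t \<in> A} \<union> {t. affine_pt t \<in> A'})" using a fin by auto
      moreover have "{t. affine_pt t \<in> ?C} \<subseteq> {t. affine_pt t \<in> A} \<union> {t. affine_pt t \<in> A'}" using a by auto
      ultimately show False using Cinf finite_subset by blast
    qed
  qed
  define cls where "cls t = {q \<in> ?C. same_point (affine_pt t) q}" for t
  have cls: "closedin ?X (cls t)" if "t \<notin> B" for t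
    unfolding cls_def by (rule closedin_same_point[OF affine_line_subset]) (simp add: affine_pt_line that)
  have in_cls: "p \<in> cls t \<longleftrightarrow> p \<in> ?C \<and> lk p 1 / lk p 0 = t" for p t
  proof
    assume "p \<in> cls t" then show "p \<in> ?C \<and> lk p 1 / lk p 0 = t"
      by (auto simp: cls_def same_point_def lookup_cscale lookup_affine_pt)
  next
    assume a: "p \<in> ?C \<and> lk p 1 / lk p 0 = t"
    then have "p = cscale (lk p 0) (affine_pt t)" "lk p 0 \<noteq> 0"
      using affine_line_normal[of p B] by (auto simp: affine_line_def)
    then show "p \<in> cls t" using a by (auto simp: cls_def same_point_def)
  qed
  have cls_sub: "cls t \<subseteq> A" if A: "closedin ?X A" "p \<in> A" "p \<in> cls t" for A p t
  proof
    fix q assume q: "q \<in> cls t"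
    have pC: "p \<in> ?C" "q \<in> ?C" using A(3) q in_cls by auto
    have p: "p = cscale (lk p 0) (affine_pt t)" "q = cscale (lk q 0) (affine_pt t)"
      using A(3) q in_cls affine_line_normal[OF pC(1)] affine_line_normal[OF pC(2)] by auto
    have nz: "lk p 0 \<noteq> 0" "lk q 0 \<noteq> 0" using pC by (auto simp: affine_line_def)
    have "cscale (lk q 0 / lk p 0) p = cscale (lk q 0 / lk p 0) (cscale (lk p 0) (affine_pt t))" using p(1) by simp
    also have "\<dots> = q" using p(2) nz by simp
    finally have "q = cscale (lk q 0 / lk p 0) p" ..
    then show "q \<in> A" using closedin_zariski_scale[OF A(1,2), of "lk q 0 / lk p 0"] nz pC by simp
  qed
  have dim: "krull_dim ?X = 1"
  proof (rule antisym)
    show "krull_dim ?X \<le> 1" unfolding krull_dim_def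
    proof (rule Sup_least, clarify)
      fix k and Z :: "nat \<Rightarrow> coord_vec set"
      assume Z: "\<forall>i\<le>k. closedin ?X (Z i) \<and> irreducible_space (subtopology ?X (Z i))" "\<forall>i<k. Z i \<subset> Z (Suc i)"
      have "k \<le> 1"
      proof (rule ccontr)
        assume "\<not> k \<le> 1"
        then have k: "0 \<le> k" "1 \<le> k" "2 \<le> k" "0 < k" "1 < k" by auto
        have Z01: "Z 0 \<subset> Z 1" "Z 1 \<subset> Z 2" using Z(2) k(4,5) by (auto simp: numeral_2_eq_2)
        have cl: "closedin ?X (Z 0)" "closedin ?X (Z 1)" "closedin ?X (Z 2)" using Z(1) k by blast+
        have sub: "Z 0 \<subseteq> ?C" "Z 1 \<subseteq> ?C" "Z 2 \<subseteq> ?C" using cl closedin_subset top by blast+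
        have ir: "irreducible_space (subtopology ?X (Z 1))" "irreducible_space (subtopology ?X (Z 0))"
          using Z(1) k by blast+
        have fin1: "finite {t. affine_pt t \<in> Z 1}" using fin[OF cl(2)] Z01 sub by blast
        have tops: "topspace (subtopology ?X (Z 0)) = Z 0" "topspace (subtopology ?X (Z 1)) = Z 1"
          using sub top by (simp_all only: topspace_subtopology) blast+
        obtain p0 where p0: "p0 \<in> Z 0" using ir(2) unfolding irreducible_space_def tops by blast
        define t where "t = lk p0 1 / lk p0 0"
        have p0t: "p0 \<in> cls t" using p0 sub(1) by (auto simp: in_cls t_def)
        define T where "T = {s. affine_pt s \<in> Z 1} - {t}"
        have TB: "s \<notin> B" if "s \<in> T" for s using that sub(2) by (auto simp: T_def affine_pt_line)
        have tB: "t \<notin> B" using p0 sub(1) by (auto simp: t_def affine_line_def)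
        have c2: "closedin ?X (\<Union>s\<in>T. cls s)"
          using fin1 cls TB by (intro closedin_Union) (auto simp: T_def)
        have Z1: "Z 1 \<subseteq> cls t \<union> (\<Union>s\<in>T. cls s)"
        proof
          fix p assume p: "p \<in> Z 1"
          then have pC: "p \<in> ?C" using sub by blast
          let ?s = "lk p 1 / lk p 0"
          have nz: "lk p 0 \<noteq> 0" using pC by (simp add: affine_line_def)
          have "affine_pt ?s = cscale (inverse (lk p 0)) p"
            by (subst (3) affine_line_normal[OF pC]) (use nz in simp)
          moreover have "affine_pt ?s \<in> ?C" using pC by (subst affine_pt_line) (simp add: affine_line_def)
          ultimately have "affine_pt ?s \<in> Z 1" using closedin_zariski_scale[OF cl(2) p, of "inverse (lk p 0)"] nz by simp
          then show "p \<in> cls t \<union> (\<Union>s\<in>T. cls s)" using pC by (auto simp: T_def in_cls)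
        qed
        have "closedin (subtopology ?X (Z 1)) (cls t \<inter> Z 1)" "closedin (subtopology ?X (Z 1)) ((\<Union>s\<in>T. cls s) \<inter> Z 1)"
          using cls[OF tB] c2 unfolding closedin_subtopology[of ?X] by blast+
        moreover have "(cls t \<inter> Z 1) \<union> ((\<Union>s\<in>T. cls s) \<inter> Z 1) = Z 1" using Z1 by blast
        moreover have "(\<Union>s\<in>T. cls s) \<inter> Z 1 \<noteq> Z 1"
        proof -
          have "p0 \<notin> (\<Union>s\<in>T. cls s)" using p0t by (auto simp: T_def in_cls)
          then show ?thesis using p0 Z01 by blast
        qed
        ultimately have "cls t \<inter> Z 1 = Z 1" using ir(1) unfolding irreducible_space_def tops by blast
        moreover have "cls t \<subseteq> Z 0" by (rule cls_sub[OF cl(1) p0 p0t])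
        ultimately show False using Z01(1) by blast
      qed
      then show "enat k \<le> 1" by (simp add: one_enat_def)
    qed
    obtain t where t: "t \<notin> B" using Cinf by (force simp: affine_pt_line dest: not_finite_existsD)
    define Z where "Z i = (if i = (0::nat) then cls t else ?C)" for i
    have X1: "subtopology ?X ?C = ?X" by (simp add: subtopology_subtopology)
    have ptt: "affine_pt t \<in> cls t" using t by (simp add: in_cls affine_pt_line lookup_affine_pt)
    have tops: "topspace (subtopology ?X (cls t)) = cls t"
      using closedin_subset[OF cls[OF t]] top by (simp only: topspace_subtopology) blast
    have ir: "irreducible_space (subtopology ?X (cls t))" unfolding irreducible_space_def tops
    proof (intro conjI allI impI)
      show "cls t \<noteq> {}" using ptt by blast
      fix A A' assume a: "closedin (subtopology ?X (cls t)) A \<and> closedin (subtopology ?X (cls t)) A' \<and> A \<union> A' = cls t"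
      have "cls t \<subseteq> A''" if "closedin (subtopology ?X (cls t)) A''" "affine_pt t \<in> A''" for A''
      proof -
        have "closedin ?X A''" using closedin_trans_full[OF that(1) cls[OF t]] .
        then show ?thesis using cls_sub that(2) ptt by blast
      qed
      then show "A = cls t \<or> A' = cls t" using a ptt by blast
    qed
    have "cls t \<noteq> ?C"
    proof
      assume "cls t = ?C"
      then have "{s. affine_pt s \<in> ?C} \<subseteq> {t}" using in_cls[of "affine_pt _" t] by (auto simp: lookup_affine_pt)
      then show False using Cinf finite_subset by blast
    qed
    then have strict: "cls t \<subset> ?C" using in_cls by blast
    show "1 \<le> krull_dim ?X" unfolding krull_dim_def
    proof (rule Sup_upper, intro CollectI exI[of _ 1] conjI exI[of _ Z] allI impI)
      show "1 = enat 1" by (simp add: one_enat_def)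
      show "closedin ?X (Z i)" for i using cls[OF t] closedin_topspace[of ?X, unfolded top] by (simp add: Z_def)
      show "irreducible_space (subtopology ?X (Z i))" for i using ir irrC X1 by (simp add: Z_def)
      show "Z i \<subset> Z (Suc i)" if "i < 1" for i using strict that by (simp add: Z_def)
    qed
  qed
  have tan: "cone_tangent 2 ?C p = coord_space 2" for p
  proof -
    have "G = 0" if G: "G \<in> forms 2 k" "\<forall>q\<in>?C. peval G q = 0" for G k
    proof -
      obtain g where g: "\<And>t. peval G (affine_pt t) = poly g t" "g = 0 \<longleftrightarrow> G = 0"
        using form_on_line[OF G(1)] by metis
      have "{t. affine_pt t \<in> ?C} \<subseteq> {t. poly g t = 0}" using G(2) g(1) by auto
      then have "g = 0" using Cinf poly_roots_finite finite_subset by blast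
      then show ?thesis using g(2) by simp
    qed
    moreover have "pdiff i 0 = 0" for i by (simp flip: act_var)
    ultimately show ?thesis by (fastforce simp: cone_tangent_def)
  qed
  have dim2: "cvs.dim (coord_space 2) = 1 + 1"
  proof -
    let ?b = "{sg 0 1, sg 1 1} :: coord_vec set"
    have n1: "sg 1 1 \<notin> cvs.span {sg (0::nat) (1::complex)}"
    proof
      assume "sg 1 1 \<in> cvs.span {sg (0::nat) (1::complex)}"
      then obtain c where "sg 1 1 = cscale c (sg (0::nat) (1::complex))" by (auto simp: cvs.span_singleton)
      then have "lk (sg 1 (1::complex)) (1::nat) = c * lk (sg 0 1) (1::nat)" by (metis lookup_cscale)
      then show False by (simp add: lookup_single lookup_one)
    qed
    have "cvs.independent {sg (0::nat) (1::complex)}" by simp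
    with n1 have ind: "cvs.independent (insert (sg 1 1) {sg (0::nat) (1::complex)})" by (rule cvs.independent_insertI)
    have "coord_space 2 = cvs.span ?b"
    proof (intro equalityI subsetI)
      fix p assume p: "p \<in> coord_space 2"
      have "p = cscale (lk p 0) (sg 0 1) + cscale (lk p 1) (sg 1 1)" (is "p = ?q")
        by (rule coord_space_2_eqI[OF p])
           (auto simp: coord_space_def in_keys_iff lookup_add lookup_cscale lookup_single lookup_one when_def split: if_splits)
      moreover have "?q \<in> cvs.span ?b" by (intro cvs.span_add cvs.span_scale cvs.span_base) auto
      ultimately show "p \<in> cvs.span ?b" by simp
    next
      have "coord_space 2 = {p. \<forall>i. \<not> i < 2 \<longrightarrow> lk p i = 0}"
        by (auto simp: coord_space_def in_keys_iff subset_iff)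
      then have s: "cvs.subspace (coord_space 2)"
        by (auto intro!: cvs.subspaceI simp: lookup_add lookup_cscale)
      fix p assume "p \<in> cvs.span ?b"
      moreover have "?b \<subseteq> coord_space 2" by (auto simp: coord_space_def)
      ultimately show "p \<in> coord_space 2" using cvs.span_minimal[OF _ s] by blast
    qed
    moreover have "card ?b = 2"
    proof -
      have "sg 0 1 \<noteq> (sg 1 1 :: coord_vec)" using n1 cvs.span_base[of "sg 0 1" "{sg (0::nat) (1::complex)}"] by auto
      then show ?thesis by (simp only: card_2_iff) blast
    qed
    ultimately show ?thesis using cvs.dim_span_eq_card_independent[OF ind] by (simp add: insert_commute)
  qed
  show ?thesis unfolding smooth_irreducible_curve_def
    using locC irrC dim tan dim2 by auto
qed

lemma hilbert_0: "F \<noteq> 0 \<Longrightarrow> hilbert n F 0 = 1" "hilbert n 0 k = 0"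
proof -
  have "(\<lambda>\<Theta>. \<Theta> \<odot> 0) ` forms n k \<subseteq> cvs.span {}" by auto
  then have "cvs.dim ((\<lambda>\<Theta>. \<Theta> \<odot> 0) ` forms n k) \<le> card ({} :: cpoly set)" by (rule cvs.dim_le_card) simp
  then show "hilbert n 0 k = 0" by (simp add: hilbert_eq_dim)
  assume F: "F \<noteq> 0"
  have "(\<lambda>\<Theta>. \<Theta> \<odot> F) ` forms n 0 = cvs.span {F}"
    unfolding forms_0 cvs.span_singleton by (auto simp: act_scale_left image_iff)
  moreover have "cvs.independent {F}" using F by simp
  ultimately show "hilbert n F 0 = 1" unfolding hilbert_eq_dim by (simp add: cvs.dim_eq_card_independent)
qed

text \<open>
  One polynomial per coefficient.  For a family of forms of fixed degree only finitely many
  coefficients matter.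
\<close>

definition poly_family :: "(complex \<Rightarrow> cpoly) \<Rightarrow> bool" where
  "poly_family Fam \<longleftrightarrow> (\<forall>m. \<exists>q. \<forall>t. lk (Fam t) m = poly q t)"

interpretation line: specialization "range poly" "0 :: complex" cofinite
proof
  show "(\<lambda>_. c) \<in> range poly" for c :: complex by (rule range_eqI[of _ _ "[:c:]"]) auto
  fix f g :: "complex \<Rightarrow> complex" assume f: "f \<in> range poly"
  show "g \<in> range poly \<Longrightarrow> (\<lambda>p. f p + g p) \<in> range poly" using f
    by (auto simp flip: poly_add)
  show "g \<in> range poly \<Longrightarrow> (\<lambda>p. f p * g p) \<in> range poly" using f
    by (auto simp flip: poly_mult)
  assume "f 0 \<noteq> 0"
  then show "\<forall>\<^sub>\<infinity>p. f p \<noteq> 0" using f 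
    by (auto simp: eventually_cofinite intro!: poly_roots_finite)
qed

lemma poly_family_iff: "poly_family Fam \<longleftrightarrow> line.reg_family Fam"
  unfolding poly_family_def line.reg_family_def by (auto simp: image_iff fun_eq_iff)

text \<open>
  Semicontinuity gives one half of the equality of Hilbert functions, so only the upper bound has
  to be supplied.  The exceptional parameters are finite in number and are removed from the
  line; the marked point stays.
\<close>

lemma ApoLim_polyI:
  assumes Fam: "poly_family Fam" "\<And>t. Fam t \<in> forms n d" and F: "Fam 0 \<noteq> 0"
    and ds: "\<forall>\<^sub>\<infinity>t. direct_sum_form n d (Fam t)"
    and h: "\<And>k. k \<le> d \<Longrightarrow> \<forall>\<^sub>\<infinity>t. hilbert n (Fam t) k \<le> hilbert n (Fam 0) k"
  shows "Fam 0 \<in> ApoLim n d"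
proof -
  have hz: "hilbert n (Fam t) k = 0" if "d < k" for t k
  proof -
    have "(\<lambda>\<Theta>. \<Theta> \<odot> Fam t) ` forms n k \<subseteq> cvs.span {}" using act_forms_zero[OF _ Fam(2) that] by auto
    then have "cvs.dim ((\<lambda>\<Theta>. \<Theta> \<odot> Fam t) ` forms n k) \<le> card ({} :: cpoly set)" by (rule cvs.dim_le_card) simp
    then show ?thesis by (simp add: hilbert_eq_dim)
  qed
  have "\<forall>\<^sub>\<infinity>t. \<forall>k\<in>{..d}. hilbert n (Fam t) k = hilbert n (Fam 0) k"
  proof (rule eventually_ball_finite)
    show "\<forall>k\<in>{..d}. \<forall>\<^sub>\<infinity>t. hilbert n (Fam t) k = hilbert n (Fam 0) k"
    proof
      fix k assume "k \<in> {..d}"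
      then have "\<forall>\<^sub>\<infinity>t. hilbert n (Fam t) k \<le> hilbert n (Fam 0) k" using h by simp
      moreover have "\<forall>\<^sub>\<infinity>t. hilbert n (Fam 0) k \<le> hilbert n (Fam t) k"
        using line.hilbert_semicontinuous Fam(1) poly_family_iff by blast
      ultimately show "\<forall>\<^sub>\<infinity>t. hilbert n (Fam t) k = hilbert n (Fam 0) k"
        by eventually_elim simp
    qed
  qed simp
  with ds have ev: "\<forall>\<^sub>\<infinity>t. direct_sum_form n d (Fam t) \<and> hilbert n (Fam t) = hilbert n (Fam 0)"
  proof eventually_elim
    case (elim t)
    have "hilbert n (Fam t) k = hilbert n (Fam 0) k" for k
      using elim(2) hz[of k t] hz[of k 0] by (cases "k \<le> d") auto
    then show ?case using elim(1) by auto
  qed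
  define B where "B = {t. \<not> (direct_sum_form n d (Fam t) \<and> hilbert n (Fam t) = hilbert n (Fam 0))} - {0}"
  have finB: "finite B" using ev by (simp add: B_def eventually_cofinite)
  \<comment> \<open>The affine coordinate is a quotient of homogeneous coordinates, so a polynomial family is regular.\<close>
  define Fm where "Fm p = Fam (lk p 1 / lk p 0)" for p :: coord_vec
  have sub: "affine_line B \<subseteq> coord_space 2 - {0}" by (rule affine_line_subset)
  have h1: "hilbert n (Fm p) = hilbert n (Fam 0)" if "p \<in> affine_line B" for p
    using that by (cases "lk p 1 / lk p 0 = 0") (auto simp: Fm_def affine_line_def B_def)
  have nz: "Fm p \<noteq> 0" if "p \<in> affine_line B" for p
    using h1[OF that, THEN fun_cong, of 0] hilbert_0(1)[OF F, of n] hilbert_0(2)[of n 0] by (metis zero_neq_one)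
  have ratio: "regular_on 2 (affine_line B) (\<lambda>p. lk p 1 / lk p 0)"
    unfolding regular_on_def
  proof
    fix p assume "p \<in> affine_line B"
    then have p: "p \<in> coord_space 2 - {0}" using sub by blast
    have 1: "\<forall>q\<in>(coord_space 2 - {0}) \<inter> affine_line B.
        peval (var 0) q \<noteq> 0 \<and> lk q 1 / lk q 0 = peval (var 1) q / peval (var 0) q"
      by (simp add: affine_line_def)
    show "\<exists>U k. openin (zariski 2) U \<and> p \<in> U \<and> (\<exists>G\<in>forms 2 k. \<exists>H\<in>forms 2 k. \<forall>q\<in>U \<inter> affine_line B.
        peval H q \<noteq> 0 \<and> lk q 1 / lk q 0 = peval G q / peval H q)"
      by (rule exI, rule exI[of _ 1], intro conjI, rule openin_zariski_space, rule p, rule bexI, rule bexI,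
          rule 1) simp_all
  qed
  have reg_poly: "regular_on 2 (affine_line B) (\<lambda>p. poly q (lk p 1 / lk p 0))" for q
  proof (induction q)
    case 0 then show ?case using regular_const[OF sub, of 0] by simp
  next
    case (pCons a q)
    show ?case unfolding poly_pCons
      by (rule regular_combine(1)[OF regular_const[OF sub] regular_combine(2)[OF ratio pCons.IH]])
  qed
  have pt0: "affine_pt 0 \<in> affine_line B" by (simp add: affine_pt_line B_def)
  show ?thesis unfolding ApoLim_def
  proof (intro CollectI exI conjI ballI allI impI)
    show "smooth_irreducible_curve 2 (affine_line B)" by (rule affine_line_smooth_curve[OF finB])
    show "affine_pt 0 \<in> affine_line B" by (rule pt0)
    show "Fm t \<in> forms n d" for t by (simp add: Fm_def Fam(2))
    show "Fm t \<noteq> 0" if "t \<in> affine_line B" for t by (rule nz[OF that])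
    show "Fm (affine_pt 0) = Fam 0" by (simp add: Fm_def lookup_affine_pt)
    show "hilbert n (Fm t) = hilbert n (Fam 0)" if "t \<in> affine_line B" for t by (rule h1[OF that])
    show "regular_on 2 (affine_line B) (\<lambda>t. lk (Fm t) m)" for m
    proof -
      obtain q where "\<And>t. lk (Fam t) m = poly q t" using Fam(1) unfolding poly_family_def by metis
      then show ?thesis using reg_poly[of q] by (simp add: Fm_def)
    qed
    fix p assume p: "p \<in> affine_line B" "\<not> same_point (affine_pt 0) p"
    have "lk p 1 / lk p 0 \<noteq> 0"
    proof
      assume z: "lk p 1 / lk p 0 = 0"
      have "p = cscale (lk p 0) (affine_pt 0)" using affine_line_normal[OF p(1)] unfolding z .
      then show False using p unfolding same_point_def affine_line_def by blast
    qed
    then show "direct_sum_form n d (Fm p)" using p(1) by (auto simp: affine_line_def B_def Fm_def)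
  qed
qed


section \<open>Divided powers\<close>

text \<open>
  The divided power \<open>v^[k]\<close>.  Its derivatives carry no numerical factors (\<open>act_divpow\<close>).
\<close>

definition divpow :: "cpoly \<Rightarrow> nat \<Rightarrow> cpoly" where
  "divpow v k = cscale (1 / fact k) (v ^ k)"

lemma divpow_0 [simp]: "divpow v 0 = 1" by (simp add: divpow_def)

lemma act_power:
  assumes "u \<in> forms n 1" "u \<odot> v = cscale c 1"
  shows "u \<odot> v ^ Suc k = cscale (of_nat (Suc k) * c) (v ^ k)"
proof (induction k)
  case 0 then show ?case using assms by simp
next
  case (Suc k)
  have "u \<odot> v ^ Suc (Suc k) = (u \<odot> v) * v ^ Suc k + v * (u \<odot> v ^ Suc k)"
    using act_leibniz[OF assms(1), of v "v ^ Suc k"] by simp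
  also have "\<dots> = cscale c (v ^ Suc k) + cscale (of_nat (Suc k) * c) (v ^ Suc k)"
    unfolding Suc.IH assms(2) by simp
  also have "\<dots> = cscale (of_nat (Suc (Suc k)) * c) (v ^ Suc k)"
    by (simp add: algebra_simps flip: cvs.scale_left_distrib)
  finally show ?case .
qed

lemma act_divpow:
  assumes "u \<in> forms n 1" "u \<odot> v = cscale c 1"
  shows "u \<odot> divpow v (Suc k) = cscale c (divpow v k)"
  unfolding divpow_def act_scale_right act_power[OF assms] by (simp del: power_Suc of_nat_Suc add: field_simps)

lemma act_divpow_0: "u \<in> forms n 1 \<Longrightarrow> u \<odot> divpow v 0 = 0"
  by (simp add: linear_act_one[of u n])

lemma divpow_forms: "v \<in> forms n 1 \<Longrightarrow> divpow v k \<in> forms n k"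
proof -
  assume v: "v \<in> forms n 1"
  have "v ^ k \<in> forms n k"
  proof (induction k)
    case (Suc k) then show ?case using forms_mult[OF v Suc.IH] by simp
  qed simp
  then show ?thesis unfolding divpow_def by (rule forms_scale)
qed


section \<open>Direct sums in five variables without rank one operators\<close>

text \<open>
  For \<open>l \<noteq> 0\<close> the form \<open>l \<odot> F\<close> has at least two independent first derivatives.
\<close>

definition no_rank_one :: "nat \<Rightarrow> cpoly \<Rightarrow> bool" where
  "no_rank_one n F \<longleftrightarrow> (\<forall>l\<in>forms n 1. \<forall>P. (\<forall>i<n. pdiff i (l \<odot> F) \<in> cvs.span {P}) \<longrightarrow> l = 0)"

lemma span_mult:
  assumes X: "cvs.subspace X" and "\<And>x y. x \<in> A \<Longrightarrow> y \<in> B \<Longrightarrow> x * y \<in> X"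
    and "x \<in> cvs.span A" "y \<in> cvs.span B"
  shows "(x :: cpoly) * y \<in> X"
proof -
  have linl: "Vector_Spaces.linear cscale cscale (\<lambda>x. x * y)" for y :: cpoly
    by (simp add: Vector_Spaces.linear_iff cvs.vector_space_axioms distrib_right)
  have linr: "Vector_Spaces.linear cscale cscale (\<lambda>y. x * y)" for x :: cpoly
    by (simp add: Vector_Spaces.linear_iff cvs.vector_space_axioms distrib_left)
  have 1: "a * y \<in> X" if "a \<in> A" for a
  proof -
    have "cvs.span B \<subseteq> {y. a * y \<in> X}"
      by (rule cvs.span_minimal) (use assms(2) that cvp.linear_subspace_vimage[OF linr X] in \<open>auto simp: vimage_def\<close>)
    then show ?thesis using assms(4) by blast
  qed
  have "cvs.span A \<subseteq> {x. x * y \<in> X}"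
    by (rule cvs.span_minimal) (use 1 cvp.linear_subspace_vimage[OF linl X] in \<open>auto simp: vimage_def\<close>)
  then show ?thesis using assms(3) by blast
qed

lemma forms_1_span: "forms n 1 = cvs.span (var ` {..<n})"
proof
  show "forms n 1 \<subseteq> cvs.span (var ` {..<n})"
  proof
    fix u assume u: "u \<in> forms n 1"
    show "u \<in> cvs.span (var ` {..<n})"
      by (subst linear_form_expand[OF u]) (intro cvs.span_sum cvs.span_scale cvs.span_base, simp)
  qed
  show "cvs.span (var ` {..<n}) \<subseteq> forms n 1" by (rule cvs.span_minimal[OF _ subspace_forms]) auto
qed

lemma forms_Suc_span:
  assumes "forms n 1 = cvs.span B" "forms n k = cvs.span C"
  shows "forms n (Suc k) = cvs.span {x * y |x y. x \<in> B \<and> y \<in> C}"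
proof
  let ?S = "{x * y |x y. x \<in> B \<and> y \<in> C}"
  have BC: "B \<subseteq> forms n 1" "C \<subseteq> forms n k" using assms cvs.span_superset by auto
  show "cvs.span ?S \<subseteq> forms n (Suc k)"
    by (rule cvs.span_minimal[OF _ subspace_forms]) (use BC forms_mult[of _ n 1 _ k] in auto)
  show "forms n (Suc k) \<subseteq> cvs.span ?S" unfolding forms_Suc
  proof (rule cvs.span_minimal[OF _ cvs.subspace_span], clarify)
    fix i P assume "i < n" "P \<in> forms n k"
    then have "var i \<in> cvs.span B" "P \<in> cvs.span C" using assms var_forms(1) by auto
    then show "var i * P \<in> cvs.span ?S"
      by (rule span_mult[OF cvs.subspace_span, rotated 1]) (auto intro: cvs.span_base)
  qed
qed

lemma dim_forms_1: "cvs.dim (forms n 1) = n"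
proof -
  have inj: "inj_on var {..<n}"
    unfolding inj_on_def var_def by (metis keys_single singleton_inject single_exp_inj One_nat_def zero_neq_one)
  have "cvs.independent (var ` {..<n})"
  proof (rule indep_fun_independent(2))
    show "indep_fun {..<n} (\<lambda>i. lk (var i))" unfolding indep_fun_def
    proof (intro allI impI ballI)
      fix a j assume a: "\<forall>c. (\<Sum>i<n. a i * lk (var i) c) = (0::complex)" and j: "j \<in> {..<n}"
      have "(\<Sum>i<n. a i * lk (var i) (sg j 1)) = (\<Sum>i<n. if i = j then a j else 0)"
        by (intro sum.cong) (auto simp: var_def lookup_single when_def)
      then show "a j = 0" using a[rule_format, of "sg j 1"] j by simp
    qed
  qed simp
  then show ?thesis unfolding forms_1_span using inj by (simp add: cvs.dim_eq_card_independent card_image)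
qed

lemma binary_quadratic_factor:
  fixes A B C :: complex
  assumes "A \<noteq> 0 \<or> B \<noteq> 0 \<or> C \<noteq> 0"
  obtains a b c d where "a \<noteq> 0 \<or> b \<noteq> 0" "c \<noteq> 0 \<or> d \<noteq> 0" "A = a * c" "B = a * d + b * c" "C = b * d"
proof (cases "A = 0")
  case True
  then show ?thesis using assms by (intro that[of 0 1 B C]) auto
next
  case False
  have "\<exists>r. poly [:C, B, A:] r = 0"
    by (rule fundamental_theorem_of_algebra) (use False in \<open>simp add: constant_degree\<close>)
  then obtain r where r: "C + r * (B + r * A) = 0" by auto
  then have "C = - (r * (B + r * A))" by (simp only: eq_neg_iff_add_eq_0)
  then show ?thesis using False by (intro that[of 1 "- r" A "A * r + B"]) (auto simp: algebra_simps)
qed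

lemma splits_form_mixed:
  assumes "splits_form n d F U1 U2 F1 F2" "u \<in> U1" "w \<in> U2"
  shows "u \<odot> w \<odot> F = 0" "w \<odot> u \<odot> F = 0"
proof -
  have "u \<odot> w \<odot> F = u \<odot> w \<odot> F1 + w \<odot> u \<odot> F2"
    using assms by (metis act_add_right act_commute splits_form_def)
  then show 1: "u \<odot> w \<odot> F = 0" using assms by (simp add: splits_form_def)
  then show "w \<odot> u \<odot> F = 0" by (metis act_commute)
qed

text \<open>
  An operator \<open>l\<close> of one part is not noticed by the other part, so the derivatives of \<open>l \<odot> F\<close> are
  governed by \<open>U1\<close> alone; if they vanish along a hyperplane of \<open>U1\<close>, a line is left.
\<close>

lemma no_rank_oneD:
  assumes nr: "no_rank_one n F" and s: "splits_form n d F U1 U2 F1 F2" and l: "l \<in> U1"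
    and B: "U1 = cvs.span (insert w B)" "\<And>b. b \<in> B \<Longrightarrow> b \<odot> l \<odot> F = 0"
  shows "l = 0"
proof -
  have "pdiff i (l \<odot> F) \<in> cvs.span {w \<odot> l \<odot> F}" if i: "i < n" for i
  proof -
    obtain u1 u2 where u: "u1 \<in> U1" "u2 \<in> U2" "var i = u1 + u2"
      using s var_forms(1)[OF i] unfolding splits_form_def by blast
    have "U1 \<subseteq> {u. u \<odot> l \<odot> F \<in> cvs.span {w \<odot> l \<odot> F}}" unfolding B(1)
    proof (rule cvs.span_minimal)
      show "cvs.subspace {u. u \<odot> l \<odot> F \<in> cvs.span {w \<odot> l \<odot> F}}"
        using cvp.linear_subspace_vimage[OF linear_act_left cvs.subspace_span] by (simp add: vimage_def)
      show "insert w B \<subseteq> {u. u \<odot> l \<odot> F \<in> cvs.span {w \<odot> l \<odot> F}}"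
        using B(2) cvs.span_zero by (auto intro: cvs.span_base)
    qed
    then have "u1 \<odot> l \<odot> F \<in> cvs.span {w \<odot> l \<odot> F}" using u by blast
    moreover have "u2 \<odot> l \<odot> F = 0" by (rule splits_form_mixed(2)[OF s l u(2)])
    ultimately show ?thesis by (simp flip: act_var add: u(3) act_add_left)
  qed
  moreover have "l \<in> forms n 1" using s l by (auto simp: splits_form_def)
  ultimately show ?thesis using nr unfolding no_rank_one_def by blast
qed

lemma fin_gen_forms_subset: "X \<subseteq> forms n d \<Longrightarrow> fin_gen X"
  using fin_gen_subset[OF fin_gen_forms] .

lemma splits_form_dims:
  assumes s: "splits_form n d F U1 U2 F1 F2"
  shows "cvs.dim U1 + cvs.dim U2 = n"
proof -
  note S = s[unfolded splits_form_def]
  obtain B1 where B1: "B1 \<subseteq> U1" "cvs.independent B1" "U1 \<subseteq> cvs.span B1" "card B1 = cvs.dim U1" "finite B1"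
    using finite_basis_exists[OF fin_gen_forms_subset[of U1 n 1]] S by blast
  obtain B2 where B2: "B2 \<subseteq> U2" "cvs.independent B2" "U2 \<subseteq> cvs.span B2" "card B2 = cvs.dim U2" "finite B2"
    using finite_basis_exists[OF fin_gen_forms_subset[of U2 n 1]] S by blast
  have sp: "cvs.span B1 \<subseteq> U1" "cvs.span B2 \<subseteq> U2"
    using cvs.span_minimal[OF B1(1)] cvs.span_minimal[OF B2(1)] S by simp_all
  have nz: "0 \<notin> B1" using B1(2) cvs.dependent_zero[of B1] by metis
  have S12: "U1 \<inter> U2 = {0}" and sub: "U1 \<subseteq> forms n 1" "U2 \<subseteq> forms n 1"
    and sums: "\<And>u. u \<in> forms n 1 \<Longrightarrow> \<exists>u1\<in>U1. \<exists>u2\<in>U2. u = u1 + u2" using S by simp_all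
  have disj: "B1 \<inter> B2 = {}"
  proof -
    have "B1 \<inter> B2 \<subseteq> {0}" using Int_mono[OF B1(1) B2(1)] S12 by simp
    then show ?thesis using nz by (metis IntD1 insert_absorb insert_not_empty subset_singletonD insertI1)
  qed
  have ind: "cvs.independent (B1 \<union> B2)"
  proof (rule cvs.independent_if_scalars_zero)
    fix f x assume f: "(\<Sum>x\<in>B1 \<union> B2. cscale (f x) x) = 0" and x: "x \<in> B1 \<union> B2"
    let ?s1 = "\<Sum>x\<in>B1. cscale (f x) x" and ?s2 = "\<Sum>x\<in>B2. cscale (f x) x"
    have sum: "?s1 + ?s2 = 0" using f B1(5) B2(5) disj by (simp add: sum.union_disjoint)
    have "?s1 \<in> cvs.span B1" "?s2 \<in> cvs.span B2"
      by (intro cvs.span_sum cvs.span_scale cvs.span_base; simp)+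
    then have s12: "?s1 \<in> U1" "?s2 \<in> U2" using sp by blast+
    have "?s1 = - ?s2" using sum by (simp add: add_eq_0_iff2)
    then have "?s1 \<in> U2" using s12(2) S cvs.subspace_neg[of U2 ?s2] by simp
    then have "?s1 \<in> {0}" unfolding S12[symmetric] by (rule IntI[OF s12(1)])
    then have z: "?s1 = 0" by simp
    then have z2: "?s2 = 0" using sum by simp
    from x show "f x = 0"
    proof
      assume "x \<in> B1" then show ?thesis by (rule cvs.independentD[OF B1(2,5) subset_refl z])
    next
      assume "x \<in> B2" then show ?thesis by (rule cvs.independentD[OF B2(2,5) subset_refl z2])
    qed
  qed (use B1 B2 in simp)
  have span: "forms n 1 = cvs.span (B1 \<union> B2)"
  proof
    show "forms n 1 \<subseteq> cvs.span (B1 \<union> B2)"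
    proof
      fix u assume "u \<in> forms n 1"
      then obtain u1 u2 where u: "u1 \<in> U1" "u2 \<in> U2" "u = u1 + u2" using sums by blast
      then have "u1 \<in> cvs.span (B1 \<union> B2)" "u2 \<in> cvs.span (B1 \<union> B2)"
        using B1(3) B2(3) cvs.span_mono[of B1 "B1 \<union> B2"] cvs.span_mono[of B2 "B1 \<union> B2"] by blast+
      then show "u \<in> cvs.span (B1 \<union> B2)" unfolding u(3) by (rule cvs.span_add)
    qed
    have "B1 \<union> B2 \<subseteq> forms n 1" using B1(1) B2(1) sub by blast
    then show "cvs.span (B1 \<union> B2) \<subseteq> forms n 1" by (rule cvs.span_minimal[OF _ subspace_forms])
  qed
  have "n = cvs.dim (cvs.span (B1 \<union> B2))" using dim_forms_1[of n] span by simp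
  also have "\<dots> = card (B1 \<union> B2)" by (rule cvs.dim_span_eq_card_independent[OF ind])
  finally show ?thesis using B1 B2 disj by (simp add: card_Un_disjoint)
qed

text \<open>
  A binary quadric is a product \<open>m' * m\<close>.  If it kills \<open>F\<close>, then \<open>m'\<close> kills \<open>m \<odot> F\<close>, and
  only one direction of \<open>U1\<close> is left.
\<close>

lemma no_rank_one_binary:
  assumes nr: "no_rank_one n F" and s: "splits_form n d F U1 U2 F1 F2"
    and U1: "U1 = cvs.span {u1, u2}" "u1 \<noteq> u2" "cvs.independent {u1, u2}"
    and k: "(cscale A (u1 * u1) + cscale B (u1 * u2) + cscale C (u2 * u2)) \<odot> F = 0"
  shows "A = 0 \<and> B = 0 \<and> C = 0"
proof (rule ccontr)
  assume "\<not> ?thesis"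
  then obtain a b c e where f: "a \<noteq> 0 \<or> b \<noteq> 0" "c \<noteq> 0 \<or> e \<noteq> 0" "A = a * c" "B = a * e + b * c" "C = b * e"
    using binary_quadratic_factor[of A B C] by metis
  define m where "m = cscale a u1 + cscale b u2"
  define m' where "m' = cscale c u1 + cscale e u2"
  have nz: "cscale p u1 + cscale q u2 \<noteq> 0" if "p \<noteq> 0 \<or> q \<noteq> 0" for p q
  proof
    assume z: "cscale p u1 + cscale q u2 = 0"
    have "(\<Sum>x\<in>{u1,u2}. cscale (if x = u1 then p else q) x) = 0" using z U1(2) by simp
    then have "(if x = u1 then p else q) = 0" if "x \<in> {u1, u2}" for x
      using cvs.independentD[OF U1(3) _ subset_refl, of "\<lambda>x. if x = u1 then p else q"] that by simp
    from this[of u1] this[of u2] show False using that U1(2) by auto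
  qed
  have prod: "m' * m = cscale A (u1 * u1) + cscale B (u1 * u2) + cscale C (u2 * u2)"
    unfolding f m_def m'_def
    by (simp add: algebra_simps cvs.scale_left_distrib cvs.scale_right_distrib)
  have z: "m' \<odot> m \<odot> F = 0" using k by (simp flip: act_mult add: prod)
  have mU: "m \<in> U1" "m' \<in> U1" unfolding U1 m_def m'_def by (auto intro!: cvs.span_add cvs.span_scale intro: cvs.span_base)
  obtain w where w: "w \<in> {u1, u2}" "{u1, u2} \<subseteq> cvs.span {w, m'}"
  proof (cases "e = 0")
    case False
    have "u2 = cscale (1 / e) m' - cscale (c / e) u1" using False by (simp add: m'_def cvs.scale_right_distrib)
    then have "u2 \<in> cvs.span {u1, m'}" by (simp add: cvs.span_diff cvs.span_scale cvs.span_base)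
    then show ?thesis by (intro that[of u1]) (auto intro: cvs.span_base)
  next
    case True
    then have "c \<noteq> 0" using f(2) by simp
    then have "u1 = cscale (1 / c) m' - cscale (e / c) u2" by (simp add: m'_def cvs.scale_right_distrib)
    then have "u1 \<in> cvs.span {u2, m'}" by (simp add: cvs.span_diff cvs.span_scale cvs.span_base)
    then show ?thesis by (intro that[of u2]) (auto intro: cvs.span_base)
  qed
  have "U1 = cvs.span {w, m'}"
  proof
    show "U1 \<subseteq> cvs.span {w, m'}" unfolding U1 by (rule cvs.span_minimal[OF w(2) cvs.subspace_span])
    have "{w, m'} \<subseteq> U1" using w(1) mU U1 cvs.span_base by blast
    then show "cvs.span {w, m'} \<subseteq> U1" by (rule cvs.span_minimal) (use s in \<open>simp add: splits_form_def\<close>)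
  qed
  then have "m = 0" by (rule no_rank_oneD[OF nr s mU(1)]) (use z in auto)
  then show False using nz[OF f(1)] by (simp add: m_def)
qed

text \<open>
  A syzygy between two quadrics with independent linear coefficients is a multiple of the
  Koszul syzygy.  The common linear factor is computed by applying a derivation \<open>v\<close> with
  \<open>v \<odot> l = 1\<close> and \<open>v \<odot> l' = 0\<close> repeatedly to the relation.
\<close>

lemma linear_syzygy:
  fixes l l' q q' :: cpoly
  assumes l: "l \<in> forms n 1" "l' \<in> forms n 1" and q: "q \<in> forms n 2" "q' \<in> forms n 2"
    and syz: "l * q + l' * q' = 0" and ind: "l \<notin> cvs.span {l'}" and nz: "l' \<noteq> 0"
  obtains v c where "v \<in> forms n 1" "q = l' * (cscale c l - v \<odot> q')" "q' = - (l * (cscale c l - v \<odot> q'))"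
proof -
  obtain v where v: "v \<in> forms n 1" "v \<odot> l = 1" "v \<odot> l' = 0"
    using separation[OF cvs.subspace_span l(1) ind] l(2) cvs.span_base[of l' "{l'}"] by (metis singletonI)
  have const: "\<exists>c. v \<odot> v \<odot> r = cscale c 1" if r: "r \<in> forms n 2" for r
  proof -
    have "r \<in> forms n (1 + 1)" using r by (simp only: one_add_one)
    then have "v \<odot> r \<in> forms n 1" by (rule act_forms[OF v(1)])
    then have "v \<odot> v \<odot> r \<in> forms n 0" using act_forms[OF v(1), of "v \<odot> r" 0] by simp
    then show ?thesis by (auto simp: forms_0)
  qed
  obtain c where c: "v \<odot> v \<odot> q = cscale c 1" using const[OF q(1)] by blast
  obtain c' where c': "v \<odot> v \<odot> q' = cscale c' 1" using const[OF q(2)] by blast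
  have lz: "v \<odot> (l * P) = P + l * (v \<odot> P)" "v \<odot> (l' * P) = l' * (v \<odot> P)" for P
    using act_leibniz[OF v(1)] v(2,3) by simp_all
  have "v \<odot> (l * q + l' * q') = 0" using syz by simp
  then have 1: "q + l * (v \<odot> q) + l' * (v \<odot> q') = 0" by (simp add: act_add_right lz)
  then have "v \<odot> (q + l * (v \<odot> q) + l' * (v \<odot> q')) = 0" by simp
  then have 2: "v \<odot> q + v \<odot> q + cscale c l + cscale c' l' = 0"
    by (simp add: act_add_right lz c c' algebra_simps)
  have dbl: "P + P = cscale 2 P" for P :: cpoly by (metis cvs.scale_left_distrib cvs.scale_one one_add_one)
  have "0 = v \<odot> (v \<odot> q + v \<odot> q + cscale c l + cscale c' l')" unfolding 2 by simp
  also have "\<dots> = cscale c 1 + cscale c 1 + cscale c 1 + cscale c' 0"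
    by (simp only: act_add_right act_scale_right c v(2,3))
  also have "\<dots> = cscale (c + c + c) 1" by (simp only: cvs.scale_left_distrib cvs.scale_zero_right add_0_right)
  finally have "cscale (c + c + c) 1 = (0 :: cpoly)" ..
  then have c0: "c = 0" by simp
  then have "cscale 2 (v \<odot> q) = cscale (- c') l'" using 2 unfolding dbl by (simp add: add_eq_0_iff2)
  then have "cscale (1/2) (cscale 2 (v \<odot> q)) = cscale (1/2) (cscale (- c') l')" by simp
  then have vq: "v \<odot> q = cscale (- c' / 2) l'" by simp
  define e where "e = c' / 2"
  have vq': "v \<odot> q = - cscale e l'" unfolding vq e_def by simp
  have qe: "q = l' * (cscale e l - v \<odot> q')"
    using 1 unfolding vq' by (simp add: algebra_simps)
  have "l' * (l * (cscale e l - v \<odot> q') + q') = 0" using syz by (subst (asm) qe) (simp add: algebra_simps)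
  then have "l * (cscale e l - v \<odot> q') + q' = 0" using nz by simp
  then have "q' = - (l * (cscale e l - v \<odot> q'))" by (simp add: add_eq_0_iff)
  then show ?thesis using that[OF v(1) qe] by simp
qed

text \<open>
  A part without operators would belong to a zero summand, and a part with a single
  operator \<open>u\<close> would make the derivatives of \<open>u \<odot> F\<close> proportional.
\<close>

lemma no_rank_one_dim_ge_2:
  assumes nr: "no_rank_one n F" and s: "splits_form n d F U1 U2 F1 F2" and d: "1 \<le> d"
  shows "2 \<le> cvs.dim U1"
proof (rule ccontr)
  assume a: "\<not> ?thesis"
  note S = s[unfolded splits_form_def]
  have sub: "U1 \<subseteq> forms n 1" "cvs.subspace U1" using S by simp_all
  obtain B where B: "B \<subseteq> U1" "cvs.independent B" "U1 \<subseteq> cvs.span B" "card B = cvs.dim U1" "finite B"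
    using finite_basis_exists[OF fin_gen_forms_subset[OF sub(1)]] by blast
  have U1: "U1 = cvs.span B" using B(3) cvs.span_minimal[OF B(1) sub(2)] by (rule equalityI)
  consider "card B = 0" | "card B = 1" using a B(4) by linarith
  then show False
  proof cases
    case 1
    then have U0: "U1 = {0}" using U1 B(5) by simp
    have "F1 = 0"
    proof (rule form_eq_0I'[OF _ d])
      show "F1 \<in> forms n d" using S by simp
      fix u assume "u \<in> forms n 1"
      then obtain u1 u2 where "u1 \<in> U1" "u2 \<in> U2" "u = u1 + u2" using S by blast
      then show "u \<odot> F1 = 0" using U0 S by simp
    qed
    then show False using S by simp
  next
    case 2
    then obtain u where u: "B = {u}" by (rule card_1_singletonE)
    have "u = 0" by (rule no_rank_oneD[OF nr s, of u u "{}"]) (use U1 u B(1) in auto)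
    then show False using B(2) u by simp
  qed
qed

lemma cubic_products:
  fixes a b c :: "'a::comm_ring_1"
  assumes "x \<in> {a, b, c}" "y \<in> {a, b, c}" "z \<in> {a, b, c}"
  shows "x * (y * z) \<in> set [a*(a*a), a*(a*b), a*(a*c), a*(b*b), a*(b*c), a*(c*c), b*(b*b), b*(b*c), b*(c*c), c*(c*c)]"
  using assms by (auto simp: mult.commute mult.left_commute)

lemma card_set_le: "length xs \<le> k \<Longrightarrow> card (set xs) \<le> k"
  using card_length[of xs] by simp

lemma dim_span_Un_le:
  assumes "finite A" "card A \<le> a" "fin_gen Y" "X \<subseteq> cvs.span (A \<union> Y)"
  shows "cvs.dim X \<le> a + cvs.dim Y"
proof -
  obtain B where B: "B \<subseteq> Y" "Y \<subseteq> cvs.span B" "card B = cvs.dim Y" "finite B"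
    using finite_basis_exists[OF assms(3)] by metis
  have "A \<union> Y \<subseteq> cvs.span (A \<union> B)"
    using B(2) cvs.span_mono[of B "A \<union> B"] cvs.span_superset[of "A \<union> B"] by blast
  then have "X \<subseteq> cvs.span (A \<union> B)" using assms(4) cvs.span_minimal[OF _ cvs.subspace_span] by blast
  then have "cvs.dim X \<le> card (A \<union> B)" by (rule cvs.dim_le_card) (use assms(1) B(4) in simp)
  also have "\<dots> \<le> card A + card B" by (rule card_Un_le)
  finally show ?thesis using assms(2) B(3) by simp
qed

text \<open>
  Split the operators into those in two variables, those in three and the mixed ones, which kill
  \<open>F\<close>.  The two parts of a quadratic operator that kills \<open>F\<close> kill it separately, and the binary part then
  vanishes by \<open>no_rank_one_binary\<close>.  At least \<open>15 - 7 = 8\<close> dimensions of quadrics kill \<open>F\<close>, of which \<open>6\<close>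
  are mixed; so two independent ternary quadrics \<open>q\<close>, \<open>q'\<close> kill \<open>F\<close>.  The \<open>4\<close> binary
  cubics leave at least \<open>9 - 4 = 5\<close> of the \<open>10\<close> dimensions of ternary cubics not killing \<open>F\<close>,
  so the six products of \<open>q\<close> and \<open>q'\<close> with variables, which kill \<open>F\<close>, satisfy a linear relation.
\<close>

lemma no_split_2_3:
  assumes nr: "no_rank_one 5 F" and s: "splits_form 5 d F U1 U2 F1 F2" and d: "3 \<le> d"
    and h2: "hilbert 5 F 2 \<le> 7" and h3: "9 \<le> hilbert 5 F 3" and dim2: "15 \<le> cvs.dim (forms 5 2)"
    and d1: "cvs.dim U1 = 2" and d2: "cvs.dim U2 = 3"
  shows False
proof -
  note S = s[unfolded splits_form_def]
  have sub: "U1 \<subseteq> forms 5 1" "cvs.subspace U1" "U2 \<subseteq> forms 5 1" "cvs.subspace U2" using S by simp_all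
  have sums: "\<And>u. u \<in> forms 5 1 \<Longrightarrow> \<exists>u1\<in>U1. \<exists>u2\<in>U2. u = u1 + u2" using S by simp
  have Ff: "F \<in> forms 5 d" using S by (auto intro: forms_add)
  obtain B1 where B1: "B1 \<subseteq> U1" "cvs.independent B1" "U1 \<subseteq> cvs.span B1" "card B1 = cvs.dim U1" "finite B1"
    using finite_basis_exists[OF fin_gen_forms_subset[OF sub(1)]] by blast
  obtain B2 where B2: "B2 \<subseteq> U2" "cvs.independent B2" "U2 \<subseteq> cvs.span B2" "card B2 = cvs.dim U2" "finite B2"
    using finite_basis_exists[OF fin_gen_forms_subset[OF sub(3)]] by blast
  have U1: "U1 = cvs.span B1" using B1(3) cvs.span_minimal[OF B1(1) sub(2)] by (rule equalityI)
  have U2: "U2 = cvs.span B2" using B2(3) cvs.span_minimal[OF B2(1) sub(4)] by (rule equalityI)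
  obtain u1 u2 where u: "B1 = {u1, u2}" "u1 \<noteq> u2" using B1(4) d1 by (auto simp: card_2_iff)
  obtain a b c where w: "B2 = {a, b, c}" "a \<noteq> b" "b \<noteq> c" "a \<noteq> c" using B2(4) d2 by (auto simp: card_3_iff)
  note mix = splits_form_mixed[OF s]
  have BU: "x \<in> U1" if "x \<in> B1" for x using that B1(1) by blast
  have BW: "x \<in> U2" if "x \<in> B2" for x using that B2(1) by blast
  have f1: "forms 5 1 = cvs.span (B1 \<union> B2)"
  proof
    show "forms 5 1 \<subseteq> cvs.span (B1 \<union> B2)"
    proof
      fix x assume "x \<in> forms 5 1"
      then obtain y z where "y \<in> U1" "z \<in> U2" "x = y + z" using sums by blast
      then show "x \<in> cvs.span (B1 \<union> B2)" unfolding U1 U2 cvs.span_Un by blast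
    qed
    show "cvs.span (B1 \<union> B2) \<subseteq> forms 5 1"
      by (rule cvs.span_minimal[OF _ subspace_forms]) (use B1(1) B2(1) sub in blast)
  qed
  define P2 where "P2 = {x * y |x y. x \<in> B1 \<union> B2 \<and> y \<in> B1 \<union> B2}"
  have f2: "forms 5 2 = cvs.span P2" unfolding P2_def using forms_Suc_span[OF f1 f1] by (simp add: numeral_2_eq_2)
  have f3: "forms 5 3 = cvs.span {x * y |x y. x \<in> B1 \<union> B2 \<and> y \<in> P2}"
    using forms_Suc_span[OF f1 f2] by (simp add: numeral_3_eq_3 numeral_2_eq_2)
  let ?A = "{u1 * u1, u1 * u2, u2 * u2}"
  let ?M = "set [u1 * a, u1 * b, u1 * c, u2 * a, u2 * b, u2 * c]"
  let ?W = "{x * y |x y. x \<in> B2 \<and> y \<in> B2}"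
  have PAMW: "P2 \<subseteq> ?A \<union> (?M \<union> ?W)"
  proof
    fix p assume "p \<in> P2"
    then obtain x y where xy: "x \<in> B1 \<union> B2" "y \<in> B1 \<union> B2" "p = x * y" by (auto simp: P2_def)
    consider "x \<in> B1" "y \<in> B1" | "x \<in> B1" "y \<in> B2" | "x \<in> B2" "y \<in> B1" | "x \<in> B2" "y \<in> B2" using xy by blast
    then show "p \<in> ?A \<union> (?M \<union> ?W)"
      by cases (auto simp: xy(3) u(1) w(1) mult.commute)
  qed
  have Mkill: "m \<odot> F = 0" if "m \<in> cvs.span ?M" for m
  proof -
    have "cvs.span ?M \<subseteq> {m. m \<odot> F = 0}"
    proof (rule cvs.span_minimal)
      show "?M \<subseteq> {m. m \<odot> F = 0}" using mix(1) BU BW u(1) w(1) by (auto simp: act_mult)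
      show "cvs.subspace {m. m \<odot> F = 0}" by (rule cvp.linear_subspace_kernel[OF linear_act_left])
    qed
    then show ?thesis using that by blast
  qed
  have kill_other: "r \<odot> q \<odot> F = 0"
    if q: "q \<in> cvs.span {x * y |x y. x \<in> X \<and> y \<in> X}" and r: "\<And>x. x \<in> X \<Longrightarrow> r \<odot> x \<odot> F = 0" for q r X
  proof -
    have "cvs.span {x * y |x y. x \<in> X \<and> y \<in> X} \<subseteq> {q. q \<odot> r \<odot> F = 0}"
    proof (rule cvs.span_minimal)
      show "{x * y |x y. x \<in> X \<and> y \<in> X} \<subseteq> {q. q \<odot> r \<odot> F = 0}"
      proof clarify
        fix x y assume "x \<in> X" "y \<in> X"
        then show "(x * y) \<odot> r \<odot> F = 0" using r[of y] by (simp add: act_mult act_commute[of y r])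
      qed
      show "cvs.subspace {q. q \<odot> r \<odot> F = 0}" by (rule cvp.linear_subspace_kernel[OF linear_act_left])
    qed
    then show ?thesis using q by (auto simp: act_commute[of r])
  qed
  define K where "K = {\<Theta> \<in> forms 5 2. \<Theta> \<odot> F = 0}"
  define K2 where "K2 = {\<Theta> \<in> cvs.span ?W. \<Theta> \<odot> F = 0}"
  have Wf: "cvs.span ?W \<subseteq> forms 5 2" unfolding f2 by (rule cvs.span_mono) (auto simp: P2_def)
  have Af: "cvs.span ?A \<subseteq> forms 5 2" unfolding f2 by (rule cvs.span_mono) (use u(1) in \<open>auto simp: P2_def\<close>)
  have "15 - cvs.dim K \<le> 7" using h2 dim2 unfolding hilbert_def apolar_forms K_def by linarith
  then have dK: "8 \<le> cvs.dim K" by simp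
  have "K \<subseteq> cvs.span (?M \<union> K2)"
  proof
    fix \<Theta> assume \<Theta>: "\<Theta> \<in> K"
    then have "\<Theta> \<in> cvs.span (?A \<union> (?M \<union> ?W))"
      using cvs.span_mono[OF PAMW] unfolding K_def f2 by blast
    then obtain q1 q where q: "q1 \<in> cvs.span ?A" "q \<in> cvs.span (?M \<union> ?W)" "\<Theta> = q1 + q"
      unfolding cvs.span_Un by blast
    then obtain m q2 where m: "m \<in> cvs.span ?M" "q2 \<in> cvs.span ?W" "q = m + q2"
      unfolding cvs.span_Un by blast
    have z: "q1 \<odot> F + q2 \<odot> F = 0" using \<Theta> Mkill[OF m(1)] by (simp add: K_def q(3) m(3) act_add_left)
    have q1W: "q1 \<in> cvs.span {x * y |x y. x \<in> B1 \<and> y \<in> B1}"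
      using q(1) cvs.span_mono[of ?A "{x * y |x y. x \<in> B1 \<and> y \<in> B1}"] u(1) by auto
    have "q1 \<odot> F = 0"
    proof (rule form_eq_0I')
      have "2 + (d - 2) = d" using d by simp
      then have "F \<in> forms 5 (2 + (d - 2))" using Ff by simp
      moreover have "q1 \<in> forms 5 2" using q(1) Af by blast
      ultimately show "q1 \<odot> F \<in> forms 5 (d - 2)" by (intro act_forms)
      show "1 \<le> d - 2" using d by simp
      fix r assume "r \<in> forms 5 1"
      then obtain y x where yx: "y \<in> U1" "x \<in> U2" "r = y + x" using sums by blast
      have "x \<odot> q1 \<odot> F = 0" by (rule kill_other[OF q1W]) (use mix(2) BU yx in blast)
      moreover have "y \<odot> q2 \<odot> F = 0" by (rule kill_other[OF m(2)]) (use mix(1) BW yx in blast)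
      moreover have "y \<odot> q1 \<odot> F + y \<odot> q2 \<odot> F = 0" using arg_cong[OF z, of "\<lambda>t. y \<odot> t"] by (simp add: act_add_right)
      ultimately show "r \<odot> q1 \<odot> F = 0" by (simp add: yx(3) act_add_left)
    qed
    moreover obtain A B C where ABC: "q1 = cscale A (u1 * u1) + cscale B (u1 * u2) + cscale C (u2 * u2)"
    proof -
      obtain A where "q1 - cscale A (u1 * u1) \<in> cvs.span {u1 * u2, u2 * u2}"
        using q(1) cvs.span_breakdown_eq by blast
      then obtain B where "q1 - cscale A (u1 * u1) - cscale B (u1 * u2) \<in> cvs.span {u2 * u2}"
        using cvs.span_breakdown_eq by blast
      then obtain C where "q1 - cscale A (u1 * u1) - cscale B (u1 * u2) = cscale C (u2 * u2)"
        by (auto simp: cvs.span_singleton)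
      then show ?thesis by (intro that[of A B C]) (simp add: algebra_simps)
    qed
    ultimately have "A = 0 \<and> B = 0 \<and> C = 0"
      using no_rank_one_binary[OF nr s, of u1 u2 A B C] U1 u B1(2) by simp
    then have q10: "q1 = 0" using ABC by simp
    then have "q2 \<in> K2" using z m(2) by (simp add: K2_def)
    then show "\<Theta> \<in> cvs.span (?M \<union> K2)" unfolding q(3) q10 m(3)
      using m(1) cvs.span_mono[of ?M "?M \<union> K2"] by (auto intro!: cvs.span_add intro: cvs.span_base)
  qed
  moreover have "card ?M \<le> 6" by (rule card_set_le) simp
  moreover have "fin_gen K2" by (rule fin_gen_forms_subset[of _ 5 2]) (use Wf in \<open>auto simp: K2_def\<close>)
  ultimately have "cvs.dim K \<le> 6 + cvs.dim K2" by (intro dim_span_Un_le[of ?M]) (rule List.finite_set)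
  then have dK2: "2 \<le> cvs.dim K2" using dK by simp
  have K2f: "K2 \<subseteq> forms 5 2" using Wf by (auto simp: K2_def)
  obtain C2 where C2: "C2 \<subseteq> K2" "cvs.independent C2" "card C2 = cvs.dim K2" "finite C2"
    using finite_basis_exists[OF fin_gen_forms_subset[OF K2f]] by metis
  then obtain T where T: "T \<subseteq> C2" "card T = 2" using dK2 by (metis obtain_subset_with_card_n)
  then obtain q q' where qq: "T = {q, q'}" "q \<noteq> q'" by (auto simp: card_2_iff)
  have qK: "q \<in> K2" "q' \<in> K2" using T(1) C2(1) qq by auto
  have qF: "q \<odot> F = 0" "q' \<odot> F = 0" "q \<in> cvs.span ?W" "q' \<in> cvs.span ?W" using qK by (auto simp: K2_def)
  have qf: "q \<in> forms 5 2" "q' \<in> forms 5 2" using qK K2f by auto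
  have indT: "cvs.independent {q, q'}" using cvs.independent_mono[OF C2(2) T(1)] qq by simp
  have qind: "x = 0 \<and> y = 0" if z: "cscale x q + cscale y q' = 0" for x y
  proof -
    have "(\<Sum>t\<in>{q,q'}. cscale (if t = q then x else y) t) = 0" using z qq(2) by simp
    then have "(if t = q then x else y) = 0" if "t \<in> {q, q'}" for t
      using cvs.independentD[OF indT _ subset_refl, of "\<lambda>t. if t = q then x else y"] that by simp
    from this[of q] this[of q'] show ?thesis using qq(2) by auto
  qed
  \<comment> \<open>Ternary cubics: only those of the three variables in B2 can avoid the mixed products.\<close>
  define W3 where "W3 = set [a*(a*a), a*(a*b), a*(a*c), a*(b*b), a*(b*c), a*(c*c), b*(b*b), b*(b*c), b*(c*c), c*(c*c)]"
  let ?f = "\<lambda>\<Theta>. \<Theta> \<odot> F"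
  let ?A3 = "set [?f (u1*(u1*u1)), ?f (u1*(u1*u2)), ?f (u1*(u2*u2)), ?f (u2*(u2*u2))]"
  have W3mem: "x * (y * z) \<in> W3" if "x \<in> B2" "y \<in> B2" "z \<in> B2" for x y z
    using cubic_products[of x a b c y z] that unfolding W3_def w(1) .
  have W3f: "cvs.span W3 \<subseteq> forms 5 3"
  proof -
    have "W3 \<subseteq> {x * y |x y. x \<in> B1 \<union> B2 \<and> y \<in> P2}"
      unfolding W3_def P2_def w(1) by auto
    then show ?thesis unfolding f3 by (rule cvs.span_mono)
  qed
  have dW3: "cvs.dim (cvs.span W3) \<le> 10"
  proof -
    have "cvs.dim (cvs.span W3) \<le> card W3" by (rule cvs.dim_le_card) (auto simp: W3_def)
    also have "\<dots> \<le> 10" unfolding W3_def by (rule card_set_le) simp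
    finally show ?thesis .
  qed
  have T3: "?f ` forms 5 3 \<subseteq> cvs.span (?A3 \<union> ?f ` cvs.span W3)"
  proof -
    have gen: "?f (x * (y * z)) \<in> cvs.span (?A3 \<union> ?f ` cvs.span W3)"
      if xyz: "x \<in> B1 \<union> B2" "y \<in> B1 \<union> B2" "z \<in> B1 \<union> B2" for x y z
    proof (cases "x \<in> B2 \<and> y \<in> B2 \<and> z \<in> B2")
      case True
      then have "x * (y * z) \<in> cvs.span W3" using W3mem by (auto intro: cvs.span_base)
      then show ?thesis by (intro cvs.span_base) blast
    next
      case False
      show ?thesis
      proof (cases "x \<in> B1 \<and> y \<in> B1 \<and> z \<in> B1")
        case True
        then have "?f (x * (y * z)) \<in> ?A3" unfolding u(1) by (auto simp: mult.commute mult.left_commute)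
        then show ?thesis by (intro cvs.span_base) blast
      next
        case mixed: False
        have zero: "p \<odot> r \<odot> t \<odot> F = 0" if "p \<in> B1 \<and> r \<in> B2 \<or> p \<in> B2 \<and> r \<in> B1" for p r t
        proof -
          have "p \<odot> r \<odot> t \<odot> F = t \<odot> p \<odot> r \<odot> F" by (metis act_commute)
          then show ?thesis using mix that BU BW by auto
        qed
        have "x \<odot> y \<odot> z \<odot> F = 0"
        proof (cases "x \<in> B1 \<and> y \<in> B2 \<or> x \<in> B2 \<and> y \<in> B1")
          case True then show ?thesis by (rule zero)
        next
          case F1: False
          have "y \<in> B1 \<and> z \<in> B2 \<or> y \<in> B2 \<and> z \<in> B1" using F1 mixed False xyz by blast
          then have "y \<odot> z \<odot> x \<odot> F = 0" by (rule zero)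
          then show ?thesis by (metis act_commute)
        qed
        then show ?thesis by (simp add: act_mult cvs.span_zero)
      qed
    qed
    have "forms 5 3 \<subseteq> {\<Theta>. ?f \<Theta> \<in> cvs.span (?A3 \<union> ?f ` cvs.span W3)}" unfolding f3
    proof (rule cvs.span_minimal)
      show "cvs.subspace {\<Theta>. ?f \<Theta> \<in> cvs.span (?A3 \<union> ?f ` cvs.span W3)}"
        using cvp.linear_subspace_vimage[OF linear_act_left cvs.subspace_span] by (simp add: vimage_def)
      show "{x * y |x y. x \<in> B1 \<union> B2 \<and> y \<in> P2} \<subseteq> {\<Theta>. ?f \<Theta> \<in> cvs.span (?A3 \<union> ?f ` cvs.span W3)}"
        using gen by (auto simp only: P2_def mem_Collect_eq)
    qed
    then show ?thesis by blast
  qed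
  have fgW3: "fin_gen (cvs.span W3)" by (rule fin_gen_forms_subset[OF W3f])
  have "9 \<le> cvs.dim (?f ` forms 5 3)" using h3 by (simp add: hilbert_eq_dim)
  also have "\<dots> \<le> 4 + cvs.dim (?f ` cvs.span W3)"
    by (rule dim_span_Un_le[OF List.finite_set card_set_le fin_gen_image[OF linear_act_left fgW3] T3]) simp
  finally have "5 \<le> cvs.dim (?f ` cvs.span W3)" by simp
  then have dker: "cvs.dim {\<Theta> \<in> cvs.span W3. ?f \<Theta> = 0} \<le> 5"
    using rank_nullity[OF linear_act_left cvs.subspace_span fgW3, of F] dW3 by linarith
  define ww where "ww i = (if i = (0::nat) then a else if i = 1 then b else c)" for i
  have wwB: "ww i \<in> B2" for i by (simp add: ww_def w(1))
  define g where "g x = (case x of (i, e) \<Rightarrow> ww i * (if e then q else q'))" for x :: "nat \<times> bool"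
  define I where "I = {..<3::nat} \<times> (UNIV :: bool set)"
  have gker: "g x \<in> {\<Theta> \<in> cvs.span W3. ?f \<Theta> = 0}" for x
  proof -
    have "x * p \<in> cvs.span W3" if "x \<in> B2" "p \<in> cvs.span ?W" for x p
      by (rule span_mult[OF cvs.subspace_span, of "{x}" ?W])
         (use that W3mem in \<open>auto intro: cvs.span_base\<close>)
    then show ?thesis using qF wwB by (cases x) (auto simp: g_def act_mult)
  qed
  have "\<not> indep_fun I (\<lambda>x. lk (g x))"
  proof
    assume i: "indep_fun I (\<lambda>x. lk (g x))"
    have fI: "finite I" by (simp add: I_def)
    have "g ` I \<subseteq> {\<Theta> \<in> cvs.span W3. ?f \<Theta> = 0}" using gker by blast
    then have "g ` I \<subseteq> cvs.span {\<Theta> \<in> cvs.span W3. ?f \<Theta> = 0}" using cvs.span_superset by (rule subset_trans)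
    moreover have "fin_gen {\<Theta> \<in> cvs.span W3. ?f \<Theta> = 0}" by (rule fin_gen_subset[OF fgW3]) blast
    ultimately have "card (g ` I) \<le> cvs.dim {\<Theta> \<in> cvs.span W3. ?f \<Theta> = 0}"
      using independent_finite_dim[OF _ indep_fun_independent(2)[OF fI i]] by blast
    moreover have "card (g ` I) = 6" using indep_fun_independent(1)[OF fI i] by (simp add: card_image I_def card_UNIV_bool)
    ultimately show False using dker by simp
  qed
  then obtain k where k: "\<And>m. (\<Sum>x\<in>I. k x * lk (g x) m) = 0" "\<exists>x\<in>I. k x \<noteq> 0" unfolding indep_fun_def by blast
  define l where "l = cscale (k (0, True)) a + cscale (k (1, True)) b + cscale (k (2, True)) c"
  define l' where "l' = cscale (k (0, False)) a + cscale (k (1, False)) b + cscale (k (2, False)) c"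
  have I_alt: "I = {(0,True),(1,True),(2,True),(0,False),(1,False),(2,False)}"
    by (auto simp: I_def numeral_3_eq_3 less_Suc_eq)
  have "(\<Sum>x\<in>I. cscale (k x) (g x)) = 0" by (rule poly_mapping_eqI) (simp add: lk_sum_scale k(1))
  then have syz: "l * q + l' * q' = 0" unfolding I_alt
    by (simp add: g_def ww_def l_def l'_def algebra_simps)
  have lU: "l \<in> U2" "l' \<in> U2" unfolding l_def l'_def U2 w(1)
    by (intro cvs.span_add cvs.span_scale cvs.span_base; simp)+
  have lf: "l \<in> forms 5 1" "l' \<in> forms 5 1" using lU sub by auto
  have abc0: "x = 0 \<and> y = 0 \<and> z = 0" if z: "cscale x a + cscale y b + cscale z c = 0" for x y z
  proof -
    let ?h = "\<lambda>t. if t = a then x else if t = b then y else z"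
    have "(\<Sum>t\<in>B2. cscale (?h t) t) = 0" using z w by (simp add: add.assoc)
    then have "?h t = 0" if "t \<in> B2" for t
      using cvs.independentD[OF B2(2) B2(5) subset_refl, of ?h] that by simp
    from this[of a] this[of b] this[of c] show ?thesis using w by auto
  qed
  have nz: "l \<noteq> 0 \<or> l' \<noteq> 0"
    using k(2) abc0[of "k (0, True)" "k (1, True)" "k (2, True)"] abc0[of "k (0, False)" "k (1, False)" "k (2, False)"]
    unfolding I_alt l_def l'_def by auto
  consider e where "l' = cscale e l" "l \<noteq> 0" | e where "l = cscale e l'" "l' \<noteq> 0" | "l \<notin> cvs.span {l'}" "l' \<noteq> 0"
    using nz by (cases "l' = 0") (force simp: cvs.span_singleton)+
  then show False
  proof cases
    case 1
    have "l * (q + cscale e q') = 0" using syz by (simp add: 1(1) distrib_left)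
    then have "cscale 1 q + cscale e q' = 0" using 1(2) by simp
    then show False using qind by fastforce
  next
    case 2
    have "l' * (cscale e q + q') = 0" using syz by (simp add: 2(1) distrib_left)
    then have "cscale e q + cscale 1 q' = 0" using 2(2) by simp
    then show False using qind by fastforce
  next
    case 3
    obtain v k where v: "v \<in> forms 5 1" "q = l' * (cscale k l - v \<odot> q')" "q' = - (l * (cscale k l - v \<odot> q'))"
      by (rule linear_syzygy[OF lf qf syz 3])
    let ?m = "cscale k l - v \<odot> q'"
    have "cvs.span ?W \<subseteq> {p. v \<odot> p \<in> U2}"
    proof (rule cvs.span_minimal)
      show "cvs.subspace {p. v \<odot> p \<in> U2}"
        using cvp.linear_subspace_vimage[OF linear_act_right sub(4)] by (simp add: vimage_def)
      show "?W \<subseteq> {p. v \<odot> p \<in> U2}"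
      proof clarify
        fix x y assume xy: "x \<in> B2" "y \<in> B2"
        then have xyU: "x \<in> U2" "y \<in> U2" using BW by auto
        then have "x \<in> forms 5 1" "y \<in> forms 5 1" using sub by auto
        then obtain s t where "v \<odot> x = cscale s 1" "v \<odot> y = cscale t 1" using linear_form_act[OF v(1)] by blast
        then have "v \<odot> (x * y) = cscale s y + cscale t x" by (simp add: act_leibniz[OF v(1)])
        then show "v \<odot> (x * y) \<in> U2" using xyU sub(4) by (simp add: cvs.subspace_add cvs.subspace_scale)
      qed
    qed
    then have mU: "?m \<in> U2" using qF(4) lU sub(4) by (auto intro!: cvs.subspace_diff cvs.subspace_scale)
    have indl: "cvs.independent {l, l'}" using cvs.independent_insertI[OF 3(1)] 3(2) by simp
    have "l \<noteq> l'" using 3 cvs.span_base by blast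
    obtain B' where B': "{l, l'} \<subseteq> B'" "B' \<subseteq> U2" "cvs.independent B'" "U2 \<subseteq> cvs.span B'"
      using cvs.maximal_independent_subset_extend[of "{l, l'}" U2] lU indl by auto
    have cB': "card B' = 3" using cvs.basis_card_eq_dim[OF B'(2,4,3)] d2 by simp
    then have "finite B'" by (metis card.infinite zero_neq_numeral)
    then have "card (B' - {l, l'}) = 1" using cB' B'(1) \<open>l \<noteq> l'\<close> by (simp add: card_Diff_subset)
    then obtain r where "B' - {l, l'} = {r}" by (rule card_1_singletonE)
    then have "B' = insert r {l, l'}" using B'(1) by blast
    then have U2r: "U2 = cvs.span (insert r {l, l'})"
      using B'(4) cvs.span_minimal[OF B'(2) sub(4)] by auto
    have "l \<odot> ?m \<odot> F = - (q' \<odot> F)" by (subst v(3)) (simp add: act_mult act_neg_left)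
    moreover have "l' \<odot> ?m \<odot> F = q \<odot> F" by (subst v(2)) (simp add: act_mult)
    ultimately have "?m = 0"
      by (intro no_rank_oneD[OF nr splits_form_sym[OF s] mU U2r]) (use qF in auto)
    then have "q = 0" using v(2) by simp
    then show False using qind[of 1 0] by simp
  qed
qed


section \<open>A quinary form that is no limit of direct sums\<close>

text \<open>
  The variables with indices \<open>3\<close> and \<open>4\<close> play the role of \<open>y\<^sub>0\<close> and \<open>y\<^sub>1\<close>, those with
  indices \<open>0\<close>, \<open>1\<close>, \<open>2\<close> that of the \<open>x\<^sub>k\<close>.
\<close>

definition mexp :: "nat \<Rightarrow> nat \<Rightarrow> monomial" where
  "mexp p q = sg 3 p + sg 4 q"

lemma lookup_mexp: "lk (mexp p q) i = (if i = 3 then p else if i = 4 then q else 0)"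
  by (auto simp: mexp_def lookup_add lookup_single when_def)

lemma mexp_inj [simp]: "mexp p q = mexp p' q' \<longleftrightarrow> p = p' \<and> q = q'"
  by (metis lookup_mexp numeral_eq_iff semiring_norm(87) verit_eq_simplify(9) num.distinct(5))

lemma var_power: "var i ^ k = sg (sg i k) 1"
  by (induction k) (simp_all add: var_def mult_single flip: single_add)

lemma divpow_var: "divpow (var i) k = sg (sg i k) (1 / fact k)"
  unfolding divpow_def var_power by (rule poly_mapping_eqI) (simp add: lookup_cscale lookup_single when_def)

text \<open>
  The degree is \<open>e - j + 5\<close>.  The indices are such that a derivative with respect to \<open>y\<^sub>0\<close> raises
  \<open>j\<close>, and one with respect to \<open>y\<^sub>1\<close> raises both \<open>j\<close> and \<open>s\<close>.
\<close>

definition yform :: "nat \<Rightarrow> nat \<Rightarrow> nat \<Rightarrow> cpoly" where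
  "yform e j s = divpow (var 3) (e - j + s) * divpow (var 4) (5 - s)"

lemma yform_single: "yform e j s = sg (mexp (e - j + s) (5 - s)) (1 / (fact (e - j + s) * fact (5 - s)))"
  by (simp add: yform_def divpow_var mult_single mexp_def)

lemma lookup_yform: "lk (yform e j s) m = (if m = mexp (e - j + s) (5 - s) then 1 / (fact (e - j + s) * fact (5 - s)) else 0)"
  by (simp add: yform_single lookup_single when_def)

lemma lookup_var_yform: "lk (var k * yform e j s) m =
    (if m = sg k 1 + mexp (e - j + s) (5 - s) then 1 / (fact (e - j + s) * fact (5 - s)) else 0)"
  by (simp add: yform_single var_def mult_single lookup_single when_def)

lemma pdiff_var: "pdiff i (var j) = (if i = j then 1 else 0)"
  by (auto simp: var_def pdiff_single lookup_single)

lemma pdiff_one [simp]: "pdiff i 1 = 0"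
  by (rule pdiff_forms_0) (rule one_forms)

lemma pdiff_divpow: "pdiff i (divpow (var j) k) = (if i = j \<and> k \<noteq> 0 then divpow (var j) (k - 1) else 0)"
proof (cases k)
  case (Suc k')
  have "var i \<odot> divpow (var j) (Suc k') = cscale (if i = j then 1 else 0) (divpow (var j) k')"
    by (rule act_divpow[of _ "Suc i"]) (auto simp: act_var pdiff_var)
  then show ?thesis using Suc by (simp add: act_var)
qed simp

lemma pdiff_yform:
  "j < e \<Longrightarrow> pdiff 3 (yform e j s) = yform e (Suc j) s"
  "j < e \<Longrightarrow> s < 5 \<Longrightarrow> pdiff 4 (yform e j s) = yform e (Suc j) (Suc s)"
  "i < 3 \<Longrightarrow> pdiff i (yform e j s) = 0"
proof -
  show "pdiff 3 (yform e j s) = yform e (Suc j) s" if "j < e"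
  proof -
    have "e - j + s - 1 = e - Suc j + s" using that by simp
    then show ?thesis using that by (simp add: yform_def pdiff_mult pdiff_divpow)
  qed
  show "pdiff 4 (yform e j s) = yform e (Suc j) (Suc s)" if "j < e" "s < 5"
  proof -
    have "5 - s - 1 = 5 - Suc s" "e - Suc j + Suc s = e - j + s" using that by auto
    then show ?thesis using that by (simp add: yform_def pdiff_mult pdiff_divpow)
  qed
  show "pdiff i (yform e j s) = 0" if "i < 3"
    using that by (simp add: yform_def pdiff_mult pdiff_divpow)
qed

definition example_form :: "nat \<Rightarrow> cpoly" where
  "example_form e = var 0 * yform e 0 0 + var 1 * yform e 0 1 + var 2 * yform e 0 2"

text \<open>
  The derivatives of \<open>example_form\<close> with respect to the \<open>y\<close>-variables.
\<close>

definition xsum :: "nat \<Rightarrow> nat \<Rightarrow> nat \<Rightarrow> cpoly" where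
  "xsum e j s = var 0 * yform e j s + var 1 * yform e j (s + 1) + var 2 * yform e j (s + 2)"

lemma pdiff_xsum:
  "j < e \<Longrightarrow> pdiff 3 (xsum e j s) = xsum e (Suc j) s"
  "j < e \<Longrightarrow> s < 3 \<Longrightarrow> pdiff 4 (xsum e j s) = xsum e (Suc j) (Suc s)"
  "i < 3 \<Longrightarrow> pdiff i (xsum e j s) = yform e j (s + i)"
proof -
  show "j < e \<Longrightarrow> pdiff 3 (xsum e j s) = xsum e (Suc j) s"
    by (simp add: xsum_def pdiff_add pdiff_mult pdiff_var pdiff_yform(1))
  show "j < e \<Longrightarrow> s < 3 \<Longrightarrow> pdiff 4 (xsum e j s) = xsum e (Suc j) (Suc s)"
    by (simp add: xsum_def pdiff_add pdiff_mult pdiff_var pdiff_yform(2))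
  show "pdiff i (xsum e j s) = yform e j (s + i)" if "i < 3"
  proof -
    have "i = 0 \<or> i = 1 \<or> i = 2" using that by linarith
    then show ?thesis by (elim disjE) (simp_all add: xsum_def pdiff_add pdiff_mult pdiff_var pdiff_yform(3))
  qed
qed

lemma example_form_xsum: "example_form e = xsum e 0 0"
  by (simp add: example_form_def xsum_def numeral_2_eq_2)

lemma yform_forms: "s \<le> 5 \<Longrightarrow> yform e j s \<in> forms 5 (e - j + 5)"
proof -
  assume s: "s \<le> 5"
  have "yform e j s \<in> forms 5 ((e - j + s) + (5 - s))"
    unfolding yform_def by (intro forms_mult divpow_forms var_forms) auto
  then show ?thesis using s by simp
qed

lemma example_form_forms: "example_form e \<in> forms 5 (e + 6)"
proof -
  have "var k * yform e 0 s \<in> forms 5 (e + 6)" if "k < 5" "s \<le> 5" for k s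
    using forms_mult[OF var_forms(1)[OF that(1)] yform_forms[OF that(2), of e 0]] by (simp add: add.commute)
  then show ?thesis unfolding example_form_def by (intro forms_add) auto
qed

lemma yform_nonzero: "yform e j s \<noteq> 0"
proof
  assume "yform e j s = 0"
  then have "lk (yform e j s) (mexp (e - j + s) (5 - s)) = 0" by simp
  then show False by (simp add: lookup_yform)
qed

lemma less_5_cases: "i < 5 \<Longrightarrow> i < 3 \<or> i = 3 \<or> i = (4::nat)" by linarith

text \<open>
  The gradient of \<open>y\<^sub>0^[e+1] * y\<^sub>1^[5]\<close> is shared: its two nonzero entries are the derivatives
  of the example with respect to \<open>x\<^sub>0\<close> and \<open>x\<^sub>1\<close>.
\<close>

lemma example_form_ApoEqu: "4 \<le> e \<Longrightarrow> example_form e \<in> ApoEqu 5 (e + 6)"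
proof -
  assume e: "4 \<le> e"
  let ?G = "divpow (var 3) (e + 1) * divpow (var 4) 5"
  have G: "?G \<in> forms 5 (e + 6)"
    using forms_mult[OF divpow_forms divpow_forms, of "var 3" 5 "var 4" "e + 1" 5] by (simp add: add.commute)
  have d0: "pdiff 0 (example_form e) = yform e 0 0" unfolding example_form_xsum using pdiff_xsum(3)[of 0 e 0 0] by simp
  have nz: "example_form e \<noteq> 0"
  proof
    assume "example_form e = 0"
    then have "pdiff 0 (0 :: cpoly) = yform e 0 0" using d0 by simp
    moreover have "pdiff 0 (0 :: cpoly) = 0" by (simp flip: act_var)
    ultimately show False using yform_nonzero[of e 0 0] by simp
  qed
  have Gd: "pdiff i ?G \<in> derivs1 5 (example_form e)" if "i < 5" for i
  proof -
    from less_5_cases[OF that] show ?thesis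
    proof (elim disjE)
      assume "i < 3"
      then have "pdiff i ?G = 0" by (simp add: pdiff_mult pdiff_divpow)
      then show ?thesis using cvs.subspace_0[OF subspace_derivs1] by simp
    next
      assume "i = 3"
      then have "pdiff i ?G = pdiff 0 (example_form e)" unfolding d0 by (simp add: pdiff_mult pdiff_divpow yform_def)
      then show ?thesis unfolding derivs1_def act_var[symmetric] by auto
    next
      assume "i = 4"
      then have "pdiff i ?G = pdiff 1 (example_form e)"
        unfolding example_form_xsum by (simp add: pdiff_xsum(3) pdiff_mult pdiff_divpow yform_def)
      then show ?thesis unfolding derivs1_def act_var[symmetric] by auto
    qed
  qed
  have "?G \<notin> cvs.span {example_form e}"
  proof
    assume "?G \<in> cvs.span {example_form e}"
    then obtain c where c: "?G = cscale c (example_form e)" by (auto simp: cvs.span_singleton)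
    have "pdiff 0 ?G = cscale c (yform e 0 0)" unfolding c pdiff_scale d0 ..
    moreover have "pdiff 0 ?G = 0" by (simp add: pdiff_mult pdiff_divpow)
    ultimately have "c = 0" using yform_nonzero[of e 0 0] by simp
    then have "?G = 0" using c by simp
    then have "pdiff 3 ?G = pdiff 3 0" by (rule arg_cong)
    also have "pdiff 3 (0 :: cpoly) = 0" using pdiff_scale[of 3 0 0] by simp
    finally have "pdiff 3 ?G = 0" .
    moreover have "pdiff 3 ?G = yform e 0 0" by (simp add: pdiff_mult pdiff_divpow yform_def)
    ultimately show False using yform_nonzero[of e 0 0] by simp
  qed
  then show ?thesis
    using ApoEqu_iff[of "e + 6" "example_form e" 5] example_form_forms nz G Gd
    unfolding shares_gradient_def by (auto intro!: bexI[of _ ?G])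
qed

lemma hilbert_2_le:
  assumes "\<And>i j. i < n \<Longrightarrow> j < n \<Longrightarrow> pdiff i (pdiff j F) \<in> cvs.span S" "finite S"
  shows "hilbert n F 2 \<le> card S"
proof -
  have "\<Theta> \<odot> F \<in> cvs.span S" if \<Theta>: "\<Theta> \<in> forms n 2" for \<Theta>
  proof (rule forms_Suc_induct[OF _ cvs.subspace_span _ linear_act_left])
    show "\<Theta> \<in> forms n (Suc 1)" using \<Theta> by (simp add: numeral_2_eq_2)
    fix i P assume i: "i < n" and P: "P \<in> forms n 1"
    have "(var i * P) \<odot> F = (\<Sum>j<n. cscale (lk P (sg j 1)) (pdiff i (pdiff j F)))"
      by (simp only: act_mult act_linear_expand[OF P] act_var pdiff_sum pdiff_scale)
    also have "\<dots> \<in> cvs.span S" by (intro cvs.span_sum cvs.span_scale assms(1) i) simp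
    finally show "(var i * P) \<odot> F \<in> cvs.span S" .
  qed
  then show ?thesis unfolding hilbert_eq_dim by (intro cvs.dim_le_card assms(2)) auto
qed

lemma example_second_derivatives:
  assumes e: "4 \<le> e"
  shows "k < 3 \<Longrightarrow> l < 3 \<Longrightarrow> pdiff k (pdiff l (example_form e)) = 0"
    "k < 3 \<Longrightarrow> pdiff 3 (pdiff k (example_form e)) = yform e 1 k"
    "k < 3 \<Longrightarrow> pdiff 4 (pdiff k (example_form e)) = yform e 1 (k + 1)"
    "k < 3 \<Longrightarrow> pdiff k (pdiff 3 (example_form e)) = yform e 1 k"
    "k < 3 \<Longrightarrow> pdiff k (pdiff 4 (example_form e)) = yform e 1 (k + 1)"
    "pdiff 3 (pdiff 3 (example_form e)) = xsum e 2 0"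
    "pdiff 4 (pdiff 3 (example_form e)) = xsum e 2 1"
    "pdiff 3 (pdiff 4 (example_form e)) = xsum e 2 1"
    "pdiff 4 (pdiff 4 (example_form e)) = xsum e 2 2"
  using e by (simp_all add: example_form_xsum pdiff_xsum pdiff_yform(2,3) pdiff_yform(1) numeral_2_eq_2)

text \<open>
  The second derivatives are spanned by four forms in \<open>y\<^sub>0, y\<^sub>1\<close> and three forms linear in
  the \<open>x\<^sub>k\<close>.
\<close>

lemma example_hilbert_2: "4 \<le> e \<Longrightarrow> hilbert 5 (example_form e) 2 \<le> 7"
proof -
  assume e: "4 \<le> e"
  note D = example_second_derivatives[OF e]
  let ?S = "set [yform e 1 0, yform e 1 1, yform e 1 2, yform e 1 3, xsum e 2 0, xsum e 2 1, xsum e 2 2]"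
  have y: "yform e 1 k \<in> cvs.span ?S" "yform e 1 (k + 1) \<in> cvs.span ?S" if "k < 3" for k
  proof -
    have "k = 0 \<or> k = 1 \<or> k = 2" using that by linarith
    then show "yform e 1 k \<in> cvs.span ?S" "yform e 1 (k + 1) \<in> cvs.span ?S"
      by (elim disjE; auto intro!: cvs.span_base simp: numeral_2_eq_2 numeral_3_eq_3)+
  qed
  have x: "xsum e 2 s \<in> cvs.span ?S" if "s \<in> {0,1,2}" for s
    using that by (auto intro!: cvs.span_base)
  have "pdiff i (pdiff j (example_form e)) \<in> cvs.span ?S" if "i < 5" "j < 5" for i j
    using less_5_cases[OF that(1)] less_5_cases[OF that(2)]
  proof (elim disjE)
    assume "i < 3" "j < 3" then show ?thesis by (simp only: D(1) cvs.span_zero)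
  next
    assume "i < 3" "j = 3" then show ?thesis using y by (simp only: D)
  next
    assume "i < 3" "j = 4" then show ?thesis using y by (simp only: D)
  next
    assume "i = 3" "j < 3" then show ?thesis using y by (simp only: D)
  next
    assume "i = 4" "j < 3" then show ?thesis using y by (simp only: D)
  qed (use x in \<open>simp_all only: D, auto\<close>)
  then have "hilbert 5 (example_form e) 2 \<le> card ?S" using hilbert_2_le[OF _ List.finite_set] by blast
  also have "\<dots> \<le> 7" by (rule card_set_le) simp
  finally show ?thesis .
qed

lemma indep_fun_diagonal:
  assumes "finite I" "\<And>i j. i \<in> I \<Longrightarrow> j \<in> I \<Longrightarrow> v i (c j) \<noteq> 0 \<longleftrightarrow> i = j"
  shows "indep_fun I v"
  unfolding indep_fun_def
proof (intro allI impI ballI)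
  fix a j assume a: "\<forall>c. (\<Sum>i\<in>I. a i * v i c) = 0" and j: "j \<in> I"
  have "(\<Sum>i\<in>I. a i * v i (c j)) = (\<Sum>i\<in>I. if i = j then a j * v j (c j) else 0)"
    using assms(2) j by (intro sum.cong) auto
  then have "a j * v j (c j) = 0" using a[rule_format, of "c j"] j assms(1) by simp
  then show "a j = 0" using assms(2)[OF j j] by simp
qed

text \<open>
  Five monomials in \<open>y\<^sub>0, y\<^sub>1\<close> and four forms linear in the \<open>x\<^sub>k\<close> occur among the third
  derivatives; each is detected by a monomial that occurs in none of the others.
\<close>

lemma example_hilbert_3: "4 \<le> e \<Longrightarrow> 9 \<le> hilbert 5 (example_form e) 3"
proof -
  assume e: "4 \<le> e"
  define \<Theta> where "\<Theta> x = (case x of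
      Inl s \<Rightarrow> (if s \<le> 2 then var 3 ^ (2 - s) * var 4 ^ s * var 0 else var 4 ^ 2 * var (s - 2))
    | Inr s \<Rightarrow> var 3 ^ (3 - s) * var 4 ^ s)" for x :: "nat + nat"
  define c where "c x = (case x of Inl s \<Rightarrow> mexp (e - 2 + s) (5 - s)
    | Inr s \<Rightarrow> sg 0 1 + mexp (e - 3 + s) (5 - s))" for x :: "nat + nat"
  let ?I = "{..<5} <+> {..<4} :: (nat + nat) set"
  have pw: "var i ^ k \<in> forms 5 k" if "i < 5" for i k
    using divpow_forms[of "var i" 5 k] that unfolding divpow_def
    by (metis cvs.scale_scale cvs.scale_one fact_nonzero forms_scale nonzero_mult_div_cancel_left times_divide_eq_right mult.right_neutral var_forms(1))
  have s5: "s = 0 \<or> s = 1 \<or> s = 2 \<or> s = 3 \<or> s = 4" if "s < 5" for s :: nat using that by linarith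
  have s4: "s = 0 \<or> s = 1 \<or> s = 2 \<or> s = 3" if "s < 4" for s :: nat using that by linarith
  have 1: "\<Theta> x \<in> forms 5 3" if "x \<in> ?I" for x
  proof -
    have *: "a + b = 3 \<Longrightarrow> P \<in> forms 5 a \<Longrightarrow> Q \<in> forms 5 b \<Longrightarrow> P * Q \<in> forms 5 3" for a b P Q
      using forms_mult by metis
    have 2: "var 3 ^ (2 - s) * var 4 ^ s \<in> forms 5 2" if "s \<le> 2" for s
      using forms_mult[OF pw pw, of 3 4 "2 - s" s] that by simp
    show ?thesis
    proof (cases x)
      case (Inl s)
      then have "s < 5" using that by auto
      then show ?thesis using Inl *[OF _ 2[of s] var_forms(1)[of 0]] *[OF _ pw[of 4 2] var_forms(1)[of "s - 2"]]
        by (auto simp: \<Theta>_def)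
    next
      case (Inr s)
      then have "s < 4" using that by auto
      then show ?thesis using Inr *[OF _ pw[of 3 "3 - s"] pw[of 4 s]] by (simp add: \<Theta>_def)
    qed
  qed
  have L: "\<Theta> (Inl s) \<odot> example_form e = yform e 2 s" if "s < 5" for s
    using s5[OF that] e
    by (elim disjE) (simp_all add: \<Theta>_def act_mult act_var example_form_xsum pdiff_xsum pdiff_yform(2,3) pdiff_yform(1)
        power2_eq_square power3_eq_cube numeral_2_eq_2[symmetric])
  have R: "\<Theta> (Inr s) \<odot> example_form e = xsum e 3 s" if "s < 4" for s
    using s4[OF that] e
    by (elim disjE) (simp_all add: \<Theta>_def act_mult act_var example_form_xsum pdiff_xsum pdiff_yform(2,3) pdiff_yform(1)
        power2_eq_square power3_eq_cube numeral_2_eq_2[symmetric])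
  have ne: "sg k (Suc 0) + mexp p q \<noteq> mexp p' q'" "sg 0 (Suc 0) + mexp p' q' = sg k (Suc 0) + mexp p q \<longleftrightarrow> k = 0 \<and> p = p' \<and> q = q'"
    if "k < 3" for k p q p' q'
  proof -
    show "sg k (Suc 0) + mexp p q \<noteq> mexp p' q'"
    proof
      assume "sg k (Suc 0) + mexp p q = mexp p' q'"
      from arg_cong[OF this, of "\<lambda>m. lk m k"] show False using that by (simp add: lookup_add lookup_mexp)
    qed
    show "sg 0 (Suc 0) + mexp p' q' = sg k (Suc 0) + mexp p q \<longleftrightarrow> k = 0 \<and> p = p' \<and> q = q'"
    proof
      assume a: "sg 0 (Suc 0) + mexp p' q' = sg k (Suc 0) + mexp p q"
      from arg_cong[OF a, of "\<lambda>m. lk m k"] have "k = 0"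
        using that by (auto simp: lookup_add lookup_mexp lookup_single when_def split: if_splits)
      then show "k = 0 \<and> p = p' \<and> q = q'" using a by simp
    qed simp
  qed
  have "indep_fun ?I (\<lambda>x. lk (\<Theta> x \<odot> example_form e))"
  proof (rule indep_fun_diagonal[where c = c])
    fix x y assume xy: "x \<in> ?I" "y \<in> ?I"
    show "lk (\<Theta> x \<odot> example_form e) (c y) \<noteq> 0 \<longleftrightarrow> x = y"
    proof (cases x; cases y)
      fix s t assume "x = Inl s" "y = Inl t"
      then show ?thesis using xy by (auto simp: L c_def lookup_yform split: if_splits)
    next
      fix s t assume "x = Inl s" "y = Inr t"
      then show ?thesis using xy ne(1)[of 0] by (auto simp: L c_def lookup_yform split: if_splits)
    next
      fix s t assume "x = Inr s" "y = Inl t"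
      then show ?thesis using xy ne(1)[THEN not_sym] by (auto simp: R c_def xsum_def lookup_add lookup_var_yform split: if_splits)
    next
      fix s t assume "x = Inr s" "y = Inr t"
      then show ?thesis using xy by (auto simp: R c_def xsum_def lookup_add lookup_var_yform ne(2) split: if_splits)
    qed
  qed simp
  then have "card ?I \<le> hilbert 5 (example_form e) 3" by (intro hilbert_geI[where \<Theta> = \<Theta>] 1) auto
  then show ?thesis by (simp add: card_Plus)
qed

text \<open>
  The monomials of degree two in five variables, as nondecreasing pairs of indices.
\<close>

definition pairs5 :: "(nat \<times> nat) set" where
  "pairs5 = {(0,0),(0,1),(0,2),(0,3),(0,4),(1,1),(1,2),(1,3),(1,4),(2,2),(2,3),(2,4),(3,3),(3,4),(4,4)}"

lemma dim_forms_5_2: "15 \<le> cvs.dim (forms 5 2)"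
proof -
  let ?g = "\<lambda>x. var (fst x) * var (snd x)" and ?c = "\<lambda>x. sg (fst x) 1 + sg (snd x) (1::nat)"
  have le: "fst x \<le> snd x \<and> snd x < 5" if "x \<in> pairs5" for x using that by (auto simp: pairs5_def)
  have inj: "i = j \<and> i' = j'" if "sg i 1 + sg i' 1 = sg j 1 + sg j' (1::nat)" "i \<le> i'" "j \<le> j'" for i i' j j' :: nat
  proof -
    have le: "\<not> a < b" if "sg a 1 + sg a' 1 = sg b 1 + sg b' (1::nat)" "b \<le> b'" for a a' b b' :: nat
      using arg_cong[OF that(1), of "\<lambda>m. lk m a"] that(2) by (auto simp: lookup_add lookup_single when_def)
    have "i = j" using le[OF that(1,3)] le[OF that(1)[symmetric] that(2)] by simp
    then show ?thesis using that(1) by simp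
  qed
  have fin: "finite pairs5" by (simp add: pairs5_def)
  have "indep_fun pairs5 (\<lambda>x. lk (?g x))"
  proof (rule indep_fun_diagonal[OF fin, where c = ?c])
    fix x y assume "x \<in> pairs5" "y \<in> pairs5"
    then show "lk (?g x) (?c y) \<noteq> 0 \<longleftrightarrow> x = y"
      using inj[of "fst x" "snd x" "fst y" "snd y"] le[of x] le[of y]
      by (auto simp: var_def mult_single lookup_single when_def prod_eq_iff)
  qed
  note ind = indep_fun_independent[OF fin this]
  have "?g ` pairs5 \<subseteq> cvs.span (forms 5 2)"
  proof clarify
    fix i j assume "(i, j) \<in> pairs5"
    then have "i < 5" "j < 5" using le by fastforce+
    then have "var i * var j \<in> forms 5 (1 + 1)" by (intro forms_mult var_forms)
    then show "var (fst (i, j)) * var (snd (i, j)) \<in> cvs.span (forms 5 2)" by (simp add: cvs.span_base numeral_2_eq_2)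
  qed
  then have "card (?g ` pairs5) \<le> cvs.dim (forms 5 2)"
    using independent_finite_dim[OF fin_gen_forms ind(2)] by blast
  moreover have "card pairs5 = 15" by (simp add: pairs5_def)
  ultimately show ?thesis using ind(1) by (simp add: card_image)
qed

text \<open>
  A coefficient of the second derivative in the directions \<open>i\<close> and \<open>j\<close>, at the monomial \<open>r\<close> in
  \<open>y\<^sub>0, y\<^sub>1\<close>, scaled such that it is \<open>0\<close> or \<open>1\<close> for the example.
\<close>

definition hcoef :: "nat \<Rightarrow> cpoly \<Rightarrow> nat \<Rightarrow> nat \<Rightarrow> nat \<Rightarrow> complex" where
  "hcoef e P i j r = fact (e - 1 + r) * fact (5 - r) * lk (pdiff i (pdiff j P)) (mexp (e - 1 + r) (5 - r))"

text \<open>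
  Write the derivatives of \<open>l \<odot> P\<close> as a matrix with rows \<open>j\<close> and columns \<open>r\<close>.  Its minors are
  quadrics in \<open>l\<close>, and this is the coefficient at \<open>(i, i')\<close> of the minor with rows \<open>j, j'\<close> and
  columns \<open>r, r'\<close>, up to the factor \<open>2\<close> of the squares.
\<close>

definition minor :: "nat \<Rightarrow> cpoly \<Rightarrow> nat \<times> nat \<Rightarrow> nat \<times> nat \<times> nat \<times> nat \<Rightarrow> complex" where
  "minor e P = (\<lambda>(i, i') (j, j', r, r').
     if j < 5 \<and> j' < 5 then
       hcoef e P i j r * hcoef e P i' j' r' - hcoef e P i j r' * hcoef e P i' j' r +
       (hcoef e P i' j r * hcoef e P i j' r' - hcoef e P i' j r' * hcoef e P i j' r)
     else 0)"

lemma example_hcoef: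
  assumes e: "4 \<le> e" and "i < 5" "j < 5" "r < 4"
  shows "hcoef e (example_form e) i j r =
     (if i < 3 \<and> 3 \<le> j \<and> r + 3 = i + j \<or> j < 3 \<and> 3 \<le> i \<and> r + 3 = i + j then 1 else 0)"
proof -
  note D = example_second_derivatives[OF e]
  have y: "fact (e - 1 + r) * fact (5 - r) * lk (yform e 1 s) (mexp (e - 1 + r) (5 - r)) = (if r = s then 1 else 0)" for s
    using assms(4) by (auto simp: lookup_yform)
  have ne: "mexp p' q' \<noteq> sg k (Suc 0) + mexp p q" if "k < 3" for k p q p' q'
  proof
    assume "mexp p' q' = sg k (Suc 0) + mexp p q"
    from arg_cong[OF this, of "\<lambda>m. lk m k"] show False using that by (simp add: lookup_add lookup_mexp)
  qed
  have x: "lk (xsum e j' s) (mexp p q) = 0" for j' s p q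
    using ne by (simp add: xsum_def lookup_add lookup_var_yform)
  show ?thesis
    using less_5_cases[OF assms(2)] less_5_cases[OF assms(3)]
    by (elim disjE) (simp_all only: hcoef_def D y x, auto)
qed

text \<open>
  The minors span all quadrics in \<open>l\<close>.  The rows and columns used below isolate one coefficient
  after the other.
\<close>

lemma example_minor_indep:
  assumes e: "4 \<le> e"
  shows "indep_fun pairs5 (minor e (example_form e))"
  unfolding indep_fun_def
proof (intro allI impI)
  fix a :: "nat \<times> nat \<Rightarrow> complex"
  assume a: "\<forall>c. (\<Sum>x\<in>pairs5. a x * minor e (example_form e) x c) = 0"
  note S = a[rule_format]
  note simps = pairs5_def minor_def example_hcoef[OF e]
  have "a (3,3) = 0" using S[of "(0,2,0,2)"] by (simp add: simps)
  moreover have "a (3,4) = 0" using S[of "(0,2,0,3)"] by (simp add: simps)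
  moreover have "a (4,4) = 0" using S[of "(0,2,1,3)"] by (simp add: simps)
  moreover have "a (0,0) = 0" using S[of "(3,4,0,1)"] by (simp add: simps)
  moreover have "a (0,1) = 0" using S[of "(3,4,0,2)"] by (simp add: simps)
  moreover have a02: "a (0,2) = 0" using S[of "(3,4,0,3)"] by (simp add: simps)
  moreover have "a (1,1) = 0" using S[of "(3,4,1,2)"] a02 by (simp add: simps)
  moreover have "a (1,2) = 0" using S[of "(3,4,1,3)"] by (simp add: simps)
  moreover have "a (2,2) = 0" using S[of "(3,4,2,3)"] by (simp add: simps)
  moreover have "a (0,3) = 0" using S[of "(0,4,0,1)"] by (simp add: simps)
  moreover have "a (1,3) = 0" using S[of "(0,4,0,2)"] by (simp add: simps)
  moreover have "a (2,3) = 0" using S[of "(0,4,0,3)"] by (simp add: simps)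
  moreover have "a (0,4) = 0" using S[of "(2,3,3,0)"] by (simp add: simps)
  moreover have "a (1,4) = 0" using S[of "(2,3,3,1)"] by (simp add: simps)
  moreover have "a (2,4) = 0" using S[of "(2,3,3,2)"] by (simp add: simps)
  ultimately show "\<forall>x\<in>pairs5. a x = 0" by (simp add: pairs5_def)
qed

text \<open>
  If the derivatives of \<open>l \<odot> P\<close> are proportional, all minors vanish at \<open>l\<close>; as they span the
  quadrics, so do all products of two coordinates of \<open>l\<close>.
\<close>

lemma no_rank_one_if_minors:
  assumes ind: "indep_fun pairs5 (minor e P)"
  shows "no_rank_one 5 P"
  unfolding no_rank_one_def
proof (intro ballI allI impI)
  fix l Q assume l: "l \<in> forms 5 1" and Q: "\<forall>i<5. pdiff i (l \<odot> P) \<in> cvs.span {Q}"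
  define x where "x i = lk l (sg i 1)" for i
  define f where "f r m = fact (e - 1 + r) * fact (5 - r) * lk m (mexp (e - 1 + r) (5 - r))" for r and m :: cpoly
  have f_sum: "f r (\<Sum>i<5. cscale (x i) (g i)) = (\<Sum>i<5. x i * f r (g i))" for r and g :: "nat \<Rightarrow> cpoly"
    by (simp add: f_def lk_sum_scale sum_distrib_left mult.left_commute)
  have com: "pdiff i (pdiff j P) = pdiff j (pdiff i P)" for i j by (metis act_commute act_var)
  define h where "h i j r = hcoef e P i j r" for i j r
  have X: "f r (pdiff j (l \<odot> P)) = (\<Sum>i<5. x i * h i j r)" for j r
    unfolding act_linear_expand[OF l] pdiff_sum pdiff_scale x_def[symmetric] f_sum
    by (simp add: h_def hcoef_def f_def com)
  have "\<forall>j\<in>{..<5}. \<exists>y. pdiff j (l \<odot> P) = cscale y Q" using Q by (auto simp: cvs.span_singleton)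
  then obtain y where y: "\<And>j. j < 5 \<Longrightarrow> pdiff j (l \<odot> P) = cscale (y j) Q" by (metis lessThan_iff)
  have Y: "f r (pdiff j (l \<odot> P)) = y j * f r Q" if "j < 5" for j r
    using y[OF that] by (simp add: f_def lookup_cscale)
  have com_h: "hcoef e P i j r = hcoef e P j i r" for i j r by (simp add: hcoef_def com)
  \<comment> \<open>The products of coordinates of l; a square occurs twice in the coefficient of the minor, hence the factor 1/2.\<close>
  define k where "k z = (if fst z = snd z then 1/2 else 1) * (x (fst z) * x (snd z))" for z :: "nat \<times> nat"
  have "(\<Sum>z\<in>pairs5. k z * minor e P z c) = 0" if c: "c = (j, j', r, r')" "j < 5" "j' < 5" for c j j' r r'
  proof -
    define w where "w i i' = h i j r * h i' j' r' - h i j r' * h i' j' r" for i i'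
    have "(\<Sum>z\<in>pairs5. k z * minor e P z c) = (\<Sum>z\<in>pairs5. k z * (w (fst z) (snd z) + w (snd z) (fst z)))"
      by (intro sum.cong) (auto simp: minor_def c w_def h_def)
    also have "\<dots> = (\<Sum>i<5. \<Sum>i'<5. x i * x i' * w i i')"
      by (simp add: pairs5_def k_def eval_nat_numeral lessThan_Suc algebra_simps)
    also have "\<dots> = (\<Sum>i<5. x i * h i j r) * (\<Sum>i<5. x i * h i j' r') - (\<Sum>i<5. x i * h i j r') * (\<Sum>i<5. x i * h i j' r)"
      unfolding sum_product sum_subtractf[symmetric] w_def by (intro sum.cong) (auto simp: algebra_simps)
    also have "\<dots> = 0" unfolding X[symmetric] Y[OF c(2)] Y[OF c(3)] by simp
    finally show ?thesis .
  qed
  moreover have "(\<Sum>z\<in>pairs5. k z * minor e P z c) = 0" if "c = (j, j', r, r')" "\<not> (j < 5 \<and> j' < 5)" for c j j' r r'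
    using that by (intro sum.neutral) (auto simp: minor_def)
  ultimately have "(\<Sum>z\<in>pairs5. k z * minor e P z c) = 0" for c by (cases c) blast
  then have kz: "k z = 0" if "z \<in> pairs5" for z using ind that unfolding indep_fun_def by blast
  have "x i = 0" if "i < 5" for i
  proof -
    have "i = 0 \<or> i = 1 \<or> i = 2 \<or> i = 3 \<or> i = 4" using that by linarith
    then have "(i, i) \<in> pairs5" by (elim disjE) (simp_all add: pairs5_def)
    from kz[OF this] show ?thesis by (simp add: k_def)
  qed
  then show "l = 0" by (subst linear_form_expand[OF l]) (simp add: x_def)
qed

lemma (in specialization) no_rank_one_open:
  assumes Fam: "reg_family Fam" "Fam pt = example_form e" and e: "4 \<le> e"
  shows "eventually (\<lambda>p. no_rank_one 5 (Fam p)) Fil"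
proof -
  have "reg_family (\<lambda>p. pdiff i (pdiff j (Fam p)))" for i j
    using reg_family_act[OF Fam(1), of "var i * var j"] by (simp add: act_mult act_var)
  then have h: "(\<lambda>p. hcoef e (Fam p) i j r) \<in> Reg" for i j r
    unfolding hcoef_def by (intro reg_scale) (simp add: reg_family_def)
  have m: "(\<lambda>p. minor e (Fam p) x c) \<in> Reg" for x c
  proof -
    obtain i i' where x: "x = (i, i')" by (cases x)
    obtain j j' r r' where c: "c = (j, j', r, r')" by (cases c)
    show ?thesis
    proof (cases "j < 5 \<and> j' < 5")
      case True
      then show ?thesis unfolding x c minor_def prod.case if_P[OF True]
        by (intro reg_add reg_diff reg_mult h)
    next
      case False
      show ?thesis unfolding x c minor_def prod.case if_not_P[OF False] by (rule reg_const)
    qed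
  qed
  have "indep_fun pairs5 (minor e (Fam pt))" using example_minor_indep[OF e] Fam(2) by simp
  then have "eventually (\<lambda>p. indep_fun pairs5 (minor e (Fam p))) Fil"
    by (rule indep_fun_open[rotated 2]) (simp_all add: m pairs5_def)
  then show ?thesis by eventually_elim (rule no_rank_one_if_minors)
qed

lemma example_not_ApoLim:
  assumes e: "4 \<le> e"
  shows "example_form e \<notin> ApoLim 5 (e + 6)"
proof
  assume "example_form e \<in> ApoLim 5 (e + 6)"
  then obtain Reg pt and Fil :: "coord_vec filter" and Fam where sp: "specialization Reg pt Fil" "Fil \<noteq> bot"
    "specialization.reg_family Reg Fam" "Fam pt = example_form e" "example_form e \<in> forms 5 (e + 6)" "example_form e \<noteq> 0"
    "eventually (\<lambda>p. Fam p \<in> forms 5 (e + 6) \<and> Fam p \<noteq> 0 \<and> direct_sum_form 5 (e + 6) (Fam p) \<and>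
        hilbert 5 (Fam p) = hilbert 5 (example_form e)) Fil"
    by (rule ApoLim_specialization)
  have "eventually (\<lambda>p. no_rank_one 5 (Fam p)) Fil"
    by (rule specialization.no_rank_one_open[OF sp(1,3,4) e])
  with sp(7) have "eventually (\<lambda>p. False) Fil"
  proof eventually_elim
    case (elim p)
    obtain U1 U2 F1 F2 where s: "splits_form 5 (e + 6) (Fam p) U1 U2 F1 F2"
      using direct_sum_splits elim(1) by blast
    note s' = splits_form_sym[OF s]
    have h: "hilbert 5 (Fam p) 2 \<le> 7" "9 \<le> hilbert 5 (Fam p) 3"
      using elim(1) example_hilbert_2[OF e] example_hilbert_3[OF e] by simp_all
    have "2 \<le> cvs.dim U1" "2 \<le> cvs.dim U2" "cvs.dim U1 + cvs.dim U2 = 5"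
      using no_rank_one_dim_ge_2[OF elim(2) s] no_rank_one_dim_ge_2[OF elim(2) s'] splits_form_dims[OF s] by simp_all
    then have "cvs.dim U1 = 2 \<and> cvs.dim U2 = 3 \<or> cvs.dim U2 = 2 \<and> cvs.dim U1 = 3" by linarith
    then show False
      using no_split_2_3[OF elim(2) s _ h dim_forms_5_2] no_split_2_3[OF elim(2) s' _ h dim_forms_5_2] by auto
  qed
  then show False using sp(2) by (simp add: trivial_limit_def)
qed

lemma ApoLim_strict_5:
  assumes "10 \<le> d" shows "ApoLim 5 d \<subset> ApoEqu 5 d"
proof -
  have "example_form (d - 6) \<in> ApoEqu 5 d" "example_form (d - 6) \<notin> ApoLim 5 d"
    using example_form_ApoEqu[of "d - 6"] example_not_ApoLim[of "d - 6"] assms by simp_all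
  then show ?thesis using ApoLim_subset_ApoEqu[of d 5] assms by auto
qed


section \<open>Self-adjoint operators: splitting or nilpotency\<close>

lemma complement_projection:
  assumes X: "cvs.subspace X" "X \<subseteq> Y" and Y: "cvs.subspace (Y :: ('a \<Rightarrow>\<^sub>0 complex) set)"
  obtains Z \<pi> where "cvs.subspace Z" "Z \<subseteq> Y" "Vector_Spaces.linear cscale cscale \<pi>"
    "\<And>x. x \<in> X \<Longrightarrow> \<pi> x = 0" "\<And>z. z \<in> Z \<Longrightarrow> \<pi> z = z" "\<And>y. y \<in> Y \<Longrightarrow> \<pi> y \<in> Z" "\<And>y. y \<in> Y \<Longrightarrow> y - \<pi> y \<in> X"
proof -
  obtain B0 where B0: "B0 \<subseteq> X" "cvs.independent B0" "X \<subseteq> cvs.span B0" using cvs.basis_exists[of X] by metis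
  obtain B where B: "B0 \<subseteq> B" "B \<subseteq> Y" "cvs.independent B" "Y \<subseteq> cvs.span B"
    using cvs.maximal_independent_subset_extend[OF subset_trans[OF B0(1) X(2)] B0(2)] by metis
  obtain \<pi> :: "('a \<Rightarrow>\<^sub>0 complex) \<Rightarrow> ('a \<Rightarrow>\<^sub>0 complex)" where \<pi>: "Vector_Spaces.linear cscale cscale \<pi>"
    "\<forall>b\<in>B. \<pi> b = (if b \<in> B0 then 0 else b)"
    using cvp.linear_independent_extend[OF B(3), of "\<lambda>b. if b \<in> B0 then 0 else b"] by metis
  define Z where "Z = cvs.span (B - B0)"
  have lin2: "Vector_Spaces.linear cscale cscale (\<lambda>y. y - \<pi> y)"
    using \<pi>(1) by (simp add: Vector_Spaces.linear_iff cvs.scale_right_diff_distrib)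
  show ?thesis
  proof (rule that[of Z \<pi>])
    show "cvs.subspace Z" by (simp add: Z_def)
    show "Z \<subseteq> Y" unfolding Z_def by (rule cvs.span_minimal[OF _ Y]) (use B(2) in blast)
    show "Vector_Spaces.linear cscale cscale \<pi>" by (rule \<pi>(1))
    show "\<pi> x = 0" if "x \<in> X" for x
      by (rule cvp.linear_eq_0_on_span[OF \<pi>(1), of B0]) (use \<pi>(2) B(1) B0(3) that in auto)
    show "\<pi> z = z" if "z \<in> Z" for z
    proof -
      have "z - \<pi> z = 0"
        by (rule cvp.linear_eq_0_on_span[OF lin2, of "B - B0"]) (use \<pi>(2) that in \<open>auto simp: Z_def\<close>)
      then show ?thesis by simp
    qed
    show "\<pi> y \<in> Z" if "y \<in> Y" for y
    proof -
      have "\<pi> ` B \<subseteq> Z" using \<pi>(2) cvs.span_base[of _ "B - B0"] by (auto simp: Z_def cvs.span_zero)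
      then have "\<pi> ` cvs.span B \<subseteq> Z" unfolding cvp.linear_span_image[OF \<pi>(1), symmetric] Z_def
        by (rule cvs.span_minimal) simp
      then show ?thesis using that B(4) by blast
    qed
    show "y - \<pi> y \<in> X" if "y \<in> Y" for y
    proof -
      have "(\<lambda>y. y - \<pi> y) ` B \<subseteq> X" using \<pi>(2) B0(1) cvs.subspace_0[OF X(1)] by auto
      then have "(\<lambda>y. y - \<pi> y) ` cvs.span B \<subseteq> X" unfolding cvp.linear_span_image[OF lin2, symmetric]
        by (rule cvs.span_minimal[OF _ X(1)])
      then show ?thesis using that B(4) by blast
    qed
  qed
qed

lemma dim_0_gen: "fin_gen X \<Longrightarrow> cvs.dim X = 0 \<Longrightarrow> x \<in> X \<Longrightarrow> x = 0"
proof -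
  assume X: "fin_gen X" "cvs.dim X = 0" "x \<in> X"
  obtain B where B: "X \<subseteq> cvs.span B" "card B = cvs.dim X" "finite B"
    using finite_basis_exists[OF X(1)] by metis
  then have "B = {}" using X(2) by simp
  then show "x = 0" using B(1) X(3) by auto
qed

text \<open>
  Choose a polynomial \<open>p\<close> of least degree with \<open>p(A) v = 0\<close> and split off a root of it.
\<close>

lemma eigenvector_exists:
  assumes A: "Vector_Spaces.linear cscale cscale A" and Z: "cvs.subspace Z" "fin_gen Z" "\<And>z. z \<in> Z \<Longrightarrow> A z \<in> Z"
    and v: "v \<in> Z" "v \<noteq> 0"
  obtains a z where "z \<in> Z" "z \<noteq> 0" "A z = cscale a (z :: 'a \<Rightarrow>\<^sub>0 complex)"
proof -
  have pw: "(A ^^ i) v \<in> Z" for i using v(1) Z(3) by (induction i) auto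
  define ev where "ev N p = (\<Sum>i\<le>N. cscale (coeff p i) ((A ^^ i) v))" for N and p :: "complex poly"
  have evZ: "ev N p \<in> Z" for N p unfolding ev_def using pw
    by (intro cvs.subspace_sum[OF Z(1)] cvs.subspace_scale[OF Z(1)])
  \<comment> \<open>The truncation at N makes the evaluation a finite sum; all values at least the degree give the same result.\<close>
  have ev_shift: "ev (Suc N) (pCons 0 p) = A (ev N p)" for N p
    unfolding ev_def sum.atMost_Suc_shift by (simp add: cvp.linear_sum[OF A] cvp.linear_scale[OF A])
  have ev_Suc: "ev (Suc N) p = ev N p" if "degree p \<le> N" for N p
    using that by (simp add: ev_def coeff_eq_0)
  have ev_mono: "ev M p = ev (degree p) p" if "degree p \<le> M" for M p
    using that by (induction M rule: dec_induct) (simp_all add: ev_Suc)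
  define N where "N = cvs.dim Z"
  have "\<not> indep_fun {..N} (\<lambda>i. lk ((A ^^ i) v))"
  proof
    assume i: "indep_fun {..N} (\<lambda>i. lk ((A ^^ i) v))"
    note j = indep_fun_independent[OF finite_atMost i]
    have "(\<lambda>i. (A ^^ i) v) ` {..N} \<subseteq> cvs.span Z" using pw by (auto intro: cvs.span_base)
    then have "card ((\<lambda>i. (A ^^ i) v) ` {..N}) \<le> N"
      unfolding N_def using independent_finite_dim[OF Z(2) j(2)[unfolded N_def]] by blast
    then show False using j(1) by (simp add: card_image)
  qed
  then obtain a i0 where a: "\<And>c. (\<Sum>i\<le>N. a i * lk ((A ^^ i) v) c) = 0" "i0 \<le> N" "a i0 \<noteq> 0"
    unfolding indep_fun_def by auto
  define p0 where "p0 = (\<Sum>i\<le>N. monom (a i) i)"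
  have cp0: "coeff p0 i = (if i \<le> N then a i else 0)" for i
    unfolding p0_def coeff_sum by (simp add: if_distrib cong: if_cong)
  have "ev N p0 = 0" unfolding ev_def by (rule poly_mapping_eqI) (simp add: lk_sum_scale cp0 a(1))
  moreover have "degree p0 \<le> N" by (rule degree_le) (simp add: cp0)
  ultimately have "ev (degree p0) p0 = 0" using ev_mono[of p0 N] by metis
  moreover have "p0 \<noteq> 0" using cp0[of i0] a(2,3) by auto
  ultimately obtain p where p: "p \<noteq> 0" "ev (degree p) p = 0"
    and least: "\<And>q. q \<noteq> 0 \<Longrightarrow> ev (degree q) q = 0 \<Longrightarrow> degree p \<le> degree q"
    using ex_has_least_nat[of "\<lambda>p. p \<noteq> 0 \<and> ev (degree p) p = 0" p0 degree] by blast
  have "degree p \<noteq> 0"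
  proof
    assume d0: "degree p = 0"
    then obtain c where "p = [:c:]" by (rule degree_eq_zeroE)
    then have "cscale c v = 0" "c \<noteq> 0" using p by (auto simp: ev_def)
    then show False using v(2) by simp
  qed
  then obtain r where "poly p r = 0"
    using fundamental_theorem_of_algebra[of p] by (auto simp: constant_degree)
  then obtain q where q: "p = [:-r, 1:] * q" using poly_eq_0_iff_dvd by (auto simp: dvd_def)
  have q0: "q \<noteq> 0" using p(1) q by auto
  then have dq: "degree p = Suc (degree q)" unfolding q by (subst degree_mult_eq) auto
  have w: "ev (degree q) q \<noteq> 0" using least[OF q0] dq by auto
  have "ev (Suc (degree q)) ([:-r, 1:] * q) = ev (Suc (degree q)) (pCons 0 q) - cscale r (ev (Suc (degree q)) q)"
    unfolding ev_def cvs.scale_sum_right sum_subtractf[symmetric]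
    by (intro sum.cong refl) (simp add: algebra_simps cvs.scale_left_diff_distrib)
  then have "A (ev (degree q) q) = cscale r (ev (degree q) q)"
    using p(2) unfolding dq ev_shift ev_Suc[OF order_refl] by (simp add: q)
  then show ?thesis using that[OF evZ w] by blast
qed

text \<open>
  Self-adjoint for the pairing \<open>(u, v) \<mapsto> u \<odot> v \<odot> F\<close> with values in the forms of degree \<open>d - 2\<close>.  The
  two conditions on operators that kill \<open>F\<close> let \<open>N\<close> descend to the first derivatives of \<open>F\<close>
  without loss of rank.
\<close>

definition nilpotent_self_adjoint :: "nat \<Rightarrow> cpoly \<Rightarrow> (cpoly \<Rightarrow> cpoly) \<Rightarrow> bool" where
  "nilpotent_self_adjoint n F N \<longleftrightarrow> Vector_Spaces.linear cscale cscale N \<and>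
     (\<forall>u\<in>forms n 1. N u \<in> forms n 1 \<and> N (N u) = 0 \<and> (u \<odot> F = 0 \<longrightarrow> N u = 0) \<and> (N u \<odot> F = 0 \<longrightarrow> N u = 0)) \<and>
     (\<forall>u\<in>forms n 1. \<forall>v\<in>forms n 1. N u \<odot> v \<odot> F = u \<odot> N v \<odot> F) \<and>
     (\<exists>u\<in>forms n 1. N u \<odot> F \<noteq> 0)"

lemma linear_funpow:
  "Vector_Spaces.linear cscale cscale B \<Longrightarrow> Vector_Spaces.linear cscale cscale ((B :: ('a \<Rightarrow>\<^sub>0 complex) \<Rightarrow> ('a \<Rightarrow>\<^sub>0 complex)) ^^ k)"
  by (induction k) (simp_all add: Vector_Spaces.linear_iff cvs.vector_space_axioms)

text \<open>
  High powers of \<open>B\<close> have a stable image \<open>I\<close>.  If \<open>I = 0\<close>, the last nonzero power of \<open>B\<close> has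
  positive exponent, as \<open>B \<noteq> 0\<close>, and squares to zero.  Otherwise the projector to \<open>I\<close> along
  the kernel of that power is self-adjoint and splits \<open>F\<close>; the vector \<open>z0\<close> in the kernel makes the
  second summand nonzero.
\<close>

lemma fitting_dichotomy:
  assumes d: "2 \<le> d" and F: "F \<in> forms n d"
    and Z: "cvs.subspace Z" "Z \<subseteq> forms n 1" "\<And>z. z \<in> Z \<Longrightarrow> z \<odot> F = 0 \<Longrightarrow> z = 0"
    and B: "Vector_Spaces.linear cscale cscale B" "\<And>u. u \<in> forms n 1 \<Longrightarrow> B u \<in> Z"
    and BR: "\<And>u. u \<in> forms n 1 \<Longrightarrow> u \<odot> F = 0 \<Longrightarrow> B u = 0"
    and adj: "\<And>u v. u \<in> forms n 1 \<Longrightarrow> v \<in> forms n 1 \<Longrightarrow> B u \<odot> v \<odot> F = u \<odot> B v \<odot> F"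
    and sing: "z0 \<in> Z" "z0 \<noteq> 0" "B z0 = 0" and nz: "\<exists>u\<in>forms n 1. B u \<noteq> 0"
  shows "direct_sum_form n d F \<or> (\<exists>N. nilpotent_self_adjoint n F N)"
proof -
  let ?T = "forms n 1"
  define P where "P k = B ^^ k" for k
  have linP: "Vector_Spaces.linear cscale cscale (P k)" for k unfolding P_def by (rule linear_funpow[OF B(1)])
  have Pf: "P k u \<in> ?T" if "u \<in> ?T" for k u
    using that B(2) Z(2) unfolding P_def by (induction k) auto
  have PSuc: "P (Suc k) u = P k (B u)" for k u by (simp add: P_def funpow_swap1)
  have Pz: "P (Suc k) u \<in> Z" if "u \<in> ?T" for k u
    using B(2)[OF Pf[OF that, of k]] by (simp add: P_def)
  have Padj: "P k u \<odot> v \<odot> F = u \<odot> P k v \<odot> F" if "u \<in> ?T" "v \<in> ?T" for k u v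
    using that
  proof (induction k arbitrary: v)
    case 0 then show ?case by (simp add: P_def)
  next
    case (Suc k)
    have "P (Suc k) u \<odot> v \<odot> F = B (P k u) \<odot> v \<odot> F" by (simp add: P_def)
    also have "\<dots> = P k u \<odot> B v \<odot> F" using adj Pf Suc.prems by blast
    also have "\<dots> = u \<odot> P k (B v) \<odot> F" using Suc.IH[of "B v"] Suc.prems B(2) Z(2) by blast
    finally show ?case by (simp add: PSuc)
  qed
  have Padd: "P (k + l) u = P k (P l u)" for k l u by (simp add: P_def funpow_add)
  obtain m0 where m0: "\<And>m. cvs.dim (P (Suc m0) ` ?T) \<le> cvs.dim (P (Suc m) ` ?T)"
    using ex_has_least_nat[of "\<lambda>_. True" 0 "\<lambda>m. cvs.dim (P (Suc m) ` ?T)"] by blast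
  define m where "m = Suc m0"
  define I where "I = P m ` ?T"
  have sI: "cvs.subspace I" unfolding I_def by (rule subspace_image[OF linP subspace_forms])
  have IZ: "I \<subseteq> Z" unfolding I_def m_def using Pz by blast
  have IT: "I \<subseteq> ?T" using IZ Z(2) by blast
  have stable: "P k ` ?T = I" if "m \<le> k" for k
  proof (rule subspace_eq_of_dim)
    show "cvs.subspace (P k ` ?T)" by (rule subspace_image[OF linP subspace_forms])
    show "fin_gen I" by (rule fin_gen_forms_subset[OF IT])
    have "P k u = P m (P (k - m) u)" for u using that Padd[of m "k - m" u] by simp
    then show "P k ` ?T \<subseteq> I" using Pf unfolding I_def by auto
    obtain k' where "k = Suc k'" using Suc_le_D[of m0 k] \<open>m \<le> k\<close> unfolding m_def by blast
    then show "cvs.dim I \<le> cvs.dim (P k ` ?T)" using m0 unfolding I_def m_def by blast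
  qed
  show ?thesis
  proof (cases "I = {0}")
    case True
    have nil: "\<forall>u\<in>?T. P m u = 0" using True unfolding I_def by auto
    define j where "j = (LEAST j. \<forall>u\<in>?T. P j u = 0)"
    have j: "\<forall>u\<in>?T. P j u = 0" unfolding j_def by (rule LeastI[of "\<lambda>j. \<forall>u\<in>?T. P j u = 0", OF nil])
    have jmin: "\<not> (\<forall>u\<in>?T. P i u = 0)" if "i < j" for i using that unfolding j_def by (rule not_less_Least)
    have "j \<noteq> 0"
    proof
      assume "j = 0"
      then have "P 0 z0 = 0" using j sing(1) Z(2) by blast
      then show False using sing(2) by (simp add: P_def)
    qed
    moreover have "j \<noteq> 1"
    proof
      assume "j = 1"
      then have "\<forall>u\<in>?T. P 1 u = 0" using j by blast
      then show False using nz by (simp add: P_def)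
    qed
    ultimately obtain i where i: "j = Suc (Suc i)" by (metis One_nat_def not0_implies_Suc)
    have jk: "P k u = 0" if "j \<le> k" "u \<in> ?T" for k u
    proof -
      have "P k u = P j (P (k - j) u)" using that(1) Padd[of j "k - j" u] by simp
      then show ?thesis using j Pf[OF that(2)] by simp
    qed
    define N where "N = P (Suc i)"
    \<comment> \<open>Twice the exponent of the last nonzero power is at least j, since j is at least two.\<close>
    have "nilpotent_self_adjoint n F N" unfolding nilpotent_self_adjoint_def
    proof (intro conjI ballI impI)
      show "Vector_Spaces.linear cscale cscale N" unfolding N_def by (rule linP)
      show "\<exists>u\<in>?T. N u \<odot> F \<noteq> 0"
      proof -
        obtain u where "u \<in> ?T" "N u \<noteq> 0" using jmin[of "Suc i"] i unfolding N_def by auto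
        then show ?thesis using Z(3)[of "N u"] Pz[of u i] unfolding N_def by blast
      qed
      fix u assume u: "u \<in> ?T"
      show "N u \<in> ?T" unfolding N_def by (rule Pf[OF u])
      show "N (N u) = 0" unfolding N_def Padd[symmetric] by (rule jk) (use i u in auto)
      show "N u = 0" if "u \<odot> F = 0" unfolding N_def PSuc BR[OF u that] by (rule cvp.linear_0[OF linP])
      show "N u = 0" if "N u \<odot> F = 0" using Z(3)[OF Pz[OF u]] that unfolding N_def by blast
      show "N u \<odot> v \<odot> F = u \<odot> N v \<odot> F" if "v \<in> ?T" for v unfolding N_def by (rule Padj[OF u that])
    qed
    then show ?thesis by blast
  next
    case False
    have PI: "P m ` I = I"
    proof -
      have "P m ` I = P (m + m) ` ?T" unfolding I_def image_image Padd ..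
      then show ?thesis using stable[of "m + m"] by simp
    qed
    have fgI: "fin_gen I" by (rule fin_gen_forms_subset[OF IT])
    have "cvs.dim {x \<in> I. P m x = 0} = 0" using rank_nullity[OF linP sI fgI, of m] PI by simp
    then have ker0: "x = 0" if "x \<in> I" "P m x = 0" for x
      using dim_0_gen[OF fin_gen_subset[OF fgI], of "{x \<in> I. P m x = 0}" x] that by auto
    have "inj_on (P m) I"
    proof (rule inj_onI)
      fix x y assume "x \<in> I" "y \<in> I" "P m x = P m y"
      then show "x = y" using ker0[of "x - y"] cvs.subspace_diff[OF sI] by (simp add: cvp.linear_diff[OF linP])
    qed
    then obtain g where g: "g ` UNIV \<subseteq> I" "Vector_Spaces.linear cscale cscale g" "\<forall>v\<in>I. g (P m v) = v"
      using cvp.linear_exists_left_inverse_on[OF linP sI] by blast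
    define E where "E u = g (P m u)" for u
    have EI: "E u \<in> I" for u using g(1) unfolding E_def by blast
    have Eid: "E u = u" if "u \<in> I" for u using g(3) that unfolding E_def by blast
    have PE: "P m (E u) = P m u" if "u \<in> ?T" for u
    proof -
      have "P m u \<in> P m ` I" using PI that unfolding I_def by blast
      then obtain i where "i \<in> I" "P m u = P m i" by blast
      then show ?thesis using g(3) unfolding E_def by auto
    qed
    have "direct_sum_form n d F"
    proof (rule direct_sum_projector[of d F n E])
      show "1 \<le> d" "F \<in> forms n d" using d F by simp_all
      show "Vector_Spaces.linear cscale cscale E" unfolding E_def
        using Vector_Spaces.linear_compose[OF linP g(2), of m] by (simp add: comp_def)
      show "E u \<in> ?T" for u using EI IT by blast
      show "E (E u) = E u" for u by (rule Eid[OF EI])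
      show "(v - E v) \<odot> E u \<odot> F = 0" if uv: "u \<in> ?T" "v \<in> ?T" for u v
      proof -
        obtain w where w: "w \<in> ?T" "E u = P m w" using EI[of u] unfolding I_def by blast
        have "v - E v \<in> ?T" using uv(2) EI IT by (auto intro: forms_diff)
        then have "(v - E v) \<odot> E u \<odot> F = P m (v - E v) \<odot> w \<odot> F" unfolding w(2) using Padj w(1) by simp
        then show ?thesis using PE[OF uv(2)] by (simp add: cvp.linear_diff[OF linP])
      qed
      obtain x where x: "x \<in> I" "x \<noteq> 0" using False cvs.subspace_0[OF sI] by blast
      then show "\<exists>u\<in>?T. E u \<odot> F \<noteq> 0" using Z(3)[of x] IZ IT Eid[OF x(1)] by (metis subsetD)
      have "P m z0 = 0" unfolding m_def PSuc sing(3) by (rule cvp.linear_0[OF linP])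
      then have "E z0 = 0" unfolding E_def using cvp.linear_0[OF g(2)] by simp
      then show "\<exists>u\<in>?T. (u - E u) \<odot> F \<noteq> 0" using Z(2,3) sing(1,2) by (intro bexI[of _ z0]) auto
    qed
    then show ?thesis by blast
  qed
qed

text \<open>
  Sharing the gradient gives \<open>A\<close> with \<open>A u \<odot> F = u \<odot> G\<close>; it is made unique by taking values in a
  complement \<open>Z\<close> of the operators that kill \<open>F\<close>.  It is self-adjoint because \<open>u \<odot> v \<odot> G\<close> is symmetric.
  Replacing \<open>G\<close> by \<open>G - c F\<close>, with an eigenvalue \<open>c\<close>, makes it singular but not zero, as \<open>G\<close> is no
  multiple of \<open>F\<close>.
\<close>

lemma ApoEqu_dichotomy:
  assumes d: "2 \<le> d" and F: "F \<in> ApoEqu n d"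
  shows "direct_sum_form n d F \<or> (\<exists>N. nilpotent_self_adjoint n F N)"
proof -
  have d1: "1 \<le> d" using d by simp
  obtain G where F: "F \<in> forms n d" "F \<noteq> 0" and G: "G \<in> forms n d" "G \<notin> cvs.span {F}" "shares_gradient n F G"
    using F ApoEqu_iff[OF d1] by blast
  let ?T = "forms n 1"
  define R where "R = {u \<in> ?T. u \<odot> F = 0}"
  have sR: "cvs.subspace R" unfolding R_def by (rule subspace_kernel[OF linear_act_left subspace_forms])
  have RT: "R \<subseteq> ?T" by (auto simp: R_def)
  obtain Z \<pi> where Z: "cvs.subspace Z" "Z \<subseteq> ?T" and \<pi>: "Vector_Spaces.linear cscale cscale \<pi>"
    "\<And>x. x \<in> R \<Longrightarrow> \<pi> x = 0" "\<And>z. z \<in> Z \<Longrightarrow> \<pi> z = z" "\<And>y. y \<in> ?T \<Longrightarrow> \<pi> y \<in> Z" "\<And>y. y \<in> ?T \<Longrightarrow> y - \<pi> y \<in> R"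
    by (rule complement_projection[OF sR RT subspace_forms]) (rule that)
  have \<pi>F: "\<pi> u \<odot> F = u \<odot> F" if "u \<in> ?T" for u
    using \<pi>(5)[OF that] by (simp add: R_def act_diff_left)
  have Z0: "z = 0" if "z \<in> Z" "z \<odot> F = 0" for z using \<pi>(2,3)[of z] that Z(2) by (auto simp: R_def)
  obtain a where a: "\<And>i. i < n \<Longrightarrow> a i \<in> ?T \<and> pdiff i G = a i \<odot> F"
  proof -
    have "\<forall>i. \<exists>b. i < n \<longrightarrow> b \<in> ?T \<and> pdiff i G = b \<odot> F" using G(3) by (auto simp: shares_gradient_def derivs1_def)
    then show ?thesis using that by metis
  qed
  define A where "A u = (\<Sum>i<n. cscale (lk u (sg i 1)) (\<pi> (a i)))" for u :: cpoly
  have linA: "Vector_Spaces.linear cscale cscale A"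
    by (simp add: Vector_Spaces.linear_iff cvs.vector_space_axioms A_def lookup_add lookup_cscale
        cvs.scale_left_distrib sum.distrib cvs.scale_sum_right)
  have AZ: "A u \<in> Z" for u unfolding A_def using \<pi>(4) a
    by (intro cvs.subspace_sum[OF Z(1)] cvs.subspace_scale[OF Z(1)]) auto
  have AG: "A u \<odot> F = u \<odot> G" if "u \<in> ?T" for u
    unfolding act_linear_expand[OF that] A_def act_sum_left act_scale_left
    by (intro sum.cong refl) (use \<pi>F a in force)
  have RG: "u \<odot> G = 0" if u: "u \<in> R" for u
  proof (rule form_eq_0I[of _ n "d - 1"])
    show "u \<odot> G \<in> forms n (d - 1)" using act_forms[of u n 1 G "d - 1"] u G(1) d by (simp add: R_def)
    show "1 \<le> d - 1" using d by simp
    fix i assume i: "i < n"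
    have "pdiff i (u \<odot> G) = a i \<odot> u \<odot> F" using a[OF i] by (metis act_commute act_var)
    then show "pdiff i (u \<odot> G) = 0" using u by (simp add: R_def)
  qed
  have AR: "A u = 0" if "u \<in> R" for u
    using Z0[OF AZ] AG[of u] RG[OF that] that by (simp add: R_def)
  have "\<exists>z\<in>Z. z \<noteq> 0"
  proof (rule ccontr)
    assume no: "\<not> ?thesis"
    have "u \<odot> F = 0" if "u \<in> ?T" for u using \<pi>(4)[OF that] no \<pi>F[OF that] by force
    then show False using form_eq_0I'[OF F(1) d1] F(2) by blast
  qed
  then obtain v where v: "v \<in> Z" "v \<noteq> 0" by blast
  obtain c z0 where z0: "z0 \<in> Z" "z0 \<noteq> 0" "A z0 = cscale c z0"
    using eigenvector_exists[OF linA Z(1) fin_gen_forms_subset[OF Z(2)] AZ v] by metis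
  define B where "B u = A u - cscale c (\<pi> u)" for u
  define G1 where "G1 = G - cscale c F"
  have BG: "B u \<odot> F = u \<odot> G1" if "u \<in> ?T" for u
    by (simp add: B_def G1_def act_diff_left act_diff_right act_scale_left act_scale_right AG[OF that] \<pi>F[OF that])
  show ?thesis
  proof (rule fitting_dichotomy[OF d F(1) Z Z0])
    show "Vector_Spaces.linear cscale cscale B"
      using linA \<pi>(1) by (simp add: Vector_Spaces.linear_iff B_def cvs.scale_right_distrib
          cvs.scale_right_diff_distrib cvs.scale_left_commute[of c] mult.commute)
    show "B u \<in> Z" if "u \<in> ?T" for u unfolding B_def
      using AZ \<pi>(4)[OF that] by (intro cvs.subspace_diff[OF Z(1)] cvs.subspace_scale[OF Z(1)])
    show "B u = 0" if "u \<in> ?T" "u \<odot> F = 0" for u using AR[of u] \<pi>(2)[of u] that by (simp add: B_def R_def)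
    show "B u \<odot> v \<odot> F = u \<odot> B v \<odot> F" if "u \<in> ?T" "v \<in> ?T" for u v
    proof -
      have "B u \<odot> v \<odot> F = v \<odot> u \<odot> G1" by (metis act_commute BG[OF that(1)])
      also have "\<dots> = u \<odot> v \<odot> G1" by (rule act_commute)
      finally show ?thesis by (simp add: BG[OF that(2)])
    qed
    show "z0 \<in> Z" "z0 \<noteq> 0" by (rule z0)+
    show "B z0 = 0" using z0 \<pi>(3) by (simp add: B_def)
    show "\<exists>u\<in>?T. B u \<noteq> 0"
    proof (rule ccontr)
      assume no: "\<not> ?thesis"
      have "G1 = 0"
      proof (rule form_eq_0I'[OF _ d1])
        show "G1 \<in> forms n d" unfolding G1_def by (intro forms_diff forms_scale G(1) F(1))
        show "u \<odot> G1 = 0" if "u \<in> ?T" for u using BG[OF that] no that by simp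
      qed
      then show False using G(2) by (auto simp: G1_def cvs.span_singleton)
    qed
  qed
qed

text \<open>
  The derivatives of order \<open>k\<close> and of order \<open>d - k\<close> are dual to each other; a dual family
  of operators for a basis of the former yields independent vectors in the latter.
\<close>

lemma hilbert_le_dual:
  assumes F: "F \<in> forms n d" and k: "k \<le> d"
  shows "hilbert n F k \<le> hilbert n F (d - k)"
proof -
  let ?h = "hilbert n F k"
  obtain \<Theta> where \<Theta>: "\<And>i. i < ?h \<Longrightarrow> \<Theta> i \<in> forms n k" "indep_fun {..<?h} (\<lambda>i. lk (\<Theta> i \<odot> F))"
    using hilbert_basis[of n F k] by metis
  note ind = indep_fun_independent[OF finite_lessThan \<Theta>(2)]
  have \<Theta>F: "\<Theta> i \<odot> F \<in> forms n (d - k)" if "i < ?h" for i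
    using act_forms[OF \<Theta>(1)[OF that], of F "d - k"] F k by simp
  have "\<exists>\<Psi>. \<Psi> \<in> forms n (d - k) \<and> (\<forall>i<?h. \<Psi> \<odot> \<Theta> i \<odot> F = (if i = j then 1 else 0))" if j: "j < ?h" for j
  proof -
    let ?X = "cvs.span ((\<lambda>i. \<Theta> i \<odot> F) ` ({..<?h} - {j}))"
    have "(\<lambda>i. \<Theta> i \<odot> F) ` ({..<?h} - {j}) = (\<lambda>i. \<Theta> i \<odot> F) ` {..<?h} - {\<Theta> j \<odot> F}"
      using inj_on_image_set_diff[OF ind(1), of "{..<?h}" "{j}"] j by simp
    then have "\<Theta> j \<odot> F \<notin> ?X" using ind(2) j unfolding cvs.dependent_def by auto
    then obtain \<Psi> where \<Psi>: "\<Psi> \<in> forms n (d - k)" "\<And>P. P \<in> ?X \<Longrightarrow> P \<in> forms n (d - k) \<Longrightarrow> \<Psi> \<odot> P = 0" "\<Psi> \<odot> \<Theta> j \<odot> F = 1"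
      using separation[OF cvs.subspace_span \<Theta>F[OF j]] by metis
    have "\<Psi> \<odot> \<Theta> i \<odot> F = 0" if "i < ?h" "i \<noteq> j" for i
      using \<Psi>(2)[OF cvs.span_base \<Theta>F[OF that(1)]] that by blast
    then show ?thesis using \<Psi> by auto
  qed
  then obtain \<Psi> where \<Psi>: "\<And>j. j < ?h \<Longrightarrow> \<Psi> j \<in> forms n (d - k)"
    "\<And>i j. j < ?h \<Longrightarrow> i < ?h \<Longrightarrow> \<Psi> j \<odot> \<Theta> i \<odot> F = (if i = j then 1 else 0)" by metis
  have "indep_fun {..<?h} (\<lambda>j. lk (\<Psi> j \<odot> F))" unfolding indep_fun_def
  proof (intro allI impI ballI)
    fix a i assume a: "\<forall>c. (\<Sum>j<?h. a j * lk (\<Psi> j \<odot> F) c) = 0" and i: "i \<in> {..<?h}"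
    have "(\<Sum>j<?h. cscale (a j) (\<Psi> j \<odot> F)) = 0" by (rule poly_mapping_eqI) (use a in \<open>simp add: lk_sum_scale\<close>)
    then have "0 = \<Theta> i \<odot> (\<Sum>j<?h. cscale (a j) (\<Psi> j \<odot> F))" by simp
    also have "\<dots> = (\<Sum>j<?h. cscale (a j) (\<Psi> j \<odot> \<Theta> i \<odot> F))"
      by (simp add: act_sum_right act_scale_right act_commute[of "\<Theta> i"])
    also have "\<dots> = (\<Sum>j<?h. if j = i then cscale (a i) 1 else 0)"
      by (intro sum.cong refl) (use \<Psi>(2) i in auto)
    finally have "cscale (a i) 1 = (0 :: cpoly)" using i by simp
    then show "a i = 0" by simp
  qed
  then have "card {..<?h} \<le> hilbert n F (d - k)" by (intro hilbert_geI[where \<Theta> = \<Psi>] \<Psi>(1)) auto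
  then show ?thesis by simp
qed

lemma hilbert_symmetric: "F \<in> forms n d \<Longrightarrow> k \<le> d \<Longrightarrow> hilbert n F k = hilbert n F (d - k)"
  using hilbert_le_dual[of F n d k] hilbert_le_dual[of F n d "d - k"] by simp

lemma direct_sum_ApoLim:
  assumes "F \<in> forms n d" "F \<noteq> 0" "direct_sum_form n d F"
  shows "F \<in> ApoLim n d"
proof -
  have "poly_family (\<lambda>_. F)" unfolding poly_family_def by (metis poly_const_conv)
  then show ?thesis using ApoLim_polyI[of "\<lambda>_. F" n d] assms by simp
qed


section \<open>Linear forms and cubics\<close>

text \<open>
  Second derivatives of a linear form vanish, so every projector will do for which it and its
  complement do not kill \<open>F\<close>.  It is chosen of rank one, and \<open>s\<close> is such that the complement acts
  nontrivially.
\<close>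

lemma linear_form_direct_sum:
  assumes F: "F \<in> forms n 1" "F \<noteq> 0" and n: "2 \<le> n"
  shows "direct_sum_form n 1 F"
proof -
  let ?f = "\<lambda>i. lk F (sg i 1)"
  have FE: "F = (\<Sum>i<n. cscale (?f i) (var i))" by (rule linear_form_expand[OF F(1)])
  have "\<exists>p<n. ?f p \<noteq> 0"
  proof (rule ccontr)
    assume "\<not> ?thesis"
    then have "(\<Sum>i<n. cscale (?f i) (var i)) = 0" by (intro sum.neutral) auto
    then show False using FE F(2) by argo
  qed
  then obtain p where p: "p < n" "?f p \<noteq> 0" by blast
  define q where "q = (if p = 0 then 1 else 0 :: nat)"
  have q: "q < n" "q \<noteq> p" using n by (auto simp: q_def)
  define s :: complex where "s = (if ?f q = ?f p then 0 else 1)"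
  have s: "?f q \<noteq> ?f p * s" using p(2) by (auto simp: s_def)
  define c where "c u = lk u (sg p 1) + s * lk u (sg q 1)" for u :: cpoly
  define E where "E u = cscale (c u) (var p)" for u
  have cp: "c (var p) = 1" using q(2) by (simp add: c_def var_def lookup_single when_def)
  have cE: "c (cscale a v) = a * c v" for a v by (simp add: c_def lookup_cscale algebra_simps)
  have act: "u \<odot> F = cscale (\<Sum>i<n. lk u (sg i 1) * ?f i) 1" if "u \<in> forms n 1" for u
    by (rule linear_form_act[OF that F(1)])
  have vF: "var i \<odot> F = cscale (?f i) 1" for i by (simp only: act_var pdiff_linear_form[OF F(1)])
  show ?thesis
  proof (rule direct_sum_projector[of 1 F n E])
    show "Vector_Spaces.linear cscale cscale E"
      by (simp add: Vector_Spaces.linear_iff cvs.vector_space_axioms E_def c_def lookup_add lookup_cscale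
          algebra_simps flip: cvs.scale_left_distrib)
    show "E u \<in> forms n 1" for u unfolding E_def using p(1) by (intro forms_scale) simp
    show "E (E u) = E u" for u by (simp add: E_def cE cp)
    show "(v - E v) \<odot> E u \<odot> F = 0" if "v \<in> forms n 1" for u v
    proof -
      have "(v - E v) \<odot> 1 = 0"
        by (rule linear_act_one[of _ n]) (use that p(1) in \<open>auto simp: E_def intro!: forms_diff forms_scale\<close>)
      moreover have "E u \<odot> F = cscale (c u * ?f p) 1" by (simp add: E_def act_scale_left vF[simplified])
      ultimately show ?thesis by (simp add: act_scale_right)
    qed
    show "\<exists>u\<in>forms n 1. E u \<odot> F \<noteq> 0"
      by (rule bexI[of _ "var p"]) (use p vF[of p] in \<open>simp_all add: E_def cp\<close>)
    have "(var q - E (var q)) \<odot> F = cscale (?f q - c (var q) * ?f p) 1"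
      unfolding act_diff_left E_def act_scale_left vF by (simp add: cvs.scale_left_diff_distrib)
    moreover have "c (var q) = s" using q(2) by (simp add: c_def var_def lookup_single when_def)
    ultimately show "\<exists>u\<in>forms n 1. (u - E u) \<odot> F \<noteq> 0"
      using s q(1) by (intro bexI[of _ "var q"]) (simp_all add: mult.commute)
  qed (use F in simp_all)
qed

text \<open>
  Self-adjointness is the symmetry of mixed derivatives of the prescribed gradient \<open>N u \<odot> F\<close>.
\<close>

lemma integrate_gradient:
  assumes F: "F \<in> forms n d" and d: "1 \<le> d"
    and N: "Vector_Spaces.linear cscale cscale N" "\<And>u. u \<in> forms n 1 \<Longrightarrow> N u \<in> forms n 1"
    and adj: "\<And>u v. u \<in> forms n 1 \<Longrightarrow> v \<in> forms n 1 \<Longrightarrow> N u \<odot> v \<odot> F = u \<odot> N v \<odot> F"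
  obtains H where "H \<in> forms n d" "\<And>u. u \<in> forms n 1 \<Longrightarrow> u \<odot> H = N u \<odot> F"
proof -
  define H where "H = cscale (inverse (of_nat d)) (\<Sum>k<n. var k * (N (var k) \<odot> F))"
  have Ff: "N u \<odot> F \<in> forms n (d - 1)" if "u \<in> forms n 1" for u
    using act_forms[OF N(2)[OF that], of F "d - 1"] F d by simp
  have Hf: "H \<in> forms n d" unfolding H_def
  proof (intro forms_scale forms_sum)
    fix k assume "k \<in> {..<n}"
    then show "var k * (N (var k) \<odot> F) \<in> forms n d"
      using forms_mult[OF var_forms(1) Ff[of "var k"], of k] d by simp
  qed
  have pH: "pdiff j H = N (var j) \<odot> F" if j: "j < n" for j
  proof -
    have "(\<Sum>k<n. pdiff j (var k * (N (var k) \<odot> F))) = (\<Sum>k<n. (if k = j then N (var j) \<odot> F else 0) + var k * pdiff k (N (var j) \<odot> F))"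
    proof (intro sum.cong refl)
      fix k assume "k \<in> {..<n}"
      then have "pdiff j (N (var k) \<odot> F) = pdiff k (N (var j) \<odot> F)"
        using adj[of "var k" "var j"] j by (simp flip: act_var) (metis act_commute)
      then show "pdiff j (var k * (N (var k) \<odot> F)) = (if k = j then N (var j) \<odot> F else 0) + var k * pdiff k (N (var j) \<odot> F)"
        by (simp add: pdiff_mult pdiff_var)
    qed
    also have "\<dots> = N (var j) \<odot> F + cscale (of_nat (d - 1)) (N (var j) \<odot> F)"
      using j by (simp add: sum.distrib euler[OF Ff])
    also have "\<dots> = cscale (of_nat d) (N (var j) \<odot> F)"
      using d cvs.scale_left_distrib[of 1 "of_nat (d - 1)" "N (var j) \<odot> F"] by (simp add: of_nat_diff)
    finally show ?thesis unfolding H_def pdiff_scale pdiff_sum using d by simp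
  qed
  have "u \<odot> H = N u \<odot> F" if u: "u \<in> forms n 1" for u
  proof -
    have "u \<odot> H = (\<Sum>j<n. cscale (lk u (sg j 1)) (N (var j) \<odot> F))"
      unfolding act_linear_expand[OF u] by (intro sum.cong refl) (simp add: pH)
    also have "\<dots> = N u \<odot> F" by (subst linear_expand[OF N(1) u]) (simp add: act_sum_left act_scale_left)
    finally show ?thesis .
  qed
  with Hf show ?thesis by (rule that)
qed

text \<open>
  The derivation, or linear vector field, that corresponds to an endomorphism of the linear
  operators.
\<close>

definition vfield :: "nat \<Rightarrow> (cpoly \<Rightarrow> cpoly) \<Rightarrow> cpoly \<Rightarrow> cpoly" where
  "vfield n X P = (\<Sum>k<n. var k * (X (var k) \<odot> P))"

lemma vfield_linear_simps:
  "vfield n X (P + Q) = vfield n X P + vfield n X Q"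
  "vfield n X (cscale c P) = cscale c (vfield n X P)"
  "vfield n X 0 = 0"
  by (simp_all add: vfield_def act_add_right act_scale_right distrib_left sum.distrib cvs.scale_sum_right)

lemma vfield_forms:
  assumes X: "\<And>u. u \<in> forms n 1 \<Longrightarrow> X u \<in> forms n 1" and P: "P \<in> forms n e"
  shows "vfield n X P \<in> forms n e" "e = 0 \<Longrightarrow> vfield n X P = 0"
proof -
  show 0: "vfield n X P = 0" if "e = 0"
    unfolding vfield_def using P that X by (intro sum.neutral) (auto simp: act_forms_zero[of _ n 1 _ 0])
  show "vfield n X P \<in> forms n e"
  proof (cases e)
    case 0 then show ?thesis using \<open>e = 0 \<Longrightarrow> vfield n X P = 0\<close> by simp
  next
    case (Suc e')
    have "var k * (X (var k) \<odot> P) \<in> forms n e" if k: "k < n" for k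
      using forms_mult[OF var_forms(1)[OF k] act_forms[OF X[OF var_forms(1)[OF k]], of P e']] P Suc by simp
    then show ?thesis unfolding vfield_def by (intro forms_sum) simp
  qed
qed

lemma vfield_commutator:
  assumes X: "Vector_Spaces.linear cscale cscale X" and u: "u \<in> forms n 1"
  shows "u \<odot> vfield n X P = vfield n X (u \<odot> P) + X u \<odot> P"
proof -
  have "u \<odot> vfield n X P = (\<Sum>k<n. cscale (lk u (sg k 1)) (X (var k) \<odot> P) + var k * (X (var k) \<odot> u \<odot> P))"
    unfolding vfield_def act_sum_right
    by (intro sum.cong refl) (simp add: act_leibniz[OF u] var_act_linear_form[OF u, simplified] act_commute[of u])
  also have "\<dots> = (\<Sum>k<n. cscale (lk u (sg k 1)) (X (var k))) \<odot> P + vfield n X (u \<odot> P)"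
    by (simp add: sum.distrib vfield_def act_sum_left act_scale_left)
  also have "(\<Sum>k<n. cscale (lk u (sg k 1)) (X (var k))) = X u" by (rule linear_expand[OF X u, symmetric])
  finally show ?thesis by (simp add: add.commute)
qed

text \<open>
  Take a complement \<open>Y\<close> of the kernel of \<open>N\<close>; let \<open>X\<close> map \<open>N y\<close> back to \<open>y\<close> and kill both \<open>Y\<close>
  and the operators that kill \<open>F\<close>.  This is consistent because these two spaces together meet the image
  of \<open>N\<close> only in zero.
\<close>

lemma partial_inverse_exists:
  assumes N: "nilpotent_self_adjoint n F N"
  obtains X where "Vector_Spaces.linear cscale cscale X" "\<And>u. X u \<in> forms n 1" "\<And>u. X (X u) = 0"
    "\<And>u. u \<in> forms n 1 \<Longrightarrow> N (X (N u)) = N u" "\<And>u. u \<in> forms n 1 \<Longrightarrow> u \<odot> F = 0 \<Longrightarrow> X u = 0"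
proof -
  let ?T = "forms n 1"
  have lin: "Vector_Spaces.linear cscale cscale N" using N by (simp add: nilpotent_self_adjoint_def)
  have NT: "N u \<in> ?T" "N (N u) = 0" "u \<odot> F = 0 \<Longrightarrow> N u = 0" "N u \<odot> F = 0 \<Longrightarrow> N u = 0" if "u \<in> ?T" for u
    using N that unfolding nilpotent_self_adjoint_def by blast+
  define K where "K = {u \<in> ?T. N u = 0}"
  have sK: "cvs.subspace K" unfolding K_def by (rule subspace_kernel[OF lin subspace_forms])
  have KT: "K \<subseteq> ?T" by (auto simp: K_def)
  obtain Y \<pi> where Y: "cvs.subspace Y" "Y \<subseteq> ?T" and \<pi>: "Vector_Spaces.linear cscale cscale \<pi>"
    "\<And>x. x \<in> K \<Longrightarrow> \<pi> x = 0" "\<And>z. z \<in> Y \<Longrightarrow> \<pi> z = z" "\<And>y. y \<in> ?T \<Longrightarrow> \<pi> y \<in> Y" "\<And>y. y \<in> ?T \<Longrightarrow> y - \<pi> y \<in> K"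
    by (rule complement_projection[OF sK KT subspace_forms]) (rule that)
  have KY: "y = 0" if "y \<in> Y" "N y = 0" for y using \<pi>(2,3)[of y] that Y(2) by (auto simp: K_def)
  define R where "R = {u \<in> ?T. u \<odot> F = 0}"
  have sR: "cvs.subspace R" unfolding R_def by (rule subspace_kernel[OF linear_act_left subspace_forms])
  define W where "W = {r + y |r y. r \<in> R \<and> y \<in> Y}"
  have sW: "cvs.subspace W" unfolding W_def by (rule cvs.subspace_sums[OF sR Y(1)])
  have WT: "W \<subseteq> ?T" using Y(2) by (auto simp: W_def R_def intro: forms_add)
  have YW: "y \<in> W" if "y \<in> Y" for y using that cvs.subspace_0[OF sR] unfolding W_def by force
  have RW: "r \<in> W" if "r \<in> R" for r using that cvs.subspace_0[OF Y(1)] unfolding W_def by force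
  obtain Z \<tau> where \<tau>: "Vector_Spaces.linear cscale cscale \<tau>"
    "\<And>x. x \<in> W \<Longrightarrow> \<tau> x = 0" "\<And>y. y \<in> ?T \<Longrightarrow> y - \<tau> y \<in> W"
    by (rule complement_projection[OF sW WT subspace_forms]) (rule that)
  have imW: "x = 0" if x: "x \<in> N ` ?T" "x \<in> W" for x
  proof -
    obtain u r y where u: "u \<in> ?T" "x = N u" "r \<in> R" "y \<in> Y" "x = r + y" using x unfolding W_def by blast
    have "N x = N r + N y" using u(5) by (simp add: cvp.linear_add[OF lin])
    moreover have "N r = 0" using u(3) NT(3) by (simp add: R_def)
    moreover have "N x = 0" using u(1,2) NT(2) by simp
    ultimately have "y = 0" using KY u(4) by simp
    then show ?thesis using u NT(4)[of u] by (simp add: R_def)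
  qed
  have s1: "cvs.subspace (N ` ?T)" by (rule subspace_image[OF lin subspace_forms])
  have inj\<tau>: "inj_on \<tau> (N ` ?T)"
  proof (rule inj_onI)
    fix x x' assume x: "x \<in> N ` ?T" "x' \<in> N ` ?T" "\<tau> x = \<tau> x'"
    have d: "x - x' \<in> N ` ?T" using x cvs.subspace_diff[OF s1] by blast
    have "\<tau> (x - x') = 0" using x(3) by (simp add: cvp.linear_diff[OF \<tau>(1)])
    moreover have "x - x' \<in> ?T" using d NT(1) by (elim imageE) simp
    ultimately have "x - x' \<in> W" using \<tau>(3)[of "x - x'"] by simp
    then show "x = x'" using imW[OF d] by simp
  qed
  have injN: "inj_on N Y"
  proof (rule inj_onI)
    fix x x' assume x: "x \<in> Y" "x' \<in> Y" "N x = N x'"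
    then have "x - x' = 0" by (intro KY[OF cvs.subspace_diff[OF Y(1)]]) (simp_all add: cvp.linear_diff[OF lin])
    then show "x = x'" by simp
  qed
  obtain h where h: "Vector_Spaces.linear cscale cscale h" "\<forall>v\<in>N ` ?T. h (\<tau> v) = v"
    using cvp.linear_exists_left_inverse_on[OF \<tau>(1) s1 inj\<tau>] by metis
  obtain g where g: "g ` UNIV \<subseteq> Y" "Vector_Spaces.linear cscale cscale g" "\<forall>v\<in>Y. g (N v) = v"
    using cvp.linear_exists_left_inverse_on[OF lin Y(1) injN] by metis
  define X where "X u = g (h (\<tau> u))" for u
  have XY: "X u \<in> Y" for u using g(1) by (auto simp: X_def)
  have XW: "X u = 0" if "u \<in> W" for u
    using \<tau>(2)[OF that] cvp.linear_0[OF h(1)] cvp.linear_0[OF g(2)] by (simp add: X_def)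
  show ?thesis
  proof (rule that[of X])
    show "Vector_Spaces.linear cscale cscale X" unfolding X_def
      using Vector_Spaces.linear_compose[OF Vector_Spaces.linear_compose[OF \<tau>(1) h(1)] g(2)] by (simp add: comp_def)
    show "X u \<in> ?T" for u using XY Y(2) by blast
    show "X (X u) = 0" for u using XW YW XY by blast
    show "X u = 0" if "u \<in> ?T" "u \<odot> F = 0" for u using XW RW that by (simp add: R_def)
    show "N (X (N u)) = N u" if u: "u \<in> ?T" for u
    proof -
      have "X (N u) = g (N u)" using h(2) u by (simp add: X_def)
      moreover have "N u = N (\<pi> u)" using \<pi>(5)[OF u] by (simp add: K_def cvp.linear_diff[OF lin])
      ultimately show ?thesis using g(3) \<pi>(4)[OF u] by simp
    qed
  qed
qed

lemma line_act_nonzero: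
  assumes "poly_family Fam" "\<Theta> \<odot> Fam 0 \<noteq> 0"
  shows "\<forall>\<^sub>\<infinity>t. \<Theta> \<odot> Fam t \<noteq> 0"
proof -
  obtain m where m: "lk (\<Theta> \<odot> Fam 0) m \<noteq> 0" using assms(2) by (metis lookup_zero poly_mapping_eqI)
  have "line.reg_family (\<lambda>t. \<Theta> \<odot> Fam t)" using assms(1) line.reg_family_act poly_family_iff by blast
  then have "\<forall>\<^sub>\<infinity>t. lk (\<Theta> \<odot> Fam t) m \<noteq> 0" using m unfolding line.reg_family_def by (intro line.reg_nonzero) auto
  then show ?thesis by eventually_elim auto
qed

lemma hilbert_0_le_1: "hilbert n P 0 \<le> 1"
  using hilbert_0(1)[of P n] hilbert_0(2)[of n 0] by (cases "P = 0") auto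

text \<open>
  Let \<open>H\<close> be the form with \<open>u \<odot> H = N u \<odot> F\<close>, let \<open>X\<close> be a partial inverse of \<open>N\<close> and \<open>D\<close> its vector
  field.  The family is \<open>F + (exp(t D) H - H - t D H) / t\<close>, a difference quotient of the flow
  corrected to take the value \<open>F\<close> at \<open>0\<close>; the exponential series stops after the cubic term.  The
  projector \<open>E t = N X + N / t\<close> splits its members.  Operators
  that kill \<open>F\<close> commute with \<open>D\<close> and kill \<open>H\<close>, hence kill the whole family, which settles \<open>h(1)\<close>.
\<close>

lemma cubic_ApoLim:
  assumes F: "F \<in> ApoEqu n 3" shows "F \<in> ApoLim n 3"
proof -
  have F3: "F \<in> forms n 3" "F \<noteq> 0" using F by (auto simp: ApoEqu_def)
  consider "direct_sum_form n 3 F" | N where "nilpotent_self_adjoint n F N"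
    using ApoEqu_dichotomy[OF _ F] by auto
  then show ?thesis
  proof cases
    case 1 then show ?thesis using direct_sum_ApoLim F3 by blast
  next
    case (2 N)
    let ?T = "forms n 1"
    have lin: "Vector_Spaces.linear cscale cscale N" using 2 by (simp add: nilpotent_self_adjoint_def)
    have NT: "N u \<in> ?T" "N (N u) = 0" "u \<odot> F = 0 \<Longrightarrow> N u = 0" if "u \<in> ?T" for u
      using 2 that unfolding nilpotent_self_adjoint_def by blast+
    have adj: "N u \<odot> v \<odot> F = u \<odot> N v \<odot> F" if "u \<in> ?T" "v \<in> ?T" for u v
      using 2 that unfolding nilpotent_self_adjoint_def by blast
    obtain u0 where u0: "u0 \<in> ?T" "N u0 \<odot> F \<noteq> 0" using 2 unfolding nilpotent_self_adjoint_def by blast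
    obtain H where H: "H \<in> forms n 3" "\<And>u. u \<in> ?T \<Longrightarrow> u \<odot> H = N u \<odot> F"
      by (rule integrate_gradient[OF F3(1) _ lin NT(1) adj]) auto
    obtain X where X: "Vector_Spaces.linear cscale cscale X" "\<And>u. X u \<in> ?T" "\<And>u. X (X u) = 0"
      "\<And>u. u \<in> ?T \<Longrightarrow> N (X (N u)) = N u" "\<And>u. u \<in> ?T \<Longrightarrow> u \<odot> F = 0 \<Longrightarrow> X u = 0"
      using partial_inverse_exists[OF 2] by blast
    define D where "D = vfield n X"
    note Dl = vfield_linear_simps[of n X, folded D_def]
    have Df: "P \<in> forms n e \<Longrightarrow> D P \<in> forms n e" "P \<in> forms n 0 \<Longrightarrow> D P = 0" for P e
      using vfield_forms[of n X P] X(2) unfolding D_def by blast+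
    have com: "u \<odot> D P = D (u \<odot> P) + X u \<odot> P" if "u \<in> ?T" for u P
      unfolding D_def by (rule vfield_commutator[OF X(1) that])
    have comX: "X u \<odot> D P = D (X u \<odot> P)" for u P using com[OF X(2)] X(3) by simp
    define Fam where "Fam t = F + cscale (t / 2) (D (D H)) + cscale (t\<^sup>2 / 6) (D (D (D H)))" for t
    have Famf: "Fam t \<in> forms n 3" for t unfolding Fam_def by (intro forms_add forms_scale F3 Df H(1))
    have Fam0: "Fam 0 = F" by (simp add: Fam_def)
    have pf: "poly_family Fam" unfolding poly_family_def
    proof
      fix m show "\<exists>q. \<forall>t. lk (Fam t) m = poly q t"
        by (rule exI[of _ "[:lk F m, lk (D (D H)) m / 2, lk (D (D (D H))) m / 6:]"])
           (simp add: Fam_def lookup_add lookup_cscale algebra_simps power2_eq_square)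
    qed
    \<comment> \<open>Operators in the image of N see the flow of the single form Q.\<close>
    have alpha: "N u \<odot> Fam t = Q + cscale t (D Q) + cscale (t\<^sup>2 / 2) (D (D Q))"
      if u: "u \<in> ?T" and Q: "Q = X (N u) \<odot> H" for u t Q
    proof -
      have Nu: "N u \<in> ?T" by (rule NT(1)[OF u])
      have 0: "N u \<odot> H = 0" using H(2)[OF Nu] NT(2)[OF u] by simp
      have FQ: "N u \<odot> F = Q" using H(2)[OF X(2)] X(4)[OF u] Q by simp
      have 1: "N u \<odot> D H = Q" using com[OF Nu, of H] 0 Q by (simp add: Dl)
      have 2: "N u \<odot> D (D H) = D Q + D Q" using com[OF Nu, of "D H"] 1 comX Q by simp
      have 3: "N u \<odot> D (D (D H)) = D (D Q) + D (D Q) + D (D Q)"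
        by (simp only: com[OF Nu, of "D (D H)"] 2 Dl comX Q)
      have e: "t / 2 + t / 2 = t" "t\<^sup>2 / 6 + t\<^sup>2 / 6 + t\<^sup>2 / 6 = t\<^sup>2 / 2" by simp_all
      show ?thesis
        unfolding Fam_def act_add_right act_scale_right FQ 2 3 cvs.scale_right_distrib
          cvs.scale_left_distrib[symmetric] e ..
    qed
    define E where "E t u = N (X u + cscale (1 / t) u)" for t u
    have linE: "Vector_Spaces.linear cscale cscale (E t)" for t
      using lin X(1) by (simp add: E_def Vector_Spaces.linear_iff cvs.scale_right_distrib mult.commute add_ac)
    have Eu: "E t u = N (X u) + cscale (1 / t) (N u)" for t u
      by (simp add: E_def cvp.linear_add[OF lin] cvp.linear_scale[OF lin])
    have arg: "X u + cscale (1 / t) u \<in> ?T" if "u \<in> ?T" for u t by (intro forms_add forms_scale X(2) that)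
    have ET: "E t u \<in> ?T" if "u \<in> ?T" for t u unfolding E_def by (rule NT(1)[OF arg[OF that]])
    have EN: "E t (N u) = N u" if u: "u \<in> ?T" for t u unfolding Eu using X(4)[OF u] NT(2)[OF u] by simp
    have mixed: "(v - E t v) \<odot> E t u \<odot> Fam t = 0" if t: "t \<noteq> 0" and uv: "u \<in> ?T" "v \<in> ?T" for t u v
    proof -
      let ?w = "v - E t v"
      define y where "y = X (N (X u + cscale (1 / t) u))"
      define Q where "Q = y \<odot> H"
      have yT: "y \<in> ?T" unfolding y_def by (rule X(2))
      have w: "?w \<in> ?T" using uv ET forms_diff by blast
      have Nw: "N ?w = N v"
      proof -
        have "N (E t v) = 0" unfolding E_def by (rule NT(2)[OF arg[OF uv(2)]])
        then show ?thesis by (simp add: cvp.linear_diff[OF lin])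
      qed
      define c where "c = y \<odot> v \<odot> H"
      have cf: "c \<in> forms n 1"
      proof -
        have e: "1 + 2 = (3::nat)" "1 + 1 = (2::nat)" by simp_all
        have "v \<odot> H \<in> forms n 2" by (rule act_forms[OF uv(2)]) (unfold e, rule H(1))
        then show ?thesis unfolding c_def by (intro act_forms[OF yT]) (unfold e)
      qed
      have wQ: "?w \<odot> Q = c"
      proof -
        have "?w \<odot> H = v \<odot> H" using H(2)[OF w] H(2)[OF uv(2)] Nw by simp
        then show ?thesis unfolding Q_def c_def by (metis act_commute)
      qed
      have XwQ: "X ?w \<odot> Q = cscale (- 1 / t) c"
      proof -
        have "N (X ?w) = N (X v) - N (X (N (X v))) - cscale (1 / t) (N (X (N v)))"
          unfolding Eu by (simp add: cvp.linear_diff[OF X(1)] cvp.linear_diff[OF lin] cvp.linear_add[OF X(1)]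
              cvp.linear_add[OF lin] cvp.linear_scale[OF X(1)] cvp.linear_scale[OF lin])
        also have "\<dots> = cscale (- 1 / t) (N v)" using X(4)[OF X(2)[of v]] X(4)[OF uv(2)] by simp
        finally have "X ?w \<odot> H = cscale (- 1 / t) (v \<odot> H)"
          using H(2)[OF X(2)[of ?w]] H(2)[OF uv(2)] by (simp add: act_scale_left act_neg_left)
        then show ?thesis unfolding Q_def c_def by (metis act_commute act_scale_right)
      qed
      have DD0: "D (D c) = 0"
      proof (rule form_eq_0I'[of _ n 1])
        show "D (D c) \<in> forms n 1" by (intro Df cf)
        fix r assume r: "r \<in> ?T"
        have k: "s \<odot> c \<in> forms n 0" if "s \<in> ?T" for s using act_forms[OF that, of c 0] cf by simp
        have "r \<odot> D (D c) = D (D (r \<odot> c) + X r \<odot> c) + D (X r \<odot> c)" using com[OF r] comX by simp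
        then show "r \<odot> D (D c) = 0" using Df(2)[OF k[OF r]] Df(2)[OF k[OF X(2)[of r]]] by (simp add: Dl)
      qed simp
      have 1: "?w \<odot> D Q = D c + cscale (- 1 / t) c" using com[OF w, of Q] wQ XwQ by simp
      have 2: "?w \<odot> D (D Q) = cscale (- 1 / t) (D c) + cscale (- 1 / t) (D c)"
        by (simp only: com[OF w, of "D Q"] 1 comX XwQ Dl DD0 add_0_left)
      have "E t u \<odot> Fam t = Q + cscale t (D Q) + cscale (t\<^sup>2 / 2) (D (D Q))"
        unfolding E_def by (rule alpha[OF arg[OF uv(1)]]) (simp add: Q_def y_def)
      then have "?w \<odot> E t u \<odot> Fam t = c + cscale t (D c + cscale (- 1 / t) c) +
          cscale (t\<^sup>2 / 2) (cscale (- 1 / t) (D c) + cscale (- 1 / t) (D c))"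
        by (simp only: act_add_right act_scale_right wQ 1 2)
      also have "\<dots> = c + (cscale t (D c) + cscale (t * (- 1 / t)) c) + cscale (t\<^sup>2 / 2 * (- 1 / t) + t\<^sup>2 / 2 * (- 1 / t)) (D c)"
        by (simp only: cvs.scale_right_distrib cvs.scale_scale cvs.scale_left_distrib)
      also have "t * (- 1 / t) = - 1" using t by simp
      also have "t\<^sup>2 / 2 * (- 1 / t) + t\<^sup>2 / 2 * (- 1 / t) = - t" using t by (simp add: power2_eq_square)
      also have "c + (cscale t (D c) + cscale (- 1) c) + cscale (- t) (D c) = 0" by simp
      finally show ?thesis .
    qed
    have "\<forall>\<^sub>\<infinity>t. N u0 \<odot> Fam t \<noteq> 0" by (rule line_act_nonzero[OF pf]) (use u0(2) Fam0 in simp)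
    moreover
    have "\<forall>\<^sub>\<infinity>t. (N u0 \<odot> Fam t - cscale t (X (N u0) \<odot> Fam t)) \<noteq> 0"
    proof -
      obtain m where m: "lk (N u0 \<odot> F) m \<noteq> 0" using u0(2) by (metis lookup_zero poly_mapping_eqI)
      have r: "(\<lambda>t. lk (\<Theta> \<odot> Fam t) m) \<in> range poly" for \<Theta>
        using line.reg_family_act[of Fam \<Theta>] pf poly_family_iff unfolding line.reg_family_def by blast
      have "(\<lambda>t::complex. t) \<in> range poly" by (rule range_eqI[of _ _ "[:0, 1:]"]) auto
      then have "(\<lambda>t. lk (N u0 \<odot> Fam t) m - t * lk (X (N u0) \<odot> Fam t) m) \<in> range poly"
        by (intro line.reg_diff line.reg_mult r)
      then have "\<forall>\<^sub>\<infinity>t. lk (N u0 \<odot> Fam t) m - t * lk (X (N u0) \<odot> Fam t) m \<noteq> 0"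
        by (rule line.reg_nonzero) (use m Fam0 in simp)
      then show ?thesis by eventually_elim (auto simp: poly_mapping_eq_iff fun_eq_iff lookup_minus lookup_cscale)
    qed
    moreover have "\<forall>\<^sub>\<infinity>t. t \<noteq> (0::complex)" by (simp add: eventually_cofinite)
    ultimately have ds: "\<forall>\<^sub>\<infinity>t. direct_sum_form n 3 (Fam t)"
    proof eventually_elim
      case (elim t)
      show ?case
      proof (rule direct_sum_projector[OF _ Famf linE ET _ mixed[OF elim(3)]])
        show "E t (E t u) = E t u" if "u \<in> ?T" for u
          using EN[OF arg[OF that], of t t] unfolding E_def[of t u] .
        show "\<exists>u\<in>?T. E t u \<odot> Fam t \<noteq> 0"
          by (rule bexI[of _ "N u0"]) (use EN[OF u0(1)] elim(1) NT(1)[OF u0(1)] in simp_all)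
        let ?x = "X (N u0)"
        have "E t ?x = cscale (1 / t) (N u0)" unfolding Eu X(3) using X(4)[OF u0(1)] cvp.linear_0[OF lin] by simp
        then have "cscale (- t) ((?x - E t ?x) \<odot> Fam t) = N u0 \<odot> Fam t - cscale t (?x \<odot> Fam t)"
          using elim(3) by (simp add: act_diff_left act_scale_left cvs.scale_right_diff_distrib)
        then have "(?x - E t ?x) \<odot> Fam t \<noteq> 0" using elim(2) by auto
        then show "\<exists>u\<in>?T. (u - E t u) \<odot> Fam t \<noteq> 0" using X(2) by blast
      qed simp
    qed
    have h1: "hilbert n (Fam t) 1 \<le> hilbert n (Fam 0) 1" for t
    proof -
      have "{\<Theta> \<in> ?T. \<Theta> \<odot> F = 0} \<subseteq> {\<Theta> \<in> ?T. \<Theta> \<odot> Fam t = 0}"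
      proof clarify
        fix r assume r: "r \<in> ?T" "r \<odot> F = 0"
        have rD: "r \<odot> D P = D (r \<odot> P)" for P using com[OF r(1)] X(5)[OF r] by simp
        have "r \<odot> H = 0" using H(2)[OF r(1)] NT(3)[OF r] by simp
        then show "r \<odot> Fam t = 0" using r(2) by (simp add: Fam_def act_add_right act_scale_right rD Dl)
      qed
      then have "cvs.dim {\<Theta> \<in> ?T. \<Theta> \<odot> F = 0} \<le> cvs.dim {\<Theta> \<in> ?T. \<Theta> \<odot> Fam t = 0}"
        by (intro dim_subset_gen fin_gen_forms_subset[of _ n 1]) auto
      then show ?thesis unfolding hilbert_def apolar_forms Fam0 by simp
    qed
    have "Fam 0 \<in> ApoLim n 3"
    proof (rule ApoLim_polyI[OF pf Famf _ ds])
      show "Fam 0 \<noteq> 0" using F3 Fam0 by simp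
      fix k :: nat assume "k \<le> 3"
      have h0: "hilbert n (Fam t) 0 \<le> hilbert n (Fam 0) 0" for t
        using hilbert_0_le_1[of n "Fam t"] hilbert_0(1)[of "Fam 0" n] F3 Fam0 by simp
      have "hilbert n (Fam t) k \<le> hilbert n (Fam 0) k" for t
      proof -
        have "k = 0 \<or> k = 1 \<or> k = 2 \<or> k = 3" using \<open>k \<le> 3\<close> by linarith
        then show ?thesis
          using h0[of t] h1[of t] hilbert_symmetric[OF Famf, of 0] hilbert_symmetric[OF Famf, of 1] by auto
      qed
      then show "\<forall>\<^sub>\<infinity>t. hilbert n (Fam t) k \<le> hilbert n (Fam 0) k" by simp
    qed
    then show ?thesis using Fam0 by simp
  qed
qed


section \<open>Binary forms in dual bases\<close>

lemma divpow_add: "divpow (u + v) d = (\<Sum>j\<le>d. divpow u j * divpow v (d - j))"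
proof -
  have "(u + v) ^ d = (\<Sum>j\<le>d. cscale (of_nat (d choose j)) (u ^ j * v ^ (d - j)))"
    unfolding binomial_ring by (intro sum.cong refl) (simp add: cscale_eq_mult flip: single_of_nat mult.assoc)
  then have "divpow (u + v) d = (\<Sum>j\<le>d. cscale (of_nat (d choose j) / fact d) (u ^ j * v ^ (d - j)))"
    by (simp add: divpow_def cvs.scale_sum_right)
  also have "\<dots> = (\<Sum>j\<le>d. divpow u j * divpow v (d - j))"
    by (intro sum.cong refl) (simp add: divpow_def binomial_fact mult.commute)
  finally show ?thesis .
qed

lemma divpow_scale: "divpow (cscale c u) k = cscale (c ^ k) (divpow u k)"
proof -
  have "(cscale c u) ^ k = cscale (c ^ k) (u ^ k)" by (induction k) simp_all
  then show ?thesis by (simp add: divpow_def mult.commute)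
qed

lemma divpow_1 [simp]: "divpow u (Suc 0) = u" by (simp add: divpow_def)

lemma dim_insert_ge:
  assumes "cvs.subspace X" "fin_gen X" "x \<notin> X" "X \<subseteq> Y" "x \<in> Y" "fin_gen Y"
  shows "cvs.dim X + 1 \<le> cvs.dim Y"
proof -
  obtain B where B: "B \<subseteq> X" "cvs.independent B" "X \<subseteq> cvs.span B" "card B = cvs.dim X" "finite B"
    using finite_basis_exists[OF assms(2)] by metis
  have "x \<notin> cvs.span B" using assms(3) cvs.span_minimal[OF B(1) assms(1)] by auto
  then have "cvs.independent (insert x B)" using B(2) by (rule cvs.independent_insertI)
  moreover have "insert x B \<subseteq> cvs.span Y" using assms(4,5) B(1) by (auto intro: cvs.span_base)
  ultimately have "card (insert x B) \<le> cvs.dim Y" using independent_finite_dim[OF assms(6)] by blast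
  moreover have "x \<notin> B" using assms(3) B(1) by blast
  ultimately show ?thesis using B(4,5) by simp
qed

text \<open>
  More vectors than coordinates.
\<close>

lemma finite_support_dependent:
  assumes "finite C" "finite I" "card C < card I" "\<And>i c. i \<in> I \<Longrightarrow> c \<notin> C \<Longrightarrow> v i c = 0"
  shows "\<not> indep_fun I (v :: 'i \<Rightarrow> 'c \<Rightarrow> complex)"
proof
  assume ind: "indep_fun I v"
  define e where "e i = (\<Sum>c\<in>C. sg c (v i c))" for i
  have lke: "lk (e i) c = v i c" if "i \<in> I" for i c
  proof (cases "c \<in> C")
    case True then show ?thesis using assms(1) by (simp add: e_def lookup_sum lookup_single when_def)
  next
    case False
    then have "lk (e i) c = 0" unfolding e_def lookup_sum by (intro sum.neutral) (auto simp: lookup_single when_def)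
    then show ?thesis using False assms(4) that by simp
  qed
  have ind': "indep_fun I (\<lambda>i. lk (e i))" unfolding indep_fun_def
  proof (intro allI impI)
    fix a assume a: "\<forall>c. (\<Sum>i\<in>I. a i * lk (e i) c) = 0"
    have "(\<Sum>i\<in>I. a i * v i c) = 0" for c
      using a[rule_format, of c] by (simp add: lke cong: sum.cong)
    then show "\<forall>i\<in>I. a i = 0" using ind unfolding indep_fun_def by blast
  qed
  note j = indep_fun_independent[OF assms(2) ind']
  have "sg c b \<in> cvs.span ((\<lambda>c. sg c 1) ` C)" if "c \<in> C" for c and b :: complex
  proof -
    have "sg c b = cscale b (sg c 1)"
      by (rule poly_mapping_eqI) (simp add: lookup_cscale lookup_single when_def)
    then show ?thesis using cvs.span_scale[OF cvs.span_base[OF imageI[OF that]], of b "\<lambda>c. sg c 1"] by simp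
  qed
  then have "e i \<in> cvs.span ((\<lambda>c. sg c 1) ` C)" for i unfolding e_def by (intro cvs.span_sum) simp
  then have "e ` I \<subseteq> cvs.span ((\<lambda>c. sg c 1) ` C)" by auto
  then have "card (e ` I) \<le> card ((\<lambda>c. sg c (1::complex)) ` C)"
    using cvs.independent_span_bound[OF _ j(2)] assms(1) by blast
  also have "\<dots> \<le> card C" using assms(1) by (rule card_image_le)
  finally show False using assms(3) j(1) by (simp add: card_image)
qed

text \<open>
  The sequence \<open>f(S) g\<close>, where \<open>S\<close> is the shift operator and \<open>f\<close> the list of coefficients of a
  polynomial of degree at most \<open>a\<close>.
\<close>

definition contract :: "nat \<Rightarrow> (nat \<Rightarrow> complex) \<Rightarrow> (nat \<Rightarrow> complex) \<Rightarrow> nat \<Rightarrow> complex" where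
  "contract a f g i = (\<Sum>j\<le>a. f j * g (i + j))"

text \<open>
  Arbitrary coordinates \<open>x, y, z\<close> of the ternary forms, and the dual basis of the operators.
\<close>

locale dual_bases =
  fixes \<alpha> \<beta> \<gamma> x y z :: cpoly
  assumes forms_1: "\<alpha> \<in> forms 3 1" "\<beta> \<in> forms 3 1" "\<gamma> \<in> forms 3 1" "x \<in> forms 3 1" "y \<in> forms 3 1" "z \<in> forms 3 1"
    and pairing: "\<alpha> \<odot> x = 1" "\<alpha> \<odot> y = 0" "\<alpha> \<odot> z = 0" "\<beta> \<odot> x = 0" "\<beta> \<odot> y = 1" "\<beta> \<odot> z = 0"
      "\<gamma> \<odot> x = 0" "\<gamma> \<odot> y = 0" "\<gamma> \<odot> z = 1"
    and span_1: "forms 3 1 = cvs.span {\<alpha>, \<beta>, \<gamma>}"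
begin

lemma act_divpow_one: "u \<in> forms 3 1 \<Longrightarrow> u \<odot> v = 1 \<Longrightarrow> u \<odot> divpow v (Suc k) = divpow v k"
  using act_divpow[of u 3 v 1 k] by simp

lemma act_divpow_zero: "u \<in> forms 3 1 \<Longrightarrow> u \<odot> v = 0 \<Longrightarrow> u \<odot> divpow v k = 0"
  using act_divpow[of u 3 v 0 "k - 1"] act_divpow_0[of u 3 v] by (cases k) simp_all

lemma act_divpow_0': "u \<in> forms 3 1 \<Longrightarrow> u \<odot> 1 = 0"
  by (rule linear_act_one)

lemmas leib = act_leibniz[OF forms_1(1)] act_leibniz[OF forms_1(2)] act_leibniz[OF forms_1(3)]

lemmas divpow_rules = act_divpow_one[OF forms_1(1) pairing(1)] act_divpow_zero[OF forms_1(1) pairing(2)] act_divpow_zero[OF forms_1(1) pairing(3)]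
  act_divpow_zero[OF forms_1(2) pairing(4)] act_divpow_one[OF forms_1(2) pairing(5)] act_divpow_zero[OF forms_1(2) pairing(6)]
  act_divpow_zero[OF forms_1(3) pairing(7)] act_divpow_zero[OF forms_1(3) pairing(8)] act_divpow_one[OF forms_1(3) pairing(9)]
  act_divpow_0'[OF forms_1(1)] act_divpow_0'[OF forms_1(2)] act_divpow_0'[OF forms_1(3)]

text \<open>
  With divided powers, \<open>\<beta>\<close> forgets the last coefficient of a binary form and \<open>\<gamma>\<close> shifts the
  sequence of coefficients, so that the length \<open>e\<close> and the sequence can be treated separately.
\<close>

definition binary_form :: "nat \<Rightarrow> (nat \<Rightarrow> complex) \<Rightarrow> cpoly" where
  "binary_form e g = (\<Sum>i\<le>e. cscale (g i) (divpow y (e - i) * divpow z i))"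

lemma binary_form_forms: "binary_form e g \<in> forms 3 e"
  unfolding binary_form_def
proof (intro forms_sum forms_scale)
  fix i assume "i \<in> {..e}"
  then show "divpow y (e - i) * divpow z i \<in> forms 3 e"
    using forms_mult[OF divpow_forms[OF forms_1(5)] divpow_forms[OF forms_1(6)], of "e - i" i] by simp
qed

lemma alpha_binary_form: "\<alpha> \<odot> binary_form e g = 0"
  unfolding binary_form_def act_sum_right act_scale_right leib divpow_rules by simp

lemma beta_binary_form: "\<beta> \<odot> binary_form (Suc e) g = binary_form e g"
proof -
  have "\<beta> \<odot> binary_form (Suc e) g = (\<Sum>i\<le>e. cscale (g i) (\<beta> \<odot> divpow y (Suc e - i) * divpow z i))"
    unfolding binary_form_def act_sum_right act_scale_right leib divpow_rules by (simp add: divpow_rules)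
  also have "\<dots> = binary_form e g" unfolding binary_form_def
    by (intro sum.cong refl) (simp add: Suc_diff_le divpow_rules)
  finally show ?thesis .
qed

lemma gamma_binary_form: "\<gamma> \<odot> binary_form (Suc e) g = binary_form e (\<lambda>i. g (Suc i))"
  unfolding binary_form_def sum.atMost_Suc_shift act_add_right act_sum_right act_scale_right leib divpow_rules
  by (simp add: divpow_rules act_sum_right act_scale_right leib)

lemma binary_form_0 [simp]: "binary_form 0 g = cscale (g 0) 1" by (simp add: binary_form_def)

lemma binary_form_cong: "(\<And>i. i \<le> e \<Longrightarrow> g i = h i) \<Longrightarrow> binary_form e g = binary_form e h"
  unfolding binary_form_def by (intro sum.cong) auto

lemma binary_form_add: "binary_form e (\<lambda>i. g i + h i) = binary_form e g + binary_form e h"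
  by (simp add: binary_form_def cvs.scale_left_distrib sum.distrib)
lemma binary_form_scale: "binary_form e (\<lambda>i. c * g i) = cscale c (binary_form e g)"
  by (simp add: binary_form_def cvs.scale_sum_right)
lemma binary_form_diff: "binary_form e (\<lambda>i. g i - h i) = binary_form e g - binary_form e h"
  by (simp add: binary_form_def cvs.scale_left_diff_distrib sum_subtractf)
lemma binary_form_zero [simp]: "binary_form e (\<lambda>i. 0) = 0" by (simp add: binary_form_def)

lemma binary_form_eq_0D: "binary_form e g = 0 \<Longrightarrow> i \<le> e \<Longrightarrow> g i = 0"
proof (induction e arbitrary: g i)
  case 0 then show ?case by simp
next
  case (Suc e)
  have "binary_form e g = 0" "binary_form e (\<lambda>i. g (Suc i)) = 0"
    using Suc.prems(1) beta_binary_form[of e g] gamma_binary_form[of e g] by simp_all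
  then show ?case using Suc.IH[of g i] Suc.IH[of "\<lambda>i. g (Suc i)" "i - 1"] Suc.prems(2) by (cases i) auto
qed

lemma binary_form_inj: "binary_form e g = binary_form e h \<Longrightarrow> i \<le> e \<Longrightarrow> g i = h i"
  using binary_form_eq_0D[of e "\<lambda>i. g i - h i" i] by (simp add: binary_form_diff)

lemma eq_0_if_killed:
  assumes "P \<in> forms 3 e" "1 \<le> e" "\<alpha> \<odot> P = 0" "\<beta> \<odot> P = 0" "\<gamma> \<odot> P = 0"
  shows "P = 0"
proof (rule form_eq_0I'[OF assms(1,2)])
  have "cvs.span {\<alpha>, \<beta>, \<gamma>} \<subseteq> {u. u \<odot> P = 0}"
    by (rule cvs.span_minimal[OF _ cvp.linear_subspace_kernel[OF linear_act_left]]) (use assms(3-5) in auto)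
  then show "u \<odot> P = 0" if "u \<in> forms 3 1" for u using that span_1 by blast
qed

text \<open>
  Ternary forms killed by \<open>\<alpha>\<close> do not involve \<open>x\<close>.  By induction the two derivatives are
  binary, and the symmetry of the mixed derivative glues their coefficient sequences together.
\<close>

lemma binary_form_exists:
  assumes "P \<in> forms 3 e" "\<alpha> \<odot> P = 0"
  obtains g where "P = binary_form e g"
  using assms
proof (induction e arbitrary: P thesis)
  case 0
  then obtain c where "P = cscale c 1" by (auto simp: forms_0)
  then show ?case using 0(1)[of "\<lambda>_. c"] by simp
next
  case (Suc e)
  have fP: "\<beta> \<odot> P \<in> forms 3 e" "\<gamma> \<odot> P \<in> forms 3 e"
    using act_forms[OF forms_1(2), of P e] act_forms[OF forms_1(3), of P e] Suc.prems(2) by simp_all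
  have k: "\<alpha> \<odot> \<beta> \<odot> P = 0" "\<alpha> \<odot> \<gamma> \<odot> P = 0" using Suc.prems(3) by (metis act_commute act_zero_right)+
  obtain g1 where g1: "\<beta> \<odot> P = binary_form e g1" using Suc.IH[OF _ fP(1) k(1)] by blast
  obtain g2 where g2: "\<gamma> \<odot> P = binary_form e g2" using Suc.IH[OF _ fP(2) k(2)] by blast
  have comp: "g1 (Suc i) = g2 i" if "Suc i \<le> e" for i
  proof -
    have "0 < e" using that by simp
    then obtain e' where e': "e = Suc e'" by (auto simp: gr0_conv_Suc)
    have "binary_form e' (\<lambda>i. g1 (Suc i)) = \<gamma> \<odot> \<beta> \<odot> P" unfolding g1 e' gamma_binary_form ..
    also have "\<dots> = \<beta> \<odot> \<gamma> \<odot> P" by (rule act_commute)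
    also have "\<dots> = binary_form e' g2" unfolding g2 e' beta_binary_form ..
    finally show ?thesis using binary_form_inj[of e' "\<lambda>i. g1 (Suc i)" g2 i] that e' by simp
  qed
  define g where "g i = (if i \<le> e then g1 i else g2 e)" for i
  have "P - binary_form (Suc e) g = 0"
  proof (rule eq_0_if_killed)
    show "P - binary_form (Suc e) g \<in> forms 3 (Suc e)" by (intro forms_diff Suc.prems(2) binary_form_forms)
    show "\<alpha> \<odot> (P - binary_form (Suc e) g) = 0" by (simp add: act_diff_right alpha_binary_form Suc.prems(3))
    have "binary_form e g1 = binary_form e g" by (rule binary_form_cong) (simp add: g_def)
    then show "\<beta> \<odot> (P - binary_form (Suc e) g) = 0" by (simp add: act_diff_right beta_binary_form g1)
    have "binary_form e g2 = binary_form e (\<lambda>i. g (Suc i))" by (rule binary_form_cong) (auto simp: g_def comp not_le less_Suc_eq_le)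
    then show "\<gamma> \<odot> (P - binary_form (Suc e) g) = 0" by (simp add: act_diff_right gamma_binary_form g2)
  qed simp
  then show ?case using Suc.prems(1)[of g] by simp
qed

text \<open>
  The polynomial with coefficients \<open>f\<close>, homogenized and evaluated at \<open>\<gamma>\<close> and \<open>\<beta>\<close>.
\<close>

definition homog :: "nat \<Rightarrow> (nat \<Rightarrow> complex) \<Rightarrow> cpoly" where
  "homog a f = (\<Sum>j\<le>a. cscale (f j) (\<beta> ^ (a - j) * \<gamma> ^ j))"

lemma power_forms: "u \<in> forms 3 1 \<Longrightarrow> u ^ k \<in> forms 3 k"
proof (induction k)
  case (Suc k)
  then show ?case using forms_mult[of u 3 1 "u ^ k" k] by simp
qed simp

lemma beta_pow_binary_form: "\<beta> ^ k \<odot> binary_form (k + e) g = binary_form e g"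
proof (induction k)
  case (Suc k)
  have "\<beta> ^ Suc k \<odot> binary_form (Suc k + e) g = \<beta> ^ k \<odot> \<beta> \<odot> binary_form (Suc (k + e)) g"
    by (simp add: act_mult act_commute[of \<beta>])
  also have "\<dots> = binary_form e g" unfolding beta_binary_form Suc.IH ..
  finally show ?case .
qed simp

lemma gamma_pow_binary_form: "\<gamma> ^ k \<odot> binary_form (k + e) g = binary_form e (\<lambda>i. g (i + k))"
proof (induction k arbitrary: g)
  case (Suc k)
  have "\<gamma> ^ Suc k \<odot> binary_form (Suc k + e) g = \<gamma> ^ k \<odot> \<gamma> \<odot> binary_form (Suc (k + e)) g"
    by (simp add: act_mult act_commute[of \<gamma>])
  also have "\<dots> = binary_form e (\<lambda>i. g (Suc (i + k)))" unfolding gamma_binary_form Suc.IH ..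
  finally show ?case by simp
qed simp

lemma monomial_binary_form: "j \<le> a \<Longrightarrow> (\<beta> ^ (a - j) * \<gamma> ^ j) \<odot> binary_form (a + e) g = binary_form e (\<lambda>i. g (i + j))"
proof -
  assume j: "j \<le> a"
  then have "binary_form (a + e) g = binary_form (j + (a - j + e)) g" by simp
  then have "(\<beta> ^ (a - j) * \<gamma> ^ j) \<odot> binary_form (a + e) g = \<beta> ^ (a - j) \<odot> binary_form (a - j + e) (\<lambda>i. g (i + j))"
    by (simp only: act_mult gamma_pow_binary_form)
  then show ?thesis by (simp only: beta_pow_binary_form)
qed

lemma binary_form_sum: "binary_form e (\<lambda>i. \<Sum>j\<in>A. h j i) = (\<Sum>j\<in>A. binary_form e (h j))"
  by (induction A rule: infinite_finite_induct) (simp_all add: binary_form_add)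

text \<open>
  Apolarity of binary forms is contraction of sequences: \<open>f\<close> kills the binary form if and only if
  its coefficients satisfy the linear recurrence \<open>f\<close>.
\<close>

lemma homog_binary_form: "homog a f \<odot> binary_form (a + e) g = binary_form e (contract a f g)"
proof -
  have "homog a f \<odot> binary_form (a + e) g = (\<Sum>j\<le>a. cscale (f j) (binary_form e (\<lambda>i. g (i + j))))"
    unfolding homog_def act_sum_left act_scale_left by (intro sum.cong refl) (simp add: monomial_binary_form)
  also have "\<dots> = binary_form e (\<lambda>i. \<Sum>j\<le>a. f j * g (i + j))" by (simp add: binary_form_sum binary_form_scale)
  finally show ?thesis by (simp add: contract_def[abs_def])
qed

text \<open>
  On forms without \<open>x\<close>, monomials that contain \<open>\<alpha>\<close> act as zero.
\<close>

lemma forms_act_binary_form: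
  assumes "\<Theta> \<in> forms 3 k"
  obtains p where "\<And>e g. \<Theta> \<odot> binary_form (k + e) g = homog k p \<odot> binary_form (k + e) g"
proof -
  let ?X = "{\<Theta>. \<exists>p. \<forall>e g. \<Theta> \<odot> binary_form (k + e) g = homog k p \<odot> binary_form (k + e) g}"
  have homog_add: "homog k (\<lambda>j. p j + q j) = homog k p + homog k q" for k p q
    by (simp add: homog_def cvs.scale_left_distrib sum.distrib)
  have homog_scale: "homog k (\<lambda>j. c * p j) = cscale c (homog k p)" for k p c
    by (simp add: homog_def cvs.scale_sum_right)
  have sub: "cvs.subspace {\<Theta>. \<exists>p. \<forall>e g. \<Theta> \<odot> binary_form (k + e) g = homog k p \<odot> binary_form (k + e) g}" for k
  proof (rule cvs.subspaceI)
    show "0 \<in> {\<Theta>. \<exists>p. \<forall>e g. \<Theta> \<odot> binary_form (k + e) g = homog k p \<odot> binary_form (k + e) g}"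
      by (auto intro!: exI[of _ "\<lambda>_. 0"] simp: homog_def)
    fix \<Theta> \<Psi> c assume "\<Theta> \<in> {\<Theta>. \<exists>p. \<forall>e g. \<Theta> \<odot> binary_form (k + e) g = homog k p \<odot> binary_form (k + e) g}"
    then obtain p where p: "\<And>e g. \<Theta> \<odot> binary_form (k + e) g = homog k p \<odot> binary_form (k + e) g" by blast
    then have "\<forall>e g. cscale c \<Theta> \<odot> binary_form (k + e) g = homog k (\<lambda>j. c * p j) \<odot> binary_form (k + e) g"
      by (simp add: homog_scale act_scale_left)
    then show "cscale c \<Theta> \<in> {\<Theta>. \<exists>p. \<forall>e g. \<Theta> \<odot> binary_form (k + e) g = homog k p \<odot> binary_form (k + e) g}" by blast
    assume "\<Psi> \<in> {\<Theta>. \<exists>p. \<forall>e g. \<Theta> \<odot> binary_form (k + e) g = homog k p \<odot> binary_form (k + e) g}"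
    then obtain q where "\<And>e g. \<Psi> \<odot> binary_form (k + e) g = homog k q \<odot> binary_form (k + e) g" by blast
    then have "\<forall>e g. (\<Theta> + \<Psi>) \<odot> binary_form (k + e) g = homog k (\<lambda>j. p j + q j) \<odot> binary_form (k + e) g"
      using p by (simp add: homog_add act_add_left)
    then show "\<Theta> + \<Psi> \<in> {\<Theta>. \<exists>p. \<forall>e g. \<Theta> \<odot> binary_form (k + e) g = homog k p \<odot> binary_form (k + e) g}" by blast
  qed
  have "forms 3 k \<subseteq> ?X"
  proof (induction k)
    case 0
    show ?case
    proof
      fix \<Theta> assume "\<Theta> \<in> forms 3 0"
      then obtain c where "\<Theta> = cscale c 1" by (auto simp: forms_0)
      then show "\<Theta> \<in> {\<Theta>. \<exists>p. \<forall>e g. \<Theta> \<odot> binary_form (0 + e) g = homog 0 p \<odot> binary_form (0 + e) g}"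
        by (auto intro!: exI[of _ "\<lambda>_. c"] simp: homog_def)
    qed
  next
    case (Suc k)
    have "forms 3 (Suc k) = cvs.span {u * P |u P. u \<in> {\<alpha>, \<beta>, \<gamma>} \<and> P \<in> forms 3 k}"
      by (rule forms_Suc_span[OF span_1]) (metis cvs.span_eq_iff subspace_forms)
    also have "\<dots> \<subseteq> {\<Theta>. \<exists>p. \<forall>e g. \<Theta> \<odot> binary_form (Suc k + e) g = homog (Suc k) p \<odot> binary_form (Suc k + e) g}"
    proof (rule cvs.span_minimal[OF _ sub], rule subsetI)
      fix \<Theta> assume "\<Theta> \<in> {u * P |u P. u \<in> {\<alpha>, \<beta>, \<gamma>} \<and> P \<in> forms 3 k}"
      then obtain u P where uP: "\<Theta> = u * P" "u \<in> {\<alpha>, \<beta>, \<gamma>}" "P \<in> forms 3 k" by blast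
      obtain p where p: "\<And>e g. P \<odot> binary_form (k + e) g = homog k p \<odot> binary_form (k + e) g" using Suc uP(3) by blast
      have P: "\<Theta> \<odot> binary_form (Suc k + e) g = u \<odot> binary_form (Suc e) (contract k p g)" for e g
        using p[of "Suc e" g] homog_binary_form[of k p "Suc e" g] by (simp add: uP(1) act_mult)
      have "\<exists>q. \<forall>e g. \<Theta> \<odot> binary_form (Suc k + e) g = binary_form e (contract (Suc k) q g)"
      proof -
        consider "u = \<alpha>" | "u = \<beta>" | "u = \<gamma>" using uP(2) by blast
        then show ?thesis
        proof cases
          case 1
          have "\<Theta> \<odot> binary_form (Suc k + e) g = binary_form e (contract (Suc k) (\<lambda>_. 0) g)" for e g
            unfolding P 1 alpha_binary_form by (simp add: contract_def[abs_def])
          then show ?thesis by blast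
        next
          case 2
          have "\<Theta> \<odot> binary_form (Suc k + e) g = binary_form e (contract (Suc k) (\<lambda>j. if j \<le> k then p j else 0) g)" for e g
            unfolding P 2 beta_binary_form by (intro binary_form_cong) (simp add: contract_def)
          then show ?thesis by blast
        next
          case 3
          have "\<Theta> \<odot> binary_form (Suc k + e) g = binary_form e (contract (Suc k) (\<lambda>j. case j of 0 \<Rightarrow> 0 | Suc j \<Rightarrow> p j) g)" for e g
            unfolding P 3 gamma_binary_form by (intro binary_form_cong) (simp add: contract_def sum.atMost_Suc_shift del: sum.atMost_Suc)
          then show ?thesis by blast
        qed
      qed
      then show "\<Theta> \<in> {\<Theta>. \<exists>p. \<forall>e g. \<Theta> \<odot> binary_form (Suc k + e) g = homog (Suc k) p \<odot> binary_form (Suc k + e) g}"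
        using homog_binary_form[of "Suc k"] by auto
    qed
    finally show ?case .
  qed
  then show ?thesis using assms that by blast
qed

end


section \<open>Linear recurrences and Hilbert functions of binary forms\<close>

lemma indep_funI:
  assumes "\<And>c. (\<Sum>i\<in>I. cscale (c i) (v i)) = 0 \<Longrightarrow> \<forall>i\<in>I. c i = 0"
  shows "indep_fun I (\<lambda>i. lk (v i :: 'a \<Rightarrow>\<^sub>0 complex))"
  unfolding indep_fun_def
proof (intro allI impI)
  fix a assume "\<forall>c. (\<Sum>i\<in>I. a i * lk (v i) c) = 0"
  then have "(\<Sum>i\<in>I. cscale (a i) (v i)) = 0" by (intro poly_mapping_eqI) (simp add: lk_sum_scale)
  then show "\<forall>i\<in>I. a i = 0" by (rule assms)
qed

text \<open>
  Finitely many functionals without common zero bound the dimension.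
\<close>

lemma dim_le_functionals:
  fixes \<phi> :: "'c \<Rightarrow> ('a \<Rightarrow>\<^sub>0 complex) \<Rightarrow> complex"
  assumes X: "cvs.subspace X" "fin_gen X" and C: "finite C"
    and lin: "\<And>c P Q. \<phi> c (P + Q) = \<phi> c P + \<phi> c Q" "\<And>c b P. \<phi> c (cscale b P) = b * \<phi> c P"
    and inj: "\<And>P. P \<in> X \<Longrightarrow> (\<And>c. c \<in> C \<Longrightarrow> \<phi> c P = 0) \<Longrightarrow> P = 0"
  shows "cvs.dim X \<le> card C"
proof (rule ccontr)
  assume gt: "\<not> ?thesis"
  obtain B where B: "B \<subseteq> X" "cvs.independent B" "X \<subseteq> cvs.span B" "card B = cvs.dim X" "finite B"
    by (rule finite_basis_exists[OF X(2)])
  define v where "v b c = (if c \<in> C then \<phi> c b else 0)" for b c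
  have "\<not> indep_fun B v"
    by (rule finite_support_dependent[OF C B(5)]) (use gt B(4) in \<open>simp_all add: v_def\<close>)
  then obtain u b where u: "\<And>c. (\<Sum>b\<in>B. u b * v b c) = 0" "b \<in> B" "u b \<noteq> 0"
    unfolding indep_fun_def by blast
  define P where "P = (\<Sum>b\<in>B. cscale (u b) b)"
  have z: "\<phi> c 0 = 0" for c using lin(2)[of c 0 0] by simp
  have s: "\<phi> c (\<Sum>b\<in>A. cscale (u b) b) = (\<Sum>b\<in>A. u b * \<phi> c b)" for A c
    by (induction A rule: infinite_finite_induct) (simp_all add: z lin)
  have "P \<in> X" unfolding P_def using B(1) by (intro cvs.subspace_sum[OF X(1)] cvs.subspace_scale[OF X(1)]) auto
  moreover have "\<phi> c P = 0" if "c \<in> C" for c using u(1)[of c] that by (simp add: P_def s v_def)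
  ultimately have "P = 0" by (rule inj)
  then show False using B(2,5) u(2,3) unfolding P_def cvs.dependent_finite[OF B(5)] by blast
qed

lemma divpow_act_forms:
  assumes L: "L \<in> forms n 1"
  shows "\<Theta> \<in> forms n k \<Longrightarrow> \<Theta> \<odot> divpow L (k + e) \<in> cvs.span {divpow L e}"
proof (induction k arbitrary: \<Theta>)
  case 0
  then obtain c where "\<Theta> = cscale c 1" by (auto simp: forms_0)
  then show ?case by (simp add: act_scale_left cvs.span_base cvs.span_scale)
next
  case (Suc k)
  show ?case
  proof (rule forms_Suc_induct[OF Suc.prems cvs.subspace_span _ linear_act_left])
    fix i P assume i: "i < n" "P \<in> forms n k"
    have vi: "var i \<in> forms n 1" using i(1) by simp
    obtain c where c: "var i \<odot> L = cscale c 1" using linear_form_act[OF vi L] by blast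
    have "(var i * P) \<odot> divpow L (Suc k + e) = P \<odot> var i \<odot> divpow L (Suc (k + e))"
      by (simp add: act_mult act_commute[of "var i"])
    also have "\<dots> = cscale c (P \<odot> divpow L (k + e))" by (simp only: act_divpow[OF vi c] act_scale_right)
    finally show "(var i * P) \<odot> divpow L (Suc k + e) \<in> cvs.span {divpow L e}"
      using Suc.IH[OF i(2)] by (simp add: cvs.span_scale)
  qed
qed

lemma contract_commute: "contract a f (contract b p g) i = contract b p (contract a f g) i"
  unfolding contract_def sum_distrib_left by (subst sum.swap) (simp add: ac_simps)

text \<open>
  A nonzero recurrence of length \<open>a\<close> for the coefficients with indices at most \<open>D\<close>.  The
  leading coefficient may vanish: recurrences are binary forms, and roots at infinity count.
\<close>

definition recurrence :: "nat \<Rightarrow> nat \<Rightarrow> (nat \<Rightarrow> complex) \<Rightarrow> (nat \<Rightarrow> complex) \<Rightarrow> bool" where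
  "recurrence D a f g \<longleftrightarrow> (\<exists>j\<le>a. f j \<noteq> 0) \<and> (\<forall>i. i + a \<le> D \<longrightarrow> contract a f g i = 0)"

text \<open>
  For this length there are more unknowns than equations.
\<close>

lemma recurrence_exists:
  obtains f where "recurrence D (D div 2 + 1) f g"
proof -
  let ?a = "D div 2 + 1"
  define v where "v j i = (if i + ?a \<le> D then g (i + j) else 0)" for j i
  have C: "finite {i. i + ?a \<le> D}" by (rule finite_subset[of _ "{..D}"]) auto
  have "{i. i + ?a \<le> D} \<subseteq> {..<?a}" by auto
  then have "card {i. i + ?a \<le> D} \<le> ?a" using card_mono[of "{..<?a}"] by fastforce
  then have "\<not> indep_fun {..?a} v"
    by (intro finite_support_dependent[OF C]) (auto simp: v_def)
  then obtain f j where f: "\<And>i. (\<Sum>j\<le>?a. f j * v j i) = 0" "j \<le> ?a" "f j \<noteq> 0" unfolding indep_fun_def by blast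
  have "contract ?a f g i = 0" if "i + ?a \<le> D" for i using f(1)[of i] that by (simp add: contract_def v_def)
  then show ?thesis using that[of f] f(2,3) by (auto simp: recurrence_def)
qed

context dual_bases
begin

lemma homog_binary_form': "k \<le> D \<Longrightarrow> homog k p \<odot> binary_form D g = binary_form (D - k) (contract k p g)"
  using homog_binary_form[of k p "D - k" g] by simp

lemma forms_act_binary_form':
  assumes "\<Theta> \<in> forms 3 k" "k \<le> D"
  obtains p where "\<Theta> \<odot> binary_form D g = binary_form (D - k) (contract k p g)"
proof -
  obtain p where "\<And>e g. \<Theta> \<odot> binary_form (k + e) g = homog k p \<odot> binary_form (k + e) g" by (rule forms_act_binary_form[OF assms(1)]) (rule that)
  from this[of "D - k" g] have "\<Theta> \<odot> binary_form D g = binary_form (D - k) (contract k p g)"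
    using assms(2) by (simp add: homog_binary_form')
  then show ?thesis by (rule that)
qed

definition coord :: "nat \<Rightarrow> nat \<Rightarrow> cpoly \<Rightarrow> complex" where
  "coord e i P = lk ((\<beta> ^ (e - i) * \<gamma> ^ i) \<odot> P) 0"

lemma coord_binary_form: "i \<le> e \<Longrightarrow> coord e i (binary_form e h) = h i"
  using monomial_binary_form[of i e 0 h] by (simp add: coord_def lookup_cscale lookup_one)

lemma coord_linear: "coord e i (P + Q) = coord e i P + coord e i Q" "coord e i (cscale c P) = c * coord e i P"
  by (simp_all add: coord_def act_add_right act_scale_right lookup_add lookup_cscale)

lemma act_image: "cvs.subspace ((\<lambda>\<Theta>. \<Theta> \<odot> F) ` forms n k)" "fin_gen ((\<lambda>\<Theta>. \<Theta> \<odot> F) ` forms n k)"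
  by (rule subspace_image[OF linear_act_left subspace_forms] fin_gen_image[OF linear_act_left fin_gen_forms])+

lemma hilbert_binary_form_degree:
  assumes "k \<le> d"
  shows "hilbert 3 (binary_form d g) k \<le> d - k + 1"
proof -
  have "cvs.dim ((\<lambda>\<Theta>. \<Theta> \<odot> binary_form d g) ` forms 3 k) \<le> card {..d - k}"
  proof (rule dim_le_functionals[where \<phi> = "coord (d - k)", OF act_image _ coord_linear])
    fix P assume P: "P \<in> (\<lambda>\<Theta>. \<Theta> \<odot> binary_form d g) ` forms 3 k" "\<And>i. i \<in> {..d - k} \<Longrightarrow> coord (d - k) i P = 0"
    obtain \<Theta> where \<Theta>: "\<Theta> \<in> forms 3 k" "P = \<Theta> \<odot> binary_form d g" using P(1) by blast
    obtain p where p: "P = binary_form (d - k) (contract k p g)"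
      unfolding \<Theta>(2) by (rule forms_act_binary_form'[OF \<Theta>(1) assms, of g])
    have "binary_form (d - k) (contract k p g) = binary_form (d - k) (\<lambda>_. 0)"
      by (rule binary_form_cong) (use P(2) coord_binary_form p in auto)
    then show "P = 0" by (simp add: p)
  qed simp
  then show ?thesis by (simp add: hilbert_eq_dim)
qed

text \<open>
  All derivatives of order \<open>k\<close> satisfy the recurrence.  If \<open>t\<close> is the largest index with \<open>f t \<noteq> 0\<close>,
  the recurrence determines the \<open>e - a + 1\<close> coefficients with indices from \<open>t\<close> to \<open>t + (e - a)\<close> by the
  remaining \<open>a\<close> coefficients.
\<close>

lemma hilbert_binary_form_recurrence:
  assumes k: "k + a \<le> d" and rec: "recurrence d a f g"
  shows "hilbert 3 (binary_form d g) k \<le> a"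
proof -
  define e where "e = d - k"
  have e: "a \<le> e" "k \<le> d" "d = k + e" using k by (auto simp: e_def)
  have "finite {j. j \<le> a \<and> f j \<noteq> 0}" "{j. j \<le> a \<and> f j \<noteq> 0} \<noteq> {}" using rec by (auto simp: recurrence_def)
  define t where "t = Max {j. j \<le> a \<and> f j \<noteq> 0}"
  have t: "t \<le> a" "f t \<noteq> 0"
    using Max_in[OF \<open>finite {j. j \<le> a \<and> f j \<noteq> 0}\<close> \<open>{j. j \<le> a \<and> f j \<noteq> 0} \<noteq> {}\<close>] by (auto simp: t_def)
  have t': "f j = 0" if "t < j" "j \<le> a" for j
  proof (rule ccontr)
    assume "f j \<noteq> 0"
    then have "j \<le> t" using Max_ge[OF \<open>finite {j. j \<le> a \<and> f j \<noteq> 0}\<close>, of j] that by (simp add: t_def)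
    then show False using that by simp
  qed
  let ?C = "{..<t} \<union> {t + (e - a)<..e}"
  have "cvs.dim ((\<lambda>\<Theta>. \<Theta> \<odot> binary_form d g) ` forms 3 k) \<le> card ?C"
  proof (rule dim_le_functionals[where \<phi> = "coord e", OF act_image _ coord_linear])
    fix P assume P: "P \<in> (\<lambda>\<Theta>. \<Theta> \<odot> binary_form d g) ` forms 3 k" "\<And>i. i \<in> ?C \<Longrightarrow> coord e i P = 0"
    obtain \<Theta> where \<Theta>: "\<Theta> \<in> forms 3 k" "P = \<Theta> \<odot> binary_form d g" using P(1) by blast
    obtain p where p: "P = binary_form e (contract k p g)"
      unfolding \<Theta>(2) e_def by (rule forms_act_binary_form'[OF \<Theta>(1) e(2), of g])
    define h where "h = contract k p g"
    have h0: "h i = 0" if "i \<in> ?C" for i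
    proof -
      have "i \<le> e" using that t e by auto
      then show ?thesis using P(2)[OF that] coord_binary_form[of i e h] by (simp add: p h_def)
    qed
    have hr: "contract a f h i = 0" if "i + a \<le> e" for i
    proof -
      have "contract a f h i = contract k p (contract a f g) i" unfolding h_def by (rule contract_commute)
      also have "\<dots> = 0" using rec that e unfolding contract_def[of k] recurrence_def by (intro sum.neutral) auto
      finally show ?thesis .
    qed
    have "h i = 0" if "i \<le> e" for i using that
    proof (induction i rule: less_induct)
      case (less i)
      show ?case
      proof (cases "i \<in> ?C")
        case False
        then have i: "t \<le> i" "i \<le> t + (e - a)" using less.prems by auto
        have "0 = contract a f h (i - t)" using hr[of "i - t"] i e t by simp
        also have "\<dots> = (\<Sum>j\<in>{t}. f j * h (i - t + j))" unfolding contract_def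
        proof (rule sum.mono_neutral_right)
          show "\<forall>j\<in>{..a} - {t}. f j * h (i - t + j) = 0"
          proof
            fix j assume j: "j \<in> {..a} - {t}"
            show "f j * h (i - t + j) = 0"
            proof (cases "t < j")
              case True then show ?thesis using t' j by simp
            next
              case False
              then have "i - t + j < i" using j i by auto
              then show ?thesis using less by simp
            qed
          qed
        qed (use t in auto)
        finally show ?thesis using t i by simp
      qed (rule h0)
    qed
    then have "binary_form e h = binary_form e (\<lambda>_. 0)" by (intro binary_form_cong) auto
    then show "P = 0" by (simp add: p h_def)
  qed simp
  also have "card ?C \<le> a" using t e by (subst card_Un_disjoint) auto
  finally show ?thesis by (simp add: hilbert_eq_dim)
qed

lemma hilbert_binary_form_upper:
  assumes k: "k \<le> d" and rec: "recurrence d a f g"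
  shows "hilbert 3 (binary_form d g) k \<le> min (min (k + 1) a) (d - k + 1)"
proof -
  have "hilbert 3 (binary_form d g) k \<le> k + 1"
    using hilbert_symmetric[OF binary_form_forms k] hilbert_binary_form_degree[of "d - k" d g] k by simp
  moreover note hilbert_binary_form_degree[OF k, of g]
  moreover have "hilbert 3 (binary_form d g) k \<le> a" if "k + a \<le> d" by (rule hilbert_binary_form_recurrence[OF that rec])
  moreover have "hilbert 3 (binary_form d g) k \<le> a" if "\<not> k + a \<le> d"
    using hilbert_binary_form_degree[OF k, of g] that k by simp
  ultimately show ?thesis by (cases "k + a \<le> d") simp_all
qed

lemma dim_binary_forms:
  assumes "fin_gen X" "\<And>h. binary_form e h \<in> X"
  shows "e + 1 \<le> cvs.dim X"
proof -
  define v where "v i = binary_form e (\<lambda>k. if k = i then 1 else 0)" for i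
  have ind: "indep_fun {..e} (\<lambda>i. lk (v i))"
  proof (rule indep_funI)
    fix c assume "(\<Sum>i\<le>e. cscale (c i) (v i)) = 0"
    then have "binary_form e (\<lambda>k. \<Sum>i\<le>e. c i * (if k = i then 1 else 0)) = 0"
      by (simp only: binary_form_sum binary_form_scale v_def)
    moreover have "binary_form e (\<lambda>k. \<Sum>i\<le>e. c i * (if k = i then 1 else 0)) = binary_form e c"
      by (rule binary_form_cong) (simp add: if_distrib[of "(*) _"] cong: if_cong)
    ultimately show "\<forall>i\<in>{..e}. c i = 0" using binary_form_eq_0D by auto
  qed
  note j = indep_fun_independent[OF finite_atMost ind]
  have "v ` {..e} \<subseteq> cvs.span X" using assms(2) by (auto simp: v_def intro: cvs.span_base)
  then show ?thesis using independent_finite_dim[OF assms(1) j(2)] j(1) by (simp add: card_image)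
qed

text \<open>
  The derivatives \<open>W'\<close> of a space \<open>W\<close> of binary forms have at least the dimension of \<open>W\<close>, unless they
  are everything.  The operator \<open>\<gamma> - s \<beta>\<close> kills only the multiples of a power of the linear form
  \<open>y + s z\<close>, so it is injective on \<open>W\<close> if this power is not in \<open>W\<close>.  If \<open>W\<close> contains these powers for
  all \<open>s\<close>, it contains all binary forms, which they span.
\<close>

lemma binary_step:
  assumes W: "cvs.subspace W" "fin_gen W" "\<And>P. P \<in> W \<Longrightarrow> \<exists>h. P = binary_form (Suc e) h" "a \<le> cvs.dim W" "a \<le> Suc e"
    and W': "fin_gen W'" "cvs.subspace W'" "\<And>P. P \<in> W \<Longrightarrow> \<beta> \<odot> P \<in> W'" "\<And>P. P \<in> W \<Longrightarrow> \<gamma> \<odot> P \<in> W'"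
  shows "a \<le> cvs.dim W'"
proof (cases "\<exists>s. binary_form (Suc e) (\<lambda>i. s ^ i) \<notin> W")
  case True
  then obtain s where s: "binary_form (Suc e) (\<lambda>i. s ^ i) \<notin> W" by blast
  define \<theta> where "\<theta> = \<gamma> - cscale s \<beta>"
  \<comment> \<open>A sequence with \<open>h (i + 1) = s * h i\<close> is geometric.\<close>
  have "P = 0" if P: "P \<in> W" "\<theta> \<odot> P = 0" for P
  proof -
    obtain h where h: "P = binary_form (Suc e) h" using W(3)[OF P(1)] by blast
    have "binary_form e (\<lambda>i. h (Suc i)) = binary_form e (\<lambda>i. s * h i)"
      using P(2) by (simp add: \<theta>_def h act_diff_left act_scale_left beta_binary_form gamma_binary_form binary_form_scale)
    then have rec: "h (Suc i) = s * h i" if "i \<le> e" for i using binary_form_inj[OF _ that] by blast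
    have "h i = h 0 * s ^ i" if "i \<le> Suc e" for i using that by (induction i) (simp_all add: rec)
    then have "P = binary_form (Suc e) (\<lambda>i. h 0 * s ^ i)" unfolding h by (rule binary_form_cong)
    then have Ps: "P = cscale (h 0) (binary_form (Suc e) (\<lambda>i. s ^ i))" by (simp only: binary_form_scale)
    show "P = 0"
    proof (cases "h 0 = 0")
      case False
      then have "binary_form (Suc e) (\<lambda>i. s ^ i) = cscale (1 / h 0) P" by (simp add: Ps)
      then show ?thesis using s P(1) cvs.subspace_scale[OF W(1)] by metis
    qed (simp add: Ps)
  qed
  then have "{P \<in> W. \<theta> \<odot> P = 0} \<subseteq> cvs.span {}" by auto
  then have "cvs.dim {P \<in> W. \<theta> \<odot> P = 0} \<le> card ({} :: cpoly set)" by (rule cvs.dim_le_card) simp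
  then have "cvs.dim W = cvs.dim ((\<lambda>P. \<theta> \<odot> P) ` W)" using rank_nullity[OF linear_act_right W(1,2), of \<theta>] by simp
  also have "\<dots> \<le> cvs.dim W'"
    by (rule dim_subset_gen[OF W'(1)])
       (use W'(3,4) in \<open>auto simp: \<theta>_def act_diff_left act_scale_left intro!: cvs.subspace_diff[OF W'(2)] cvs.subspace_scale[OF W'(2)]\<close>)
  finally show ?thesis using W(4) by simp
next
  case False
  have "binary_form (Suc e) h \<in> W" for h
  proof (rule ccontr)
    assume "binary_form (Suc e) h \<notin> W"
    then obtain \<Theta> where \<Theta>: "\<Theta> \<in> forms 3 (Suc e)" "\<And>P. P \<in> W \<Longrightarrow> P \<in> forms 3 (Suc e) \<Longrightarrow> \<Theta> \<odot> P = 0"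
      "\<Theta> \<odot> binary_form (Suc e) h = 1"
      using separation[OF W(1) binary_form_forms, of "Suc e" h] by metis
    obtain p where p: "\<And>e' g. \<Theta> \<odot> binary_form (Suc e + e') g = homog (Suc e) p \<odot> binary_form (Suc e + e') g"
      by (rule forms_act_binary_form[OF \<Theta>(1)]) (rule that)
    have p: "\<Theta> \<odot> binary_form (Suc e) g = cscale (\<Sum>j\<le>Suc e. p j * g j) 1" for g
      using p[of 0 g] homog_binary_form[of "Suc e" p 0 g] by (simp add: contract_def del: sum.atMost_Suc)
    have "(\<Sum>j\<le>Suc e. p j * s ^ j) = 0" for s
      using \<Theta>(2)[of "binary_form (Suc e) (\<lambda>j. s ^ j)"] False binary_form_forms p[of "\<lambda>j. s ^ j"] by (auto simp del: sum.atMost_Suc)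
    then have "p j = 0" if "j \<le> Suc e" for j using polyfun_eq_0[of p "Suc e"] that by (simp del: sum.atMost_Suc)
    then have "(\<Sum>j\<le>Suc e. p j * h j) = 0" by (intro sum.neutral) auto
    then show False using \<Theta>(3) p[of h] by simp
  qed
  then have "binary_form e h \<in> W'" for h using W'(3)[of "binary_form (Suc e) h"] by (simp add: beta_binary_form)
  then show ?thesis using dim_binary_forms[OF W'(1), of e] W(5) by simp
qed

end

locale minimal_recurrence = dual_bases +
  fixes D a :: nat and f g :: "nat \<Rightarrow> complex"
  assumes rec: "recurrence D a f g" and minimal: "\<And>b p. b < a \<Longrightarrow> \<not> recurrence D b p g" and length: "2 * a \<le> D + 2"
begin

text \<open>
  Below the minimal length, the monomials in \<open>\<beta>\<close> and \<open>\<gamma>\<close> act independently, since a relation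
  between their values would be a shorter recurrence.
\<close>

lemma hilbert_low:
  assumes "j < a" "j \<le> D"
  shows "j + 1 \<le> hilbert 3 (binary_form D g) j"
proof -
  have "card {..j} \<le> hilbert 3 (binary_form D g) j"
  proof (rule hilbert_geI)
    show "indep_fun {..j} (\<lambda>i. lk ((\<beta> ^ (j - i) * \<gamma> ^ i) \<odot> binary_form D g))"
    proof (rule indep_funI)
      fix c assume "(\<Sum>i\<le>j. cscale (c i) ((\<beta> ^ (j - i) * \<gamma> ^ i) \<odot> binary_form D g)) = 0"
      then have "homog j c \<odot> binary_form D g = 0" by (simp only: homog_def act_sum_left act_scale_left)
      then have "binary_form (D - j) (contract j c g) = 0" using homog_binary_form'[OF assms(2)] by simp
      then have "contract j c g i = 0" if "i + j \<le> D" for i using binary_form_eq_0D[of "D - j" _ i] that by simp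
      then show "\<forall>i\<in>{..j}. c i = 0" using minimal[OF assms(1), of c] by (auto simp: recurrence_def)
    qed
    show "\<beta> ^ (j - i) * \<gamma> ^ i \<in> forms 3 j" if "i \<in> {..j}" for i
      using forms_mult[OF power_forms[OF forms_1(2)] power_forms[OF forms_1(3)], of "j - i" i] that by simp
  qed simp
  then show ?thesis by simp
qed

lemma hilbert_mid:
  assumes "1 \<le> a"
  shows "a - 1 + m + a \<le> D + 1 \<Longrightarrow> a \<le> hilbert 3 (binary_form D g) (a - 1 + m)"
proof (induction m)
  case 0
  then show ?case using hilbert_low[of "a - 1"] assms by simp
next
  case (Suc m)
  define j where "j = a - 1 + m"
  define e where "e = D - Suc j"
  have j: "Suc j + a \<le> D + 1" "Suc j \<le> D" using Suc.prems assms by (auto simp: j_def)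
  then have De: "D - j = Suc e" by (simp add: e_def)
  have IH: "a \<le> hilbert 3 (binary_form D g) j" using Suc j by (simp add: j_def)
  have "a \<le> cvs.dim ((\<lambda>\<Theta>. \<Theta> \<odot> binary_form D g) ` forms 3 (Suc j))"
  proof (rule binary_step[OF act_image _ _ _ act_image(2,1)])
    show "a \<le> cvs.dim ((\<lambda>\<Theta>. \<Theta> \<odot> binary_form D g) ` forms 3 j)" using IH by (simp add: hilbert_eq_dim)
    show "a \<le> Suc e" using j De by simp
    fix P assume "P \<in> (\<lambda>\<Theta>. \<Theta> \<odot> binary_form D g) ` forms 3 j"
    then obtain \<Theta> where \<Theta>: "\<Theta> \<in> forms 3 j" "P = \<Theta> \<odot> binary_form D g" by blast
    have "j \<le> D" using j by simp
    from forms_act_binary_form'[OF \<Theta>(1) this, of g] show "\<exists>h. P = binary_form (Suc e) h" using De \<Theta>(2) by metis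
    have "u \<odot> P \<in> (\<lambda>\<Theta>. \<Theta> \<odot> binary_form D g) ` forms 3 (Suc j)" if "u \<in> forms 3 1" for u
      using forms_mult[OF that \<Theta>(1)] by (auto simp: \<Theta>(2) act_mult intro!: image_eqI[of _ _ "u * \<Theta>"])
    then show "\<beta> \<odot> P \<in> (\<lambda>\<Theta>. \<Theta> \<odot> binary_form D g) ` forms 3 (Suc j)" "\<gamma> \<odot> P \<in> (\<lambda>\<Theta>. \<Theta> \<odot> binary_form D g) ` forms 3 (Suc j)"
      using forms_1 by blast+
  qed
  then show ?case by (simp add: hilbert_eq_dim j_def)
qed

text \<open>
  The Hilbert function of a binary form climbs to the length of its minimal recurrence, is constant
  from there on, and descends symmetrically.
\<close>

lemma hilbert_lower:
  assumes j: "j \<le> D"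
  shows "min (min (j + 1) a) (D - j + 1) \<le> hilbert 3 (binary_form D g) j"
proof -
  have "a = 0 \<or> j < a \<or> (D - j < a \<and> a \<le> j) \<or> (1 \<le> a \<and> a \<le> j \<and> j + a \<le> D)" using j by linarith
  then show ?thesis
  proof (elim disjE conjE)
    assume "j < a" then show ?thesis using hilbert_low[OF _ j] by simp
  next
    assume "D - j < a"
    then show ?thesis using hilbert_low[of "D - j"] hilbert_symmetric[OF binary_form_forms j, of g] by simp
  next
    assume "1 \<le> a" "a \<le> j" "j + a \<le> D"
    then show ?thesis using hilbert_mid[of "j - (a - 1)"] by simp
  qed simp
qed

end


section \<open>Ternary forms\<close>

text \<open>
  Solve for the coefficient at the largest index with \<open>f j \<noteq> 0\<close>, starting with zeros; polynomial
  right-hand sides that vanish at \<open>0\<close> produce polynomial solutions that vanish at \<open>0\<close>.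
\<close>

lemma recurrence_solution:
  fixes rhs :: "nat \<Rightarrow> complex poly"
  assumes f: "\<exists>j\<le>a. f j \<noteq> 0" and rhs: "\<And>i. poly (rhs i) 0 = 0"
  obtains R where "\<And>i. (\<Sum>j\<le>a. smult (f j) (R (i + j))) = rhs i" "\<And>i. poly (R i) 0 = 0"
proof -
  let ?J = "{j. j \<le> a \<and> f j \<noteq> 0}"
  define e where "e = Max ?J"
  have "e \<in> ?J" unfolding e_def using f by (intro Max_in) auto
  then have e: "e \<le> a" "f e \<noteq> 0" by auto
  have e': "f j = 0" if "e < j" "j \<le> a" for j
  proof (rule ccontr)
    assume "f j \<noteq> 0"
    then have "j \<le> e" unfolding e_def using that by (intro Max_ge) auto
    then show False using that by simp
  qed
  define step where "step R i = (if i < e then 0 else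
    smult (1 / f e) (rhs (i - e) - (\<Sum>j<e. smult (f j) (R (i - e + j)))))" for R :: "nat \<Rightarrow> complex poly" and i
  define R where "R = wfrec less_than step"
  have "R i = step (cut R less_than i) i" for i unfolding R_def by (rule wfrec) simp
  also have "step (cut R less_than i) i = step R i" for i
  proof (cases "i < e")
    case False
    have "cut R less_than i (i - e + j) = R (i - e + j)" if "j < e" for j
    proof -
      have "i - e + j < i" using False that by simp
      then show ?thesis unfolding cut_def by (simp only: less_than_iff if_True)
    qed
    then have "(\<Sum>j<e. smult (f j) (cut R less_than i (i - e + j))) = (\<Sum>j<e. smult (f j) (R (i - e + j)))"
      by (intro sum.cong refl) (simp only: lessThan_iff)
    then show ?thesis by (simp only: step_def)
  qed (simp add: step_def)
  finally have R: "R i = step R i" for i .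
  have eq: "(\<Sum>j\<le>a. smult (f j) (R (i + j))) = rhs i" for i
  proof -
    have "R (i + e) = smult (1 / f e) (rhs i - (\<Sum>j<e. smult (f j) (R (i + j))))"
      by (subst R) (simp add: step_def)
    then have "smult (f e) (R (i + e)) + (\<Sum>j<e. smult (f j) (R (i + j))) = rhs i" using e(2) by simp
    also have "smult (f e) (R (i + e)) + (\<Sum>j<e. smult (f j) (R (i + j))) = (\<Sum>j\<le>e. smult (f j) (R (i + j)))"
      by (simp add: lessThan_Suc_atMost[symmetric] add.commute)
    also have "\<dots> = (\<Sum>j\<le>a. smult (f j) (R (i + j)))"
      using e e' by (intro sum.mono_neutral_left) auto
    finally show ?thesis .
  qed
  have "poly (R i) 0 = 0" for i
  proof (induction i rule: less_induct)
    case (less i)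
    have "poly (step R i) 0 = 0"
    proof (cases "i < e")
      case False
      have "poly (R (i - e + j)) 0 = 0" if "j < e" for j using less that False by simp
      then have "(\<Sum>j<e. f j * poly (R (i - e + j)) 0) = 0" by (intro sum.neutral) auto
      then show ?thesis using rhs False by (simp only: step_def poly_smult poly_diff poly_sum if_False) simp
    qed (simp add: step_def)
    then show ?case by (subst R)
  qed
  with eq show ?thesis by (rule that)
qed

context dual_bases
begin

lemma divpow_add_line: "divpow (cscale c z + y) e = binary_form e (\<lambda>i. c ^ i)"
  unfolding divpow_add divpow_scale binary_form_def by (simp add: mult.commute)

lemma divpow_y: "divpow y e = binary_form e (\<lambda>i. 0 ^ i)"
  using divpow_add_line[of 0 e] by simp

lemma divpow_y_nonzero: "divpow y e \<noteq> 0"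
  using binary_form_eq_0D[of e "\<lambda>i. 0 ^ i" 0] by (auto simp: divpow_y)

end

text \<open>
  The recurrence is that of \<open>\<gamma> \<odot> F\<close>, where \<open>F\<close> is defined next; its coefficients are those of the
  binary part of \<open>F\<close> without the first.
\<close>

locale ternary_form = minimal_recurrence \<alpha> \<beta> \<gamma> x y z D a f "\<lambda>i. h (Suc i)"
  for \<alpha> \<beta> \<gamma> x y z :: cpoly and D a :: nat and f h :: "nat \<Rightarrow> complex" +
  assumes D: "1 \<le> D"
begin

definition F :: cpoly where "F = x * divpow y D + binary_form (Suc D) h"

lemma alpha_F: "\<alpha> \<odot> F = divpow y D"
  unfolding F_def by (simp add: act_add_right leib divpow_rules pairing alpha_binary_form)

lemma gamma_F: "\<gamma> \<odot> F = binary_form D (\<lambda>i. h (Suc i))"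
  unfolding F_def by (simp add: act_add_right leib divpow_rules pairing gamma_binary_form)

lemma F_forms: "F \<in> forms 3 (Suc D)"
  unfolding F_def using forms_mult[OF forms_1(4) divpow_forms[OF forms_1(5)], of D] by (intro forms_add binary_form_forms) simp

lemma F_nonzero: "F \<noteq> 0"
  using alpha_F divpow_y_nonzero[of D] by auto

text \<open>
  The length of the recurrence satisfied by the binary parts of the approximating forms.  If
  \<open>f 0 = 0\<close>, it is the minimal recurrence itself; otherwise the recurrence has to be multiplied by the
  shift, in order not to involve the first coefficient.
\<close>

definition width :: nat where "width = (if f 0 = 0 then a else Suc a)"

lemma width_pos: "1 \<le> width"
proof -
  have "a \<noteq> 0" if "f 0 = 0" 
  proof
    assume "a = 0"
    moreover obtain j where "j \<le> a" "f j \<noteq> 0" using rec unfolding recurrence_def by blast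
    ultimately show False using that by simp
  qed
  then show ?thesis by (auto simp: width_def)
qed

text \<open>
  The derivatives of order \<open>k\<close> include \<open>\<beta>^k \<odot> F\<close>, which is not binary, and the binary forms
  \<open>Y = y^[d-k] = \<alpha> \<beta>^(k-1) \<odot> F\<close> and \<open>V\<close>, the derivatives of \<open>\<gamma> \<odot> F\<close>, with \<open>d = D + 1\<close>.  The dimension of \<open>V\<close> is known from
  \<open>hilbert_lower\<close>; if it is too small for the claim, then \<open>Y\<close> is not in \<open>V\<close>.  For \<open>f 0 \<noteq> 0\<close> the
  reason is that \<open>f\<close> kills \<open>V\<close> but not \<open>Y\<close>.  For \<open>f 0 = 0\<close>, an operator that produces \<open>Y\<close> from
  \<open>\<gamma> \<odot> F\<close> becomes, multiplied by \<open>\<gamma>\<close>, a recurrence that is too short.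
\<close>

lemma hilbert_F_lower:
  assumes k: "1 \<le> k" "k \<le> D"
  shows "1 + min (min (k + 1) width) (D + 2 - k) \<le> hilbert 3 F k"
proof -
  define g where "g i = h (Suc i)" for i
  define V where "V = (\<lambda>\<Theta>. \<Theta> \<odot> binary_form D g) ` forms 3 (k - 1)"
  define X where "X = (\<lambda>\<Theta>. \<Theta> \<odot> F) ` forms 3 k"
  define X0 where "X0 = {P \<in> X. \<alpha> \<odot> P = 0}"
  define Y where "Y = divpow y (D + 1 - k)"
  define m where "m = min (min k a) (D + 2 - k)"
  have gF: "\<gamma> \<odot> F = binary_form D g" unfolding g_def by (rule gamma_F)
  have fX: "fin_gen X" "cvs.subspace X" unfolding X_def by (rule act_image)+
  have sX0: "cvs.subspace X0" unfolding X0_def by (rule subspace_kernel[OF linear_act_right fX(2)])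
  have fX0: "fin_gen X0" by (rule fin_gen_subset[OF fX(1)]) (simp add: X0_def)
  have kk: "Suc (k - 1) = k" using k by simp
  have VX0: "V \<subseteq> X0"
  proof
    fix P assume "P \<in> V"
    then obtain \<Theta> where \<Theta>: "\<Theta> \<in> forms 3 (k - 1)" "P = \<Theta> \<odot> binary_form D g" by (auto simp: V_def)
    have "\<gamma> * \<Theta> \<in> forms 3 k" using forms_mult[OF forms_1(3) \<Theta>(1)] kk by simp
    moreover have "P = (\<gamma> * \<Theta>) \<odot> F" unfolding \<Theta>(2) gF[symmetric] act_mult by (rule act_commute)
    moreover have "\<alpha> \<odot> P = 0" unfolding \<Theta>(2) by (metis act_commute alpha_binary_form act_zero_right)
    ultimately show "P \<in> X0" by (auto simp: X0_def X_def)
  qed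
  have bpow: "\<beta> ^ j \<odot> divpow y (j + e) = divpow y e" for j e unfolding divpow_y by (rule beta_pow_binary_form)
  have YX0: "Y \<in> X0"
  proof -
    have "\<alpha> * \<beta> ^ (k - 1) \<in> forms 3 k"
      using forms_mult[OF forms_1(1) power_forms[OF forms_1(2)], of "k - 1"] kk by simp
    moreover have "(\<alpha> * \<beta> ^ (k - 1)) \<odot> F = Y"
    proof -
      have "(\<alpha> * \<beta> ^ (k - 1)) \<odot> F = \<beta> ^ (k - 1) \<odot> divpow y (k - 1 + (D + 1 - k))"
        unfolding act_mult using k by (simp add: act_commute[of \<alpha>] alpha_F)
      then show ?thesis unfolding bpow Y_def .
    qed
    moreover have "\<alpha> \<odot> Y = 0" unfolding Y_def divpow_rules ..
    ultimately show ?thesis unfolding X0_def X_def by blast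
  qed
  have top: "\<beta> ^ k \<odot> F \<in> X" "\<beta> ^ k \<odot> F \<notin> X0"
  proof -
    show "\<beta> ^ k \<odot> F \<in> X" unfolding X_def using power_forms[OF forms_1(2), of k] by blast
    have "\<alpha> \<odot> \<beta> ^ k \<odot> F = \<beta> ^ k \<odot> divpow y (k + (D - k))"
      using k by (subst act_commute) (simp add: alpha_F)
    also have "\<dots> \<noteq> 0" unfolding bpow by (rule divpow_y_nonzero)
    finally show "\<beta> ^ k \<odot> F \<notin> X0" by (simp add: X0_def)
  qed
  have 1: "cvs.dim X0 + 1 \<le> hilbert 3 F k"
    using dim_insert_ge[OF sX0 fX0 top(2) _ top(1) fX(1)] by (auto simp: X0_def X_def hilbert_eq_dim)
  have "m \<le> hilbert 3 (binary_form D g) (k - 1)"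
    using hilbert_lower[of "k - 1", folded g_def] k by (simp add: m_def Suc_diff_le)
  then have 2: "m \<le> cvs.dim V" by (simp add: hilbert_eq_dim V_def)
  show ?thesis
  proof (cases "Y \<in> V")
    case False
    have "cvs.dim V + 1 \<le> cvs.dim X0"
      by (rule dim_insert_ge[OF _ _ False VX0 YX0 fX0]) (unfold V_def, (rule act_image)+)
    moreover have "min (min (k + 1) width) (D + 2 - k) \<le> m + 1" unfolding m_def width_def by (auto simp: min_def)
    ultimately show ?thesis using 1 2 by linarith
  next
    case True
    obtain \<Theta> where \<Theta>: "\<Theta> \<in> forms 3 (k - 1)" "Y = \<Theta> \<odot> binary_form D g" using True by (auto simp: V_def)
    have "k - 1 \<le> D" using k by simp
    then obtain p where "Y = binary_form (D - (k - 1)) (contract (k - 1) p g)"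
      unfolding \<Theta>(2) by (rule forms_act_binary_form'[OF \<Theta>(1), of _ g])
    then have "binary_form (D + 1 - k) (contract (k - 1) p g) = binary_form (D + 1 - k) (\<lambda>i. 0 ^ i)"
      unfolding Y_def divpow_y using k by (simp add: Suc_diff_le)
    then have p: "contract (k - 1) p g i = 0 ^ i" if "i \<le> D + 1 - k" for i by (rule binary_form_inj) (rule that)
    have "min (min (k + 1) width) (D + 2 - k) \<le> m"
    proof (cases "f 0 = 0")
      case f0: False
      \<comment> \<open>Contraction of the identity p by f gives f 0 on one side and 0 on the other.\<close>
      have "\<not> a \<le> D + 1 - k"
      proof
        assume le: "a \<le> D + 1 - k"
        have "contract a f (contract (k - 1) p g) 0 = (\<Sum>j\<le>a. f j * 0 ^ j)"
          unfolding contract_def[of a] using le by (intro sum.cong refl, subst p) auto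
        also have "\<dots> = f 0" by (simp add: power_0_left if_distrib[of "(*) _"] cong: if_cong)
        finally have "f 0 = contract (k - 1) p (contract a f g) 0" by (simp add: contract_commute)
        also have "\<dots> = 0" unfolding contract_def[of "k - 1"]
          using rec[folded g_def] le k by (intro sum.neutral) (auto simp: recurrence_def)
        finally show False using f0 by simp
      qed
      then have "D + 2 - k \<le> a" by simp
      moreover have "D + 2 - k \<le> k" using calculation length by linarith
      ultimately show ?thesis by (simp add: m_def)
    next
      case f0: True
      have "\<not> (k < a)"
      proof
        assume ka: "k < a"
        define q where "q j = (case j of 0 \<Rightarrow> 0 | Suc j \<Rightarrow> p j)" for j
        have q: "contract k q g i = contract (k - 1) p g (Suc i)" for i
        proof -
          have "contract (Suc (k - 1)) q g i = contract (k - 1) p g (Suc i)"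
            by (simp add: contract_def q_def sum.atMost_Suc_shift del: sum.atMost_Suc)
          then show ?thesis using kk by simp
        qed
        have "\<exists>j\<le>k - 1. p j \<noteq> 0"
        proof (rule ccontr)
          assume "\<not> ?thesis"
          then have "contract (k - 1) p g 0 = 0" unfolding contract_def by (intro sum.neutral) auto
          then show False using p[of 0] by simp
        qed
        then obtain j where "j \<le> k - 1" "p j \<noteq> 0" by blast
        then have "Suc j \<le> k" "q (Suc j) \<noteq> 0" using k by (auto simp: q_def)
        moreover have "contract k q g i = 0" if "i + k \<le> D" for i using q[of i] p[of "Suc i"] that by simp
        ultimately have "recurrence D k q g" unfolding recurrence_def by blast
        then show False using minimal[OF ka, folded g_def] by blast
      qed
      then show ?thesis using f0 by (simp add: m_def width_def)
    qed
    moreover have "m \<le> cvs.dim X0" using 2 dim_subset_gen[OF fX0 VX0] by simp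
    ultimately show ?thesis using 1 by linarith
  qed
qed

text \<open>
  With \<open>L = y + w z + \<sigma> x\<close>, the member of the family at \<open>t\<close> is \<open>L^[d] / \<sigma> + G\<close> for a binary form
  \<open>G\<close>, whose own pole cancels that of the first summand.  It is a direct sum, because \<open>L\<close> is independent of \<open>y\<close> and \<open>z\<close>;
  the projector is \<open>u \<mapsto> (u \<odot> L / \<sigma>) \<alpha>\<close>.  In each degree the derivatives of \<open>L^[d]\<close> add at most one
  to the Hilbert function of \<open>G\<close>, which the recurrence bounds, and the resulting bound coincides with
  that of \<open>hilbert_F_lower\<close>.
\<close>

lemma family_ApoLim:
  fixes w \<sigma> :: "complex poly" and R :: "nat \<Rightarrow> complex poly"
  assumes \<sigma>: "\<sigma> \<noteq> 0" and zero: "poly \<sigma> 0 = 0" "poly w 0 = 0" "\<And>i. poly (R i) 0 = 0"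
    and rc: "\<And>t. poly \<sigma> t \<noteq> 0 \<Longrightarrow>
      \<exists>p. recurrence (Suc D) width p (\<lambda>i. h i - poly (R i) t - poly w t ^ i / poly \<sigma> t)"
  shows "F \<in> ApoLim 3 (Suc D)"
proof -
  define Fam where "Fam t = binary_form (Suc D) (\<lambda>i. h i - poly (R i) t) +
    (\<Sum>j\<le>D. cscale (poly \<sigma> t ^ j) (divpow x (Suc j) * binary_form (D - j) (\<lambda>i. poly w t ^ i)))" for t
  have Fam0: "Fam 0 = F"
  proof -
    have "(\<Sum>j\<le>D. cscale (0 ^ j) (divpow x (Suc j) * binary_form (D - j) (\<lambda>i. 0 ^ i))) =
        (\<Sum>j\<in>{0}. cscale (0 ^ j) (divpow x (Suc j) * binary_form (D - j) (\<lambda>i. 0 ^ i)))"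
      by (rule sum.mono_neutral_right) auto
    then show ?thesis by (simp add: Fam_def F_def zero divpow_y add.commute)
  qed
  have Famf: "Fam t \<in> forms 3 (Suc D)" for t
    unfolding Fam_def
  proof (intro forms_add forms_sum forms_scale binary_form_forms)
    fix j assume "j \<in> {..D}"
    then show "divpow x (Suc j) * binary_form (D - j) (\<lambda>i. poly w t ^ i) \<in> forms 3 (Suc D)"
      using forms_mult[OF divpow_forms[OF forms_1(4)] binary_form_forms, of "Suc j" "D - j" "\<lambda>i. poly w t ^ i"] by simp
  qed
  have pf: "poly_family Fam" unfolding poly_family_iff line.reg_family_def
  proof
    fix m
    have p: "(\<lambda>t. poly q t ^ k) \<in> range poly" for q :: "complex poly" and k
      by (rule range_eqI[of _ _ "q ^ k"]) auto
    have p1: "poly q \<in> range poly" for q :: "complex poly" by simp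
    have "(\<lambda>t. lk (Fam t) m) = (\<lambda>t. (\<Sum>i\<le>Suc D. (h i - poly (R i) t) * lk (divpow y (Suc D - i) * divpow z i) m) +
      (\<Sum>j\<le>D. poly \<sigma> t ^ j * (\<Sum>i\<le>D - j. poly w t ^ i * lk (divpow x (Suc j) * (divpow y (D - j - i) * divpow z i)) m)))"
      by (simp add: Fam_def binary_form_def lookup_add lookup_sum lookup_cscale sum_distrib_left fun_eq_iff del: sum.atMost_Suc)
    also have "\<dots> \<in> range poly"
      by (intro line.reg_add line.reg_sum line.reg_mult line.reg_diff line.reg_const p p1)
    finally show "(\<lambda>t. lk (Fam t) m) \<in> range poly" .
  qed
  define L where "L t = cscale (poly \<sigma> t) x + (cscale (poly w t) z + y)" for t
  define G where "G t = binary_form (Suc D) (\<lambda>i. h i - poly (R i) t - poly w t ^ i / poly \<sigma> t)" for t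
  have Lf: "L t \<in> forms 3 1" for t unfolding L_def by (intro forms_add forms_scale forms_1)
  have aL: "\<alpha> \<odot> L t = cscale (poly \<sigma> t) 1" for t
    by (simp add: L_def act_add_right act_scale_right pairing)
  have Fam_eq: "Fam t = cscale (1 / poly \<sigma> t) (divpow (L t) (Suc D)) + G t" if s: "poly \<sigma> t \<noteq> 0" for t
  proof -
    have "divpow (L t) (Suc D) = binary_form (Suc D) (\<lambda>i. poly w t ^ i) +
        (\<Sum>j\<le>D. cscale (poly \<sigma> t ^ Suc j) (divpow x (Suc j) * binary_form (D - j) (\<lambda>i. poly w t ^ i)))"
      unfolding L_def divpow_add[of "cscale (poly \<sigma> t) x"] divpow_add_line divpow_scale
      by (simp add: sum.atMost_Suc_shift del: sum.atMost_Suc power_Suc)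
    then have "cscale (1 / poly \<sigma> t) (divpow (L t) (Suc D)) = binary_form (Suc D) (\<lambda>i. 1 / poly \<sigma> t * poly w t ^ i) +
        (\<Sum>j\<le>D. cscale (poly \<sigma> t ^ j) (divpow x (Suc j) * binary_form (D - j) (\<lambda>i. poly w t ^ i)))"
      using s by (simp add: cvs.scale_right_distrib cvs.scale_sum_right flip: binary_form_scale)
    then show ?thesis by (simp add: Fam_def G_def binary_form_diff)
  qed
  have upper: "hilbert 3 (Fam t) k \<le> 1 + min (min (k + 1) width) (D + 2 - k)"
    if s: "poly \<sigma> t \<noteq> 0" and k: "k \<le> D" for t k
  proof -
    have "(\<lambda>\<Theta>. \<Theta> \<odot> Fam t) ` forms 3 k \<subseteq> cvs.span ({divpow (L t) (Suc D - k)} \<union> (\<lambda>\<Theta>. \<Theta> \<odot> G t) ` forms 3 k)" (is "_ \<subseteq> ?S")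
    proof
      fix P assume "P \<in> (\<lambda>\<Theta>. \<Theta> \<odot> Fam t) ` forms 3 k"
      then obtain \<Theta> where \<Theta>: "\<Theta> \<in> forms 3 k" "P = \<Theta> \<odot> Fam t" by blast
      have "\<Theta> \<odot> divpow (L t) (Suc D) \<in> cvs.span {divpow (L t) (Suc D - k)}"
        using divpow_act_forms[OF Lf \<Theta>(1), of t "Suc D - k"] k by simp
      also have "\<dots> \<subseteq> ?S" by (rule cvs.span_mono) simp
      finally have "cscale (1 / poly \<sigma> t) (\<Theta> \<odot> divpow (L t) (Suc D)) \<in> ?S" by (rule cvs.span_scale)
      moreover have "\<Theta> \<odot> G t \<in> ?S" using \<Theta>(1) by (intro cvs.span_base) auto
      ultimately show "P \<in> ?S" unfolding \<Theta>(2) Fam_eq[OF s] act_add_right act_scale_right by (rule cvs.span_add)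
    qed
    then have "hilbert 3 (Fam t) k \<le> 1 + hilbert 3 (G t) k"
      unfolding hilbert_eq_dim by (intro dim_span_Un_le[where A = "{divpow (L t) (Suc D - k)}", OF _ _ act_image(2)]) auto
    also obtain p where "recurrence (Suc D) width p (\<lambda>i. h i - poly (R i) t - poly w t ^ i / poly \<sigma> t)" using rc[OF s] by blast
    then have "hilbert 3 (G t) k \<le> min (min (k + 1) width) (Suc D - k + 1)"
      unfolding G_def using k by (intro hilbert_binary_form_upper) auto
    finally show ?thesis using k by (simp add: Suc_diff_le)
  qed
  have "finite {t. poly \<sigma> t = 0}" by (rule poly_roots_finite[OF \<sigma>])
  then have gen: "\<forall>\<^sub>\<infinity>t. poly \<sigma> t \<noteq> 0" by (simp add: eventually_cofinite)
  show ?thesis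
  proof (rule ApoLim_polyI[of Fam 3 "Suc D", unfolded Fam0, OF pf Famf F_nonzero])
    fix k assume k: "k \<le> Suc D"
    have h0: "hilbert 3 (Fam t) 0 \<le> hilbert 3 F 0" for t using hilbert_0_le_1[of 3 "Fam t"] hilbert_0(1)[OF F_nonzero, of 3] by simp
    have "k = 0 \<or> k = Suc D \<or> (1 \<le> k \<and> k \<le> D)" using k by linarith
    then show "\<forall>\<^sub>\<infinity>t. hilbert 3 (Fam t) k \<le> hilbert 3 F k"
    proof (elim disjE conjE)
      assume "k = Suc D"
      then show ?thesis using h0 hilbert_symmetric[OF Famf, of "Suc D"] hilbert_symmetric[OF F_forms, of "Suc D"] by simp
    next
      assume k: "1 \<le> k" "k \<le> D"
      show ?thesis using gen
      proof eventually_elim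
        case (elim t)
        show ?case using upper[OF elim k(2)] hilbert_F_lower[OF k] by simp
      qed
    qed (simp add: h0)
  next
    have "\<forall>\<^sub>\<infinity>t. \<alpha> \<odot> Fam t \<noteq> 0" by (rule line_act_nonzero[OF pf]) (simp add: Fam0 alpha_F divpow_y_nonzero)
    moreover have "\<forall>\<^sub>\<infinity>t. hilbert 3 (Fam 0) 1 \<le> hilbert 3 (Fam t) 1"
      using line.hilbert_semicontinuous pf poly_family_iff by blast
    ultimately show "\<forall>\<^sub>\<infinity>t. direct_sum_form 3 (Suc D) (Fam t)" using gen
    proof eventually_elim
      case (elim t)
      let ?s = "poly \<sigma> t"
      define E where "E u = cscale (lk (u \<odot> L t) 0 / ?s) \<alpha>" for u
      have aFam: "\<alpha> \<odot> Fam t = divpow (L t) D"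
        unfolding Fam_eq[OF elim(3)] act_add_right act_scale_right act_divpow[OF forms_1(1) aL]
        using elim(3) by (simp add: G_def alpha_binary_form)
      have EL: "(v - E v) \<odot> L t = 0" if v: "v \<in> forms 3 1" for v
      proof -
        obtain c where c: "v \<odot> L t = cscale c 1" using linear_form_act[OF v Lf] by blast
        then show ?thesis using elim(3)
          by (simp add: E_def act_diff_left act_scale_left aL lookup_cscale lookup_one)
      qed
      have Ef: "E u \<in> forms 3 1" for u unfolding E_def by (intro forms_scale forms_1)
      show ?case
      proof (rule direct_sum_projector[of "Suc D" "Fam t" 3 E])
        show "Vector_Spaces.linear cscale cscale E"
          by (simp add: Vector_Spaces.linear_iff cvs.vector_space_axioms E_def act_add_left act_scale_left
              lookup_add lookup_cscale add_divide_distrib cvs.scale_left_distrib)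
        show "E (E u) = E u" for u using elim(3)
          by (simp add: E_def act_scale_left aL lookup_cscale lookup_one)
        show "(v - E v) \<odot> E u \<odot> Fam t = 0" if v: "v \<in> forms 3 1" for u v
        proof -
          have vE: "v - E v \<in> forms 3 1" by (rule forms_diff[OF v Ef])
          have "(v - E v) \<odot> divpow (L t) D = 0"
            using act_divpow[OF vE, of "L t" 0 "D - 1"] EL[OF v] D by simp
          then show ?thesis unfolding E_def[of u] act_scale_left act_scale_right aFam by simp
        qed
        have "E \<alpha> = \<alpha>" using elim(3) by (simp add: E_def aL lookup_cscale lookup_one)
        then show "\<exists>u\<in>forms 3 1. E u \<odot> Fam t \<noteq> 0" using elim(1) forms_1(1) by metis
        show "\<exists>u\<in>forms 3 1. (u - E u) \<odot> Fam t \<noteq> 0"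
        proof (rule ccontr)
          assume "\<not> ?thesis"
          then have "u \<odot> Fam t = cscale (lk (u \<odot> L t) 0 / ?s) (\<alpha> \<odot> Fam t)" if "u \<in> forms 3 1" for u
            using that by (simp add: E_def act_diff_left act_scale_left)
          then have "(\<lambda>\<Theta>. \<Theta> \<odot> Fam t) ` forms 3 1 \<subseteq> cvs.span {\<alpha> \<odot> Fam t}"
            by (auto simp: cvs.span_singleton)
          then have "hilbert 3 (Fam t) 1 \<le> card {\<alpha> \<odot> Fam t}" unfolding hilbert_eq_dim by (rule cvs.dim_le_card) simp
          then show False using elim(2) hilbert_F_lower[of 1] D width_pos by (simp add: Fam0)
        qed
      qed (use Famf Ef in auto)
    qed
  qed
qed

text \<open>
  For \<open>f 0 \<noteq> 0\<close> let the linear form move from \<open>y\<close> in the direction of \<open>x\<close>: only the first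
  coefficient of the binary part has a pole, and the shifted recurrence ignores it.  For \<open>f 0 = 0\<close> the
  recurrence fails for the binary part of \<open>F\<close> in one place only, by \<open>\<kappa> \<noteq> 0\<close>.  Let the linear form move
  along \<open>y + t z\<close>; the recurrence evaluates to \<open>f(t)\<close> on its powers, so with \<open>\<sigma> = f(t) / \<kappa>\<close> the defect
  changes from \<open>\<kappa>\<close> times the sequence \<open>0^i\<close> to \<open>\<kappa>\<close> times the difference of \<open>0^i\<close> and \<open>t^i\<close>, and that is absorbed by a
  correction \<open>R\<close> that tends to zero.
\<close>

lemma F_ApoLim: "F \<in> ApoLim 3 (Suc D)"
proof (cases "f 0 = 0")
  case False
  define p where "p j = (case j of 0 \<Rightarrow> 0 | Suc j \<Rightarrow> f j)" for j
  show ?thesis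
  proof (rule family_ApoLim[of "[:0, 1:]" 0 "\<lambda>_. 0"])
    fix t :: complex assume "poly [:0, 1:] t \<noteq> 0"
    have "contract (Suc a) p (\<lambda>i. h i - poly 0 t - poly 0 t ^ i / poly [:0, 1:] t) i = contract a f (\<lambda>i. h (Suc i)) i" for i
      by (simp add: contract_def p_def sum.atMost_Suc_shift del: sum.atMost_Suc)
    moreover have "\<exists>j\<le>Suc a. p j \<noteq> 0" using False by (intro exI[of _ 1]) (simp add: p_def)
    ultimately show "\<exists>p. recurrence (Suc D) width p (\<lambda>i. h i - poly 0 t - poly 0 t ^ i / poly [:0, 1:] t)"
      using rec False unfolding recurrence_def width_def by auto
  qed auto
next
  case True
  define \<kappa> where "\<kappa> = contract a f h 0"
  have a: "1 \<le> a" using width_pos True by (simp add: width_def)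
  have fh: "contract a f h (Suc i) = 0" if "Suc i + a \<le> Suc D" for i
    using rec that unfolding recurrence_def contract_def by simp
  \<comment> \<open>Otherwise f divided by the shift would be a shorter recurrence.\<close>
  have \<kappa>: "\<kappa> \<noteq> 0"
  proof
    assume k0: "\<kappa> = 0"
    define q where "q j = f (Suc j)" for j
    have sa: "Suc (a - 1) = a" using a by simp
    have q: "contract (a - 1) q (\<lambda>i. h (Suc i)) i = contract a f h i" for i
    proof -
      have "contract (Suc (a - 1)) f h i = contract (a - 1) q (\<lambda>i. h (Suc i)) i"
        by (simp add: contract_def q_def True sum.atMost_Suc_shift del: sum.atMost_Suc)
      then show ?thesis unfolding sa ..
    qed
    have "contract (a - 1) q (\<lambda>i. h (Suc i)) i = 0" if "i + (a - 1) \<le> D" for i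
      unfolding q using k0 fh[of "i - 1"] that a by (cases i) (auto simp: \<kappa>_def)
    moreover obtain j where j: "j \<le> a" "f j \<noteq> 0" using rec unfolding recurrence_def by blast
    have "\<exists>j\<le>a - 1. q j \<noteq> 0" using j True by (intro exI[of _ "j - 1"]) (cases j; auto simp: q_def)
    ultimately have "recurrence D (a - 1) q (\<lambda>i. h (Suc i))" unfolding recurrence_def by blast
    then show False using minimal[of "a - 1" q] a by simp
  qed
  define fX where "fX = (\<Sum>j\<le>a. monom (f j) j)"
  define \<sigma> where "\<sigma> = smult (1 / \<kappa>) fX"
  have pfX: "poly fX t = (\<Sum>j\<le>a. f j * t ^ j)" for t by (simp add: fX_def poly_sum poly_monom)
  have "fX \<noteq> 0"
  proof
    assume "fX = 0"
    moreover obtain j where j: "j \<le> a" "f j \<noteq> 0" using rec unfolding recurrence_def by blast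
    moreover have "coeff fX j = f j" using j by (simp add: fX_def coeff_sum)
    ultimately show False by simp
  qed
  then have \<sigma>: "\<sigma> \<noteq> 0" using \<kappa> by (simp add: \<sigma>_def)
  obtain R :: "nat \<Rightarrow> complex poly" where R:
    "\<And>i. (\<Sum>j\<le>a. smult (f j) (R (i + j))) = [:\<kappa>:] * (0 ^ i - [:0, 1:] ^ i)" "\<And>i. poly (R i) 0 = 0"
  proof (rule recurrence_solution[of a f "\<lambda>i. [:\<kappa>:] * (0 ^ i - [:0, 1:] ^ i)"])
    show "\<exists>j\<le>a. f j \<noteq> 0" using rec unfolding recurrence_def by blast
    show "poly ([:\<kappa>:] * (0 ^ i - [:0, 1:] ^ i)) 0 = 0" for i by (cases i) auto
  qed (rule that)
  show ?thesis
  proof (rule family_ApoLim[of \<sigma> "[:0, 1:]" R])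
    show "poly \<sigma> 0 = 0" using True by (simp add: \<sigma>_def pfX power_0_left if_distrib[of "(*) _"] cong: if_cong)
    fix t assume s: "poly \<sigma> t \<noteq> 0"
    have "contract a f (\<lambda>i. h i - poly (R i) t - poly [:0, 1:] t ^ i / poly \<sigma> t) i = 0" if i: "i + a \<le> Suc D" for i
    proof -
      have "contract a f (\<lambda>i. h i - poly (R i) t - poly [:0, 1:] t ^ i / poly \<sigma> t) i =
          contract a f h i - (\<Sum>j\<le>a. f j * poly (R (i + j)) t) - t ^ i / poly \<sigma> t * (\<Sum>j\<le>a. f j * t ^ j)"
        by (simp add: contract_def right_diff_distrib sum_subtractf sum_distrib_left power_add mult_ac)
      also have "(\<Sum>j\<le>a. f j * poly (R (i + j)) t) = \<kappa> * (0 ^ i - t ^ i)"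
        using arg_cong[OF R(1)[of i], of "\<lambda>q. poly q t"] by (simp add: poly_sum)
      also have "(\<Sum>j\<le>a. f j * t ^ j) = \<kappa> * poly \<sigma> t" using \<kappa> by (simp add: \<sigma>_def pfX)
      also have "contract a f h i = \<kappa> * 0 ^ i" using fh[of "i - 1"] i by (cases i) (simp_all add: \<kappa>_def)
      finally show ?thesis using s by (simp add: algebra_simps)
    qed
    then show "\<exists>p. recurrence (Suc D) width p (\<lambda>i. h i - poly (R i) t - poly [:0, 1:] t ^ i / poly \<sigma> t)"
      using rec True unfolding recurrence_def width_def by auto
  qed (use \<sigma> R(2) in auto)
qed

end

lemma dual_vector_exists:
  assumes "v \<in> forms n 1" "v \<notin> cvs.span B" "B \<subseteq> forms n 1"
  obtains y where "y \<in> forms n 1" "v \<odot> y = 1" "\<And>b. b \<in> B \<Longrightarrow> b \<odot> y = 0"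
proof -
  obtain y where y: "y \<in> forms n 1" "\<And>P. P \<in> cvs.span B \<Longrightarrow> P \<in> forms n 1 \<Longrightarrow> y \<odot> P = 0" "y \<odot> v = 1"
    using separation[OF cvs.subspace_span assms(1,2)] by metis
  show ?thesis
  proof (rule that[OF y(1)])
    show "v \<odot> y = 1" using act_same_degree_sym[OF assms(1) y(1)] y(3) by simp
    fix b assume b: "b \<in> B"
    then have "b \<in> forms n 1" using assms(3) by blast
    then show "b \<odot> y = 0" using act_same_degree_sym[of b n 1 y] y(1,2) cvs.span_base[OF b] by simp
  qed
qed

lemma dual_bases_exists:
  assumes abc: "\<alpha> \<in> forms 3 1" "\<beta> \<in> forms 3 1" "\<gamma> \<in> forms 3 1"
    and ind: "\<alpha> \<noteq> 0" "\<gamma> \<notin> cvs.span {\<alpha>}" "\<beta> \<notin> cvs.span {\<gamma>, \<alpha>}"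
  obtains x y z where "dual_bases \<alpha> \<beta> \<gamma> x y z"
proof -
  have "cvs.independent {\<beta>, \<gamma>, \<alpha>}"
    by (intro cvs.independent_insertI ind cvs.independent_empty) (use ind in simp)
  moreover have dist: "\<beta> \<noteq> \<gamma>" "\<beta> \<noteq> \<alpha>" "\<gamma> \<noteq> \<alpha>" using ind cvs.span_base[of _ "{\<gamma>, \<alpha>}"] cvs.span_base[of _ "{\<alpha>}"] by auto
  ultimately have i: "cvs.independent {\<alpha>, \<beta>, \<gamma>}" "card {\<alpha>, \<beta>, \<gamma>} = 3" by (auto simp: insert_commute)
  have sub: "{\<alpha>, \<beta>, \<gamma>} \<subseteq> forms 3 1" using abc by simp
  have "cvs.span {\<alpha>, \<beta>, \<gamma>} = forms 3 1"
  proof (rule subspace_eq_of_dim[OF cvs.subspace_span fin_gen_forms])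
    show "cvs.span {\<alpha>, \<beta>, \<gamma>} \<subseteq> forms 3 1" by (rule cvs.span_minimal[OF sub subspace_forms])
    show "cvs.dim (forms 3 1) \<le> cvs.dim (cvs.span {\<alpha>, \<beta>, \<gamma>})"
      using cvs.dim_span_eq_card_independent[OF i(1)] i(2) dim_forms_1[of 3] by simp
  qed
  moreover have nin: "v \<notin> cvs.span ({\<alpha>, \<beta>, \<gamma>} - {v})" if "v \<in> {\<alpha>, \<beta>, \<gamma>}" for v
    using i(1) that unfolding cvs.dependent_def by blast
  have ex: "\<exists>y\<in>forms 3 1. v \<odot> y = 1 \<and> (\<forall>b\<in>{\<alpha>, \<beta>, \<gamma>} - {v}. b \<odot> y = 0)" if "v \<in> {\<alpha>, \<beta>, \<gamma>}" for v
  proof -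
    note vin = that
    have v: "v \<in> forms 3 1" "{\<alpha>, \<beta>, \<gamma>} - {v} \<subseteq> forms 3 1" using sub that by blast+
    show ?thesis by (rule dual_vector_exists[OF v(1) nin[OF vin] v(2)]) blast
  qed
  obtain x y z where
    "x \<in> forms 3 1" "\<alpha> \<odot> x = 1" "\<forall>b\<in>{\<alpha>, \<beta>, \<gamma>} - {\<alpha>}. b \<odot> x = 0"
    "y \<in> forms 3 1" "\<beta> \<odot> y = 1" "\<forall>b\<in>{\<alpha>, \<beta>, \<gamma>} - {\<beta>}. b \<odot> y = 0"
    "z \<in> forms 3 1" "\<gamma> \<odot> z = 1" "\<forall>b\<in>{\<alpha>, \<beta>, \<gamma>} - {\<gamma>}. b \<odot> z = 0"
    using ex[of \<alpha>] ex[of \<beta>] ex[of \<gamma>] by blast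
  then have "dual_bases \<alpha> \<beta> \<gamma> x y z" using abc dist calculation by unfold_locales auto
  then show ?thesis by (rule that)
qed

lemma dual_bases_rescale:
  assumes "dual_bases \<alpha> \<beta> \<gamma> x y z" "c \<noteq> 0"
  shows "dual_bases (cscale (1 / c) \<alpha>) \<beta> \<gamma> (cscale c x) y z"
proof -
  interpret dual_bases \<alpha> \<beta> \<gamma> x y z by fact
  have "cvs.span {\<alpha>, \<beta>, \<gamma>} = cvs.span {cscale (1 / c) \<alpha>, \<beta>, \<gamma>}"
  proof (subst cvs.span_eq, intro conjI)
    have "\<alpha> = cscale c (cscale (1 / c) \<alpha>)" using assms(2) by simp
    then have "\<alpha> \<in> cvs.span {cscale (1 / c) \<alpha>, \<beta>, \<gamma>}" by (metis cvs.span_base cvs.span_scale insertI1)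
    then show "{\<alpha>, \<beta>, \<gamma>} \<subseteq> cvs.span {cscale (1 / c) \<alpha>, \<beta>, \<gamma>}" by (simp add: cvs.span_base)
    show "{cscale (1 / c) \<alpha>, \<beta>, \<gamma>} \<subseteq> cvs.span {\<alpha>, \<beta>, \<gamma>}" by (simp add: cvs.span_base cvs.span_scale)
  qed
  then have "forms 3 1 = cvs.span {cscale (1 / c) \<alpha>, \<beta>, \<gamma>}" using span_1 by simp
  then show ?thesis
    by (intro dual_bases.intro forms_scale forms_1)
       (use assms(2) in \<open>simp_all add: pairing act_scale_left act_scale_right\<close>)
qed

text \<open>
  The image of \<open>N\<close> is contained in its kernel, which therefore has dimension at least two and
  contains, besides \<open>\<alpha> = N \<beta>\<close>, an independent \<open>\<gamma>\<close>.  Self-adjointness makes \<open>\<alpha>\<close> and \<open>\<gamma>\<close> kill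
  \<open>\<alpha> \<odot> F\<close>, so this is a multiple of a power of \<open>y\<close>.
\<close>

lemma ternary_normal_form:
  assumes F: "F \<in> forms 3 (Suc D)" and N: "nilpotent_self_adjoint 3 F N"
  obtains \<alpha> \<beta> \<gamma> x y z h where "dual_bases \<alpha> \<beta> \<gamma> x y z" "F = x * divpow y D + dual_bases.binary_form y z (Suc D) h"
proof -
  let ?T = "forms 3 1"
  have lin: "Vector_Spaces.linear cscale cscale N" using N by (simp add: nilpotent_self_adjoint_def)
  have NT: "N u \<in> ?T" "N (N u) = 0" if "u \<in> ?T" for u
    using N that unfolding nilpotent_self_adjoint_def by blast+
  have adj: "N u \<odot> v \<odot> F = u \<odot> N v \<odot> F" if "u \<in> ?T" "v \<in> ?T" for u v
    using N that unfolding nilpotent_self_adjoint_def by blast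
  obtain \<beta> where \<beta>: "\<beta> \<in> ?T" "N \<beta> \<odot> F \<noteq> 0" using N unfolding nilpotent_self_adjoint_def by blast
  define \<alpha> where "\<alpha> = N \<beta>"
  have \<alpha>: "\<alpha> \<in> ?T" "N \<alpha> = 0" "\<alpha> \<odot> F \<noteq> 0" using \<beta> NT by (auto simp: \<alpha>_def)
  have an0: "\<alpha> \<noteq> 0" using \<alpha>(3) by auto
  let ?K = "{u \<in> ?T. N u = 0}"
  have sK: "cvs.subspace ?K" by (rule subspace_kernel[OF lin subspace_forms])
  have fK: "fin_gen ?K" by (rule fin_gen_forms_subset[of _ 3 1]) auto
  have "3 = cvs.dim (N ` ?T) + cvs.dim ?K" using rank_nullity[OF lin subspace_forms fin_gen_forms, of 3 1] dim_forms_1[of 3] by simp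
  moreover have "cvs.dim (N ` ?T) \<le> cvs.dim ?K" by (rule dim_subset_gen[OF fK]) (use NT in auto)
  ultimately have "2 \<le> cvs.dim ?K" by simp
  then have "\<not> ?K \<subseteq> cvs.span {\<alpha>}" using cvs.dim_le_card[of ?K "{\<alpha>}"] by auto
  then obtain \<gamma> where \<gamma>: "\<gamma> \<in> ?T" "N \<gamma> = 0" "\<gamma> \<notin> cvs.span {\<alpha>}" by blast
  have "cvs.span {\<gamma>, \<alpha>} \<subseteq> ?K" by (rule cvs.span_minimal[OF _ sK]) (use \<alpha> \<gamma> in auto)
  then have "\<beta> \<notin> cvs.span {\<gamma>, \<alpha>}" using an0 by (auto simp: \<alpha>_def)
  then obtain x y z where db: "dual_bases \<alpha> \<beta> \<gamma> x y z"
    using dual_bases_exists[OF \<alpha>(1) \<beta>(1) \<gamma>(1) an0 \<gamma>(3)] by metis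
  interpret b: dual_bases \<alpha> \<beta> \<gamma> x y z by fact
  have "\<alpha> \<odot> \<alpha> \<odot> F = 0" "\<gamma> \<odot> \<alpha> \<odot> F = 0"
    using adj[OF \<beta>(1) \<alpha>(1)] adj[OF \<beta>(1) \<gamma>(1)] \<alpha>(2) \<gamma>(2) act_commute[of \<gamma> \<alpha> F] by (simp_all add: \<alpha>_def)
  moreover have "\<alpha> \<odot> F \<in> forms 3 D" using act_forms[OF \<alpha>(1), of F D] F by simp
  ultimately obtain g where g: "\<alpha> \<odot> F = b.binary_form D g" and g\<gamma>: "\<gamma> \<odot> b.binary_form D g = 0" using b.binary_form_exists by metis
  have "g i = g 0 * 0 ^ i" if i: "i \<le> D" for i
  proof (cases i)
    case (Suc j)
    then obtain e where e: "D = Suc e" using i by (cases D) auto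
    have "b.binary_form e (\<lambda>i. g (Suc i)) = 0" using g\<gamma> unfolding e b.gamma_binary_form .
    then show ?thesis using b.binary_form_eq_0D[of e "\<lambda>i. g (Suc i)" j] Suc i e by simp
  qed simp
  then have "\<alpha> \<odot> F = b.binary_form D (\<lambda>i. g 0 * 0 ^ i)" unfolding g by (rule b.binary_form_cong)
  then have aF: "\<alpha> \<odot> F = cscale (g 0) (divpow y D)" by (simp only: b.binary_form_scale b.divpow_y)
  then have g0: "g 0 \<noteq> 0" using \<alpha>(3) by auto
  define \<alpha>' where "\<alpha>' = cscale (1 / g 0) \<alpha>"
  define x' where "x' = cscale (g 0) x"
  have db': "dual_bases \<alpha>' \<beta> \<gamma> x' y z" unfolding \<alpha>'_def x'_def by (rule dual_bases_rescale[OF db g0])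
  interpret b': dual_bases \<alpha>' \<beta> \<gamma> x' y z by fact
  have "\<alpha>' \<odot> (F - x' * divpow y D) = 0"
    unfolding act_diff_right b'.leib b'.divpow_rules b'.pairing using g0 by (simp add: \<alpha>'_def act_scale_left aF)
  moreover have "F - x' * divpow y D \<in> forms 3 (Suc D)"
    using forms_mult[OF b'.forms_1(4) divpow_forms[OF b'.forms_1(5)], of D] by (intro forms_diff F) simp
  ultimately obtain h where "F - x' * divpow y D = b'.binary_form (Suc D) h" using b'.binary_form_exists by metis
  then have "F = x' * divpow y D + b'.binary_form (Suc D) h" by (simp add: algebra_simps)
  then show ?thesis by (rule that[OF db'])
qed

lemma ternary_ApoLim:
  assumes d: "1 \<le> d" and F: "F \<in> ApoEqu 3 d"
  shows "F \<in> ApoLim 3 d"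
proof -
  have Fd: "F \<in> forms 3 d" "F \<noteq> 0" using F by (auto simp: ApoEqu_def)
  have "d = 1 \<or> 2 \<le> d" using d by linarith
  then have "direct_sum_form 3 d F \<or> (2 \<le> d \<and> (\<exists>N. nilpotent_self_adjoint 3 F N))"
    using linear_form_direct_sum[of F 3] Fd ApoEqu_dichotomy[OF _ F] by auto
  then show ?thesis
  proof
    assume "direct_sum_form 3 d F" then show ?thesis by (rule direct_sum_ApoLim[OF Fd])
  next
    assume "2 \<le> d \<and> (\<exists>N. nilpotent_self_adjoint 3 F N)"
    then obtain N where d2: "2 \<le> d" and N: "nilpotent_self_adjoint 3 F N" by blast
    define D where "D = d - 1"
    have dD: "d = Suc D" and D: "1 \<le> D" using d2 by (auto simp: D_def)
    obtain \<alpha> \<beta> \<gamma> x y z h where db: "dual_bases \<alpha> \<beta> \<gamma> x y z" and Fe: "F = x * divpow y D + dual_bases.binary_form y z (Suc D) h"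
      using ternary_normal_form[OF Fd(1)[unfolded dD] N] by metis
    let ?P = "\<lambda>a. \<exists>f. recurrence D a f (\<lambda>i. h (Suc i))"
    define a where "a = (LEAST a. ?P a)"
    have ex: "?P (D div 2 + 1)" using recurrence_exists by blast
    have "?P a" unfolding a_def by (rule LeastI[of ?P, OF ex])
    then obtain f where f: "recurrence D a f (\<lambda>i. h (Suc i))" by blast
    have "a \<le> D div 2 + 1" unfolding a_def by (rule Least_le[of ?P, OF ex])
    then have len: "2 * a \<le> D + 2" by simp
    have min: "\<not> recurrence D b p (\<lambda>i. h (Suc i))" if "b < a" for b p
      using not_less_Least[of b ?P] that unfolding a_def by blast
    interpret dual_bases \<alpha> \<beta> \<gamma> x y z by (rule db)
    interpret T: ternary_form \<alpha> \<beta> \<gamma> x y z D a f h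
      by unfold_locales (rule f min len D; assumption?)+
    have "F = T.F" unfolding Fe T.F_def ..
    then show ?thesis using T.F_ApoLim dD by simp
  qed
qed


section \<open>Apolar limits and equipotent apolar generators\<close>

theorem theorem1p8:
  shows "(\<forall>n d :: nat. 1 \<le> d \<longrightarrow> ApoLim n d \<subseteq> ApoEqu n d) \<and>
    (\<exists>n :: nat. \<forall>d :: nat. 2 * n \<le> d \<longrightarrow> ApoLim n d \<subset> ApoEqu n d) \<and>
    (\<forall>n d :: nat. 1 \<le> d \<and> (d = 3 \<or> n = 3) \<longrightarrow> ApoLim n d = ApoEqu n d)"
proof (intro conjI allI impI)
  fix n d :: nat
  show "ApoLim n d \<subseteq> ApoEqu n d" if "1 \<le> d" by (rule ApoLim_subset_ApoEqu[OF that])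
  show "ApoLim n d = ApoEqu n d" if "1 \<le> d \<and> (d = 3 \<or> n = 3)"
    using that ApoLim_subset_ApoEqu[of d n] cubic_ApoLim ternary_ApoLim[of d] by blast
next
  show "\<exists>n. \<forall>d. 2 * n \<le> d \<longrightarrow> ApoLim n d \<subset> ApoEqu n d"
    by (rule exI[of _ 5]) (simp add: ApoLim_strict_5)
qed

end
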